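(* Let $r\in(0,4/3)$ be fixed. For every sufficiently large prime $p$ (in terms of $r$), every real $N\in[1,\tfrac12p)$, and $\nu:=\min(N,p/N)$, we have $$\frac1{p-2}\sum_{\chi\neq\chi_0}\Big|\sum_{n\leqslant N}\chi(n)\Big|^r\gg\frac{N^{r/2}}{\mathcal E_\nu^{1-r/2}},$$ where the sum is over all non-principal Dirichlet characters $\chi$ modulo $p$ and the implied constant depends at most on $r$. In particular (case $r=1$), $$\frac1{p-2}\sum_{\chi\neq\chi_0}\Big|\sum_{n\leqslant N}\chi(n)\Big|\gg\sqrt{\frac N{\mathcal E_\nu}},$$ and, when $\nu\geqslant 3$, $$\sqrt{\frac N{\mathcal E_\nu}}\gg\frac{\sqrt N}{(\log\nu)^{\delta/2}(\log\log\nu)^3}.$$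
   Context: For an integer $N\geqslant 1$, $$\mathcal E_N:=\inf_{\boldsymbol c\in(\mathbb R^+)^N,\ \|\boldsymbol c\|_1=1}N^2\sum_{1\leqslant n\leqslant N^2}\Bigg(\sum_{\substack{d\leqslant N,\ t\leqslant N\\ dt=n}}c_dc_t\Bigg)^2,$$ where $\mathbb R^+=[0,\infty)$ and $\|\boldsymbol c\|_1=\sum_{n\leqslant N}|c_n|$. For real $\nu\geqslant 1$, $\mathcal E_\nu$ means $\mathcal E_{\lfloor\nu\rfloor}$. The exponent is $\delta:=1-\dfrac{1+\log\log 2}{\log 2}\approx 0.08607$. $\chi_0$ denotes the principal character modulo $p$. The notation $A\gg B$ means $A\geqslant KB$ for some constant $K>0$. *)

theory Defs
  imports Complex_Main "HOL-Number_Theory.Number_Theory"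
begin

definition dirichlet_character :: "nat \<Rightarrow> (int \<Rightarrow> complex) \<Rightarrow> bool" where
  "dirichlet_character m \<chi> \<longleftrightarrow>
     (\<forall>a. \<chi> (a + int m) = \<chi> a) \<and>
     (\<forall>a b. \<chi> (a * b) = \<chi> a * \<chi> b) \<and>
     (\<forall>a. \<chi> a \<noteq> 0 \<longleftrightarrow> coprime a (int m))"

definition principal_character :: "nat \<Rightarrow> int \<Rightarrow> complex" where
  "principal_character m a = (if coprime a (int m) then 1 else 0)"

definition nonprincipal_characters :: "nat \<Rightarrow> (int \<Rightarrow> complex) set" where
  "nonprincipal_characters m = {\<chi>. dirichlet_character m \<chi> \<and> \<chi> \<noteq> principal_character m}"

definition character_sum :: "(int \<Rightarrow> complex) \<Rightarrow> real \<Rightarrow> complex" where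
  "character_sum \<chi> x = (\<Sum>n = 1..nat \<lfloor>x\<rfloor>. \<chi> (int n))"

text \<open>Weight vectors are functions on all naturals, of which only the values
  at 1, ..., \<open>N\<close> are constrained and used.\<close>

definition normalized_weights :: "nat \<Rightarrow> (nat \<Rightarrow> real) set" where
  "normalized_weights N = {c. (\<forall>n\<in>{1..N}. c n \<ge> 0) \<and> (\<Sum>n = 1..N. \<bar>c n\<bar>) = 1}"

definition weighted_energy :: "nat \<Rightarrow> (nat \<Rightarrow> real) \<Rightarrow> real" where
  "weighted_energy N c =
     real N ^ 2 * (\<Sum>n = 1..N ^ 2.
       (\<Sum>(d, t) \<in> {(d, t). d \<in> {1..N} \<and> t \<in> {1..N} \<and> d * t = n}. c d * c t) ^ 2)"

definition min_energy :: "real \<Rightarrow> real" where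
  "min_energy \<nu> = (INF c \<in> normalized_weights (nat \<lfloor>\<nu>\<rfloor>). weighted_energy (nat \<lfloor>\<nu>\<rfloor>) c)"

definition delta_exp :: real where
  "delta_exp = 1 - (1 + ln (ln 2)) / ln 2"

text \<open>The following facts show that the sums over characters and the infimum
  above are genuine: \<open>sum\<close> over an infinite set would be 0, and the infimum of an empty
  or unbounded set of reals would be unspecified.\<close>

lemma dirichlet_character_cong:
  assumes "dirichlet_character m \<chi>" "[a = b] (mod int m)"
  shows "\<chi> a = \<chi> b"
proof -
  have per: "\<chi> (x + int m) = \<chi> x" for x
    using assms(1) by (simp add: dirichlet_character_def)
  have nat_step: "\<chi> (x + int k * int m) = \<chi> x" for x and k :: nat
  proof (induction k)
    case (Suc k)
    have "x + int (Suc k) * int m = (x + int k * int m) + int m"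
      by (simp add: algebra_simps)
    then show ?case using per[of "x + int k * int m"] Suc by metis
  qed simp
  obtain k where k: "b = a + int m * k"
    using assms(2) by (auto simp: cong_iff_lin)
  show ?thesis
  proof (cases "k \<ge> 0")
    case True
    then show ?thesis using nat_step[of a "nat k"] k by (simp add: mult.commute)
  next
    case False
    then have "b + int (nat (- k)) * int m = a" using k by (simp add: algebra_simps)
    then show ?thesis using nat_step[of b "nat (- k)"] by metis
  qed
qed

lemma dirichlet_character_one:
  assumes "dirichlet_character m \<chi>"
  shows "\<chi> 1 = 1"
proof -
  have "\<chi> (1 * 1) = \<chi> 1 * \<chi> 1" "\<chi> 1 \<noteq> 0"
    using assms unfolding dirichlet_character_def by (blast, simp)
  then show ?thesis by simp
qed

lemma dirichlet_character_power:
  assumes "dirichlet_character m \<chi>"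
  shows "\<chi> (a ^ k) = \<chi> a ^ k"
  using assms dirichlet_character_one[OF assms]
  by (induction k) (auto simp: dirichlet_character_def)

lemma finite_dirichlet_characters:
  assumes "m > 0"
  shows "finite {\<chi>. dirichlet_character m \<chi>}"
proof -
  let ?D = "{\<chi>. dirichlet_character m \<chi>}"
  let ?R = "insert 0 {z :: complex. z ^ totient m = 1}"
  let ?res = "\<lambda>\<chi> :: int \<Rightarrow> complex. restrict \<chi> {0..<int m}"
  have tot: "totient m > 0" using assms by simp
  have val: "\<chi> a \<in> ?R" if \<chi>: "dirichlet_character m \<chi>" and a: "a \<in> {0..<int m}" for \<chi> a
  proof (cases "coprime a (int m)")
    case False
    then show ?thesis using \<chi> by (auto simp: dirichlet_character_def)
  next
    case True
    have an: "a = int (nat a)" using a by simp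
    then have "coprime (nat a) m" using True by (metis coprime_int_iff)
    then have "[nat a ^ totient m = 1] (mod m)" by (rule euler_theorem)
    then have "[a ^ totient m = 1] (mod int m)"
      using an by (metis cong_int_iff of_nat_1 of_nat_power)
    then have "\<chi> (a ^ totient m) = 1"
      using dirichlet_character_cong[OF \<chi>] dirichlet_character_one[OF \<chi>] by metis
    then show ?thesis using dirichlet_character_power[OF \<chi>] by simp
  qed
  have "?res ` ?D \<subseteq> PiE {0..<int m} (\<lambda>_. ?R)"
    using val unfolding PiE_iff image_subset_iff by fastforce
  moreover have "finite (PiE {0..<int m} (\<lambda>_. ?R))"
  proof (rule finite_PiE)
    have "finite {z :: complex. z ^ totient m = 1}"
      using tot by (intro finite_roots_unity) linarith
    then show "finite ?R" by simp
  qed simp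
  ultimately have "finite (?res ` ?D)" by (rule finite_subset)
  moreover have "inj_on ?res ?D"
  proof (rule inj_onI, rule ext)
    fix \<chi> \<psi> a
    assume D: "\<chi> \<in> ?D" "\<psi> \<in> ?D" and eq: "?res \<chi> = ?res \<psi>"
    have r: "a mod int m \<in> {0..<int m}" using assms by simp
    have c: "[a = a mod int m] (mod int m)" by (simp add: cong_def)
    have "\<chi> a = \<chi> (a mod int m)" using D c dirichlet_character_cong by blast
    also have "\<dots> = \<psi> (a mod int m)" using fun_cong[OF eq, of "a mod int m"] r by simp
    also have "\<dots> = \<psi> a" using D c dirichlet_character_cong by (metis mem_Collect_eq)
    finally show "\<chi> a = \<psi> a" .
  qed
  ultimately show ?thesis by (rule finite_imageD)
qed

lemma finite_nonprincipal_characters: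
  "m > 0 \<Longrightarrow> finite (nonprincipal_characters m)"
  using finite_dirichlet_characters[of m]
  by (rule finite_subset[rotated]) (auto simp: nonprincipal_characters_def)

lemma dirichlet_character_principal: "dirichlet_character m (principal_character m)"
proof -
  have "coprime (a + int m) (int m) \<longleftrightarrow> coprime a (int m)" for a
    by (simp add: coprime_iff_gcd_eq_1)
  then show ?thesis
    unfolding dirichlet_character_def principal_character_def by simp
qed

lemma normalized_weights_nonempty:
  assumes "N \<ge> 1"
  shows "normalized_weights N \<noteq> {}"
proof -
  have "(\<Sum>n = 1..N. \<bar>if n = 1 then 1 else 0 :: real\<bar>) = (\<Sum>n = 1..N. if n = 1 then 1 else 0)"
    by (intro sum.cong) auto
  also have "\<dots> = 1" using assms by (subst sum.delta) auto
  finally have "(\<lambda>n. if n = 1 then 1 else 0) \<in> normalized_weights N"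
    unfolding normalized_weights_def by auto
  then show ?thesis by blast
qed

lemma weighted_energy_nonneg: "weighted_energy N c \<ge> 0"
  unfolding weighted_energy_def by (intro mult_nonneg_nonneg sum_nonneg) auto

lemma bdd_below_weighted_energy: "bdd_below (weighted_energy N ` normalized_weights N)"
  using weighted_energy_nonneg by (intro bdd_belowI2)

end

theory Submission
  imports Defs "HOL-Real_Asymp.Real_Asymp" "HOL-Computational_Algebra.Squarefree" "HOL-Analysis.Convex"
begin

text \<open>
  Write \<open>S(\<chi>)\<close> for the sum of \<open>\<chi>(n)\<close> over \<open>n \<le> N\<close>. By orthogonality the mean square of \<open>S\<close> is
  at most \<open>p N\<close>, so if some function \<open>T\<close> of the characters correlates well with \<open>S\<close> but has a small
  fourth moment, then Hoelder's inequality with exponents for \<open>|S|^r\<close>, \<open>|S|^2\<close> and \<open>|T|^4\<close>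
  bounds the \<open>r\<close>-th moment of \<open>S\<close> from below (\<open>low_moment_ge\<close>). The condition \<open>r < 4/3\<close> is exactly
  what keeps the exponent of \<open>|S|^2\<close> positive.

  If \<open>N^2 \<le> p\<close>, the conjugate of the sum of \<open>c_h \<chi>(h)\<close> over \<open>h \<le> N\<close> is a suitable \<open>T\<close>, for a
  nonnegative weight \<open>c\<close> of total mass \<open>1\<close>. Orthogonality gives the correlation, and since all products
  of two indices are below \<open>p\<close>, the fourth moment is \<open>p - 1\<close> times the sum of the squares of the
  Dirichlet convolution \<open>c * c\<close>, that is, the energy of \<open>c\<close>. A near minimizer gives the claim
  (\<open>resonates_short\<close>).

  If \<open>N^2 > p\<close>, the products leave the range where congruence is equality, and one passes to the dual
  length \<open>\<nu> = p / N\<close>: \<open>T\<close> is the sum of \<open>c_h \<chi>(h)\<close> over \<open>h \<le> \<nu>\<close> times the conjugate Gauss sum. Now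
  \<open>S\<close> correlates with \<open>\<chi>(h)\<close> times the conjugate Gauss sum through the sum of \<open>e(-n h / p)\<close> over
  \<open>n \<le> N\<close>, which is of order \<open>N\<close> when \<open>h\<close> is at most a small multiple of \<open>\<nu>\<close>. So a near
  minimizer supported on \<open>h \<le> \<nu> / 512\<close> is needed (\<open>resonates_long\<close>); bounded \<open>\<nu>\<close> is handled by \<open>h = 1\<close>
  alone (\<open>resonates_very_long\<close>).

  Shrinking the support (\<open>energy_shrink\<close>) works by writing an integer in the support as \<open>q m\<close> with \<open>q\<close>
  its largest prime factor, and averaging over the replacement of \<open>q\<close> by primes smaller by a constant
  factor. If the other prime factors are much smaller than \<open>q\<close>, the new prime can be recognised
  inside a product, and the energy grows by a constant factor only (\<open>prime_replacement_energy\<close>). Integers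
  without such a dominating prime factor carry at most half of the mass, because their products lie in
  a set of density about \<open>1 / sqrt (log N)\<close>, provided that the energy is at most a small
  multiple of \<open>sqrt (log N)\<close>.

  That proviso follows from an upper bound for the minimal energy, of order
  \<open>(log N)^\<delta> (log log N)^6\<close> (\<open>energy_upper_bound\<close>), because \<open>\<delta> < 1/2\<close>; the same bound gives the
  last inequality of the theorem. It comes from the uniform weight on integers \<open>q p_1 ... p_k\<close>, with
  a large prime \<open>q\<close> and \<open>k\<close> of size \<open>log log N / (2 log 2)\<close> small primes, chosen sparse at every scale: at most
  \<open>log log y / (2 log 2)\<close> of them are below \<open>y\<close>. Typical integers in a multiplication table have this
  shape. The energy counts quadruples with equal products, that is, two ways of splitting the same
  prime factors. Sparseness allows every prime below the scale of the exchanged part to be counted with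
  weight \<open>1/2\<close> at the cost of the logarithm of that scale, which is also the saving in the number of
  candidates for the exchanged part; with halved weights, the two roles that a small prime can play
  add up to its original weight (\<open>quad_sum_le\<close>). The number of sparse sets is computed by comparing the
  weighted count with the volume of a truncated simplex (\<open>sparse_volume_lower\<close>, \<open>sparse_volume_upper\<close>),
  and a ballot-type factor there costs only powers of \<open>log log N\<close>.
\<close>

section \<open>Prime counts of Chebyshev and Mertens type\<close>

text \<open>Rational bounds for \<open>ln 2\<close> suffice wherever numerical values of constants matter
  below: they give \<open>\<delta> < 1/2\<close>, \<open>ln 3 > 1\<close>, and the gap length used
  for the sparse sets. The decomposition \<open>2 = (5/4)(6/5)(7/6)(8/7)\<close> makes the bound
  \<open>1 - 1/x \<le> ln x \<le> x - 1\<close> sharp enough.\<close>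

lemma ln2_bounds: "63 / 100 \<le> ln (2::real)" "ln (2::real) \<le> 76 / 100"
proof -
  have eq: "ln (2::real) = ln (5 / 4) + ln (6 / 5) + ln (7 / 6) + ln (8 / 7)"
    by (simp add: ln_divide_pos) (simp add: ln_realpow[of 2 3, simplified] ln_realpow[of 2 2, simplified])
  have lo: "1 - 1 / x \<le> ln x" if "x > 0" for x :: real
    using ln_le_minus_one[of "1 / x"] that by (simp add: ln_divide_pos)
  have "(1 - 4 / 5) + (1 - 5 / 6) + (1 - 6 / 7) + (1 - 7 / 8) \<le> ln (2::real)"
    using lo[of "5 / 4"] lo[of "6 / 5"] lo[of "7 / 6"] lo[of "8 / 7"] unfolding eq by simp
  then show "63 / 100 \<le> ln (2::real)" by simp
  have "ln (2::real) \<le> (5 / 4 - 1) + (6 / 5 - 1) + (7 / 6 - 1) + (8 / 7 - 1)"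
    unfolding eq by (intro add_mono ln_le_minus_one) auto
  then show "ln (2::real) \<le> 76 / 100" by simp
qed

definition primes_le :: "nat \<Rightarrow> nat set" where
  "primes_le n = {p. prime p \<and> p \<le> n}"

lemma finite_primes_le [simp, intro]: "finite (primes_le n)"
  unfolding primes_le_def by (rule finite_subset[of _ "{..n}"]) auto

lemma primes_leD: "p \<in> primes_le n \<Longrightarrow> prime p \<and> p \<le> n \<and> 2 \<le> p"
  unfolding primes_le_def by (auto dest: prime_ge_2_nat)

lemma primes_le_0 [simp]: "primes_le 0 = {}" "primes_le (Suc 0) = {}"
  unfolding primes_le_def by (auto dest: prime_ge_2_nat)

lemma primes_le_Suc:
  "primes_le (Suc n) = (if prime (Suc n) then insert (Suc n) (primes_le n) else primes_le n)"
  unfolding primes_le_def by (auto simp: le_Suc_eq)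

lemma primes_le_mono: "m \<le> n \<Longrightarrow> primes_le m \<subseteq> primes_le n"
  unfolding primes_le_def by auto

lemma prod_primes_dvd:
  assumes "finite P" "\<And>p. p \<in> P \<Longrightarrow> prime p" "\<And>p. p \<in> P \<Longrightarrow> p dvd (m::nat)"
  shows "\<Prod>P dvd m"
  using assms
proof (induction P rule: finite_induct)
  case (insert p P)
  have "coprime p (\<Prod>P)"
  proof (rule prod_coprime_right)
    fix q assume "q \<in> P"
    then show "coprime p q" using insert by (metis insertCI primes_coprime)
  qed
  then show ?case using insert by (auto intro: divides_mult)
qed simp

text \<open>Erdos' argument: the primes in \<open>(m + 1, 2 m + 1]\<close> divide the numerator of the
  binomial coefficient but not its denominator.\<close>

lemma prod_primes_le_dvd_binomial:
  "\<Prod>{p. prime p \<and> m + 1 < p \<and> p \<le> 2 * m + 1} dvd ((2 * m + 1) choose m)"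
proof (rule prod_primes_dvd)
  show "finite {p. prime p \<and> m + 1 < p \<and> p \<le> 2 * m + 1}"
    by (rule finite_subset[of _ "{..2 * m + 1}"]) auto
next
  fix p assume p: "p \<in> {p. prime p \<and> m + 1 < p \<and> p \<le> 2 * m + 1}"
  have "fact m * fact (2 * m + 1 - m) * ((2 * m + 1) choose m) = (fact (2 * m + 1) :: nat)"
    by (rule binomial_fact_lemma) simp
  moreover have "p dvd fact (2 * m + 1)" using p prime_dvd_fact_iff[of p "2 * m + 1"] by blast
  moreover have "\<not> p dvd fact m" "\<not> p dvd fact (2 * m + 1 - m)"
    using p prime_dvd_fact_iff[of p m] prime_dvd_fact_iff[of p "2 * m + 1 - m"] by auto
  ultimately show "p dvd ((2 * m + 1) choose m)"
    using p by (metis (no_types, lifting) mem_Collect_eq prime_dvd_mult_iff)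
qed auto

lemma binomial_odd_le: "((2 * m + 1) choose m) \<le> 4 ^ m"
proof -
  have "2 * ((2 * m + 1) choose m) = ((2 * m + 1) choose m) + ((2 * m + 1) choose (m + 1))"
    using binomial_symmetric[of m "2 * m + 1"] by simp
  also have "\<dots> = (\<Sum>k\<in>{m, m + 1}. (2 * m + 1) choose k)" by simp
  also have "\<dots> \<le> (\<Sum>k\<le>2 * m + 1. (2 * m + 1) choose k)" by (rule sum_mono2) auto
  also have "\<dots> = 2 * 4 ^ m" by (subst choose_row_sum) (simp add: power_mult)
  finally show ?thesis by simp
qed

lemma primorial_le: "\<Prod>(primes_le n) \<le> 4 ^ n"
proof (induction n rule: less_induct)
  case (less n)
  consider "n = 0" | "n = 1" | "n = 2" | "n > 2" "even n" | m where "n = 2 * m + 1" "m \<ge> 1"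
    by (metis One_nat_def Suc_1 Suc_eq_plus1 Suc_lessI gr_zeroI less_one linorder_not_less oddE mult_0_right add_0)
  then show ?case
  proof cases
    assume "n = 2"
    then show ?thesis by (simp add: numeral_2_eq_2 primes_le_Suc)
  next
    assume n: "n > 2" "even n"
    then have "\<not> prime n" using prime_odd_nat by blast
    then have "primes_le n = primes_le (n - 1)"
      using n primes_le_Suc[of "n - 1"] by simp
    then have "\<Prod>(primes_le n) \<le> 4 ^ (n - 1)" using less[of "n - 1"] n by simp
    also have "\<dots> \<le> 4 ^ n" by (rule power_increasing) auto
    finally show ?thesis .
  next
    fix m assume n: "n = 2 * m + 1" "m \<ge> 1"
    let ?Q = "{p. prime p \<and> m + 1 < p \<and> p \<le> 2 * m + 1}"
    have fin: "finite ?Q" by (rule finite_subset[of _ "{..2 * m + 1}"]) auto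
    have "primes_le n = primes_le (m + 1) \<union> ?Q" using n unfolding primes_le_def by auto
    moreover have "primes_le (m + 1) \<inter> ?Q = {}" unfolding primes_le_def by auto
    ultimately have "\<Prod>(primes_le n) = \<Prod>(primes_le (m + 1)) * \<Prod>?Q"
      using fin prod.union_disjoint[of "primes_le (m + 1)" ?Q "\<lambda>x. x"] by simp
    also have "\<dots> \<le> 4 ^ (m + 1) * 4 ^ m"
    proof (rule mult_mono)
      show "\<Prod>(primes_le (m + 1)) \<le> 4 ^ (m + 1)" using less[of "m + 1"] n by simp
      have "\<Prod>?Q \<le> ((2 * m + 1) choose m)"
        using prod_primes_le_dvd_binomial by (intro dvd_imp_le) auto
      then show "\<Prod>?Q \<le> 4 ^ m" using binomial_odd_le le_trans by blast
    qed auto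
    also have "\<dots> = 4 ^ n" using n by (simp flip: power_add)
    finally show ?thesis .
  qed (auto simp: One_nat_def)
qed

lemma sum_ln_primes_le: "(\<Sum>p\<in>primes_le n. ln (real p)) \<le> real n * ln 4"
proof -
  have "(\<Sum>p\<in>primes_le n. ln (real p)) = ln (\<Prod>p\<in>primes_le n. real p)"
    by (subst ln_prod) (auto dest: primes_leD)
  also have "\<dots> \<le> ln (4 ^ n)"
  proof -
    have "(\<Prod>p\<in>primes_le n. real p) = real (\<Prod>(primes_le n))" by simp
    also have "\<dots> \<le> real (4 ^ n)" using primorial_le[of n] by (subst of_nat_le_iff)
    finally have "(\<Prod>p\<in>primes_le n. real p) \<le> 4 ^ n" by simp
    moreover have "(\<Prod>p\<in>primes_le n. real p) > 0" by (rule prod_pos) (auto dest: primes_leD)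
    ultimately show ?thesis by (subst ln_le_cancel_iff) auto
  qed
  finally show ?thesis by (simp add: ln_realpow)
qed

text \<open>Legendre's formula in the form \<open>(p - 1) v_p(n!) \<le> n\<close>: the multiples \<open>p
  h\<close> with \<open>h \<le> n / p\<close> contribute one each, plus the multiplicity of
  \<open>h\<close>.\<close>

lemma sum_multiplicity_le:
  assumes "prime p"
  shows "(p - 1) * (\<Sum>g\<in>{1..n}. multiplicity p g) \<le> (n::nat)"
proof (induction n rule: less_induct)
  case (less n)
  have p2: "p \<ge> 2" using assms prime_ge_2_nat by blast
  show ?case
  proof (cases "n = 0")
    case False
    let ?k = "n div p"
    have "(\<Sum>g\<in>{1..n}. multiplicity p g) = (\<Sum>g\<in>(\<lambda>h. p * h) ` {1..?k}. multiplicity p g)"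
    proof (rule sum.mono_neutral_right)
      show "(\<lambda>h. p * h) ` {1..?k} \<subseteq> {1..n}"
        using p2 by (auto simp: less_eq_div_iff_mult_less_eq mult.commute)
      show "\<forall>i\<in>{1..n} - (\<lambda>h. p * h) ` {1..?k}. multiplicity p i = 0"
      proof
        fix i assume i: "i \<in> {1..n} - (\<lambda>h. p * h) ` {1..?k}"
        have "\<not> p dvd i"
        proof
          assume "p dvd i"
          then obtain h where h: "i = p * h" by blast
          with i p2 have "h \<in> {1..?k}" by (cases h) (auto simp: less_eq_div_iff_mult_less_eq mult.commute)
          with h i show False by blast
        qed
        then show "multiplicity p i = 0" by (rule not_dvd_imp_multiplicity_0)
      qed
    qed auto
    also have "\<dots> = (\<Sum>h\<in>{1..?k}. multiplicity p (p * h))"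
      using p2 by (subst sum.reindex) (auto simp: inj_on_def)
    also have "\<dots> = (\<Sum>h\<in>{1..?k}. Suc (multiplicity p h))"
      using p2 by (intro sum.cong) (auto simp: multiplicity_times_same)
    also have "\<dots> = ?k + (\<Sum>h\<in>{1..?k}. multiplicity p h)"
      by (simp add: sum_Suc)
    finally have "(p - 1) * (\<Sum>g\<in>{1..n}. multiplicity p g)
        = (p - 1) * ?k + (p - 1) * (\<Sum>h\<in>{1..?k}. multiplicity p h)"
      by (simp add: algebra_simps)
    also have "\<dots> \<le> (p - 1) * ?k + ?k"
      using less[of ?k] False p2 by simp
    also have "\<dots> = p * ?k" using p2 by (cases p) auto
    also have "\<dots> \<le> n" by simp
    finally show ?thesis .
  qed simp
qed

lemma ln_nat_eq_sum_multiplicity: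
  assumes "1 \<le> g" "g \<le> n"
  shows "ln (real g) = (\<Sum>p\<in>primes_le n. real (multiplicity p g) * ln (real p))"
proof -
  have "g = (\<Prod>p\<in>prime_factors g. p ^ multiplicity p g)"
    using assms prod_prime_factors[of g] by simp
  then have "ln (real g) = ln (\<Prod>p\<in>prime_factors g. real p ^ multiplicity p g)"
    by (metis (mono_tags, lifting) of_nat_power of_nat_prod prod.cong)
  also have "\<dots> = (\<Sum>p\<in>prime_factors g. ln (real p ^ multiplicity p g))"
    by (rule ln_prod) (auto dest: in_prime_factors_imp_prime simp: prime_gt_0_nat)
  also have "\<dots> = (\<Sum>p\<in>prime_factors g. real (multiplicity p g) * ln (real p))"
    by (intro sum.cong) (auto simp: ln_realpow dest: in_prime_factors_imp_prime simp: prime_gt_0_nat)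
  also have "\<dots> = (\<Sum>p\<in>primes_le n. real (multiplicity p g) * ln (real p))"
  proof (rule sum.mono_neutral_left)
    show "prime_factors g \<subseteq> primes_le n"
    proof
      fix p assume "p \<in> prime_factors g"
      then have "prime p" "p dvd g" by auto
      moreover from this have "p \<le> g" using assms by (intro dvd_imp_le) auto
      ultimately show "p \<in> primes_le n" using assms by (auto simp: primes_le_def)
    qed
    show "\<forall>p\<in>primes_le n - prime_factors g. real (multiplicity p g) * ln (real p) = 0"
      using assms by (auto simp: primes_le_def in_prime_factors_iff intro: not_dvd_imp_multiplicity_0)
  qed auto
  finally show ?thesis .
qed

lemma sum_ln_ge: "real n * ln (real n) - real n \<le> (\<Sum>g\<in>{1..n}. ln (real g))"
proof (induction n)
  case (Suc n)
  show ?case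
  proof (cases "n = 0")
    case False
    then have n: "n \<ge> 1" by simp
    have "ln (real (Suc n)) - ln (real n) = ln (1 + 1 / real n)"
      using n by (subst ln_divide_pos[symmetric]) (auto simp: add_divide_distrib add.commute)
    also have "\<dots> \<le> 1 / real n" using n by (intro ln_add_one_self_le_self) auto
    finally have "real n * ln (real (Suc n)) \<le> real n * ln (real n) + 1"
      using n by (simp add: field_simps)
    then show ?thesis using Suc by (simp add: algebra_simps)
  qed simp
qed simp

text \<open>Mertens' first theorem, upper half: count only one factor \<open>p\<close> in each multiple of
  \<open>p\<close> in \<open>n!\<close>, and repair the floor function by Chebyshev's bound.\<close>

lemma sum_ln_div_prime_upper:
  assumes "n \<ge> 1"
  shows "(\<Sum>p\<in>primes_le n. ln (real p) / real p) \<le> ln (real n) + ln 4"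
proof -
  have "(\<Sum>p\<in>primes_le n. real (n div p) * ln (real p)) \<le> (\<Sum>g\<in>{1..n}. ln (real g))"
  proof -
    have card: "real (n div p) = (\<Sum>g\<in>{1..n}. if p dvd g then 1 else 0)" if "p \<in> primes_le n" for p
    proof -
      have p: "p \<ge> 2" using that primes_leD by blast
      have "{g \<in> {1..n}. p dvd g} = (\<lambda>h. p * h) ` {1..n div p}"
      proof safe
        fix g assume "g \<in> {1..n}" "p dvd g"
        then obtain h where "g = p * h" by blast
        with \<open>g \<in> {1..n}\<close> p show "g \<in> (*) p ` {1..n div p}"
          by (intro image_eqI[of _ _ h]) (cases h; auto simp: less_eq_div_iff_mult_less_eq mult.commute)+
      qed (use p in \<open>auto simp: less_eq_div_iff_mult_less_eq mult.commute\<close>)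
      then have "card {g \<in> {1..n}. p dvd g} = n div p"
        using p by (simp add: card_image inj_on_def)
      moreover have "{1..n} \<inter> {g. p dvd g} = {g \<in> {1..n}. p dvd g}" by auto
      ultimately show ?thesis by (simp add: sum.If_cases)
    qed
    have "(\<Sum>p\<in>primes_le n. real (n div p) * ln (real p))
        = (\<Sum>p\<in>primes_le n. \<Sum>g\<in>{1..n}. (if p dvd g then 1 else 0) * ln (real p))"
      using card by (intro sum.cong) (auto simp: sum_distrib_right simp del: of_nat_div)
    also have "\<dots> = (\<Sum>g\<in>{1..n}. \<Sum>p\<in>primes_le n. (if p dvd g then 1 else 0) * ln (real p))"
      by (rule sum.swap)
    also have "\<dots> \<le> (\<Sum>g\<in>{1..n}. ln (real g))"
    proof (rule sum_mono)
      fix g assume g: "g \<in> {1..n}"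
      have "(\<Sum>p\<in>primes_le n. (if p dvd g then 1 else 0) * ln (real p))
          \<le> (\<Sum>p\<in>primes_le n. real (multiplicity p g) * ln (real p))"
      proof (rule sum_mono, rule mult_right_mono)
        fix p assume p: "p \<in> primes_le n"
        then have pp: "prime p" "p \<ge> 2" using primes_leD by auto
        then show "ln (real p) \<ge> 0" by simp
        show "(if p dvd g then 1 else 0) \<le> real (multiplicity p g)"
        proof (cases "p dvd g")
          case True
          then have "multiplicity p g > 0" using pp g
            by (subst multiplicity_gt_zero_iff) auto
          then show ?thesis by auto
        qed auto
      qed
      also have "\<dots> = ln (real g)" using ln_nat_eq_sum_multiplicity[of g n] g by simp
      finally show "(\<Sum>p\<in>primes_le n. (if p dvd g then 1 else 0) * ln (real p)) \<le> ln (real g)" .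
    qed
    finally show ?thesis .
  qed
  also have "\<dots> \<le> real n * ln (real n)"
    using sum_bounded_above[of "{1..n}" "\<lambda>g. ln (real g)" "ln (real n)"] by simp
  finally have 1: "(\<Sum>p\<in>primes_le n. real (n div p) * ln (real p)) \<le> real n * ln (real n)" .
  have "real n * (\<Sum>p\<in>primes_le n. ln (real p) / real p)
      = (\<Sum>p\<in>primes_le n. real n / real p * ln (real p))"
    by (simp add: sum_distrib_left)
  also have "\<dots> \<le> (\<Sum>p\<in>primes_le n. (real (n div p) + 1) * ln (real p))"
  proof (rule sum_mono, rule mult_right_mono)
    fix p assume p: "p \<in> primes_le n"
    then have p2: "p \<ge> 2" using primes_leD by blast
    then show "ln (real p) \<ge> 0" by simp
    have "n \<le> p * (n div p) + p"
      using mult_div_mod_eq[of p n] mod_less_divisor[of p n] p2 by linarith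
    then have "real n \<le> real p * real (n div p) + real p" by (metis of_nat_add of_nat_le_iff of_nat_mult)
    then show "real n / real p \<le> real (n div p) + 1"
      using p2 by (simp add: field_simps del: of_nat_div)
  qed
  also have "\<dots> = (\<Sum>p\<in>primes_le n. real (n div p) * ln (real p)) + (\<Sum>p\<in>primes_le n. ln (real p))"
    by (simp add: algebra_simps sum.distrib)
  also have "\<dots> \<le> real n * ln (real n) + real n * ln 4"
    using 1 sum_ln_primes_le[of n] by simp
  finally have "real n * (\<Sum>p\<in>primes_le n. ln (real p) / real p) \<le> real n * (ln (real n) + ln 4)"
    by (simp add: algebra_simps)
  then show ?thesis using assms by simp
qed

lemma sum_ln_div_consecutive_le: "(\<Sum>k\<in>{2..n}. ln (real k) / (real k * (real k - 1))) \<le> 2"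
proof -
  have "(\<Sum>k\<in>{2..n}. ln (real k) / (real k * (real k - 1))) \<le> 2 - (2 + ln (real n)) / real n" if "n \<ge> 1"
    using that
  proof (induction n rule: nat_induct_at_least)
    case base then show ?case by simp
  next
    case (Suc n)
    let ?s = "real (Suc n)"
    have "ln ?s - ln (real n) = ln (1 + 1 / real n)"
      using Suc by (subst ln_divide_pos[symmetric]) (auto simp: add_divide_distrib add.commute)
    also have "\<dots> \<le> 1 / real n" using Suc by (intro ln_add_one_self_le_self) auto
    finally have "?s * (ln ?s - ln (real n)) \<le> ?s * (1 / real n)" by (intro mult_left_mono) auto
    also have "\<dots> \<le> 2" using Suc by (simp add: field_simps)
    finally have key: "?s * ln ?s \<le> ?s * ln (real n) + 2" by (simp add: algebra_simps)
    have "ln ?s / (?s * real n) \<le> (2 + ln (real n)) / real n - (2 + ln ?s) / ?s"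
    proof -
      have "(2 + ln (real n)) / real n - (2 + ln ?s) / ?s
         = (?s * (2 + ln (real n)) - real n * (2 + ln ?s)) / (?s * real n)"
        using Suc by (simp add: field_simps)
      moreover have "ln ?s \<le> ?s * (2 + ln (real n)) - real n * (2 + ln ?s)"
        using key by (simp add: algebra_simps)
      ultimately show ?thesis using Suc by (simp add: divide_right_mono)
    qed
    moreover have "(\<Sum>k\<in>{2..Suc n}. ln (real k) / (real k * (real k - 1)))
       = (\<Sum>k\<in>{2..n}. ln (real k) / (real k * (real k - 1))) + ln ?s / (?s * real n)"
      using Suc by (subst atLeastAtMostSuc_conv) auto
    ultimately show ?case using Suc by linarith
  qed
  moreover have "(2 + ln (real n)) / real n \<ge> 0" by (cases "n = 0") auto
  ultimately show ?thesis by (cases "n = 0") (simp, force intro: order_trans)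
qed

lemma sum_ln_div_prime_minus_one:
  "(\<Sum>p\<in>primes_le n. ln (real p) / (real p - 1)) \<le> (\<Sum>p\<in>primes_le n. ln (real p) / real p) + 2"
proof -
  have "(\<Sum>p\<in>primes_le n. ln (real p) / (real p - 1))
     = (\<Sum>p\<in>primes_le n. ln (real p) / real p + ln (real p) / (real p * (real p - 1)))"
    by (intro sum.cong) (auto dest!: primes_leD simp: field_simps)
  also have "\<dots> = (\<Sum>p\<in>primes_le n. ln (real p) / real p)
      + (\<Sum>p\<in>primes_le n. ln (real p) / (real p * (real p - 1)))"
    by (rule sum.distrib)
  also have "(\<Sum>p\<in>primes_le n. ln (real p) / (real p * (real p - 1)))
     \<le> (\<Sum>k\<in>{2..n}. ln (real k) / (real k * (real k - 1)))"
    by (rule sum_mono2) (auto dest!: primes_leD)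
  also have "\<dots> \<le> 2" by (rule sum_ln_div_consecutive_le)
  finally show ?thesis by simp
qed

text \<open>Mertens' first theorem, lower half: Stirling's lower bound for \<open>ln (n!)\<close> against
  its factorisation with full multiplicities; the prime powers cost the convergent sum of
  \<open>ln p / (p (p - 1))\<close>.\<close>

lemma sum_ln_div_prime_lower:
  assumes "n \<ge> 1"
  shows "(\<Sum>p\<in>primes_le n. ln (real p) / real p) \<ge> ln (real n) - 3"
proof -
  have "real n * ln (real n) - real n \<le> (\<Sum>g\<in>{1..n}. ln (real g))" by (rule sum_ln_ge)
  also have "\<dots> = (\<Sum>g\<in>{1..n}. \<Sum>p\<in>primes_le n. real (multiplicity p g) * ln (real p))"
    using ln_nat_eq_sum_multiplicity[of _ n] by (intro sum.cong) auto
  also have "\<dots> = (\<Sum>p\<in>primes_le n. (\<Sum>g\<in>{1..n}. real (multiplicity p g)) * ln (real p))"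
    by (subst sum.swap) (simp add: sum_distrib_right)
  also have "\<dots> \<le> (\<Sum>p\<in>primes_le n. real n / (real p - 1) * ln (real p))"
  proof (rule sum_mono, rule mult_right_mono)
    fix p assume p: "p \<in> primes_le n"
    then have p2: "prime p" "p \<ge> 2" using primes_leD by auto
    then show "ln (real p) \<ge> 0" by simp
    have "real (p - 1) * real (\<Sum>g\<in>{1..n}. multiplicity p g) \<le> real n"
      using sum_multiplicity_le[OF p2(1), of n] by (metis of_nat_le_iff of_nat_mult)
    then show "(\<Sum>g\<in>{1..n}. real (multiplicity p g)) \<le> real n / (real p - 1)"
      using p2 by (simp add: field_simps of_nat_diff)
  qed
  also have "\<dots> = real n * (\<Sum>p\<in>primes_le n. ln (real p) / (real p - 1))"
    by (simp add: sum_distrib_left)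
  finally have "real n * (ln (real n) - 1) \<le> real n * (\<Sum>p\<in>primes_le n. ln (real p) / (real p - 1))"
    by (simp add: algebra_simps)
  then have "ln (real n) - 1 \<le> (\<Sum>p\<in>primes_le n. ln (real p) / (real p - 1))"
    using assms by simp
  then show ?thesis using sum_ln_div_prime_minus_one[of n] by linarith
qed

text \<open>Bertrand-type statement with ratio \<open>512 = 2^9\<close>: the two halves of Mertens' theorem
  differ by \<open>3 + ln 4 < 9 ln 2 - 1\<close>, so the primes in \<open>(n/512, n]\<close> carry
  at least \<open>1\<close> of the sum of \<open>ln p / p\<close>. This is the origin of the
  number 512 throughout.\<close>

lemma card_primes_between_ge:
  assumes "n \<ge> 512"
  shows "real (card {p. prime p \<and> n div 512 < p \<and> p \<le> n}) \<ge> real n / (512 * ln (real n))"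
proof -
  let ?m = "n div 512" and ?Q = "{p. prime p \<and> n div 512 < p \<and> p \<le> n}"
  have fin: "finite ?Q" by (rule finite_subset[of _ "{..n}"]) auto
  have m: "?m \<ge> 1" using assms by (simp add: less_eq_div_iff_mult_less_eq)
  have lnpos: "ln (real n) > 0" using assms by simp
  have "primes_le n = primes_le ?m \<union> ?Q" unfolding primes_le_def by auto
  moreover have "primes_le ?m \<inter> ?Q = {}" unfolding primes_le_def by auto
  ultimately have "(\<Sum>p\<in>primes_le n. ln (real p) / real p)
     = (\<Sum>p\<in>primes_le ?m. ln (real p) / real p) + (\<Sum>p\<in>?Q. ln (real p) / real p)"
    using fin sum.union_disjoint[of "primes_le ?m" ?Q] by simp
  then have "ln (real n) - 3 \<le> ln (real ?m) + ln 4 + (\<Sum>p\<in>?Q. ln (real p) / real p)"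
    using sum_ln_div_prime_lower[of n] sum_ln_div_prime_upper[OF m] assms by linarith
  moreover have "ln (real ?m) \<le> ln (real n / 512)"
    using m of_nat_div_le_of_nat[of n 512] by (subst ln_le_cancel_iff) auto
  moreover have "ln (real n / 512) = ln (real n) - 9 * ln 2"
    using assms ln_realpow[of 2 9] by (simp add: ln_div)
  moreover have "ln 4 = 2 * ln (2::real)" using ln_realpow[of 2 2] by simp
  moreover have "ln (2::real) \<ge> 63 / 100" by (rule ln2_bounds)
  ultimately have "1 \<le> (\<Sum>p\<in>?Q. ln (real p) / real p)" by linarith
  also have "\<dots> \<le> (\<Sum>p\<in>?Q. 512 * ln (real n) / real n)"
  proof (rule sum_mono)
    fix p assume p: "p \<in> ?Q"
    then have "p > 0" "ln (real p) \<le> ln (real n)" by (auto simp: prime_gt_0_nat)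
    moreover have "real n \<le> 512 * real p"
    proof -
      have "n < 512 * p" using p by (metis div_less_iff_less_mult mem_Collect_eq mult.commute zero_less_numeral)
      then show ?thesis by linarith
    qed
    ultimately have "ln (real p) / real p \<le> ln (real n) / real p" by (simp add: divide_right_mono)
    also have "\<dots> \<le> 512 * ln (real n) / real n"
      using \<open>p > 0\<close> \<open>real n \<le> 512 * real p\<close> lnpos assms by (simp add: field_simps)
    finally show "ln (real p) / real p \<le> 512 * ln (real n) / real n" .
  qed
  also have "\<dots> = real (card ?Q) * (512 * ln (real n) / real n)" by simp
  finally show ?thesis using lnpos assms by (simp add: field_simps)
qed

section \<open>Reciprocal sums of primes\<close>

definition prime_recip :: "nat \<Rightarrow> real" where
  "prime_recip n = (\<Sum>p\<in>primes_le n. 1 / real p)"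

lemma prime_recip_nonneg: "prime_recip n \<ge> 0"
  unfolding prime_recip_def by (intro sum_nonneg) auto

lemma prime_recip_mono: "m \<le> n \<Longrightarrow> prime_recip m \<le> prime_recip n"
  unfolding prime_recip_def by (intro sum_mono2 primes_le_mono) auto

lemma prime_dvd_prod_primes_iff:
  assumes "finite A" "\<And>p. p \<in> A \<Longrightarrow> prime p" "prime (q::nat)"
  shows "q dvd \<Prod>A \<longleftrightarrow> q \<in> A"
proof
  assume "q dvd \<Prod>A"
  then obtain p where "p \<in> A" "q dvd p" using assms by (auto simp: prime_dvd_prod_iff)
  then show "q \<in> A" using assms by (metis primes_dvd_imp_eq)
qed (use assms in \<open>auto intro: dvd_prodI\<close>)

lemma inj_on_prod_primes: "inj_on \<Prod> {A. finite A \<and> (\<forall>p\<in>A. prime (p::nat))}"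
proof (rule inj_onI)
  fix A B :: "nat set"
  assume A: "A \<in> {A. finite A \<and> (\<forall>p\<in>A. prime p)}" and B: "B \<in> {A. finite A \<and> (\<forall>p\<in>A. prime p)}"
    and eq: "\<Prod>A = \<Prod>B"
  have "prime q \<Longrightarrow> q \<in> A \<longleftrightarrow> q \<in> B" for q
    using A B eq prime_dvd_prod_primes_iff[of A q] prime_dvd_prod_primes_iff[of B q] by auto
  then show "A = B" using A B by blast
qed

lemma inj_on_prod_Pow_primes_le: "inj_on \<Prod> (Pow (primes_le n))"
  by (rule inj_on_subset[OF inj_on_prod_primes])
     (auto intro: finite_subset[OF _ finite_primes_le] dest!: primes_leD)

lemma sum_inverse_squares_le: "(\<Sum>d\<in>{1..n}. 1 / (real d)\<^sup>2) \<le> 2"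
proof -
  have "(\<Sum>d\<in>{1..n}. 1 / (real d)\<^sup>2) \<le> 2 - 1 / real n" if "n \<ge> 1"
    using that
  proof (induction n rule: nat_induct_at_least)
    case (Suc n)
    have "1 / (real (Suc n))\<^sup>2 \<le> 1 / (real n * real (Suc n))"
      using Suc by (intro divide_left_mono) (auto simp: power2_eq_square)
    also have "\<dots> = 1 / real n - 1 / real (Suc n)" using Suc by (simp add: field_simps)
    finally show ?case using Suc by simp
  qed simp
  then show ?thesis
    by (cases "n \<ge> 1") (auto intro: order_trans simp: not_le)
qed

lemma sum_inverse_squares_from2_le: "(\<Sum>d\<in>{2..n}. 1 / (real d)\<^sup>2) \<le> 1"
proof (cases "n \<ge> 1")
  case True
  have "(\<Sum>d\<in>{1..n}. 1 / (real d)\<^sup>2) = 1 + (\<Sum>d\<in>{2..n}. 1 / (real d)\<^sup>2)"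
    using True by (subst sum.atLeast_Suc_atMost) (auto simp: numeral_2_eq_2)
  then show ?thesis using sum_inverse_squares_le[of n] by simp
qed simp

lemma ln_le_sum_inverse:
  assumes "n \<ge> 1" shows "ln (real n) \<le> (\<Sum>m\<in>{1..n}. 1 / real m)"
proof -
  have "ln (real (Suc n)) \<le> (\<Sum>m\<in>{1..n}. 1 / real m)"
    using assms
  proof (induction n rule: nat_induct_at_least)
    case base
    then show ?case using ln_2_less_1 by simp
  next
    case (Suc n)
    have "ln (real (Suc (Suc n))) - ln (real (Suc n)) = ln (1 + 1 / real (Suc n))"
    proof -
      have "real (Suc (Suc n)) / real (Suc n) = 1 + 1 / real (Suc n)" by (simp add: field_simps)
      then show ?thesis using ln_divide_pos[of "real (Suc (Suc n))" "real (Suc n)"] by simp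
    qed
    also have "\<dots> \<le> 1 / real (Suc n)" by (intro ln_add_one_self_le_self) auto
    finally show ?case using Suc by simp
  qed
  moreover have "ln (real n) \<le> ln (real (Suc n))" using assms by simp
  ultimately show ?thesis by linarith
qed

text \<open>Every \<open>m \<le> n\<close> is a squarefree number times a square, so the harmonic sum is at
  most the Euler product of \<open>1 + 1/p\<close> times the sum of the inverse squares.\<close>

lemma ln_le_prime_recip:
  assumes "n \<ge> 1"
  shows "ln (real n) \<le> 2 * exp (prime_recip n)"
proof -
  let ?P = "primes_le n"
  let ?f = "\<lambda>m. (prime_factors (squarefree_part m), square_part m)"
  have dec: "squarefree_part m = \<Prod>(prime_factors (squarefree_part m))" for m :: nat
  proof -
    have nz: "squarefree_part m \<noteq> 0"
      using squarefree_squarefree_part[of m] by (metis not_squarefree_0)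
    have "squarefree_part m = (\<Prod>p\<in>prime_factors (squarefree_part m). p ^ multiplicity p (squarefree_part m))"
      using prod_prime_factors[OF nz] by simp
    also have "\<dots> = \<Prod>(prime_factors (squarefree_part m))"
      using squarefree_factorial_semiring'[of "squarefree_part m"] nz
      by (intro prod.cong) auto
    finally show ?thesis .
  qed
  have m: "m = \<Prod>(prime_factors (squarefree_part m)) * (square_part m)\<^sup>2" for m :: nat
    using squarefree_decompose[of m] dec[of m] by simp
  have "ln (real n) \<le> (\<Sum>m\<in>{1..n}. 1 / real m)" by (rule ln_le_sum_inverse[OF assms])
  also have "\<dots> = (\<Sum>m\<in>{1..n}. (\<lambda>(A, d). (1 / real (\<Prod>A)) * (1 / (real d)\<^sup>2)) (?f m))"
  proof (rule sum.cong)
    fix m assume "m \<in> {1..n}"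
    have "real m = real (\<Prod>(prime_factors (squarefree_part m))) * (real (square_part m))\<^sup>2"
      using m[of m] by (metis of_nat_mult of_nat_power)
    then show "1 / real m = (\<lambda>(A, d). (1 / real (\<Prod>A)) * (1 / (real d)\<^sup>2)) (?f m)"
      by (simp del: of_nat_prod)
  qed simp
  also have "\<dots> = (\<Sum>(A, d)\<in>?f ` {1..n}. (1 / real (\<Prod>A)) * (1 / (real d)\<^sup>2))"
  proof -
    have "inj_on ?f {1..n}"
    proof (rule inj_onI)
      fix x y :: nat assume "?f x = ?f y"
      then have pf: "prime_factors (squarefree_part x) = prime_factors (squarefree_part y)"
        and sp: "square_part x = square_part y" by simp_all
      have "squarefree_part x = squarefree_part y"
        using arg_cong[OF pf, of "\<lambda>A. \<Prod>A"] dec[of x] dec[of y] by argo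
      with sp show "x = y" by (rule squarefree_decomposition_unique)
    qed
    then show ?thesis by (simp only: sum.reindex o_def)
  qed
  also have "\<dots> \<le> (\<Sum>(A, d)\<in>Pow ?P \<times> {1..n}. (1 / real (\<Prod>A)) * (1 / (real d)\<^sup>2))"
  proof (rule sum_mono2)
    show "?f ` {1..n} \<subseteq> Pow ?P \<times> {1..n}"
    proof
      fix x assume "x \<in> ?f ` {1..n}"
      then obtain k where k: "x = ?f k" "1 \<le> k" "k \<le> n" by auto
      have d1: "squarefree_part k dvd k" by (metis squarefree_decompose dvd_triv_left)
      have "(square_part k)\<^sup>2 dvd k" by simp
      then have d2: "square_part k dvd k" by (metis dvd_mult_left power2_eq_square)
      have "square_part k \<in> {1..n}" using k d2 by (auto dest: dvd_imp_le intro!: Suc_leI Nat.gr0I)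
      moreover have "prime_factors (squarefree_part k) \<subseteq> ?P"
      proof
        fix p assume "p \<in> prime_factors (squarefree_part k)"
        then have "prime p" "p dvd k" using d1 by (auto intro: dvd_trans)
        moreover from this have "p \<le> k" using k by (intro dvd_imp_le) auto
        ultimately show "p \<in> ?P" using k by (auto simp: primes_le_def)
      qed
      ultimately show "x \<in> Pow ?P \<times> {1..n}" using k by auto
    qed
  qed (auto intro!: mult_nonneg_nonneg prod_nonneg)
  also have "\<dots> = (\<Sum>A\<in>Pow ?P. 1 / real (\<Prod>A)) * (\<Sum>d\<in>{1..n}. 1 / (real d)\<^sup>2)"
    by (simp add: sum_product sum.cartesian_product del: of_nat_prod)
  also have "\<dots> \<le> exp (prime_recip n) * 2"
  proof (rule mult_mono)
    have "(\<Sum>A\<in>Pow ?P. 1 / real (\<Prod>A)) = (\<Sum>A\<in>Pow ?P. (\<Prod>p\<in>A. 1 / real p) * (\<Prod>p\<in>?P - A. 1))"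
      by (intro sum.cong) (auto simp: prod_dividef)
    also have "\<dots> = (\<Prod>p\<in>?P. 1 / real p + 1)" by (rule prod_add[symmetric]) simp
    also have "\<dots> \<le> (\<Prod>p\<in>?P. exp (1 / real p))"
      by (intro prod_mono conjI) (auto simp: add.commute[of _ 1])
    also have "\<dots> = exp (prime_recip n)" by (simp add: exp_sum prime_recip_def)
    finally show "(\<Sum>A\<in>Pow ?P. 1 / real (\<Prod>A)) \<le> exp (prime_recip n)" .
  qed (use sum_inverse_squares_le[of n] in \<open>auto intro: sum_nonneg\<close>)
  finally show ?thesis by simp
qed

lemma prime_recip_lower:
  assumes "n \<ge> 2"
  shows "prime_recip n \<ge> ln (ln (real n)) - 1"
proof -
  have "ln (ln (real n)) \<le> ln (2 * exp (prime_recip n))"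
    using ln_le_prime_recip[of n] assms by (subst ln_le_cancel_iff) auto
  also have "\<dots> = ln 2 + prime_recip n" by (simp add: ln_mult)
  finally show ?thesis using ln_2_less_1 by linarith
qed

lemma sum_powr_le:
  assumes "\<sigma> > 0"
  shows "(\<Sum>m\<in>{1..M}. real m powr (-1 - \<sigma>)) \<le> 1 + 1 / \<sigma>"
proof -
  have "(\<Sum>m\<in>{1..M}. real m powr (-1 - \<sigma>)) \<le> 1 + 1 / \<sigma> - real M powr (-\<sigma>) / \<sigma>" if "M \<ge> 1"
    using that
  proof (induction M rule: nat_induct_at_least)
    case (Suc n)
    have "\<exists>z. real n < z \<and> z < real (Suc n) \<and>
        (real (Suc n) powr (-\<sigma>) - real n powr (-\<sigma>)) = (real (Suc n) - real n) * (- \<sigma> * z powr (-\<sigma> - 1))"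
      using Suc by (intro MVT2) (auto intro!: derivative_eq_intros simp: field_simps)
    then obtain z where z: "real n < z" "z < real (Suc n)"
      "real (Suc n) powr (-\<sigma>) - real n powr (-\<sigma>) = - \<sigma> * z powr (-\<sigma> - 1)" by auto
    have "real (Suc n) powr (-1 - \<sigma>) \<le> z powr (-\<sigma> - 1)"
      using z Suc assms powr_mono2'[of "-\<sigma> - 1" z "real (Suc n)"]
      unfolding minus_diff_commute[of 1 \<sigma>] by simp
    also have "\<dots> = (real n powr (-\<sigma>) - real (Suc n) powr (-\<sigma>)) / \<sigma>"
      using z(3) assms by (simp add: field_simps)
    finally show ?case using Suc by (simp add: diff_divide_distrib)
  qed simp
  moreover have "real M powr (-\<sigma>) / \<sigma> \<ge> 0" using assms by simp
  ultimately have "(\<Sum>m\<in>{1..M}. real m powr (-1 - \<sigma>)) \<le> 1 + 1 / \<sigma>" if "M \<ge> 1"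
    using that by linarith
  then show ?thesis using assms by (cases "M \<ge> 1") (auto simp: not_le)
qed

text \<open>Rankin's trick: with \<open>s = 1 / ln n\<close> the Euler product of \<open>1 +
  p^(-1-s)\<close> is at most \<open>\<zeta>(1 + s)\<close>, of order \<open>ln n\<close>, and
  replacing \<open>p^(-1-s)\<close> by \<open>1/p\<close> costs at most \<open>s\<close> times the
  Mertens sum, which is bounded.\<close>

lemma prime_recip_upper:
  assumes "n \<ge> 3"
  shows "prime_recip n \<le> ln (ln (real n)) + 5"
proof -
  let ?P = "primes_le n"
  define s where "s = 1 / ln (real n)"
  have ln1: "ln (real n) \<ge> 1"
  proof -
    have "exp 1 \<le> real n" using assms exp_le by linarith
    then show ?thesis using assms by (simp add: ln_ge_iff)
  qed
  have s: "0 < s" "s \<le> 1" using ln1 unfolding s_def by auto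
  have "(\<Prod>p\<in>?P. real p powr (-1 - s) + 1)
     = (\<Sum>A\<in>Pow ?P. (\<Prod>p\<in>A. real p powr (-1 - s)) * (\<Prod>p\<in>?P - A. 1))"
    by (rule prod_add) simp
  also have "\<dots> = (\<Sum>A\<in>Pow ?P. real (\<Prod>A) powr (-1 - s))"
    by (intro sum.cong) (auto simp: prod_powr_distrib)
  also have "\<dots> = (\<Sum>m\<in>\<Prod> ` Pow ?P. real m powr (-1 - s))"
    by (simp add: sum.reindex[OF inj_on_prod_Pow_primes_le] del: of_nat_prod)
  also have "\<dots> \<le> (\<Sum>m\<in>{1..\<Prod>?P}. real m powr (-1 - s))"
  proof (rule sum_mono2)
    show "\<Prod> ` Pow ?P \<subseteq> {1..\<Prod>?P}"
    proof (rule image_subsetI)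
      fix A assume A: "A \<in> Pow ?P"
      have "\<Prod>A > 0" using A by (intro prod_pos) (auto dest!: primes_leD)
      moreover have "\<Prod>A \<le> \<Prod>?P"
        using A by (intro dvd_imp_le prod_dvd_prod_subset prod_pos) (auto dest!: primes_leD)
      ultimately show "\<Prod>A \<in> {1..\<Prod>?P}" by auto
    qed
  qed auto
  also have "\<dots> \<le> 1 + 1 / s" using s by (intro sum_powr_le)
  also have "\<dots> \<le> 2 / s" using s by (simp add: field_simps)
  finally have prod: "(\<Prod>p\<in>?P. 1 + real p powr (-1 - s)) \<le> 2 * ln (real n)"
    unfolding s_def by (simp add: add.commute)
  have "(\<Sum>p\<in>?P. real p powr (-1 - s) - (real p powr (-1 - s))\<^sup>2) \<le> (\<Sum>p\<in>?P. ln (1 + real p powr (-1 - s)))"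
  proof (rule sum_mono, rule ln_one_plus_pos_lower_bound)
    fix p assume "p \<in> ?P"
    then have "p \<ge> 2" using primes_leD by blast
    then show "real p powr (-1 - s) \<le> 1" using s powr_mono[of "-1 - s" 0 "real p"] by simp
  qed auto
  also have "\<dots> = ln (\<Prod>p\<in>?P. 1 + real p powr (-1 - s))"
    by (rule ln_prod[symmetric]) (simp, metis add_pos_nonneg less_irrefl powr_ge_zero zero_less_one)
  also have "\<dots> \<le> ln (2 * ln (real n))"
    using prod ln1 by (subst ln_le_cancel_iff) (auto intro!: prod_pos add_pos_nonneg)
  also have "\<dots> \<le> 1 + ln (ln (real n))" using ln1 ln_2_less_1 by (simp add: ln_mult)
  finally have 1: "(\<Sum>p\<in>?P. real p powr (-1 - s)) \<le> 1 + ln (ln (real n)) + (\<Sum>p\<in>?P. (real p powr (-1 - s))\<^sup>2)"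
    by (simp add: sum_subtractf)
  have 2: "(\<Sum>p\<in>?P. (real p powr (-1 - s))\<^sup>2) \<le> 1"
  proof -
    have "(\<Sum>p\<in>?P. (real p powr (-1 - s))\<^sup>2) \<le> (\<Sum>p\<in>?P. 1 / (real p)\<^sup>2)"
    proof (rule sum_mono)
      fix p assume "p \<in> ?P"
      then have p: "p \<ge> 2" using primes_leD by blast
      then have "real p powr (-1 - s) \<le> real p powr (-1)" using s by (intro powr_mono) auto
      also have "\<dots> = 1 / real p" using p by (simp add: powr_minus_divide)
      finally have "(real p powr (-1 - s))\<^sup>2 \<le> (1 / real p)\<^sup>2" by (intro power_mono) auto
      then show "(real p powr (-1 - s))\<^sup>2 \<le> 1 / (real p)\<^sup>2" by (simp add: power_divide)
    qed
    also have "\<dots> \<le> (\<Sum>d\<in>{2..n}. 1 / (real d)\<^sup>2)" by (rule sum_mono2) (auto dest!: primes_leD)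
    also have "\<dots> \<le> 1" by (rule sum_inverse_squares_from2_le)
    finally show ?thesis .
  qed
  have 3: "prime_recip n - (\<Sum>p\<in>?P. real p powr (-1 - s)) \<le> 3"
  proof -
    have "prime_recip n - (\<Sum>p\<in>?P. real p powr (-1 - s)) = (\<Sum>p\<in>?P. 1 / real p - real p powr (-1 - s))"
      by (simp add: prime_recip_def sum_subtractf)
    also have "\<dots> \<le> (\<Sum>p\<in>?P. s * (ln (real p) / real p))"
    proof (rule sum_mono)
      fix p assume "p \<in> ?P"
      then have p: "p \<ge> 2" using primes_leD by blast
      have "real p powr (-1 - s) = real p powr (-1) * real p powr (-s)"
        by (subst powr_add[symmetric]) simp
      also have "\<dots> = exp (- s * ln (real p)) / real p"
        using p by (simp add: powr_def exp_minus inverse_eq_divide)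
      finally have "1 / real p - real p powr (-1 - s) = (1 - exp (- s * ln (real p))) / real p"
        by (simp add: diff_divide_distrib)
      also have "\<dots> \<le> (s * ln (real p)) / real p"
        using exp_ge_add_one_self[of "- s * ln (real p)"] by (intro divide_right_mono) auto
      finally show "1 / real p - real p powr (-1 - s) \<le> s * (ln (real p) / real p)" by simp
    qed
    also have "\<dots> = s * (\<Sum>p\<in>?P. ln (real p) / real p)" by (simp add: sum_distrib_left)
    also have "\<dots> \<le> s * (ln (real n) + ln 4)"
      using s assms by (intro mult_left_mono sum_ln_div_prime_upper) auto
    also have "\<dots> = 1 + s * ln 4" using ln1 by (simp add: s_def field_simps)
    also have "\<dots> \<le> 1 + 1 * 2"
    proof -
      have "ln 4 = 2 * ln (2::real)" using ln_realpow[of 2 2] by simp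
      then have "ln (4::real) \<le> 2" using ln_2_less_1 by simp
      then show ?thesis using s by (intro add_left_mono mult_mono) auto
    qed
    finally show ?thesis by simp
  qed
  show ?thesis using 1 2 3 by linarith
qed

section \<open>Orthogonality of Dirichlet characters modulo a prime\<close>

abbreviation (input) dchars :: "nat \<Rightarrow> (int \<Rightarrow> complex) set" where
  "dchars m \<equiv> {\<chi>. dirichlet_character m \<chi>}"

lemma dirichlet_character_mult: "dirichlet_character m \<chi> \<Longrightarrow> \<chi> (a * b) = \<chi> a * \<chi> b"
  by (simp add: dirichlet_character_def)

lemma dirichlet_character_eq_0_iff:
  "dirichlet_character m \<chi> \<Longrightarrow> \<chi> a = 0 \<longleftrightarrow> \<not> coprime a (int m)"
  by (auto simp: dirichlet_character_def)

lemma norm_dirichlet_character: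
  assumes "dirichlet_character m \<chi>" "m > 0" "coprime a (int m)"
  shows "cmod (\<chi> a) = 1"
proof -
  define b where "b = nat (a mod int m)"
  have b: "int b = a mod int m" using assms by (simp add: b_def)
  have cab: "[a = int b] (mod int m)" using b by (simp add: Cong.cong_def)
  have "coprime (int b) (int m)" using assms cab by (metis cong_imp_coprime)
  then have "[b ^ totient m = 1] (mod m)" by (intro euler_theorem) (simp add: coprime_int_iff)
  then have "[int b ^ totient m = 1] (mod int m)" by (metis cong_int_iff of_nat_1 of_nat_power)
  then have "\<chi> (int b) ^ totient m = 1"
    using dirichlet_character_cong[OF assms(1)] dirichlet_character_one[OF assms(1)]
      dirichlet_character_power[OF assms(1)] by metis
  then have "cmod (\<chi> (int b)) ^ totient m = 1" by (metis norm_one norm_power)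
  moreover have "totient m > 0" using assms(2) by simp
  ultimately have "cmod (\<chi> (int b)) = 1"
    using power_eq_imp_eq_base[of "cmod (\<chi> (int b))" "totient m" 1] by simp
  then show ?thesis using dirichlet_character_cong[OF assms(1) cab] by simp
qed

lemma dirichlet_character_times_cnj:
  assumes "dirichlet_character m \<chi>" "m > 0" "coprime a (int m)"
  shows "\<chi> a * cnj (\<chi> a) = 1"
  using norm_dirichlet_character[OF assms] by (simp add: complex_mult_cnj cmod_def flip: of_real_power)

lemma dirichlet_character_prod:
  assumes "dirichlet_character m \<chi>" "dirichlet_character m \<psi>"
  shows "dirichlet_character m (\<lambda>a. \<chi> a * \<psi> a)"
  using assms unfolding dirichlet_character_def by (auto simp: algebra_simps)

lemma dirichlet_character_cnj:
  assumes "dirichlet_character m \<chi>"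
  shows "dirichlet_character m (\<lambda>a. cnj (\<chi> a))"
  using assms unfolding dirichlet_character_def by auto

lemma coprime_int_prime_iff:
  assumes "prime p" shows "coprime a (int p) \<longleftrightarrow> \<not> int p dvd a"
  using assms by (metis coprime_commute prime_imp_coprime prime_nat_int_transfer not_prime_unit coprime_absorb_left)

text \<open>With a primitive root \<open>g\<close>, the map \<open>g^i \<mapsto> e(i / (p - 1))\<close> is a
  faithful character of the group of units.\<close>

lemma separating_character_exists:
  assumes p: "prime p" and a: "coprime a (int p)" "\<not> [a = 1] (mod int p)"
  shows "\<exists>\<psi>. dirichlet_character p \<psi> \<and> \<psi> a \<noteq> 1"
proof -
  obtain g where g: "residue_primroot p g"
    using prime_primitive_root_exists[OF prime_gt_1_nat[OF p] p] by blast
  have p2: "p \<ge> 2" using p prime_ge_2_nat by blast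
  have cg: "coprime p g" and ordg: "ord p g = p - 1"
    using g p by (auto simp: residue_primroot_def totient_prime)
  have ex: "\<exists>i. [int g ^ i = x] (mod int p)" if "coprime x (int p)" for x
  proof -
    define b where "b = nat (x mod int p)"
    have b: "int b = x mod int p" using p2 by (simp add: b_def)
    have cb: "[x = int b] (mod int p)" using b by (simp add: Cong.cong_def)
    have "coprime (int b) (int p)" using that cb by (metis cong_imp_coprime)
    moreover have "b < p" using b p2 by (metis of_nat_less_iff pos_mod_bound of_nat_0_less_iff prime_gt_0_nat p)
    ultimately have "b \<in> totatives p"
      using p2 by (cases "b = 0") (auto simp: totatives_def coprime_int_iff coprime_commute)
    then have "b \<in> (\<lambda>i. g ^ i mod p) ` {..<totient p}"
      using residue_primroot_is_generator[OF _ g] p2 unfolding bij_betw_def by simp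
    then obtain i where "g ^ i mod p = b" by blast
    moreover have "b mod p = b" using \<open>b < p\<close> by simp
    ultimately have "[g ^ i = b] (mod p)" by (simp add: Cong.cong_def)
    then have "[int g ^ i = int b] (mod int p)" by (metis cong_int_iff of_nat_power)
    then show ?thesis using cb cong_sym cong_trans by blast
  qed
  define ind where "ind x = (SOME i. [int g ^ i = x] (mod int p))" for x
  have ind: "[int g ^ ind x = x] (mod int p)" if "coprime x (int p)" for x
    using someI_ex[OF ex[OF that]] unfolding ind_def .
  have inj: "[i = j] (mod (p - 1))" if "[int g ^ i = int g ^ j] (mod int p)" for i j
    using that cg ordg by (metis cong_int_iff of_nat_power order_divides_expdiff)
  define \<psi> where "\<psi> x = (if coprime x (int p) then cis (2 * pi * real (ind x) / real (p - 1)) else 0)" for x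
  have cisc: "cis (2 * pi * real i / real (p - 1)) = cis (2 * pi * real j / real (p - 1))"
    if "[i = j] (mod (p - 1))" for i j
  proof -
    have *: "cis (2 * pi * real i / real (p - 1)) = cis (2 * pi * real (i mod (p - 1)) / real (p - 1))" for i
    proof -
      have "real i = real (i div (p - 1)) * real (p - 1) + real (i mod (p - 1))"
        by (metis of_nat_add of_nat_mult div_mult_mod_eq)
      moreover have "real (p - 1) > 0" using p2 by simp
      moreover have "2 * pi * (x * y + z) / y = 2 * pi * z / y + 2 * pi * x" if "y > 0" for x y z :: real
        using that by (simp add: field_simps)
      ultimately have "2 * pi * real i / real (p - 1)
          = 2 * pi * real (i mod (p - 1)) / real (p - 1) + 2 * pi * real (i div (p - 1))"
        by metis
      then have "cis (2 * pi * real i / real (p - 1))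
        = cis (2 * pi * real (i mod (p - 1)) / real (p - 1)) * cis (2 * pi * real (i div (p - 1)))"
        by (simp only: cis_mult)
      also have "cis (2 * pi * real (i div (p - 1))) = 1" by (rule cis_multiple_2pi) simp
      finally show ?thesis by simp
    qed
    show ?thesis using *[of i] *[of j] that by (simp add: Cong.cong_def)
  qed
  have "dirichlet_character p \<psi>"
    unfolding dirichlet_character_def
  proof (intro conjI allI)
    fix x y
    have "coprime (x + int p) (int p) \<longleftrightarrow> coprime x (int p)"
      by (simp add: coprime_iff_gcd_eq_1)
    moreover have "ind (x + int p) = ind x" unfolding ind_def by (simp add: Cong.cong_def)
    ultimately show "\<psi> (x + int p) = \<psi> x" by (simp add: \<psi>_def)
    show "\<psi> x \<noteq> 0 \<longleftrightarrow> coprime x (int p)" by (simp add: \<psi>_def)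
    show "\<psi> (x * y) = \<psi> x * \<psi> y"
    proof (cases "coprime x (int p) \<and> coprime y (int p)")
      case True
      then have c: "coprime (x * y) (int p)" by simp
      have "[int g ^ ind (x * y) = x * y] (mod int p)" by (rule ind[OF c])
      moreover have "[int g ^ ind x * int g ^ ind y = x * y] (mod int p)"
        using True ind by (intro cong_mult) auto
      ultimately have "[int g ^ ind (x * y) = int g ^ (ind x + ind y)] (mod int p)"
        by (metis cong_sym cong_trans power_add)
      then have "cis (2 * pi * real (ind (x * y)) / real (p - 1)) = cis (2 * pi * real (ind x + ind y) / real (p - 1))"
        by (intro cisc inj)
      also have "\<dots> = cis (2 * pi * real (ind x) / real (p - 1)) * cis (2 * pi * real (ind y) / real (p - 1))"
        by (simp add: cis_mult add_divide_distrib distrib_left)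
      finally show ?thesis using True c by (simp add: \<psi>_def)
    qed (auto simp: \<psi>_def)
  qed
  moreover have "\<psi> a \<noteq> 1"
  proof
    assume "\<psi> a = 1"
    then have "cis (2 * pi * real (ind a) / real (p - 1)) = 1" using a by (simp add: \<psi>_def)
    then have "cos (2 * pi * real (ind a) / real (p - 1)) = 1" by (metis cis.sel(1) one_complex.sel(1))
    then obtain k :: int where k: "2 * pi * real (ind a) / real (p - 1) = 2 * pi * of_int k"
      unfolding cos_one_2pi_int by (auto simp: mult_ac)
    moreover have "real (p - 1) > 0" using p2 by simp
    moreover have "x = z * y" if "2 * pi * x / y = 2 * pi * z" "y > 0" for x y z :: real
      using that by (simp add: field_simps)
    ultimately have "real (ind a) = of_int k * real (p - 1)" by blast
    then have "int (ind a) = k * int (p - 1)"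
      by (metis of_int_eq_iff of_int_mult of_int_of_nat_eq)
    then have "(p - 1) dvd ind a" by (metis dvd_triv_right int_dvd_int_iff)
    then have "[g ^ ind a = 1] (mod p)" using ordg by (simp add: ord_divides')
    then have "[int g ^ ind a = 1] (mod int p)" by (metis cong_int_iff of_nat_1 of_nat_power)
    then show False using ind[OF a(1)] a(2) cong_sym cong_trans by blast
  qed
  ultimately show ?thesis by blast
qed

text \<open>Multiplication by a character that separates \<open>a\<close> from \<open>1\<close> permutes the
  characters.\<close>

lemma sum_characters_eq_0:
  assumes p: "prime p" and a: "coprime a (int p)" "\<not> [a = 1] (mod int p)"
  shows "(\<Sum>\<chi>\<in>dchars p. \<chi> a) = 0"
proof -
  obtain \<psi> where \<psi>: "dirichlet_character p \<psi>" "\<psi> a \<noteq> 1"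
    using separating_character_exists[OF assms] by blast
  have p0: "p > 0" using p prime_gt_0_nat by blast
  have undo: "(\<lambda>x. \<chi> x * cnj (\<psi> x) * \<psi> x) = \<chi>" "(\<lambda>x. \<chi> x * \<psi> x * cnj (\<psi> x)) = \<chi>"
    if "dirichlet_character p \<chi>" for \<chi>
  proof -
    have "\<chi> x * cnj (\<psi> x) * \<psi> x = \<chi> x" for x
      using dirichlet_character_times_cnj[OF \<psi>(1) p0, of x] that
      by (cases "coprime x (int p)") (auto simp: dirichlet_character_eq_0_iff mult.commute mult.assoc)
    then show "(\<lambda>x. \<chi> x * cnj (\<psi> x) * \<psi> x) = \<chi>" "(\<lambda>x. \<chi> x * \<psi> x * cnj (\<psi> x)) = \<chi>"
      by (auto simp: fun_eq_iff mult_ac)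
  qed
  have "(\<Sum>\<chi>\<in>dchars p. \<chi> a) = (\<Sum>\<chi>\<in>dchars p. \<chi> a * \<psi> a)"
  proof (rule sum.reindex_bij_witness[where i = "\<lambda>\<chi> x. \<chi> x * \<psi> x" and j = "\<lambda>\<chi> x. \<chi> x * cnj (\<psi> x)"])
    fix \<chi> assume "\<chi> \<in> dchars p"
    then have \<chi>: "dirichlet_character p \<chi>" by simp
    show "(\<lambda>x. \<chi> x * cnj (\<psi> x)) \<in> dchars p"
      using dirichlet_character_prod[OF \<chi> dirichlet_character_cnj[OF \<psi>(1)]] by simp
    show "(\<lambda>x. \<chi> x * \<psi> x) \<in> dchars p" using dirichlet_character_prod[OF \<chi> \<psi>(1)] by simp
    show "(\<lambda>x. \<chi> x * cnj (\<psi> x) * \<psi> x) = \<chi>" "(\<lambda>x. \<chi> x * \<psi> x * cnj (\<psi> x)) = \<chi>"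
      using undo[OF \<chi>] by auto
    show "\<chi> a * cnj (\<psi> a) * \<psi> a = \<chi> a" using fun_cong[OF undo(1)[OF \<chi>], of a] by simp
  qed
  also have "\<dots> = (\<Sum>\<chi>\<in>dchars p. \<chi> a) * \<psi> a" by (simp add: sum_distrib_right)
  finally show ?thesis using \<psi>(2) by (metis mult_cancel_left1 mult.commute)
qed

lemma prime_units: assumes "prime p" "n \<in> {1..<p}" shows "coprime (int n) (int p)"
  using assms by (subst coprime_int_prime_iff) (auto simp: int_dvd_int_iff dest: dvd_imp_le)

lemma sum_units_dilate:
  fixes F :: "nat \<Rightarrow> complex"
  assumes p: "prime p" and b: "coprime (int b) (int p)"
  shows "(\<Sum>n\<in>{1..<p}. F (n * b mod p)) = (\<Sum>n\<in>{1..<p}. F n)"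
proof -
  have "\<not> p dvd b" using b coprime_int_prime_iff[OF p, of "int b"] by simp
  have inj: "inj_on (\<lambda>n. n * b mod p) {1..<p}"
  proof (rule inj_onI)
    fix x y assume xy: "x \<in> {1..<p}" "y \<in> {1..<p}" "x * b mod p = y * b mod p"
    have "coprime b p" using b by (simp add: coprime_int_iff)
    then have "[x = y] (mod p)" using xy(3) by (simp add: Cong.cong_def[symmetric] cong_mult_rcancel_nat)
    then show "x = y" using xy by (simp add: Cong.cong_def)
  qed
  have "(\<lambda>n. n * b mod p) ` {1..<p} \<subseteq> {1..<p}"
  proof (rule image_subsetI)
    fix n assume n: "n \<in> {1..<p}"
    then have "\<not> p dvd n" by (auto dest: dvd_imp_le)
    then have "\<not> p dvd n * b" using \<open>\<not> p dvd b\<close> p by (simp add: prime_dvd_mult_iff)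
    then show "n * b mod p \<in> {1..<p}" using n by (simp add: mod_greater_zero_iff_not_dvd Suc_leI)
  qed
  then have "(\<lambda>n. n * b mod p) ` {1..<p} = {1..<p}"
    using inj by (intro card_subset_eq) (auto simp: card_image)
  then show ?thesis using sum.reindex[OF inj, of F] by simp
qed

lemma nonprincipal_character_sum_eq_0:
  assumes p: "prime p" and \<chi>: "dirichlet_character p \<chi>" "\<chi> \<noteq> principal_character p"
  shows "(\<Sum>n\<in>{1..<p}. \<chi> (int n)) = 0"
proof -
  obtain x where x: "\<chi> x \<noteq> principal_character p x" using \<chi>(2) by blast
  then have cx: "coprime x (int p)"
    using \<chi>(1) by (metis dirichlet_character_eq_0_iff principal_character_def)
  define b where "b = nat (x mod int p)"
  have p0: "p > 0" using p prime_gt_0_nat by blast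
  have b: "int b = x mod int p" using p0 by (simp add: b_def)
  have cb: "[x = int b] (mod int p)" using b by (simp add: Cong.cong_def)
  have ccb: "coprime (int b) (int p)" using cx cb by (metis cong_imp_coprime)
  have b1: "\<chi> (int b) \<noteq> 1" using x cx dirichlet_character_cong[OF \<chi>(1) cb] by (simp add: principal_character_def)
  have "(\<Sum>n\<in>{1..<p}. \<chi> (int n)) = (\<Sum>n\<in>{1..<p}. \<chi> (int (n * b mod p)))"
    by (rule sum_units_dilate[OF p ccb, symmetric])
  also have "\<dots> = (\<Sum>n\<in>{1..<p}. \<chi> (int n) * \<chi> (int b))"
  proof (rule sum.cong)
    fix n
    have "\<chi> (int (n * b mod p)) = \<chi> (int (n * b))"
      by (rule dirichlet_character_cong[OF \<chi>(1)]) (simp add: zmod_int Cong.cong_def)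
    then show "\<chi> (int (n * b mod p)) = \<chi> (int n) * \<chi> (int b)"
      by (simp add: dirichlet_character_mult[OF \<chi>(1)])
  qed simp
  also have "\<dots> = (\<Sum>n\<in>{1..<p}. \<chi> (int n)) * \<chi> (int b)" by (simp add: sum_distrib_right)
  finally show ?thesis using b1 by (metis mult_cancel_left1 mult.commute)
qed

text \<open>Evaluate the sum of \<open>\<chi>(n)\<close> over all \<open>\<chi>\<close> and \<open>n\<close>
  in both orders: only \<open>n = 1\<close>, respectively only the principal character,
  contributes.\<close>

lemma card_dchars:
  assumes p: "prime p"
  shows "card (dchars p) = p - 1"
proof -
  have p2: "p \<ge> 2" using p prime_ge_2_nat by blast
  have fin: "finite (dchars p)" using p2 by (intro finite_dirichlet_characters) simp
  have "(\<Sum>n\<in>{1..<p}. \<Sum>\<chi>\<in>dchars p. \<chi> (int n)) = (\<Sum>n\<in>{1..<p}. if n = 1 then of_nat (card (dchars p)) else 0)"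
  proof (rule sum.cong)
    fix n assume n: "n \<in> {1..<p}"
    show "(\<Sum>\<chi>\<in>dchars p. \<chi> (int n)) = (if n = 1 then of_nat (card (dchars p)) else 0)"
    proof (cases "n = 1")
      case True
      then have "(\<Sum>\<chi>\<in>dchars p. \<chi> (int n)) = (\<Sum>\<chi>\<in>dchars p. 1)"
        by (intro sum.cong) (auto simp: dirichlet_character_one)
      then show ?thesis using True by simp
    next
      case False
      then have "\<not> [int n = 1] (mod int p)"
        using n by (metis One_nat_def atLeastLessThan_iff cong_int_iff cong_less_modulus_unique_nat of_nat_1 p2 Suc_1 Suc_le_lessD)
      then show ?thesis using False sum_characters_eq_0[OF p prime_units[OF p n]] by simp
    qed
  qed simp
  also have "\<dots> = of_nat (card (dchars p))" using p2 by (subst sum.delta) auto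
  finally have 1: "(\<Sum>n\<in>{1..<p}. \<Sum>\<chi>\<in>dchars p. \<chi> (int n)) = of_nat (card (dchars p))" .
  have "(\<Sum>n\<in>{1..<p}. \<Sum>\<chi>\<in>dchars p. \<chi> (int n)) = (\<Sum>\<chi>\<in>dchars p. \<Sum>n\<in>{1..<p}. \<chi> (int n))"
    by (rule sum.swap)
  also have "\<dots> = (\<Sum>\<chi>\<in>dchars p. if \<chi> = principal_character p then of_nat (p - 1) else 0)"
  proof (rule sum.cong)
    fix \<chi> assume \<chi>: "\<chi> \<in> dchars p"
    show "(\<Sum>n\<in>{1..<p}. \<chi> (int n)) = (if \<chi> = principal_character p then of_nat (p - 1) else 0)"
    proof (cases "\<chi> = principal_character p")
      case True
      then have "(\<Sum>n\<in>{1..<p}. \<chi> (int n)) = (\<Sum>n\<in>{1..<p}. 1)"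
        using prime_units[OF p] by (intro sum.cong) (auto simp: principal_character_def)
      then show ?thesis using True by simp
    qed (use \<chi> nonprincipal_character_sum_eq_0[OF p] in auto)
  qed simp
  also have "\<dots> = of_nat (p - 1)"
    using fin dirichlet_character_principal by (subst sum.delta) auto
  finally have "(of_nat (card (dchars p)) :: complex) = of_nat (p - 1)" using 1 by simp
  then show ?thesis by (metis of_nat_eq_iff)
qed

lemma character_orthogonality:
  assumes p: "prime p" and a: "coprime a (int p)" and b: "coprime b (int p)"
  shows "(\<Sum>\<chi>\<in>dchars p. \<chi> a * cnj (\<chi> b)) = (if [a = b] (mod int p) then of_nat (p - 1) else 0)"
proof -
  have p0: "p > 0" using p prime_gt_0_nat by blast
  obtain c where c: "[b * c = 1] (mod int p)" using b cong_solve_coprime_int by blast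
  then have cc: "coprime c (int p)" by (metis coprime_iff_invertible_int mult.commute)
  have "\<chi> a * cnj (\<chi> b) = \<chi> (a * c)" if \<chi>: "dirichlet_character p \<chi>" for \<chi>
  proof -
    have "\<chi> b * \<chi> c = 1"
      using dirichlet_character_cong[OF \<chi> c] dirichlet_character_one[OF \<chi>] dirichlet_character_mult[OF \<chi>] by metis
    moreover have "\<chi> b * cnj (\<chi> b) = 1" by (rule dirichlet_character_times_cnj[OF \<chi> p0 b])
    ultimately have "cnj (\<chi> b) = \<chi> c" by (metis mult_cancel_left mult_zero_left zero_neq_one)
    then show ?thesis using dirichlet_character_mult[OF \<chi>] by simp
  qed
  then have eq: "(\<Sum>\<chi>\<in>dchars p. \<chi> a * cnj (\<chi> b)) = (\<Sum>\<chi>\<in>dchars p. \<chi> (a * c))"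
    by (intro sum.cong) auto
  have iff: "[a * c = 1] (mod int p) \<longleftrightarrow> [a = b] (mod int p)"
    using c cc by (metis cong_mult_rcancel cong_sym cong_trans)
  show ?thesis
  proof (cases "[a = b] (mod int p)")
    case True
    then have "(\<Sum>\<chi>\<in>dchars p. \<chi> (a * c)) = (\<Sum>\<chi>\<in>dchars p. 1)"
      using iff dirichlet_character_cong dirichlet_character_one
      by (intro sum.cong) (auto, metis)
    then show ?thesis using True eq card_dchars[OF p] by simp
  next
    case False
    then have "(\<Sum>\<chi>\<in>dchars p. \<chi> (a * c)) = 0"
      using iff a cc by (intro sum_characters_eq_0[OF p]) auto
    then show ?thesis using False eq by simp
  qed
qed

text \<open>All indices lie in a complete system of units, so two indices are congruent only if they are
  equal; this is why the lengths of the sums are kept below \<open>p\<close>.\<close>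

lemma character_parseval:
  assumes p: "prime p" and A: "A \<subseteq> {1..<p}" and B: "B \<subseteq> {1..<p}"
  shows "(\<Sum>\<chi>\<in>dchars p. (\<Sum>n\<in>A. f n * \<chi> (int n)) * cnj (\<Sum>m\<in>B. h m * \<chi> (int m)))
    = of_nat (p - 1) * (\<Sum>n\<in>A \<inter> B. f n * cnj (h n))"
proof -
  have fin: "finite A" "finite B" using A B finite_subset by auto
  have "(\<Sum>\<chi>\<in>dchars p. (\<Sum>n\<in>A. f n * \<chi> (int n)) * cnj (\<Sum>m\<in>B. h m * \<chi> (int m)))
     = (\<Sum>\<chi>\<in>dchars p. \<Sum>n\<in>A. \<Sum>m\<in>B. f n * cnj (h m) * (\<chi> (int n) * cnj (\<chi> (int m))))"
    by (intro sum.cong) (auto simp: sum_product algebra_simps)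
  also have "\<dots> = (\<Sum>n\<in>A. \<Sum>m\<in>B. f n * cnj (h m) * (\<Sum>\<chi>\<in>dchars p. \<chi> (int n) * cnj (\<chi> (int m))))"
    by (subst sum.swap, intro sum.cong refl, subst sum.swap) (simp add: sum_distrib_left)
  also have "\<dots> = (\<Sum>n\<in>A. \<Sum>m\<in>B. if n = m then f n * cnj (h m) * of_nat (p - 1) else 0)"
  proof (intro sum.cong refl)
    fix n m assume nm: "n \<in> A" "m \<in> B"
    then have "n \<in> {1..<p}" "m \<in> {1..<p}" using A B by auto
    moreover from this have "[int n = int m] (mod int p) \<longleftrightarrow> n = m"
      by (auto simp: cong_int_iff Cong.cong_def)
    ultimately show "f n * cnj (h m) * (\<Sum>\<chi>\<in>dchars p. \<chi> (int n) * cnj (\<chi> (int m)))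
        = (if n = m then f n * cnj (h m) * of_nat (p - 1) else 0)"
      using character_orthogonality[OF p prime_units[OF p] prime_units[OF p]] by simp
  qed
  also have "\<dots> = (\<Sum>n\<in>A. if n \<in> B then f n * cnj (h n) * of_nat (p - 1) else 0)"
    using fin by (intro sum.cong refl) (simp add: sum.delta)
  also have "\<dots> = (\<Sum>n\<in>A \<inter> B. f n * cnj (h n) * of_nat (p - 1))"
    using fin by (simp only: sum.inter_restrict)
  finally show ?thesis by (simp add: sum_distrib_left mult_ac)
qed

lemma character_mean_square:
  assumes p: "prime p" and A: "A \<subseteq> {1..<p}"
  shows "(\<Sum>\<chi>\<in>dchars p. (cmod (\<Sum>n\<in>A. f n * \<chi> (int n)))\<^sup>2) = real (p - 1) * (\<Sum>n\<in>A. (cmod (f n))\<^sup>2)"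
proof -
  have "complex_of_real (\<Sum>\<chi>\<in>dchars p. (cmod (\<Sum>n\<in>A. f n * \<chi> (int n)))\<^sup>2)
    = (\<Sum>\<chi>\<in>dchars p. (\<Sum>n\<in>A. f n * \<chi> (int n)) * cnj (\<Sum>n\<in>A. f n * \<chi> (int n)))"
    by (simp only: of_real_sum complex_norm_square)
  also have "\<dots> = of_nat (p - 1) * (\<Sum>n\<in>A \<inter> A. f n * cnj (f n))"
    by (rule character_parseval[OF p A A])
  also have "\<dots> = complex_of_real (real (p - 1) * (\<Sum>n\<in>A. (cmod (f n))\<^sup>2))"
    by (simp only: Int_absorb of_real_mult of_real_sum complex_norm_square of_real_of_nat_eq)
  finally show ?thesis by (simp only: of_real_eq_iff)
qed

section \<open>Gauss sums and low moments\<close>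

lemma cis_2pi_mod:
  assumes "n > 0"
  shows "cis (2 * pi * real (k mod n) / real n) = cis (2 * pi * real k / real n)"
proof -
  have "real k = real (k div n) * real n + real (k mod n)"
    by (metis of_nat_add of_nat_mult div_mult_mod_eq)
  moreover have "2 * pi * (x * y + z) / y = 2 * pi * z / y + 2 * pi * x" if "y > 0" for x y z :: real
    using that by (simp add: field_simps)
  ultimately have "2 * pi * real k / real n = 2 * pi * real (k mod n) / real n + 2 * pi * real (k div n)"
    using assms by (metis of_nat_0_less_iff)
  then have "cis (2 * pi * real k / real n)
      = cis (2 * pi * real (k mod n) / real n) * cis (2 * pi * real (k div n))"
    by (simp only: cis_mult)
  also have "cis (2 * pi * real (k div n)) = 1" by (rule cis_multiple_2pi) simp
  finally show ?thesis by simp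
qed

definition gauss_sum :: "nat \<Rightarrow> (int \<Rightarrow> complex) \<Rightarrow> complex" where
  "gauss_sum p \<chi> = (\<Sum>m\<in>{1..<p}. \<chi> (int m) * cis (2 * pi * real m / real p))"

lemma gauss_sum_twist:
  assumes p: "prime p" and \<chi>: "dirichlet_character p \<chi>" and h: "coprime (int h) (int p)"
  shows "cnj (\<chi> (int h)) * gauss_sum p \<chi> = (\<Sum>m\<in>{1..<p}. cis (2 * pi * real (m * h) / real p) * \<chi> (int m))"
proof -
  have p0: "p > 0" using p prime_gt_0_nat by blast
  have "gauss_sum p \<chi> = (\<Sum>m\<in>{1..<p}. \<chi> (int (m * h mod p)) * cis (2 * pi * real (m * h mod p) / real p))"
    unfolding gauss_sum_def
    by (rule sum_units_dilate[OF p h, of "\<lambda>m. \<chi> (int m) * cis (2 * pi * real m / real p)", symmetric])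
  also have "\<dots> = (\<Sum>m\<in>{1..<p}. \<chi> (int h) * (cis (2 * pi * real (m * h) / real p) * \<chi> (int m)))"
  proof (rule sum.cong)
    fix m
    have "\<chi> (int (m * h mod p)) = \<chi> (int (m * h))"
      by (rule dirichlet_character_cong[OF \<chi>]) (simp add: zmod_int Cong.cong_def)
    then have "\<chi> (int (m * h mod p)) = \<chi> (int h) * \<chi> (int m)"
      by (simp add: dirichlet_character_mult[OF \<chi>] mult.commute)
    then show "\<chi> (int (m * h mod p)) * cis (2 * pi * real (m * h mod p) / real p)
        = \<chi> (int h) * (cis (2 * pi * real (m * h) / real p) * \<chi> (int m))"
      using cis_2pi_mod[OF p0, of "m * h"] by (simp only: mult_ac)
  qed simp
  also have "\<dots> = \<chi> (int h) * (\<Sum>m\<in>{1..<p}. cis (2 * pi * real (m * h) / real p) * \<chi> (int m))"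
    by (simp only: sum_distrib_left)
  finally have "cnj (\<chi> (int h)) * gauss_sum p \<chi>
     = (\<chi> (int h) * cnj (\<chi> (int h))) * (\<Sum>m\<in>{1..<p}. cis (2 * pi * real (m * h) / real p) * \<chi> (int m))"
    by (simp only: mult_ac)
  then show ?thesis by (simp only: dirichlet_character_times_cnj[OF \<chi> p0 h] mult_1)
qed

lemma additive_orthogonality:
  assumes "m < p" "k < p"
  shows "(\<Sum>h<p. cis (2 * pi * real (m * h) / real p) * cnj (cis (2 * pi * real (k * h) / real p)))
    = (if m = k then of_nat p else 0)"
proof (cases "m = k")
  case True
  then have "(\<Sum>h<p. cis (2 * pi * real (m * h) / real p) * cnj (cis (2 * pi * real (k * h) / real p))) = (\<Sum>h<p. 1)"
    by (intro sum.cong refl) (simp add: cis_cnj cis_mult)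
  then show ?thesis using True by simp
next
  case False
  have p0: "p > 0" using assms by simp
  define \<omega> where "\<omega> = cis (2 * pi * (real m - real k) / real p)"
  have t: "cis (2 * pi * real (m * h) / real p) * cnj (cis (2 * pi * real (k * h) / real p)) = \<omega> ^ h" for h
    unfolding \<omega>_def by (simp add: cis_cnj cis_mult Complex.DeMoivre algebra_simps diff_divide_distrib)
  have "\<omega> ^ p = cis (2 * pi * of_int (int m - int k))"
    unfolding \<omega>_def using p0 by (simp add: Complex.DeMoivre)
  also have "\<dots> = 1" by (rule cis_multiple_2pi) simp
  finally have wp: "\<omega> ^ p = 1" .
  have w1: "\<omega> \<noteq> 1"
  proof
    assume "\<omega> = 1"
    then have "cos (2 * pi * (real m - real k) / real p) = 1" unfolding \<omega>_def by (metis cis.sel(1) one_complex.sel(1))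
    then obtain j :: int where j: "2 * pi * (real m - real k) / real p = 2 * pi * of_int j"
      unfolding cos_one_2pi_int by (auto simp: mult_ac)
    moreover have "x = z * y" if "2 * pi * x / y = 2 * pi * z" "y > 0" for x y z :: real
      using that by (simp add: field_simps)
    ultimately have "real m - real k = of_int j * real p" using p0 by (metis of_nat_0_less_iff)
    then have e: "int m - int k = j * int p" by (metis of_int_diff of_int_eq_iff of_int_mult of_int_of_nat_eq)
    then have "int p dvd int m - int k" by simp
    moreover have "\<bar>int m - int k\<bar> < int p" using assms by linarith
    ultimately have "int m - int k = 0" by (metis dvd_imp_le_int abs_of_nat linorder_not_le)
    then show False using False by simp
  qed
  have "(\<Sum>h<p. \<omega> ^ h) = 0" using geometric_sum[OF w1, of p] wp by simp
  then show ?thesis using False t by simp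
qed

text \<open>For the principal character the Gauss sum is \<open>-1\<close>, so only an inequality holds for
  all characters. It follows without distinguishing cases from Parseval's identity on the additive
  group: the twists of the Gauss sum by the \<open>p - 1\<close> units all have the same modulus.\<close>

lemma norm_gauss_sum_le:
  assumes p: "prime p" and \<chi>: "dirichlet_character p \<chi>"
  shows "(cmod (gauss_sum p \<chi>))\<^sup>2 \<le> real p"
proof -
  have p2: "p \<ge> 2" using p prime_ge_2_nat by blast
  define F where "F h = (\<Sum>m\<in>{1..<p}. cis (2 * pi * real (m * h) / real p) * \<chi> (int m))" for h
  have n1: "cmod (\<chi> (int m)) = 1" if "m \<in> {1..<p}" for m
    using norm_dirichlet_character[OF \<chi> _ prime_units[OF p that]] p2 by simp
  have "complex_of_real (\<Sum>h<p. (cmod (F h))\<^sup>2) = (\<Sum>h<p. F h * cnj (F h))"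
    by (simp only: of_real_sum complex_norm_square)
  also have "\<dots> = (\<Sum>h<p. \<Sum>m\<in>{1..<p}. \<Sum>k\<in>{1..<p}. \<chi> (int m) * cnj (\<chi> (int k)) *
       (cis (2 * pi * real (m * h) / real p) * cnj (cis (2 * pi * real (k * h) / real p))))"
    unfolding F_def by (intro sum.cong refl) (simp add: sum_product algebra_simps)
  also have "\<dots> = (\<Sum>m\<in>{1..<p}. \<Sum>k\<in>{1..<p}. \<chi> (int m) * cnj (\<chi> (int k)) *
       (\<Sum>h<p. cis (2 * pi * real (m * h) / real p) * cnj (cis (2 * pi * real (k * h) / real p))))"
    unfolding sum_distrib_left by (rule trans[OF sum.swap], rule sum.cong[OF refl], rule sum.swap)
  also have "\<dots> = (\<Sum>m\<in>{1..<p}. \<Sum>k\<in>{1..<p}. if m = k then \<chi> (int m) * cnj (\<chi> (int k)) * of_nat p else 0)"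
  proof (intro sum.cong refl)
    fix m k assume "m \<in> {1..<p}" "k \<in> {1..<p}"
    then have "m < p" "k < p" by auto
    from additive_orthogonality[OF this] show "\<chi> (int m) * cnj (\<chi> (int k)) *
       (\<Sum>h<p. cis (2 * pi * real (m * h) / real p) * cnj (cis (2 * pi * real (k * h) / real p)))
       = (if m = k then \<chi> (int m) * cnj (\<chi> (int k)) * of_nat p else 0)" by simp
  qed
  also have "\<dots> = (\<Sum>m\<in>{1..<p}. \<chi> (int m) * cnj (\<chi> (int m)) * of_nat p)"
    by (intro sum.cong refl) (simp add: sum.delta)
  also have "\<dots> = (\<Sum>m\<in>{1..<p}. of_nat p)"
    using dirichlet_character_times_cnj[OF \<chi> _ prime_units[OF p]] p2 by (intro sum.cong refl) simp
  also have "\<dots> = complex_of_real (real (p - 1) * real p)" by (simp only: sum_constant) simp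
  finally have tot: "(\<Sum>h<p. (cmod (F h))\<^sup>2) = real (p - 1) * real p" by (simp only: of_real_eq_iff)
  have "real (p - 1) * (cmod (gauss_sum p \<chi>))\<^sup>2 = (\<Sum>h\<in>{1..<p}. (cmod (F h))\<^sup>2)"
  proof -
    have "cmod (F h) = cmod (gauss_sum p \<chi>)" if "h \<in> {1..<p}" for h
      using gauss_sum_twist[OF p \<chi> prime_units[OF p that]] n1[OF that]
      unfolding F_def by (metis complex_mod_cnj mult_1 norm_mult)
    then show ?thesis by simp
  qed
  also have "\<dots> \<le> (\<Sum>h<p. (cmod (F h))\<^sup>2)" by (rule sum_mono2) auto
  finally show ?thesis using tot p2 by simp
qed

text \<open>A character times the conjugate Gauss sum is the conjugate of a character sum over all units
  with additive coefficients, so orthogonality picks out the additive character at the indices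
  \<open>n \<le> N\<close>. This turns a multiplicative correlation into an exponential sum.\<close>

lemma sum_character_gauss_twist:
  assumes p: "prime p" and h: "h \<in> {1..<p}" and N: "N < p"
  shows "(\<Sum>\<chi>\<in>dchars p. (\<Sum>n\<in>{1..N}. \<chi> (int n)) * (\<chi> (int h) * cnj (gauss_sum p \<chi>)))
    = of_nat (p - 1) * (\<Sum>n\<in>{1..N}. cnj (cis (2 * pi * real (n * h) / real p)))"
proof -
  have "(\<Sum>\<chi>\<in>dchars p. (\<Sum>n\<in>{1..N}. \<chi> (int n)) * (\<chi> (int h) * cnj (gauss_sum p \<chi>)))
      = (\<Sum>\<chi>\<in>dchars p. (\<Sum>n\<in>{1..N}. 1 * \<chi> (int n)) *
           cnj (\<Sum>m\<in>{1..<p}. cis (2 * pi * real (m * h) / real p) * \<chi> (int m)))"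
  proof (rule sum.cong)
    fix \<chi> assume "\<chi> \<in> dchars p"
    then have "\<chi> (int h) * cnj (gauss_sum p \<chi>) = cnj (\<Sum>m\<in>{1..<p}. cis (2 * pi * real (m * h) / real p) * \<chi> (int m))"
      using gauss_sum_twist[OF p _ prime_units[OF p h], of \<chi>, symmetric] by simp
    then show "(\<Sum>n\<in>{1..N}. \<chi> (int n)) * (\<chi> (int h) * cnj (gauss_sum p \<chi>))
        = (\<Sum>n\<in>{1..N}. 1 * \<chi> (int n)) * cnj (\<Sum>m\<in>{1..<p}. cis (2 * pi * real (m * h) / real p) * \<chi> (int m))"
      by simp
  qed simp
  also have "\<dots> = of_nat (p - 1) * (\<Sum>n\<in>{1..N} \<inter> {1..<p}. 1 * cnj (cis (2 * pi * real (n * h) / real p)))"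
    using N by (intro character_parseval[OF p]) auto
  also have "{1..N} \<inter> {1..<p} = {1..N}" using N by auto
  finally show ?thesis by simp
qed

lemma weighted_am_gm3:
  fixes x y z a b c :: real
  assumes "x \<ge> 0" "y \<ge> 0" "z \<ge> 0" "a > 0" "b > 0" "c > 0" "a + b + c = 1"
  shows "x powr a * y powr b * z powr c \<le> a * x + b * y + c * z"
proof (cases "x = 0 \<or> y = 0 \<or> z = 0")
  case True
  then show ?thesis using assms by auto
next
  case False
  then have pos: "x > 0" "y > 0" "z > 0" using assms by auto
  define w where "w = a * x + b * y + c * z"
  have w: "w > 0" unfolding w_def using pos assms by (intro add_pos_pos mult_pos_pos) auto
  have l: "ln t - ln w \<le> t / w - 1" if "t > 0" for t
    using ln_le_minus_one[of "t / w"] that w by (simp add: ln_divide_pos)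
  have "a * (ln x - ln w) + b * (ln y - ln w) + c * (ln z - ln w)
      \<le> a * (x / w - 1) + b * (y / w - 1) + c * (z / w - 1)"
    using l pos assms by (intro add_mono mult_left_mono) auto
  also have "\<dots> = w / w - (a + b + c)"
    by (subst (4) w_def) (simp add: algebra_simps add_divide_distrib)
  also have "\<dots> = 0" using w assms by simp
  finally have "a * ln x + b * ln y + c * ln z \<le> (a + b + c) * ln w" by (simp add: algebra_simps)
  then have "exp (a * ln x + b * ln y + c * ln z) \<le> exp (ln w)" using assms by simp
  then show ?thesis using pos w by (simp add: powr_def exp_add w_def)
qed

lemma sum_holder3:
  fixes f g h :: "'a \<Rightarrow> real"
  assumes "finite I" "\<And>i. i \<in> I \<Longrightarrow> f i \<ge> 0" "\<And>i. i \<in> I \<Longrightarrow> g i \<ge> 0" "\<And>i. i \<in> I \<Longrightarrow> h i \<ge> 0"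
    and abc: "a > 0" "b > 0" "c > 0" "a + b + c = 1"
  shows "(\<Sum>i\<in>I. f i powr a * g i powr b * h i powr c) \<le> sum f I powr a * sum g I powr b * sum h I powr c"
proof (cases "sum f I = 0 \<or> sum g I = 0 \<or> sum h I = 0")
  case True
  have "(\<forall>i\<in>I. f i = 0) \<or> (\<forall>i\<in>I. g i = 0) \<or> (\<forall>i\<in>I. h i = 0)"
    using True assms by (simp add: sum_nonneg_eq_0_iff)
  then have "(\<Sum>i\<in>I. f i powr a * g i powr b * h i powr c) = 0"
    by (intro sum.neutral) auto
  then show ?thesis by simp
next
  case False
  let ?F = "sum f I" and ?G = "sum g I" and ?H = "sum h I"
  have pos: "?F > 0" "?G > 0" "?H > 0"
    using False assms by (auto intro!: order.not_eq_order_implies_strict sum_nonneg)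
  have "(\<Sum>i\<in>I. f i powr a * g i powr b * h i powr c)
      = ?F powr a * ?G powr b * ?H powr c * (\<Sum>i\<in>I. (f i / ?F) powr a * (g i / ?G) powr b * (h i / ?H) powr c)"
    unfolding sum_distrib_left using pos assms by (intro sum.cong refl) (simp add: powr_divide)
  also have "\<dots> \<le> ?F powr a * ?G powr b * ?H powr c * (\<Sum>i\<in>I. a * (f i / ?F) + b * (g i / ?G) + c * (h i / ?H))"
    using assms pos by (intro mult_left_mono sum_mono weighted_am_gm3) auto
  also have "(\<Sum>i\<in>I. a * (f i / ?F) + b * (g i / ?G) + c * (h i / ?H)) = 1"
    using pos abc by (simp add: sum.distrib flip: sum_distrib_left sum_divide_distrib)
  finally show ?thesis by simp
qed

text \<open>Hoelder's inequality with exponents \<open>a\<close>, \<open>b\<close>, \<open>1/4\<close> for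
  \<open>|S|^r\<close>, \<open>|S|^2\<close>, \<open>|T|^4\<close>, where \<open>a + b =
  3/4\<close> and \<open>r a + 2 b = 1\<close> so that the product is \<open>|S| |T|\<close>.
  Solving gives \<open>4 a = 1 / (1 - r/2)\<close>; positivity of \<open>b\<close> is the
  condition \<open>r < 4/3\<close>.\<close>

lemma low_moment_ge:
  fixes S T :: "'a \<Rightarrow> complex" and r :: real
  assumes r: "0 < r" "r < 4 / 3" and fin: "finite D"
    and pos: "\<kappa> > 0" "P > 0" "N > 0" "E > 0"
    and sq: "(\<Sum>\<chi>\<in>D. (cmod (S \<chi>))\<^sup>2) \<le> P * N"
    and Q: "(\<Sum>\<chi>\<in>D. cmod (T \<chi>) ^ 4) > 0"
    and lower: "(\<Sum>\<chi>\<in>D. cmod (S \<chi>) * cmod (T \<chi>)) ^ 4 \<ge> \<kappa> * (P ^ 3 * N\<^sup>2 / E) * (\<Sum>\<chi>\<in>D. cmod (T \<chi>) ^ 4)"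
  shows "(\<Sum>\<chi>\<in>D. cmod (S \<chi>) powr r) \<ge> \<kappa> powr (1 - r / 2) * P * (N powr (r / 2) / E powr (1 - r / 2))"
proof -
  define \<theta> where "\<theta> = 1 - r / 2"
  define a where "a = 1 / (4 * \<theta>)"
  define b where "b = 3 / 4 - a"
  let ?A = "\<Sum>\<chi>\<in>D. cmod (S \<chi>) powr r" and ?Q = "\<Sum>\<chi>\<in>D. cmod (T \<chi>) ^ 4"
  have \<theta>: "\<theta> > 1 / 3" "\<theta> < 1" unfolding \<theta>_def using r by auto
  have a0: "a > 0" unfolding a_def using \<theta> by simp
  have b0: "b > 0" unfolding b_def a_def using \<theta> by (simp add: field_simps)
  have rab: "r * a + 2 * b = 1"
  proof -
    have "r = 2 - 2 * \<theta>" by (simp add: \<theta>_def)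
    then show ?thesis unfolding b_def a_def using \<theta> by (simp add: field_simps)
  qed
  have A0: "?A \<ge> 0" by (intro sum_nonneg) auto
  have term_eq: "(x powr r) powr a * (x\<^sup>2) powr b * (y ^ 4) powr (1 / 4) = x * y" if "x \<ge> 0" "y \<ge> 0" for x y :: real
  proof (cases "x = 0 \<or> y = 0")
    case False
    then have xy: "x > 0" "y > 0" using that by auto
    have "x\<^sup>2 = x powr 2" "y ^ 4 = y powr 4" using xy powr_realpow[of x 2] powr_realpow[of y 4] by auto
    then have "(x powr r) powr a * (x\<^sup>2) powr b * (y ^ 4) powr (1 / 4) = x powr (r * a + 2 * b) * y powr (4 * (1 / 4))"
      by (simp only: powr_powr powr_add)
    then show ?thesis using xy rab by simp
  qed auto
  have "(\<Sum>\<chi>\<in>D. cmod (S \<chi>) * cmod (T \<chi>))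
      = (\<Sum>\<chi>\<in>D. (cmod (S \<chi>) powr r) powr a * ((cmod (S \<chi>))\<^sup>2) powr b * (cmod (T \<chi>) ^ 4) powr (1 / 4))"
    by (intro sum.cong refl term_eq[symmetric]) auto
  also have "\<dots> \<le> ?A powr a * (\<Sum>\<chi>\<in>D. (cmod (S \<chi>))\<^sup>2) powr b * ?Q powr (1 / 4)"
    using a0 b0 by (intro sum_holder3 fin) (auto simp: b_def)
  also have "\<dots> \<le> ?A powr a * (P * N) powr b * ?Q powr (1 / 4)"
    using sq b0 by (intro mult_right_mono mult_left_mono powr_mono2) (auto intro: sum_nonneg)
  finally have W: "(\<Sum>\<chi>\<in>D. cmod (S \<chi>) * cmod (T \<chi>)) \<le> ?A powr a * (P * N) powr b * ?Q powr (1 / 4)" .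
  have "\<kappa> * (P ^ 3 * N\<^sup>2 / E) * ?Q \<le> (?A powr a * (P * N) powr b * ?Q powr (1 / 4)) ^ 4"
    using lower power_mono[OF W, of 4] by (meson order_trans sum_nonneg mult_nonneg_nonneg norm_ge_zero)
  also have "\<dots> = ?A powr (4 * a) * (P * N) powr (4 * b) * ?Q"
  proof -
    have "(t powr e) ^ 4 = t powr (4 * e)" for t e :: real
      using powr_realpow[of "t powr e" 4] by (cases "t = 0") (auto simp: powr_powr mult.commute)
    then show ?thesis using Q by (simp add: power_mult_distrib)
  qed
  finally have main: "\<kappa> * (P ^ 3 * N\<^sup>2 / E) \<le> ?A powr (4 * a) * (P * N) powr (4 * b)"
    using Q by (rule mult_right_le_imp_le)
  have fa: "4 * a = 1 / \<theta>" using \<theta> by (simp add: a_def)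
  have fb: "4 * b = 3 - 1 / \<theta>" unfolding b_def right_diff_distrib fa by simp
  have "(\<kappa> * (P ^ 3 * N\<^sup>2 / E) * (P * N) powr - (4 * b)) powr \<theta>
      \<le> (?A powr (4 * a) * (P * N) powr (4 * b) * (P * N) powr - (4 * b)) powr \<theta>"
    using main pos \<theta> by (intro powr_mono2 mult_right_mono) auto
  also have "?A powr (4 * a) * (P * N) powr (4 * b) * (P * N) powr - (4 * b) = ?A powr (4 * a)"
    using pos by (simp add: powr_minus)
  also have "(?A powr (4 * a)) powr \<theta> = ?A" using A0 \<theta> fa by (simp add: powr_powr)
  finally have fin: "(\<kappa> * (P ^ 3 * N\<^sup>2 / E) * (P * N) powr - (4 * b)) powr \<theta> \<le> ?A" .
  have e2: "\<kappa> * (P ^ 3 * N\<^sup>2 / E) * (P * N) powr - (4 * b)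
      = \<kappa> * P powr (1 / \<theta>) * N powr (1 / \<theta> - 1) / E"
  proof -
    have "P ^ 3 = P powr 3" "N\<^sup>2 = N powr 2" using pos powr_realpow[of P 3] powr_realpow[of N 2] by auto
    then have "P ^ 3 * N\<^sup>2 * (P * N) powr - (4 * b) = P powr (3 - 4 * b) * N powr (2 - 4 * b)"
      using pos by (simp add: powr_mult powr_diff powr_minus field_simps)
    also have "\<dots> = P powr (1 / \<theta>) * N powr (1 / \<theta> - 1)" by (simp add: fb)
    finally have e: "P ^ 3 * N\<^sup>2 * (P * N) powr - (4 * b) = P powr (1 / \<theta>) * N powr (1 / \<theta> - 1)" .
    have "\<kappa> * (P ^ 3 * N\<^sup>2 / E) * (P * N) powr - (4 * b) = \<kappa> * (P ^ 3 * N\<^sup>2 * (P * N) powr - (4 * b)) / E"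
      by simp
    then show ?thesis unfolding e by (simp add: mult.assoc)
  qed
  have "(\<kappa> * (P ^ 3 * N\<^sup>2 / E) * (P * N) powr - (4 * b)) powr \<theta>
      = (\<kappa> * P powr (1 / \<theta>) * N powr (1 / \<theta> - 1) / E) powr \<theta>"
    by (simp only: e2)
  also have "\<dots> = \<kappa> powr \<theta> * P powr (1 / \<theta> * \<theta>) * N powr ((1 / \<theta> - 1) * \<theta>) / E powr \<theta>"
    using pos by (simp add: powr_mult powr_divide powr_powr)
  also have "(1 / \<theta> - 1) * \<theta> = r / 2" using \<theta> by (simp add: left_diff_distrib) (simp add: \<theta>_def)
  also have "1 / \<theta> * \<theta> = 1" using \<theta> by simp
  finally show ?thesis using fin pos unfolding \<theta>_def by simp
qed

section \<open>The multiplicative energy of a weight\<close>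

definition dconv :: "nat \<Rightarrow> (nat \<Rightarrow> real) \<Rightarrow> (nat \<Rightarrow> real) \<Rightarrow> nat \<Rightarrow> real" where
  "dconv N f g n = (\<Sum>(d, t) \<in> {(d, t). d \<in> {1..N} \<and> t \<in> {1..N} \<and> d * t = n}. f d * g t)"

text \<open>Two different weights are allowed because the energy is an inner product of their correlations
  along quotients; mixed energies then obey the Cauchy-Schwarz inequality.\<close>

definition conv_energy :: "nat \<Rightarrow> (nat \<Rightarrow> real) \<Rightarrow> (nat \<Rightarrow> real) \<Rightarrow> real" where
  "conv_energy N f g = (\<Sum>n = 1..N\<^sup>2. (dconv N f g n)\<^sup>2)"

definition ratio_corr :: "nat \<Rightarrow> (nat \<Rightarrow> real) \<Rightarrow> real \<Rightarrow> real" where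
  "ratio_corr N f \<rho> = (\<Sum>(x, z) \<in> {(x, z). x \<in> {1..N} \<and> z \<in> {1..N} \<and> real x / real z = \<rho>}. f x * f z)"

lemma weighted_energy_eq: "weighted_energy N c = real N ^ 2 * conv_energy N c c"
  by (simp add: weighted_energy_def conv_energy_def dconv_def)

lemma finite_factor_pairs [simp]: "finite {(d, t). d \<in> {1..N::nat} \<and> t \<in> {1..N::nat} \<and> P d t}"
  by (rule finite_subset[of _ "{1..N::nat} \<times> {1..N::nat}"]) auto

lemma factor_pairs_eq: "{(d, t). d \<in> {1..N} \<and> t \<in> {1..N} \<and> P d t} = {z \<in> {1..N::nat} \<times> {1..N::nat}. P (fst z) (snd z)}"
  by auto

lemma dconv_eq: "dconv N f g n = (\<Sum>z\<in>{1..N}\<times>{1..N}. if fst z * snd z = n then f (fst z) * g (snd z) else 0)"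
  unfolding dconv_def factor_pairs_eq unfolding case_prod_beta by (rule sum.inter_filter) simp

lemma ratio_corr_eq: "ratio_corr N f \<rho> =
    (\<Sum>z\<in>{1..N}\<times>{1..N}. if real (fst z) / real (snd z) = \<rho> then f (fst z) * f (snd z) else 0)"
  unfolding ratio_corr_def factor_pairs_eq unfolding case_prod_beta by (rule sum.inter_filter) simp

lemma dconv_nonneg:
  assumes "\<And>n. f n \<ge> 0" "\<And>n. g n \<ge> 0" shows "dconv N f g n \<ge> 0"
  unfolding dconv_def using assms by (intro sum_nonneg) auto

lemma dconv_mono:
  assumes "\<And>n. f n \<ge> 0" "\<And>n. g n \<ge> 0" "\<And>n. f n \<le> f' n" "\<And>n. g n \<le> g' n"
  shows "dconv N f g n \<le> dconv N f' g' n"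
proof -
  have "f x * g y \<le> f' x * g' y" for x y
    using assms(1)[of x] assms(2)[of y] assms(3)[of x] assms(4)[of y] by (intro mult_mono) auto
  then show ?thesis unfolding dconv_def by (intro sum_mono) auto
qed

lemma dconv_commute: "dconv N f g n = dconv N g f n"
proof -
  have "dconv N f g n = (\<Sum>z\<in>{1..N}\<times>{1..N}. if snd z * fst z = n then f (snd z) * g (fst z) else 0)"
    unfolding dconv_eq
    by (rule sum.reindex_bij_witness[where i = prod.swap and j = prod.swap]) auto
  then show ?thesis unfolding dconv_eq by (simp add: mult.commute cong: if_cong)
qed

lemma dconv_sum_left: "dconv N (\<lambda>x. \<Sum>i\<in>I. f i x) g n = (\<Sum>i\<in>I. dconv N (f i) g n)"
proof -
  have "dconv N (\<lambda>x. \<Sum>i\<in>I. f i x) g n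
      = (\<Sum>z\<in>{(d, t). d \<in> {1..N} \<and> t \<in> {1..N} \<and> d * t = n}. \<Sum>i\<in>I. f i (fst z) * g (snd z))"
    unfolding dconv_def by (simp add: case_prod_beta sum_distrib_right)
  also have "\<dots> = (\<Sum>i\<in>I. dconv N (f i) g n)"
    unfolding dconv_def case_prod_beta by (rule sum.swap)
  finally show ?thesis .
qed

lemma dconv_sum_right: "dconv N g (\<lambda>x. \<Sum>i\<in>I. f i x) n = (\<Sum>i\<in>I. dconv N g (f i) n)"
  using dconv_sum_left[of N f I g n] by (simp add: dconv_commute[of N g])

lemma dconv_nonzeroD:
  assumes "dconv N f g n \<noteq> 0"
  obtains x y where "x \<in> {1..N}" "y \<in> {1..N}" "x * y = n" "f x \<noteq> 0" "g y \<noteq> 0"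
proof -
  have "\<exists>z\<in>{(d, t). d \<in> {1..N} \<and> t \<in> {1..N} \<and> d * t = n}. f (fst z) * g (snd z) \<noteq> 0"
    using assms unfolding dconv_def case_prod_beta by (meson sum.not_neutral_contains_not_neutral)
  then show ?thesis using that by auto
qed

lemma conv_energy_nonneg: "conv_energy N f g \<ge> 0"
  unfolding conv_energy_def by (intro sum_nonneg) auto

lemma conv_energy_mono:
  assumes "\<And>n. f n \<ge> 0" "\<And>n. g n \<ge> 0" "\<And>n. f n \<le> f' n" "\<And>n. g n \<le> g' n"
  shows "conv_energy N f g \<le> conv_energy N f' g'"
  unfolding conv_energy_def using dconv_mono[OF assms] dconv_nonneg[of f g N, OF assms(1,2)]
  by (intro sum_mono power_mono) auto

definition ratios :: "nat \<Rightarrow> real set" where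
  "ratios N = (\<lambda>(x, z). real x / real z) ` ({1..N} \<times> {1..N})"

lemma finite_ratios [simp]: "finite (ratios N)"
  unfolding ratios_def by simp

text \<open>The equation \<open>x y = z w\<close> is the same as \<open>x / z = w / y\<close>. In this form
  each of the two weights appears in one factor only.\<close>

lemma conv_energy_ratio: "conv_energy N f g = (\<Sum>\<rho>\<in>ratios N. ratio_corr N f \<rho> * ratio_corr N g \<rho>)"
proof -
  let ?B = "{1..N} \<times> {1..N}"
  have "conv_energy N f g = (\<Sum>n = 1..N\<^sup>2. \<Sum>u\<in>?B. \<Sum>v\<in>?B.
      if fst u * snd u = n then (if fst v * snd v = n then f (fst u) * g (snd u) * (f (fst v) * g (snd v)) else 0) else 0)"
    unfolding conv_energy_def dconv_eq power2_eq_square sum_product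
    by (intro sum.cong refl) auto
  also have "\<dots> = (\<Sum>u\<in>?B. \<Sum>v\<in>?B. \<Sum>n = 1..N\<^sup>2.
      if fst u * snd u = n then (if fst v * snd v = n then f (fst u) * g (snd u) * (f (fst v) * g (snd v)) else 0) else 0)"
    by (rule trans[OF sum.swap], rule sum.cong[OF refl], rule sum.swap)
  also have "\<dots> = (\<Sum>u\<in>?B. \<Sum>v\<in>?B. if fst u * snd u = fst v * snd v then f (fst u) * g (snd u) * (f (fst v) * g (snd v)) else 0)"
  proof (intro sum.cong refl)
    fix u v assume u: "u \<in> ?B"
    have "fst u * snd u \<in> {1..N\<^sup>2}"
      using u mult_le_mono[of "fst u" N "snd u" N] by (auto simp: power2_eq_square Suc_le_eq)
    then show "(\<Sum>n = 1..N\<^sup>2. if fst u * snd u = n then (if fst v * snd v = n then f (fst u) * g (snd u) * (f (fst v) * g (snd v)) else 0) else 0)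
      = (if fst u * snd u = fst v * snd v then f (fst u) * g (snd u) * (f (fst v) * g (snd v)) else 0)"
      by (subst sum.delta') auto
  qed
  also have "\<dots> = (\<Sum>(x, y)\<in>?B. \<Sum>(z, w)\<in>?B. if x * y = z * w then f x * g y * (f z * g w) else 0)"
    by (simp add: case_prod_beta)
  also have "\<dots> = (\<Sum>x\<in>{1..N}. \<Sum>y\<in>{1..N}. \<Sum>z\<in>{1..N}. \<Sum>w\<in>{1..N}. if x * y = z * w then f x * g y * (f z * g w) else 0)"
    by (simp only: sum.cartesian_product[symmetric])
  also have "\<dots> = (\<Sum>x\<in>{1..N}. \<Sum>z\<in>{1..N}. \<Sum>y\<in>{1..N}. \<Sum>w\<in>{1..N}. if x * y = z * w then f x * g y * (f z * g w) else 0)"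
    by (intro sum.cong refl sum.swap)
  also have "\<dots> = (\<Sum>x\<in>{1..N}. \<Sum>z\<in>{1..N}. \<Sum>w\<in>{1..N}. \<Sum>y\<in>{1..N}. if x * y = z * w then f x * g y * (f z * g w) else 0)"
    by (intro sum.cong refl sum.swap)
  also have "\<dots> = (\<Sum>x\<in>{1..N}. \<Sum>z\<in>{1..N}. \<Sum>w\<in>{1..N}. \<Sum>y\<in>{1..N}.
      if real x / real z = real w / real y then f x * f z * (g w * g y) else 0)"
  proof (intro sum.cong refl)
    fix x z w y :: nat assume "z \<in> {1..N}" "y \<in> {1..N}"
    then have zy: "real z > 0" "real y > 0" by auto
    have "x * y = z * w \<longleftrightarrow> real x * real y = real z * real w" by (metis of_nat_eq_iff of_nat_mult)
    also have "\<dots> \<longleftrightarrow> real x / real z = real w / real y" using zy by (auto simp: field_simps)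
    finally show "(if x * y = z * w then f x * g y * (f z * g w) else 0)
      = (if real x / real z = real w / real y then f x * f z * (g w * g y) else 0)"
      by (simp add: mult_ac)
  qed
  also have "\<dots> = (\<Sum>(x, z)\<in>?B. \<Sum>(w, y)\<in>?B. if real x / real z = real w / real y then f x * f z * (g w * g y) else 0)"
    by (simp only: sum.cartesian_product[symmetric])
  also have "\<dots> = (\<Sum>u\<in>?B. \<Sum>v\<in>?B. \<Sum>\<rho>\<in>ratios N.
       if real (fst u) / real (snd u) = \<rho> then (if real (fst v) / real (snd v) = \<rho> then f (fst u) * f (snd u) * (g (fst v) * g (snd v)) else 0) else 0)"
    unfolding case_prod_beta
  proof (intro sum.cong refl)
    fix u v assume u: "u \<in> ?B"
    then have "real (fst u) / real (snd u) \<in> ratios N" unfolding ratios_def by (auto simp: case_prod_beta)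
    then show "(if real (fst u) / real (snd u) = real (fst v) / real (snd v) then f (fst u) * f (snd u) * (g (fst v) * g (snd v)) else 0)
      = (\<Sum>\<rho>\<in>ratios N.
       if real (fst u) / real (snd u) = \<rho> then (if real (fst v) / real (snd v) = \<rho> then f (fst u) * f (snd u) * (g (fst v) * g (snd v)) else 0) else 0)"
      by (subst sum.delta') auto
  qed
  also have "\<dots> = (\<Sum>\<rho>\<in>ratios N. \<Sum>u\<in>?B. \<Sum>v\<in>?B.
       if real (fst u) / real (snd u) = \<rho> then (if real (fst v) / real (snd v) = \<rho> then f (fst u) * f (snd u) * (g (fst v) * g (snd v)) else 0) else 0)"
    by (rule sym, rule trans[OF sum.swap], rule sum.cong[OF refl], rule sum.swap)
  also have "\<dots> = (\<Sum>\<rho>\<in>ratios N. ratio_corr N f \<rho> * ratio_corr N g \<rho>)"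
    unfolding ratio_corr_eq sum_product by (intro sum.cong refl) auto
  finally show ?thesis .
qed

lemma conv_energy_Cauchy_Schwarz:
  "(conv_energy N f g)\<^sup>2 \<le> conv_energy N f f * conv_energy N g g"
  unfolding conv_energy_ratio power2_eq_square[of "ratio_corr _ _ _", symmetric]
  using Cauchy_Schwarz_ineq_sum[of "ratio_corr N f" "ratio_corr N g" "ratios N"]
  by (simp add: power2_eq_square)

text \<open>Cauchy-Schwarz: if the pairwise products of a set \<open>B\<close> are confined to a small set
  \<open>G\<close>, then a weight that lives on \<open>B\<close> must have large energy. This is
  used both for \<open>E \<ge> 1\<close> and to show that exceptional integers carry little mass.\<close>

lemma sum_squared_le_conv_energy:
  assumes c: "\<And>n. c n \<ge> 0" and B: "B \<subseteq> {1..N}" and G: "finite G" "\<And>x y. x \<in> B \<Longrightarrow> y \<in> B \<Longrightarrow> x * y \<in> G"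
  shows "(\<Sum>n\<in>B. c n) ^ 4 \<le> real (card G) * conv_energy N c c"
proof -
  have fin: "finite B" using B finite_subset by blast
  define H where "H = G \<inter> {1..N\<^sup>2}"
  have H: "x * y \<in> H" if "x \<in> B" "y \<in> B" for x y
  proof -
    have "1 \<le> x" "x \<le> N" "1 \<le> y" "y \<le> N" using that B by auto
    then have "x * y \<in> {1..N\<^sup>2}"
      using mult_le_mono[of x N y N] by (auto simp: power2_eq_square Suc_le_eq)
    then show ?thesis using G that unfolding H_def by auto
  qed
  have "(\<Sum>n\<in>B. c n)\<^sup>2 = (\<Sum>z\<in>B \<times> B. c (fst z) * c (snd z))"
    by (simp add: power2_eq_square sum_product sum.cartesian_product case_prod_beta)
  also have "\<dots> = (\<Sum>n\<in>H. \<Sum>z\<in>{z\<in>B \<times> B. fst z * snd z = n}. c (fst z) * c (snd z))"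
    using fin G H by (intro sum.group[symmetric]) (auto simp: H_def)
  also have "\<dots> \<le> (\<Sum>n\<in>H. dconv N c c n)"
    unfolding dconv_def case_prod_beta factor_pairs_eq using c B by (intro sum_mono sum_mono2) auto
  finally have 1: "(\<Sum>n\<in>B. c n)\<^sup>2 \<le> (\<Sum>n\<in>H. dconv N c c n)" .
  have "(\<Sum>n\<in>B. c n) ^ 4 = ((\<Sum>n\<in>B. c n)\<^sup>2)\<^sup>2" by simp
  also have "\<dots> \<le> (\<Sum>n\<in>H. dconv N c c n)\<^sup>2" using 1 by (intro power_mono) auto
  also have "\<dots> \<le> (\<Sum>n\<in>H. (dconv N c c n)\<^sup>2) * real (card H)" by (rule sum_squared_le_sum_of_squares)
  also have "\<dots> \<le> conv_energy N c c * real (card G)"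
  proof (rule mult_mono)
    show "(\<Sum>n\<in>H. (dconv N c c n)\<^sup>2) \<le> conv_energy N c c"
      unfolding conv_energy_def by (rule sum_mono2) (auto simp: H_def)
    show "real (card H) \<le> real (card G)" using G by (auto simp: H_def intro: card_mono)
  qed (auto intro: conv_energy_nonneg)
  finally show ?thesis by (simp add: mult.commute)
qed

lemma conv_energy_ge:
  assumes c: "\<And>n. c n \<ge> 0" and s: "(\<Sum>n = 1..N. c n) = 1"
  shows "1 \<le> real N ^ 2 * conv_energy N c c"
proof -
  have "1 = (\<Sum>n\<in>{1..N}. c n) ^ 4" using s by simp
  also have "\<dots> \<le> real (card {1..N\<^sup>2}) * conv_energy N c c"
  proof (rule sum_squared_le_conv_energy)
    show "x * y \<in> {1..N\<^sup>2}" if "x \<in> {1..N}" "y \<in> {1..N}" for x y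
      using that mult_le_mono[of x N y N] by (auto simp: power2_eq_square Suc_le_eq)
  qed (use c in auto)
  finally show ?thesis by simp
qed

section \<open>Replacing a prime factor\<close>

text \<open>Cauchy-Schwarz restricted to the nonzero terms.\<close>

lemma sum_sparse_squared_le:
  fixes a :: "'a \<Rightarrow> real"
  assumes "finite K" "card {k\<in>K. a k \<noteq> 0} \<le> m"
  shows "(\<Sum>k\<in>K. a k)\<^sup>2 \<le> real m * (\<Sum>k\<in>K. (a k)\<^sup>2)"
proof -
  have "(\<Sum>k\<in>K. a k) = (\<Sum>k\<in>{k\<in>K. a k \<noteq> 0}. a k)"
    using assms(1) by (intro sum.mono_neutral_right) auto
  then have "(\<Sum>k\<in>K. a k)\<^sup>2 \<le> (\<Sum>k\<in>{k\<in>K. a k \<noteq> 0}. (a k)\<^sup>2) * real (card {k\<in>K. a k \<noteq> 0})"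
    using sum_squared_le_sum_of_squares[of a "{k\<in>K. a k \<noteq> 0}"] by simp
  also have "\<dots> \<le> (\<Sum>k\<in>K. (a k)\<^sup>2) * real m"
    using assms by (intro mult_mono sum_mono2) (auto intro: sum_nonneg)
  finally show ?thesis by (simp add: mult.commute)
qed

definition dilate_average :: "nat \<Rightarrow> nat set \<Rightarrow> (nat \<Rightarrow> real) \<Rightarrow> nat \<Rightarrow> real" where
  "dilate_average N K b h = (\<Sum>k\<in>K. \<Sum>m = 1..N. if k * m = h then b m / real (card K) else 0)"

lemma dilate_average_nonneg: "(\<And>m. b m \<ge> 0) \<Longrightarrow> dilate_average N K b h \<ge> 0"
  unfolding dilate_average_def by (intro sum_nonneg) auto

lemma dilate_average_nonzeroD:
  assumes "dilate_average N K b h \<noteq> 0"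
  obtains k m where "k \<in> K" "m \<in> {1..N}" "h = k * m" "b m \<noteq> 0"
proof -
  have "\<exists>k\<in>K. \<exists>m\<in>{1..N}. (if k * m = h then b m / real (card K) else 0) \<noteq> 0"
  proof (rule ccontr)
    assume "\<not> ?thesis"
    then have "dilate_average N K b h = 0"
      unfolding dilate_average_def by (intro sum.neutral ballI) blast
    then show False using assms by simp
  qed
  then obtain k m where "k \<in> K" "m \<in> {1..N}" "(if k * m = h then b m / real (card K) else 0) \<noteq> 0" by blast
  then show ?thesis using that[of k m] by (simp split: if_splits)
qed

lemma dconv_dilate_average:
  assumes K: "finite K" "\<And>k. k \<in> K \<Longrightarrow> k \<ge> 1"
    and supp: "\<And>k m. k \<in> K \<Longrightarrow> b m \<noteq> 0 \<Longrightarrow> k * m \<le> N"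
  shows "dconv N (dilate_average N K b) F n
    = (\<Sum>k\<in>K. if k dvd n then dconv N b F (n div k) / real (card K) else 0)"
proof -
  have "dconv N (dilate_average N K b) F n
     = (\<Sum>k\<in>K. dconv N (\<lambda>h. \<Sum>m = 1..N. if k * m = h then b m / real (card K) else 0) F n)"
    unfolding dilate_average_def by (rule dconv_sum_left)
  also have "\<dots> = (\<Sum>k\<in>K. if k dvd n then dconv N b F (n div k) / real (card K) else 0)"
  proof (intro sum.cong refl)
    fix k assume k: "k \<in> K"
    then have k1: "k \<ge> 1" using K by auto
    have "dconv N (\<lambda>h. \<Sum>m = 1..N. if k * m = h then b m / real (card K) else 0) F n
      = (\<Sum>m = 1..N. dconv N (\<lambda>h. if k * m = h then b m / real (card K) else 0) F n)"
      by (rule dconv_sum_left)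
    also have "\<dots> = (\<Sum>m = 1..N. \<Sum>y = 1..N. if k * m * y = n then b m / real (card K) * F y else 0)"
    proof (intro sum.cong refl)
      fix m assume m: "m \<in> {1..N}"
      have "dconv N (\<lambda>h. if k * m = h then b m / real (card K) else 0) F n
        = (\<Sum>x = 1..N. \<Sum>y = 1..N. if x * y = n then (if k * m = x then b m / real (card K) else 0) * F y else 0)"
        unfolding dconv_eq by (simp add: sum.cartesian_product case_prod_beta)
      also have "\<dots> = (\<Sum>y = 1..N. \<Sum>x = 1..N. if x * y = n then (if k * m = x then b m / real (card K) else 0) * F y else 0)"
        by (rule sum.swap)
      also have "\<dots> = (\<Sum>y = 1..N. \<Sum>x = 1..N. if k * m = x then (if k * m * y = n then b m / real (card K) * F y else 0) else 0)"
        by (intro sum.cong refl) auto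
      also have "\<dots> = (\<Sum>y = 1..N. if k * m * y = n then b m / real (card K) * F y else 0)"
      proof (intro sum.cong refl)
        fix y
        have "k * m \<in> {1..N} \<or> b m = 0" using supp[OF k, of m] k1 m by (auto simp: Suc_le_eq)
        then show "(\<Sum>x = 1..N. if k * m = x then (if k * m * y = n then b m / real (card K) * F y else 0) else 0)
          = (if k * m * y = n then b m / real (card K) * F y else 0)"
          by (subst sum.delta') auto
      qed
      finally show "dconv N (\<lambda>h. if k * m = h then b m / real (card K) else 0) F n
        = (\<Sum>y = 1..N. if k * m * y = n then b m / real (card K) * F y else 0)" .
    qed
    also have "\<dots> = (if k dvd n then (\<Sum>m = 1..N. \<Sum>y = 1..N. if m * y = n div k then b m / real (card K) * F y else 0) else 0)"
    proof (cases "k dvd n")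
      case True
      then have "k * m * y = n \<longleftrightarrow> m * y = n div k" for m y
        using k1 by (auto simp: mult.assoc)
      then show ?thesis using True by simp
    next
      case False
      then have "k * m * y \<noteq> n" for m y by (metis dvd_triv_left mult.assoc)
      then show ?thesis using False by simp
    qed
    also have "(\<Sum>m = 1..N. \<Sum>y = 1..N. if m * y = n div k then b m / real (card K) * F y else 0)
       = dconv N b F (n div k) / real (card K)"
      unfolding dconv_eq sum_divide_distrib sum.cartesian_product case_prod_beta
      by (intro sum.cong refl) simp
    finally show "dconv N (\<lambda>h. \<Sum>m = 1..N. if k * m = h then b m / real (card K) else 0) F n
       = (if k dvd n then dconv N b F (n div k) / real (card K) else 0)" .
  qed
  finally show ?thesis .
qed

text \<open>In the convolution of a dilate average with \<open>F\<close>, only divisors \<open>k\<close> of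
  \<open>n\<close> contribute. If at most \<open>m\<close> of them do, Cauchy-Schwarz loses only
  \<open>m\<close>, whereas the averaging gains the factor \<open>card K\<close>.\<close>

lemma conv_energy_dilate_average:
  assumes K: "finite K" "K \<noteq> {}" "\<And>k. k \<in> K \<Longrightarrow> k \<ge> 1"
    and supp: "\<And>k m. k \<in> K \<Longrightarrow> b m \<noteq> 0 \<Longrightarrow> k * m \<le> N"
    and sparse: "\<And>n. card {k\<in>K. k dvd n \<and> dconv N b F (n div k) \<noteq> 0} \<le> m"
  shows "conv_energy N (dilate_average N K b) F \<le> real m / real (card K) * conv_energy N b F"
proof -
  let ?c = "real (card K)"
  let ?H = "dconv N b F"
  have c0: "?c > 0" using K by (simp add: card_gt_0_iff)
  have "(dconv N (dilate_average N K b) F n)\<^sup>2 \<le> real m * (\<Sum>k\<in>K. if k dvd n then (?H (n div k))\<^sup>2 / ?c\<^sup>2 else 0)" for n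
  proof -
    have "(dconv N (dilate_average N K b) F n)\<^sup>2 = (\<Sum>k\<in>K. if k dvd n then ?H (n div k) / ?c else 0)\<^sup>2"
      using dconv_dilate_average[OF K(1,3) supp, where F = F and n = n] by simp
    also have "\<dots> \<le> real m * (\<Sum>k\<in>K. (if k dvd n then ?H (n div k) / ?c else 0)\<^sup>2)"
    proof (rule sum_sparse_squared_le[OF K(1)])
      have "{k\<in>K. (if k dvd n then ?H (n div k) / ?c else 0) \<noteq> 0} \<subseteq> {k\<in>K. k dvd n \<and> ?H (n div k) \<noteq> 0}" by auto
      then have "card {k\<in>K. (if k dvd n then ?H (n div k) / ?c else 0) \<noteq> 0} \<le> card {k\<in>K. k dvd n \<and> ?H (n div k) \<noteq> 0}"
        using K(1) by (intro card_mono) auto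
      then show "card {k\<in>K. (if k dvd n then ?H (n div k) / ?c else 0) \<noteq> 0} \<le> m"
        using sparse[of n] by (rule le_trans)
    qed
    also have "(\<Sum>k\<in>K. (if k dvd n then ?H (n div k) / ?c else 0)\<^sup>2) = (\<Sum>k\<in>K. if k dvd n then (?H (n div k))\<^sup>2 / ?c\<^sup>2 else 0)"
      by (intro sum.cong refl) (auto simp: power_divide)
    finally show ?thesis .
  qed
  then have "conv_energy N (dilate_average N K b) F
     \<le> (\<Sum>n = 1..N\<^sup>2. real m * (\<Sum>k\<in>K. if k dvd n then (?H (n div k))\<^sup>2 / ?c\<^sup>2 else 0))"
    unfolding conv_energy_def by (intro sum_mono)
  also have "\<dots> = real m * (\<Sum>k\<in>K. \<Sum>n = 1..N\<^sup>2. if k dvd n then (?H (n div k))\<^sup>2 / ?c\<^sup>2 else 0)"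
    by (simp only: sum_distrib_left[symmetric]) (subst sum.swap, rule refl)
  also have "\<dots> \<le> real m * (\<Sum>k\<in>K. conv_energy N b F / ?c\<^sup>2)"
  proof (intro mult_left_mono sum_mono)
    fix k assume "k \<in> K"
    then have k1: "k \<ge> 1" using K by auto
    have "(\<Sum>n = 1..N\<^sup>2. if k dvd n then (?H (n div k))\<^sup>2 / ?c\<^sup>2 else 0)
      = (\<Sum>n\<in>{n\<in>{1..N\<^sup>2}. k dvd n}. (?H (n div k))\<^sup>2 / ?c\<^sup>2)"
      by (rule sum.inter_filter[symmetric]) simp
    also have "\<dots> = (\<Sum>v\<in>(\<lambda>n. n div k) ` {n\<in>{1..N\<^sup>2}. k dvd n}. (?H v)\<^sup>2 / ?c\<^sup>2)"
      using k1 by (subst sum.reindex) (auto intro!: inj_onI)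
    also have "\<dots> \<le> (\<Sum>v\<in>{1..N\<^sup>2}. (?H v)\<^sup>2 / ?c\<^sup>2)"
    proof (rule sum_mono2)
      show "(\<lambda>n. n div k) ` {n\<in>{1..N\<^sup>2}. k dvd n} \<subseteq> {1..N\<^sup>2}"
      proof (rule image_subsetI)
        fix n assume n: "n \<in> {n\<in>{1..N\<^sup>2}. k dvd n}"
        then have "k \<le> n" by (auto intro: dvd_imp_le)
        then have "n div k \<ge> 1" using k1 by (simp add: less_eq_div_iff_mult_less_eq)
        moreover have "n div k \<le> n" by simp
        ultimately show "n div k \<in> {1..N\<^sup>2}" using n by (auto simp del: div_le_dividend)
      qed
    qed auto
    also have "\<dots> = conv_energy N b F / ?c\<^sup>2" by (simp add: conv_energy_def sum_divide_distrib)
    finally show "(\<Sum>n = 1..N\<^sup>2. if k dvd n then (?H (n div k))\<^sup>2 / ?c\<^sup>2 else 0) \<le> conv_energy N b F / ?c\<^sup>2" .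
  qed auto
  also have "\<dots> = real m / ?c * conv_energy N b F" using c0 by (simp add: power2_eq_square)
  finally show ?thesis .
qed

text \<open>The quotients \<open>x / z\<close> do not change when both entries are multiplied by the same
  \<open>q\<close>, so the correlations of the slices \<open>m \<mapsto> c (q m)\<close> occur
  disjointly inside those of \<open>c\<close>.\<close>

lemma sum_conv_energy_slices_le:
  assumes c: "\<And>n. c n \<ge> 0" and g: "\<And>n. g n \<ge> 0" and A: "\<And>q m. A q m \<ge> 0" and Q: "finite Q"
    and dom: "\<And>q m. q \<in> Q \<Longrightarrow> A q m \<noteq> 0 \<Longrightarrow> 1 \<le> m \<and> 1 \<le> q \<and> q * m \<le> N \<and> A q m \<le> c (q * m)"
    and inj: "\<And>q q' m m'. q \<in> Q \<Longrightarrow> q' \<in> Q \<Longrightarrow> A q m \<noteq> 0 \<Longrightarrow> A q' m' \<noteq> 0 \<Longrightarrow> q * m = q' * m' \<Longrightarrow> q = q'"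
  shows "(\<Sum>q\<in>Q. conv_energy N (A q) g) \<le> conv_energy N c g"
proof -
  have r0: "ratio_corr N g \<rho> \<ge> 0" for \<rho> unfolding ratio_corr_def using g by (intro sum_nonneg) auto
  have slice: "(\<Sum>q\<in>Q. ratio_corr N (A q) \<rho>) \<le> ratio_corr N c \<rho>" for \<rho>
  proof -
    let ?P = "{(x, z). x \<in> {1..N} \<and> z \<in> {1..N} \<and> real x / real z = \<rho>}"
    let ?S = "{t \<in> Q \<times> ?P. A (fst t) (fst (snd t)) \<noteq> 0 \<and> A (fst t) (snd (snd t)) \<noteq> 0}"
    let ?f = "\<lambda>t. (fst t * fst (snd t), fst t * snd (snd t))"
    have finP: "finite ?P" by (rule finite_factor_pairs)
    have "(\<Sum>q\<in>Q. ratio_corr N (A q) \<rho>) = (\<Sum>t\<in>Q \<times> ?P. A (fst t) (fst (snd t)) * A (fst t) (snd (snd t)))"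
      unfolding ratio_corr_def by (simp add: sum.cartesian_product case_prod_beta)
    also have "\<dots> = (\<Sum>t\<in>?S. A (fst t) (fst (snd t)) * A (fst t) (snd (snd t)))"
      using Q finP by (intro sum.mono_neutral_right) auto
    also have "\<dots> \<le> (\<Sum>t\<in>?S. c (fst (?f t)) * c (snd (?f t)))"
      using A dom by (intro sum_mono mult_mono) (auto intro: c)
    also have "\<dots> = (\<Sum>w\<in>?f ` ?S. c (fst w) * c (snd w))"
    proof (rule sum.reindex[symmetric, unfolded o_def])
      show "inj_on ?f ?S"
      proof (rule inj_onI)
        fix s t assume s: "s \<in> ?S" and t: "t \<in> ?S" and e: "?f s = ?f t"
        have "fst s = fst t" using inj[of "fst s" "fst t" "fst (snd s)" "fst (snd t)"] s t e by auto
        moreover have "fst s \<ge> 1" using dom[of "fst s" "fst (snd s)"] s by auto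
        ultimately show "s = t" using e by (auto simp: prod_eq_iff)
      qed
    qed
    also have "\<dots> \<le> (\<Sum>w\<in>?P. c (fst w) * c (snd w))"
    proof (rule sum_mono2[OF finP])
      show "?f ` ?S \<subseteq> ?P"
      proof (rule image_subsetI)
        fix t assume t: "t \<in> ?S"
        have d1: "1 \<le> fst t" "fst t * fst (snd t) \<le> N" "1 \<le> fst (snd t)" using dom[of "fst t" "fst (snd t)"] t by auto
        have d2: "fst t * snd (snd t) \<le> N" "1 \<le> snd (snd t)" using dom[of "fst t" "snd (snd t)"] t by auto
        have "real (fst t * fst (snd t)) / real (fst t * snd (snd t)) = real (fst (snd t)) / real (snd (snd t))"
          using d1 by simp
        also have "\<dots> = \<rho>" using t by auto
        finally show "?f t \<in> ?P" using d1 d2 by (auto simp: Suc_le_eq)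
      qed
    qed (use c in auto)
    also have "\<dots> = ratio_corr N c \<rho>" unfolding ratio_corr_def by (intro sum.cong) auto
    finally show ?thesis .
  qed
  have "(\<Sum>q\<in>Q. conv_energy N (A q) g) = (\<Sum>\<rho>\<in>ratios N. (\<Sum>q\<in>Q. ratio_corr N (A q) \<rho>) * ratio_corr N g \<rho>)"
    unfolding conv_energy_ratio sum_distrib_right by (rule sum.swap)
  also have "\<dots> \<le> (\<Sum>\<rho>\<in>ratios N. ratio_corr N c \<rho> * ratio_corr N g \<rho>)"
    using slice r0 by (intro sum_mono mult_right_mono)
  finally show ?thesis by (simp add: conv_energy_ratio)
qed

text \<open>Here \<open>A q m\<close> is the part of \<open>c (q m)\<close> with \<open>q\<close> the
  dominating prime factor, in block \<open>j\<close>, and the new weight \<open>c'\<close>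
  replaces \<open>q\<close> by a random prime from \<open>K j\<close>. The primes in \<open>K
  j\<close> exceed \<open>U j\<close>, all other prime factors of numbers in block
  \<open>j\<close> are at most \<open>U j\<close>, and blocks below \<open>j\<close> are also
  replaced by primes at most \<open>U j\<close>.

    Therefore the larger of the two blocks involved in a product \<open>n\<close> can be read off
  from \<open>n\<close>, and for the weights in that block at most two elements of \<open>K
  j\<close> can divide \<open>n\<close>. The energy of \<open>c'\<close> thus splits into mixed
  energies over the blocks. Undoing the replacement, which costs the ratio \<open>C\<close> of the
  block sizes, and collecting the slices yields \<open>E(c', c') \<le> 8 C E(c, c')\<close>, and
  the Cauchy-Schwarz inequality for the mixed energy closes the argument.\<close>

lemma prime_replacement_energy:
  fixes c :: "nat \<Rightarrow> real" and Bl K :: "nat \<Rightarrow> nat set" and A :: "nat \<Rightarrow> nat \<Rightarrow> real" and U :: "nat \<Rightarrow> nat"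
  assumes c: "\<And>n. c n \<ge> 0" and A: "\<And>q m. A q m \<ge> 0" and J: "finite (J :: nat set)"
    and fB: "\<And>j. j \<in> J \<Longrightarrow> finite (Bl j)" and fK: "\<And>j. j \<in> J \<Longrightarrow> finite (K j) \<and> K j \<noteq> {}"
    and disj: "\<And>i j. i \<in> J \<Longrightarrow> j \<in> J \<Longrightarrow> i \<noteq> j \<Longrightarrow> Bl i \<inter> Bl j = {}"
    and dom: "\<And>j q m. j \<in> J \<Longrightarrow> q \<in> Bl j \<Longrightarrow> A q m \<noteq> 0 \<Longrightarrow> 1 \<le> m \<and> q * m \<le> N \<and> A q m \<le> c (q * m)"
    and smooth: "\<And>j q m r. j \<in> J \<Longrightarrow> q \<in> Bl j \<Longrightarrow> A q m \<noteq> 0 \<Longrightarrow> prime r \<Longrightarrow> r dvd m \<Longrightarrow> r \<le> U j"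
    and inj: "\<And>i j q q' m m'. i \<in> J \<Longrightarrow> j \<in> J \<Longrightarrow> q \<in> Bl i \<Longrightarrow> q' \<in> Bl j \<Longrightarrow>
        A q m \<noteq> 0 \<Longrightarrow> A q' m' \<noteq> 0 \<Longrightarrow> q * m = q' * m' \<Longrightarrow> q = q'"
    and K: "\<And>j k. j \<in> J \<Longrightarrow> k \<in> K j \<Longrightarrow> prime k \<and> U j < k"
    and KU: "\<And>i j k. i \<in> J \<Longrightarrow> j \<in> J \<Longrightarrow> i < j \<Longrightarrow> k \<in> K i \<Longrightarrow> k \<le> U j"
    and U: "\<And>i j. i \<le> j \<Longrightarrow> U i \<le> U j"
    and Kq: "\<And>j q k. j \<in> J \<Longrightarrow> q \<in> Bl j \<Longrightarrow> k \<in> K j \<Longrightarrow> k \<le> q"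
    and C: "\<And>j. j \<in> J \<Longrightarrow> real (card (Bl j)) \<le> C * real (card (K j))" and C0: "C \<ge> 0"
  defines "b \<equiv> \<lambda>j m. \<Sum>q\<in>Bl j. A q m"
  defines "c' \<equiv> \<lambda>h. \<Sum>j\<in>J. dilate_average N (K j) (b j) h"
  shows "conv_energy N c' c' \<le> 64 * C\<^sup>2 * conv_energy N c c"
proof -
  define D where "D = (\<lambda>j. dilate_average N (K j) (b j))"
  define F where "F = (\<lambda>j x. \<Sum>i\<in>{i\<in>J. i \<le> j}. D i x)"
  have b0: "b j m \<ge> 0" for j m unfolding b_def using A by (intro sum_nonneg) auto
  have D0: "D j x \<ge> 0" for j x unfolding D_def by (intro dilate_average_nonneg b0)
  have F0: "F j x \<ge> 0" for j x unfolding F_def by (intro sum_nonneg D0)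
  have c'D: "c' = (\<lambda>h. \<Sum>j\<in>J. D j h)" unfolding c'_def D_def by simp
  have c'0: "c' x \<ge> 0" for x unfolding c'D by (intro sum_nonneg D0)
  have bD: "\<exists>q\<in>Bl j. A q m \<noteq> 0" if "b j m \<noteq> 0" for j m
    using that unfolding b_def by (meson sum.not_neutral_contains_not_neutral)
  have b_smooth: "r \<le> U j" if "j \<in> J" "b j m \<noteq> 0" "prime r" "r dvd m" for j m r
    using bD[OF that(2)] smooth that by blast
  have D_primes: "r \<le> U j \<or> r \<in> K j" if j: "j \<in> J" and x: "D j x \<noteq> 0" and r: "prime r" "r dvd x" for j x r
  proof -
    obtain k m where km: "k \<in> K j" "x = k * m" "b j m \<noteq> 0"
      using dilate_average_nonzeroD[OF x[unfolded D_def]] by metis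
    have "r dvd k \<or> r dvd m" using r km by (simp add: prime_dvd_mult_iff)
    then show ?thesis
    proof
      assume "r dvd k"
      then have "r = k" using K[OF j km(1)] r by (simp add: primes_dvd_imp_eq)
      then show ?thesis using km by simp
    qed (use b_smooth[OF j km(3) r(1)] in auto)
  qed
  have D_prime: "\<exists>k\<in>K j. k dvd x" if "D j x \<noteq> 0" for j x
    using dilate_average_nonzeroD[OF that[unfolded D_def]] by (metis dvd_triv_left)
  \<comment> \<open>the block of the largest replaced prime\<close>
  define t where "t = (\<lambda>j n. \<Sum>(i, i')\<in>{(i, i'). i \<in> J \<and> i' \<in> J \<and> max i i' = j}. dconv N (D i) (D i') n)"
  have dd0: "dconv N (D i) (D i') n \<ge> 0" for i i' n by (intro dconv_nonneg D0)
  have fin2: "finite {(i, i'). i \<in> J \<and> i' \<in> J \<and> max i i' = j}" for j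
    by (rule finite_subset[of _ "J \<times> J"]) (use J in auto)
  have t0: "t j n \<ge> 0" for j n unfolding t_def using dd0 by (intro sum_nonneg) auto
  have tD: "(\<exists>k\<in>K j. k dvd n) \<and> (\<forall>j'\<in>J. j < j' \<longrightarrow> \<not> (\<exists>k\<in>K j'. k dvd n))"
    if j: "j \<in> J" and n: "t j n \<noteq> 0" for j n
  proof -
    have "\<exists>p\<in>{(i, i'). i \<in> J \<and> i' \<in> J \<and> max i i' = j}. dconv N (D (fst p)) (D (snd p)) n \<noteq> 0"
      using n unfolding t_def case_prod_beta by (meson sum.not_neutral_contains_not_neutral)
    then obtain i i' where i: "i \<in> J" "i' \<in> J" "max i i' = j" "dconv N (D i) (D i') n \<noteq> 0" by auto
    obtain x y where xy: "x * y = n" "D i x \<noteq> 0" "D i' y \<noteq> 0"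
      using dconv_nonzeroD[OF i(4)] by metis
    have "\<exists>k\<in>K j. k dvd n"
    proof -
      have "j = i \<or> j = i'" using i(3) by (auto simp: max_def)
      then show ?thesis
        using D_prime[OF xy(2)] D_prime[OF xy(3)] xy(1) by (metis dvd_mult dvd_mult2)
    qed
    moreover have "\<not> (\<exists>k\<in>K j'. k dvd n)" if j': "j' \<in> J" "j < j'" for j'
    proof
      assume "\<exists>k\<in>K j'. k dvd n"
      then obtain k where k: "k \<in> K j'" "k dvd n" by blast
      then have pk: "prime k" "U j' < k" using K j' by auto
      have ii: "i < j'" "i' < j'" using i j' by auto
      have "k dvd x \<or> k dvd y" using k(2) pk(1) xy(1) prime_dvd_mult_iff[of k x y] by simp
      then have "k \<le> U i \<or> k \<in> K i \<or> k \<le> U i' \<or> k \<in> K i'"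
        using D_primes[OF i(1) xy(2) pk(1)] D_primes[OF i(2) xy(3) pk(1)] by blast
      then have "k \<le> U j'"
        using KU[OF i(1) j'(1) ii(1)] KU[OF i(2) j'(1) ii(2)] U[of i j'] U[of i' j'] ii by (meson le_trans less_imp_le_nat)
      then show False using pk by simp
    qed
    ultimately show ?thesis by blast
  qed
  have split: "dconv N c' c' n = (\<Sum>j\<in>J. t j n)" for n
  proof -
    have "dconv N c' c' n = (\<Sum>i\<in>J. \<Sum>i'\<in>J. dconv N (D i) (D i') n)"
      unfolding c'D by (simp add: dconv_sum_left dconv_sum_right)
    also have "\<dots> = (\<Sum>p\<in>J \<times> J. dconv N (D (fst p)) (D (snd p)) n)"
      by (simp add: sum.cartesian_product case_prod_beta)
    also have "\<dots> = (\<Sum>j\<in>J. \<Sum>p\<in>{p \<in> J \<times> J. max (fst p) (snd p) = j}. dconv N (D (fst p)) (D (snd p)) n)"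
      using J by (intro sum.group[symmetric]) (auto simp: max_def)
    also have "\<dots> = (\<Sum>j\<in>J. t j n)"
      unfolding t_def case_prod_beta by (intro sum.cong refl) auto
    finally show ?thesis .
  qed
  have t_le: "t j n \<le> 2 * dconv N (D j) (F j) n" if j: "j \<in> J" for j n
  proof -
    let ?L = "{i\<in>J. i \<le> j}"
    have "t j n \<le> (\<Sum>p\<in>({j} \<times> ?L) \<union> (?L \<times> {j}). dconv N (D (fst p)) (D (snd p)) n)"
      unfolding t_def case_prod_beta using J dd0 by (intro sum_mono2) (auto simp: max_def split: if_splits)
    also have "\<dots> \<le> (\<Sum>p\<in>{j} \<times> ?L. dconv N (D (fst p)) (D (snd p)) n) + (\<Sum>p\<in>?L \<times> {j}. dconv N (D (fst p)) (D (snd p)) n)"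
      using J dd0 by (subst sum.union_inter[symmetric]) (auto intro!: sum_nonneg)
    also have "(\<Sum>p\<in>{j} \<times> ?L. dconv N (D (fst p)) (D (snd p)) n) = (\<Sum>i\<in>?L. dconv N (D j) (D i) n)"
      by (rule sum.reindex_bij_witness[where i = "\<lambda>i. (j, i)" and j = snd]) auto
    also have "(\<Sum>p\<in>?L \<times> {j}. dconv N (D (fst p)) (D (snd p)) n) = (\<Sum>i\<in>?L. dconv N (D j) (D i) n)"
      by (rule sum.reindex_bij_witness[where i = "\<lambda>i. (i, j)" and j = fst]) (auto simp: dconv_commute[of N "D j"])
    also have "(\<Sum>i\<in>?L. dconv N (D j) (D i) n) = dconv N (D j) (F j) n"
      unfolding F_def by (rule dconv_sum_right[symmetric])
    finally show ?thesis by simp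
  qed
  have "conv_energy N c' c' \<le> (\<Sum>n = 1..N\<^sup>2. \<Sum>j\<in>J. 4 * (dconv N (D j) (F j) n)\<^sup>2)"
    unfolding conv_energy_def
  proof (rule sum_mono)
    fix n
    have "card {j\<in>J. t j n \<noteq> 0} \<le> 1"
    proof (rule card_le_Suc0_iff_eq[THEN iffD2, unfolded One_nat_def[symmetric]])
      show "\<forall>j\<in>{j\<in>J. t j n \<noteq> 0}. \<forall>j'\<in>{j\<in>J. t j n \<noteq> 0}. j = j'"
        using tD by (metis (mono_tags, lifting) linorder_neqE_nat mem_Collect_eq)
    qed (use J in auto)
    then have "(dconv N c' c' n)\<^sup>2 \<le> (\<Sum>j\<in>J. (t j n)\<^sup>2)"
      unfolding split using sum_sparse_squared_le[OF J, of "\<lambda>j. t j n" 1] by simp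
    also have "\<dots> \<le> (\<Sum>j\<in>J. (2 * dconv N (D j) (F j) n)\<^sup>2)"
      using t_le t0 by (intro sum_mono power_mono)
    finally show "(dconv N c' c' n)\<^sup>2 \<le> (\<Sum>j\<in>J. 4 * (dconv N (D j) (F j) n)\<^sup>2)"
      by (simp add: power_mult_distrib)
  qed
  also have "\<dots> = 4 * (\<Sum>j\<in>J. conv_energy N (D j) (F j))"
    unfolding conv_energy_def sum_distrib_left by (rule sum.swap)
  also have "\<dots> \<le> 4 * (\<Sum>j\<in>J. 2 * C * (\<Sum>q\<in>Bl j. conv_energy N (A q) c'))"
  proof (intro mult_left_mono sum_mono)
    fix j assume j: "j \<in> J"
    have kpos: "real (card (K j)) > 0" using fK[OF j] by (simp add: card_gt_0_iff)
    have "conv_energy N (D j) (F j) \<le> real 2 / real (card (K j)) * conv_energy N (b j) (F j)"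
      unfolding D_def
    proof (rule conv_energy_dilate_average)
      show "finite (K j)" "K j \<noteq> {}" using fK[OF j] by auto
      show "k \<ge> 1" if "k \<in> K j" for k using K[OF j that] prime_ge_1_nat by blast
      show "k * m \<le> N" if kb: "k \<in> K j" "b j m \<noteq> 0" for k m
      proof -
        obtain q where q: "q \<in> Bl j" "A q m \<noteq> 0" using bD[OF kb(2)] by blast
        have "k * m \<le> q * m" using Kq[OF j q(1) kb(1)] by simp
        also have "\<dots> \<le> N" using dom[OF j q] by blast
        finally show ?thesis .
      qed
      show "card {k\<in>K j. k dvd n \<and> dconv N (b j) (F j) (n div k) \<noteq> 0} \<le> 2" for n
      proof (cases "{k\<in>K j. k dvd n \<and> dconv N (b j) (F j) (n div k) \<noteq> 0} = {}")
        case False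
        then obtain k where k: "k \<in> K j" "k dvd n" "dconv N (b j) (F j) (n div k) \<noteq> 0" by blast
        obtain m y where my: "m * y = n div k" "b j m \<noteq> 0" "F j y \<noteq> 0"
          using dconv_nonzeroD[OF k(3)] by metis
        have n: "n = k * (m * y)" using k my by simp
        obtain i where i: "i \<in> J" "i \<le> j" "D i y \<noteq> 0"
          using my(3) unfolding F_def by (metis (mono_tags, lifting) mem_Collect_eq sum.not_neutral_contains_not_neutral)
        obtain k' m' where km: "k' \<in> K i" "y = k' * m'" "b i m' \<noteq> 0"
          using dilate_average_nonzeroD[OF i(3)[unfolded D_def]] by metis
        have "{k\<in>K j. k dvd n \<and> dconv N (b j) (F j) (n div k) \<noteq> 0} \<subseteq> {k, k'}"
        proof
          fix l assume "l \<in> {k\<in>K j. k dvd n \<and> dconv N (b j) (F j) (n div k) \<noteq> 0}"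
          then have l: "l \<in> K j" "l dvd n" by auto
          then have pl: "prime l" "U j < l" using K[OF j] by auto
          have "l dvd k \<or> l dvd m \<or> l dvd k' \<or> l dvd m'"
            using l(2) pl(1) unfolding n km(2) by (simp add: prime_dvd_mult_iff)
          moreover have "\<not> l dvd m" using b_smooth[OF j my(2) pl(1)] pl(2) by auto
          moreover have "\<not> l dvd m'"
            using b_smooth[OF i(1) km(3) pl(1)] pl(2) U[OF i(2)] by (meson leD le_trans)
          moreover have "l dvd k \<Longrightarrow> l = k" using K[OF j k(1)] pl by (simp add: primes_dvd_imp_eq)
          moreover have "l dvd k' \<Longrightarrow> l = k'" using K[OF i(1) km(1)] pl by (simp add: primes_dvd_imp_eq)
          ultimately show "l \<in> {k, k'}" by blast
        qed
        then have "card {k\<in>K j. k dvd n \<and> dconv N (b j) (F j) (n div k) \<noteq> 0} \<le> card {k, k'}"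
          by (intro card_mono) auto
        also have "\<dots> \<le> 2" by (simp add: card_insert_le_m1)
        finally show ?thesis .
      qed (metis card.empty zero_le)
    qed
    also have "conv_energy N (b j) (F j) \<le> real (card (Bl j)) * (\<Sum>q\<in>Bl j. conv_energy N (A q) (F j))"
    proof -
      have "(dconv N (b j) (F j) n)\<^sup>2 \<le> real (card (Bl j)) * (\<Sum>q\<in>Bl j. (dconv N (A q) (F j) n)\<^sup>2)" for n
        unfolding b_def dconv_sum_left
        using sum_squared_le_sum_of_squares[of "\<lambda>q. dconv N (A q) (F j) n" "Bl j"] by (simp add: mult.commute)
      then have "conv_energy N (b j) (F j) \<le> (\<Sum>n = 1..N\<^sup>2. real (card (Bl j)) * (\<Sum>q\<in>Bl j. (dconv N (A q) (F j) n)\<^sup>2))"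
        unfolding conv_energy_def by (intro sum_mono)
      also have "\<dots> = real (card (Bl j)) * (\<Sum>q\<in>Bl j. conv_energy N (A q) (F j))"
        unfolding conv_energy_def
        by (subst sum_distrib_left[symmetric], rule arg_cong[where f = "\<lambda>x. real (card (Bl j)) * x"], rule sum.swap)
      finally show ?thesis .
    qed
    also have "(\<Sum>q\<in>Bl j. conv_energy N (A q) (F j)) \<le> (\<Sum>q\<in>Bl j. conv_energy N (A q) c')"
    proof (intro sum_mono conv_energy_mono A F0 order_refl)
      show "F j x \<le> c' x" for x unfolding F_def c'D using J D0 by (intro sum_mono2) auto
    qed
    also have "real 2 / real (card (K j)) * (real (card (Bl j)) * (\<Sum>q\<in>Bl j. conv_energy N (A q) c'))
       \<le> 2 * C * (\<Sum>q\<in>Bl j. conv_energy N (A q) c')"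
    proof -
      have "real 2 / real (card (K j)) * real (card (Bl j)) \<le> 2 * C"
        using C[OF j] kpos by (simp add: field_simps)
      then have "real 2 / real (card (K j)) * real (card (Bl j)) * (\<Sum>q\<in>Bl j. conv_energy N (A q) c')
        \<le> 2 * C * (\<Sum>q\<in>Bl j. conv_energy N (A q) c')"
        by (intro mult_right_mono sum_nonneg conv_energy_nonneg)
      then show ?thesis by (simp add: mult.assoc)
    qed
    finally show "conv_energy N (D j) (F j) \<le> 2 * C * (\<Sum>q\<in>Bl j. conv_energy N (A q) c')"
      by (meson divide_nonneg_nonneg mult_left_mono of_nat_0_le_iff order_trans)
  qed auto
  also have "\<dots> = 8 * C * (\<Sum>q\<in>(\<Union>j\<in>J. Bl j). conv_energy N (A q) c')"
    using J fB disj by (subst sum.UNION_disjoint) (auto simp: sum_distrib_left mult.assoc)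
  also have "\<dots> \<le> 8 * C * conv_energy N c c'"
  proof (intro mult_left_mono sum_conv_energy_slices_le c c'0 A)
    show "finite (\<Union>j\<in>J. Bl j)" using J fB by auto
    show "1 \<le> m \<and> 1 \<le> q \<and> q * m \<le> N \<and> A q m \<le> c (q * m)" if q: "q \<in> (\<Union>j\<in>J. Bl j)" "A q m \<noteq> 0" for q m
    proof -
      obtain j where j: "j \<in> J" "q \<in> Bl j" using q by blast
      obtain k where "k \<in> K j" using fK[OF j(1)] by blast
      then have "1 \<le> q" using Kq[OF j] K[OF j(1)] by (meson le_trans prime_ge_1_nat)
      then show ?thesis using dom[OF j q(2)] by simp
    qed
    show "q = q'" if "q \<in> (\<Union>j\<in>J. Bl j)" "q' \<in> (\<Union>j\<in>J. Bl j)" "A q m \<noteq> 0" "A q' m' \<noteq> 0" "q * m = q' * m'" for q q' m m'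
      using that inj by blast
  qed (use C0 in auto)
  finally have 1: "conv_energy N c' c' \<le> 8 * C * conv_energy N c c'" .
  have "(conv_energy N c' c')\<^sup>2 \<le> (8 * C * conv_energy N c c')\<^sup>2"
    using 1 conv_energy_nonneg by (intro power_mono)
  also have "\<dots> = 64 * C\<^sup>2 * (conv_energy N c c')\<^sup>2" by (simp add: power_mult_distrib)
  also have "\<dots> \<le> 64 * C\<^sup>2 * (conv_energy N c c * conv_energy N c' c')"
    by (intro mult_left_mono conv_energy_Cauchy_Schwarz) auto
  finally have 2: "conv_energy N c' c' * conv_energy N c' c' \<le> (64 * C\<^sup>2 * conv_energy N c c) * conv_energy N c' c'"
    by (simp add: power2_eq_square mult_ac)
  show ?thesis
  proof (cases "conv_energy N c' c' = 0")
    case True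
    then show ?thesis using conv_energy_nonneg[of N c c] by simp
  next
    case False
    then have "conv_energy N c' c' > 0" using conv_energy_nonneg[of N c' c'] by simp
    then show ?thesis using 2 by simp
  qed
qed

section \<open>Smooth numbers and close prime factors\<close>

definition smooth :: "nat \<Rightarrow> nat \<Rightarrow> bool" where
  "smooth y m \<longleftrightarrow> (\<forall>r. prime r \<longrightarrow> r dvd m \<longrightarrow> r \<le> y)"

definition prime_block :: "nat \<Rightarrow> nat \<Rightarrow> nat set" where
  "prime_block a b = {p. prime p \<and> a < p \<and> p \<le> b}"

lemma finite_prime_block [simp]: "finite (prime_block a b)"
  unfolding prime_block_def by (rule finite_subset[of _ "{..b}"]) auto

lemma sum_ln_prime_block: "(\<Sum>p\<in>prime_block a b. ln (real p)) \<le> real b * ln 4"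
proof -
  have "(\<Sum>p\<in>prime_block a b. ln (real p)) \<le> (\<Sum>p\<in>primes_le b. ln (real p))"
    by (rule sum_mono2) (auto simp: prime_block_def primes_le_def Suc_le_eq prime_gt_0_nat)
  then show ?thesis using sum_ln_primes_le[of b] by linarith
qed

lemma card_prime_block_le:
  assumes "a \<ge> 1"
  shows "real (card (prime_block a b)) * ln (real a) \<le> real b * ln 4"
proof -
  have "real (card (prime_block a b)) * ln (real a) = (\<Sum>p\<in>prime_block a b. ln (real a))" by simp
  also have "\<dots> \<le> (\<Sum>p\<in>prime_block a b. ln (real p))"
    using assms by (intro sum_mono) (auto simp: prime_block_def)
  finally show ?thesis using sum_ln_prime_block[of a b] by linarith
qed

lemma sum_inverse_prime_block_le:
  assumes "a \<ge> 1"
  shows "(\<Sum>p\<in>prime_block a b. 1 / real p) * (real a * ln (real a)) \<le> real b * ln 4"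
proof -
  have "(\<Sum>p\<in>prime_block a b. 1 / real p) \<le> (\<Sum>p\<in>prime_block a b. 1 / real a)"
    using assms by (intro sum_mono) (auto simp: prime_block_def field_simps)
  then have "(\<Sum>p\<in>prime_block a b. 1 / real p) * real a \<le> real (card (prime_block a b))"
    using assms by (simp add: field_simps)
  then have "(\<Sum>p\<in>prime_block a b. 1 / real p) * real a * ln (real a) \<le> real (card (prime_block a b)) * ln (real a)"
    using assms by (intro mult_right_mono) auto
  then show ?thesis using card_prime_block_le[OF assms, of b] by (simp add: mult.assoc)
qed

text \<open>A \<open>Y\<close>-smooth \<open>g > N\<close> has \<open>ln g \<ge> ln N\<close>, while summing
  \<open>ln g\<close> over smooth \<open>g \<le> N^2\<close> by primes gives at most
  \<open>N^2\<close> times a Mertens sum up to \<open>Y\<close>.\<close>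

lemma card_smooth_le:
  assumes N: "N \<ge> 2" and Y: "Y \<ge> 1"
  shows "real (card {g\<in>{1..N\<^sup>2}. smooth Y g}) \<le> real N + (real N)\<^sup>2 * (ln (real Y) + 4) / ln (real N)"
proof -
  let ?G = "{g\<in>{1..N\<^sup>2}. smooth Y g}"
  let ?G1 = "{g\<in>?G. N < g}"
  have lnN: "ln (real N) > 0" using N by simp
  have fin: "finite ?G" by simp
  have "?G \<subseteq> {1..N} \<union> ?G1" by auto
  then have "card ?G \<le> card ({1..N} \<union> ?G1)" by (intro card_mono) auto
  also have "\<dots> \<le> N + card ?G1" using card_Un_le[of "{1..N}" ?G1] by simp
  finally have 1: "real (card ?G) \<le> real N + real (card ?G1)" by simp
  have "real (card ?G1) * ln (real N) = (\<Sum>g\<in>?G1. ln (real N))" by simp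
  also have "\<dots> \<le> (\<Sum>g\<in>?G1. ln (real g))" using N by (intro sum_mono) auto
  also have "\<dots> \<le> (\<Sum>g\<in>?G. ln (real g))" by (rule sum_mono2) auto
  also have "\<dots> \<le> (\<Sum>g\<in>?G. \<Sum>p\<in>primes_le Y. real (multiplicity p g) * ln (real p))"
  proof (rule sum_mono)
    fix g assume g: "g \<in> ?G"
    have "ln (real g) = (\<Sum>p\<in>primes_le (N\<^sup>2). real (multiplicity p g) * ln (real p))"
      using g by (intro ln_nat_eq_sum_multiplicity) auto
    also have "\<dots> = (\<Sum>p\<in>primes_le (N\<^sup>2) \<inter> primes_le Y. real (multiplicity p g) * ln (real p))"
    proof (rule sum.mono_neutral_right)
      show "\<forall>p\<in>primes_le (N\<^sup>2) - primes_le (N\<^sup>2) \<inter> primes_le Y. real (multiplicity p g) * ln (real p) = 0"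
        using g by (auto simp: primes_le_def smooth_def intro!: not_dvd_imp_multiplicity_0)
    qed auto
    also have "\<dots> \<le> (\<Sum>p\<in>primes_le Y. real (multiplicity p g) * ln (real p))"
      by (rule sum_mono2) (auto dest!: primes_leD)
    finally show "ln (real g) \<le> (\<Sum>p\<in>primes_le Y. real (multiplicity p g) * ln (real p))" .
  qed
  also have "\<dots> \<le> (\<Sum>g\<in>{1..N\<^sup>2}. \<Sum>p\<in>primes_le Y. real (multiplicity p g) * ln (real p))"
    by (rule sum_mono2) (auto dest!: primes_leD intro!: sum_nonneg)
  also have "\<dots> = (\<Sum>p\<in>primes_le Y. (\<Sum>g\<in>{1..N\<^sup>2}. real (multiplicity p g)) * ln (real p))"
    unfolding sum_distrib_right by (rule sum.swap)
  also have "\<dots> \<le> (\<Sum>p\<in>primes_le Y. (real N)\<^sup>2 * (ln (real p) / (real p - 1)))"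
  proof (rule sum_mono)
    fix p assume p: "p \<in> primes_le Y"
    then have p2: "prime p" "p \<ge> 2" using primes_leD by auto
    have "real (p - 1) * real (\<Sum>g\<in>{1..N\<^sup>2}. multiplicity p g) \<le> real (N\<^sup>2)"
      using sum_multiplicity_le[OF p2(1), of "N\<^sup>2"] by (metis of_nat_le_iff of_nat_mult)
    then have "(\<Sum>g\<in>{1..N\<^sup>2}. real (multiplicity p g)) \<le> (real N)\<^sup>2 / (real p - 1)"
      using p2 by (simp add: field_simps of_nat_diff)
    then have "(\<Sum>g\<in>{1..N\<^sup>2}. real (multiplicity p g)) * ln (real p) \<le> (real N)\<^sup>2 / (real p - 1) * ln (real p)"
      using p2 by (intro mult_right_mono) auto
    then show "(\<Sum>g\<in>{1..N\<^sup>2}. real (multiplicity p g)) * ln (real p) \<le> (real N)\<^sup>2 * (ln (real p) / (real p - 1))"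
      by simp
  qed
  also have "\<dots> = (real N)\<^sup>2 * (\<Sum>p\<in>primes_le Y. ln (real p) / (real p - 1))" by (simp add: sum_distrib_left)
  also have "\<dots> \<le> (real N)\<^sup>2 * (ln (real Y) + 4)"
  proof (rule mult_left_mono)
    have "ln 4 = 2 * ln (2::real)" using ln_realpow[of 2 2] by simp
    then have "ln (4::real) \<le> 2" using ln_2_less_1 by simp
    then show "(\<Sum>p\<in>primes_le Y. ln (real p) / (real p - 1)) \<le> ln (real Y) + 4"
      using sum_ln_div_prime_minus_one[of Y] sum_ln_div_prime_upper[OF Y] by linarith
  qed auto
  finally have "real (card ?G1) \<le> (real N)\<^sup>2 * (ln (real Y) + 4) / ln (real N)"
    using lnN by (simp add: field_simps)
  then show ?thesis using 1 by linarith
qed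

lemma card_multiples_le:
  assumes "d \<ge> 1" shows "real (card {g\<in>{1..X}. d dvd g}) \<le> real X / real d"
proof -
  have "{g\<in>{1..X}. d dvd g} \<subseteq> (\<lambda>h. d * h) ` {1..X div d}"
  proof
    fix g assume g: "g \<in> {g\<in>{1..X}. d dvd g}"
    then obtain h where h: "g = d * h" by blast
    then have "h \<in> {1..X div d}" using g assms
      by (cases h) (auto simp: less_eq_div_iff_mult_less_eq mult.commute)
    then show "g \<in> (\<lambda>h. d * h) ` {1..X div d}" using h by blast
  qed
  then have "card {g\<in>{1..X}. d dvd g} \<le> card ((\<lambda>h. d * h) ` {1..X div d})" by (intro card_mono) auto
  also have "\<dots> \<le> X div d" using card_image_le[of "{1..X div d}"] by simp
  finally have "real (card {g\<in>{1..X}. d dvd g}) \<le> real (X div d)" by simp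
  also have "\<dots> \<le> real X / real d" by (rule of_nat_div_le_of_nat)
  finally show ?thesis .
qed

lemma sum_inverse_squares_tail_le:
  assumes "a \<ge> 2" shows "(\<Sum>j\<in>{a..b}. 1 / (real j)\<^sup>2) \<le> 2 / real a"
proof -
  have "(\<Sum>j\<in>{a..b}. 1 / (real j)\<^sup>2) \<le> 1 / (real a - 1) - 1 / real b" if "a \<le> b"
    using that
  proof (induction b rule: dec_induct)
    case base
    have "1 / (real a)\<^sup>2 + 1 / real a \<le> 1 / (real a - 1)"
      using assms by (simp add: field_simps power2_eq_square)
    then show ?case by simp
  next
    case (step n)
    have "1 / (real (Suc n))\<^sup>2 \<le> 1 / (real n * real (Suc n))"
      using step assms by (intro divide_left_mono) (auto simp: power2_eq_square)
    also have "\<dots> = 1 / real n - 1 / real (Suc n)" using step assms by (simp add: field_simps)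
    finally show ?case using step by simp
  qed
  note tele = this
  have "1 / (real a - 1) \<le> 2 / real a" using assms by (simp add: field_simps)
  then show ?thesis
  proof (cases "a \<le> b")
    case True
    have "(0::real) \<le> 1 / real b" by simp
    with tele[OF True] \<open>1 / (real a - 1) \<le> 2 / real a\<close> show ?thesis by linarith
  qed auto
qed

text \<open>A number with two prime factors of comparable size, both large, is rare: the block from
  \<open>512^j\<close> contributes a density of order \<open>1 / j^2\<close>.\<close>

lemma card_primes_close_le:
  assumes J0: "J0 \<ge> 3"
  defines "Bl \<equiv> \<lambda>j. prime_block (512 ^ j) (512 ^ (j + 1))"
    and "Bl' \<equiv> \<lambda>j. prime_block (512 ^ (j - 2)) (512 ^ (j + 1))"
  shows "real (card (\<Union>j\<in>{J0..J1}. \<Union>q\<in>Bl j. \<Union>r\<in>Bl' j. {g\<in>{1..X}. q * r dvd g})) \<le> real X * (6 * 512 ^ 4 / real J0)"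
proof -
  let ?M = "\<lambda>q r. {g\<in>{1..X}. q * r dvd g}"
  have pos: "p \<ge> 1" if "p \<in> prime_block a b" for p a b using that by (auto simp: prime_block_def prime_ge_1_nat)
  have l2: "ln (512::real) = 9 * ln 2" using ln_realpow[of 2 9] by simp
  have l4: "ln (4::real) = 2 * ln 2" using ln_realpow[of 2 2] by simp
  have ln2: "ln (2::real) > 0" by simp
  have b1: "(\<Sum>q\<in>Bl j. 1 / real q) \<le> 512 / real j" if j: "j \<ge> 3" for j
  proof -
    have "(\<Sum>q\<in>Bl j. 1 / real q) * (real (512 ^ j) * ln (real (512 ^ j))) \<le> real (512 ^ (j + 1)) * ln 4"
      unfolding Bl_def by (rule sum_inverse_prime_block_le) simp
    then have "512 ^ j * ((\<Sum>q\<in>Bl j. 1 / real q) * (real j * (9 * ln 2))) \<le> 512 ^ j * (512 * (2 * ln 2))"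
      by (simp add: ln_realpow l2 l4 mult_ac)
    then have "(\<Sum>q\<in>Bl j. 1 / real q) * (real j * (9 * ln 2)) \<le> 512 * (2 * ln 2)" by simp
    then have "((\<Sum>q\<in>Bl j. 1 / real q) * real j * 9) * ln 2 \<le> (512 * 2) * ln 2" by (simp add: mult_ac)
    then have "(\<Sum>q\<in>Bl j. 1 / real q) * real j * 9 \<le> 512 * 2" using ln2 by (rule mult_right_le_imp_le)
    then show ?thesis using j by (simp add: field_simps)
  qed
  have b2: "(\<Sum>q\<in>Bl' j. 1 / real q) \<le> 3 * 512 ^ 3 / real j" if j: "j \<ge> 3" for j
  proof -
    define i where "i = j - 2"
    have i: "i \<ge> 1" "j - 2 = i" "j + 1 = i + 3" "real j \<le> real i * 3" using j by (auto simp: i_def)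
    have "(\<Sum>q\<in>Bl' j. 1 / real q) * (real (512 ^ i) * ln (real (512 ^ i))) \<le> real (512 ^ (i + 3)) * ln 4"
      unfolding Bl'_def i by (rule sum_inverse_prime_block_le) simp
    then have "512 ^ i * ((\<Sum>q\<in>Bl' j. 1 / real q) * (real i * (9 * ln 2))) \<le> 512 ^ i * (512 ^ 3 * (2 * ln 2))"
      by (simp add: ln_realpow l2 l4 mult_ac power_add)
    then have "(\<Sum>q\<in>Bl' j. 1 / real q) * (real i * (9 * ln 2)) \<le> 512 ^ 3 * (2 * ln 2)" by simp
    then have "((\<Sum>q\<in>Bl' j. 1 / real q) * real i * 9) * ln 2 \<le> (512 ^ 3 * 2) * ln 2" by (simp add: mult_ac)
    then have "(\<Sum>q\<in>Bl' j. 1 / real q) * real i * 9 \<le> 512 ^ 3 * 2" using ln2 by (rule mult_right_le_imp_le)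
    moreover have "(\<Sum>q\<in>Bl' j. 1 / real q) * real j \<le> (\<Sum>q\<in>Bl' j. 1 / real q) * (real i * 3)"
      using i by (intro mult_left_mono sum_nonneg) auto
    ultimately have "(\<Sum>q\<in>Bl' j. 1 / real q) * real j \<le> 3 * 512 ^ 3" by simp
    then show ?thesis using j by (simp add: field_simps)
  qed
  have "real (card (\<Union>j\<in>{J0..J1}. \<Union>q\<in>Bl j. \<Union>r\<in>Bl' j. ?M q r))
     \<le> (\<Sum>j\<in>{J0..J1}. \<Sum>q\<in>Bl j. \<Sum>r\<in>Bl' j. real (card (?M q r)))"
  proof -
    have "card (\<Union>j\<in>{J0..J1}. \<Union>q\<in>Bl j. \<Union>r\<in>Bl' j. ?M q r) \<le> (\<Sum>j\<in>{J0..J1}. card (\<Union>q\<in>Bl j. \<Union>r\<in>Bl' j. ?M q r))"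
      by (rule card_UN_le) simp
    also have "\<dots> \<le> (\<Sum>j\<in>{J0..J1}. \<Sum>q\<in>Bl j. card (\<Union>r\<in>Bl' j. ?M q r))"
      by (intro sum_mono card_UN_le) (simp add: Bl_def)
    also have "\<dots> \<le> (\<Sum>j\<in>{J0..J1}. \<Sum>q\<in>Bl j. \<Sum>r\<in>Bl' j. card (?M q r))"
      by (intro sum_mono card_UN_le) (simp add: Bl'_def)
    finally show ?thesis by (simp flip: of_nat_sum)
  qed
  also have "\<dots> \<le> (\<Sum>j\<in>{J0..J1}. \<Sum>q\<in>Bl j. \<Sum>r\<in>Bl' j. real X * ((1 / real q) * (1 / real r)))"
  proof (intro sum_mono)
    fix j q r assume "q \<in> Bl j" "r \<in> Bl' j"
    then have "q * r \<ge> 1" using pos[of q] pos[of r] unfolding Bl_def Bl'_def by (simp add: Suc_le_eq)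
    from card_multiples_le[OF this, of X]
    show "real (card (?M q r)) \<le> real X * ((1 / real q) * (1 / real r))" by simp
  qed
  also have "\<dots> = (\<Sum>j\<in>{J0..J1}. real X * ((\<Sum>q\<in>Bl j. 1 / real q) * (\<Sum>r\<in>Bl' j. 1 / real r)))"
    unfolding sum_product by (simp only: sum_distrib_left)
  also have "\<dots> \<le> (\<Sum>j\<in>{J0..J1}. real X * (512 / real j * (3 * 512 ^ 3 / real j)))"
    using b1 b2 J0 by (intro sum_mono mult_left_mono mult_mono) (auto intro!: sum_nonneg)
  also have "\<dots> = real X * (3 * 512 ^ 4) * (\<Sum>j\<in>{J0..J1}. 1 / (real j)\<^sup>2)"
    unfolding sum_distrib_left by (intro sum.cong refl) (simp add: power2_eq_square)
  also have "\<dots> \<le> real X * (3 * 512 ^ 4) * (2 / real J0)"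
    using J0 by (intro mult_left_mono sum_inverse_squares_tail_le) auto
  also have "\<dots> = real X * (6 * 512 ^ 4 / real J0)" by simp
  finally show ?thesis .
qed

section \<open>Shrinking the support of a weight\<close>

lemma conv_energy_scale: "conv_energy N (\<lambda>x. a * f x) (\<lambda>x. a * f x) = a ^ 4 * conv_energy N f f"
proof -
  have "dconv N (\<lambda>x. a * f x) (\<lambda>x. a * f x) n = a\<^sup>2 * dconv N f f n" for n
    unfolding dconv_def sum_distrib_left by (intro sum.cong refl) (auto simp: power2_eq_square)
  then show ?thesis
    unfolding conv_energy_def sum_distrib_left by (simp add: power_mult_distrib flip: power_mult)
qed

lemma nat_between_powers:
  assumes "512 ^ J0 < (q::nat)"
  shows "\<exists>j\<ge>J0. 512 ^ j < q \<and> q \<le> 512 ^ (j + 1)"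
proof -
  have "q \<le> 512 ^ q" by (simp add: less_imp_le self_le_power power_gt_expt)
  then have ex: "q \<le> 512 ^ (q + 1)" by (rule le_trans) (rule power_increasing, auto)
  define j where "j = (LEAST j. q \<le> 512 ^ (j + 1))"
  have j1: "q \<le> 512 ^ (j + 1)" unfolding j_def by (rule LeastI[of _ q]) (rule ex)
  have j2: "512 ^ j < q"
  proof (cases j)
    case 0
    have "(1::nat) \<le> 512 ^ J0" by simp
    then have "1 < q" using assms by (rule le_less_trans)
    then show ?thesis using 0 by simp
  next
    case (Suc i)
    then have "\<not> q \<le> 512 ^ (i + 1)" using not_less_Least[of i "\<lambda>j. q \<le> 512 ^ (j + 1)"] by (simp add: j_def)
    then show ?thesis using Suc by simp
  qed
  have "J0 \<le> j"
  proof (rule ccontr)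
    assume "\<not> J0 \<le> j"
    then have "(512::nat) ^ (j + 1) \<le> 512 ^ J0" by (intro power_increasing) auto
    then show False using j1 assms by simp
  qed
  then show ?thesis using j1 j2 by blast
qed

text \<open>The block of replacements for the primes in \<open>(512^j, 512^(j+1)]\<close> lies two blocks
  lower; so the new prime is smaller by a factor of at least 512, and the numbers of primes in
  both blocks are comparable.\<close>

lemma card_block_ratio:
  assumes "j \<ge> 3"
  shows "real (card (prime_block (512 ^ j) (512 ^ (j + 1)))) \<le> 2 * 512 ^ 3 * real (card (prime_block (512 ^ (j - 2)) (512 ^ (j - 1))))"
    and "prime_block (512 ^ (j - 2)) (512 ^ (j - 1)) \<noteq> {}"
proof -
  define i where "i = j - 2"
  have i: "j = i + 2" "j - 2 = i" "j - 1 = i + 1" "i \<ge> 1" using assms by (auto simp: i_def)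
  let ?B = "prime_block (512 ^ j) (512 ^ (j + 1))" and ?K = "prime_block (512 ^ i) (512 ^ (i + 1))"
  have l: "ln (real (512 ^ m)) = real m * ln 512" for m by (simp add: ln_realpow)
  have l5: "ln (512::real) > 0" by simp
  have l512: "ln (512::real) = 9 * ln 2" using ln_realpow[of 2 9] by simp
  have l4: "ln (4::real) = 2 * ln 2" using ln_realpow[of 2 2] by simp
  have "real (512 ^ (i + 1)) / (512 * ln (real (512 ^ (i + 1)))) \<le> real (card {p::nat. prime p \<and> 512 ^ (i + 1) div 512 < p \<and> p \<le> 512 ^ (i + 1)})"
    by (rule card_primes_between_ge) simp
  also have "{p::nat. prime p \<and> 512 ^ (i + 1) div 512 < p \<and> p \<le> 512 ^ (i + 1)} = ?K" unfolding prime_block_def by simp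
  finally have "512 ^ i / (real (i + 1) * ln 512) \<le> real (card ?K)" unfolding l by simp
  moreover have "real (i + 1) * ln 512 > 0" using l5 by simp
  ultimately have K: "512 ^ i \<le> real (card ?K) * (real (i + 1) * ln 512)" by (simp only: pos_divide_le_eq)
  have "real (card ?B) * (real j * ln 512) \<le> real (512 ^ (j + 1)) * ln 4"
    using card_prime_block_le[of "512 ^ j" "512 ^ (j + 1)"] unfolding l by simp
  also have "\<dots> = 512 ^ 3 * ln 4 * 512 ^ i" by (simp add: i(1) power_add)
  also have "\<dots> \<le> 512 ^ 3 * ln 4 * (real (card ?K) * (real (i + 1) * ln 512))"
    using K by (intro mult_left_mono) auto
  also have "\<dots> \<le> 512 ^ 3 * 2 * (real (card ?K) * (real j * ln 512))"
    using ln_2_less_1 l4 l5 i(1) by (intro mult_mono) auto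
  finally have "real (card ?B) * (real j * ln 512) \<le> (2 * 512 ^ 3 * real (card ?K)) * (real j * ln 512)"
    by (simp add: mult_ac)
  moreover have "real j * ln 512 > 0" using assms l5 by simp
  ultimately show "real (card (prime_block (512 ^ j) (512 ^ (j + 1)))) \<le> 2 * 512 ^ 3 * real (card (prime_block (512 ^ (j - 2)) (512 ^ (j - 1))))"
    unfolding i(2,3) by (rule mult_right_le_imp_le)
  show "prime_block (512 ^ (j - 2)) (512 ^ (j - 1)) \<noteq> {}"
  proof
    assume "prime_block (512 ^ (j - 2)) (512 ^ (j - 1)) = {}"
    then have "512 ^ i \<le> (0::real)" using K unfolding i(2,3) by simp
    moreover have "(0::real) < 512 ^ i" by simp
    ultimately show False by linarith
  qed
qed

text \<open>The smoothness bound \<open>512^(j-2)\<close> is the lower end of the block of primes that will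
  replace \<open>q\<close>.\<close>

definition splits_at :: "nat \<Rightarrow> nat \<Rightarrow> nat \<Rightarrow> nat \<Rightarrow> nat \<Rightarrow> bool" where
  "splits_at J0 j q m n \<longleftrightarrow> J0 \<le> j \<and> n = q * m \<and> 1 \<le> m \<and> q \<in> prime_block (512 ^ j) (512 ^ (j + 1)) \<and> smooth (512 ^ (j - 2)) m"

text \<open>The largest prime factor is the only candidate for \<open>q\<close>. If it fails, it is small,
  or it has a companion in one of the neighbouring blocks.\<close>

lemma not_splits_at_imp:
  assumes J0: "J0 \<ge> 3" and n: "1 \<le> n" "n \<le> N" and no: "\<And>j q m. \<not> splits_at J0 j q m n"
  shows "smooth (512 ^ J0) n \<or> (\<exists>j\<in>{J0..N}. \<exists>q\<in>prime_block (512 ^ j) (512 ^ (j + 1)).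
      \<exists>r\<in>prime_block (512 ^ (j - 2)) (512 ^ (j + 1)). q * r dvd n)"
proof (cases "smooth (512 ^ J0) n")
  case False
  then obtain q0 where q0: "prime q0" "q0 dvd n" "512 ^ J0 < q0" unfolding smooth_def by auto
  define q where "q = Max (prime_factors n)"
  have ne: "prime_factors n \<noteq> {}" using q0 n by (auto simp: prime_factors_dvd)
  have qn: "q \<in> prime_factors n" unfolding q_def using ne by (intro Max_in) auto
  then have q: "prime q" "q dvd n" by auto
  have qmax: "r \<le> q" if "prime r" "r dvd n" for r
    unfolding q_def using that n by (intro Max_ge) (auto simp: prime_factors_dvd)
  have "512 ^ J0 < q" using qmax[OF q0(1,2)] q0(3) by linarith
  then obtain j where j: "j \<ge> J0" "512 ^ j < q" "q \<le> 512 ^ (j + 1)" using nat_between_powers by blast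
  have qB: "q \<in> prime_block (512 ^ j) (512 ^ (j + 1))" using q j by (simp add: prime_block_def)
  obtain m where m: "n = q * m" using q by blast
  have m1: "1 \<le> m" using m n by (cases m) auto
  have "\<not> smooth (512 ^ (j - 2)) m"
    using no[of j q m] j m m1 qB unfolding splits_at_def by blast
  then obtain r where r: "prime r" "r dvd m" "512 ^ (j - 2) < r" unfolding smooth_def by auto
  have "r \<le> q" using qmax[of r] r m by simp
  then have rB: "r \<in> prime_block (512 ^ (j - 2)) (512 ^ (j + 1))" using r j by (simp add: prime_block_def)
  have "q * r dvd n" using m r by (simp add: mult_dvd_mono)
  moreover have "j \<le> N"
  proof -
    have "j < 512 ^ j" by (rule power_gt_expt) simp
    also have "\<dots> < q" by (rule j)
    also have "q \<le> n" using q n by (intro dvd_imp_le) auto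
    finally show ?thesis using n by simp
  qed
  ultimately show ?thesis using j qB rB by (meson atLeastAtMost_iff)
qed simp

lemma splits_at_unique:
  assumes "splits_at J0 i q m n" "splits_at J0 j q' m' n"
  shows "q = q'"
proof (rule ccontr)
  assume ne: "q \<noteq> q'"
  have a: "n = q * m" "prime q" "512 ^ i < q" "smooth (512 ^ (i - 2)) m"
    using assms(1) by (auto simp: splits_at_def prime_block_def)
  have b: "n = q' * m'" "prime q'" "512 ^ j < q'" "smooth (512 ^ (j - 2)) m'"
    using assms(2) by (auto simp: splits_at_def prime_block_def)
  have "q dvd q' * m'" using a b by (metis dvd_triv_left)
  then have "q dvd m'" using a b ne by (metis prime_dvd_mult_iff primes_dvd_imp_eq)
  then have 1: "q \<le> 512 ^ (j - 2)" using a b by (simp add: smooth_def)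
  have "q' dvd q * m" using a b by (metis dvd_triv_left)
  then have "q' dvd m" using a b ne by (metis prime_dvd_mult_iff primes_dvd_imp_eq)
  then have 2: "q' \<le> 512 ^ (i - 2)" using a b by (simp add: smooth_def)
  have "(512::nat) ^ (j - 2) \<le> 512 ^ j" "(512::nat) ^ (i - 2) \<le> 512 ^ i" by (auto intro: power_increasing)
  then show False using 1 2 a b by linarith
qed

text \<open>Apply the replacement to the part of \<open>c\<close> on integers with a dominating prime factor
  and renormalise; by assumption this part has mass at least \<open>1/2\<close>, which costs the
  factor \<open>2^4\<close>.\<close>

lemma energy_shrink_core:
  assumes J0: "J0 \<ge> 3" and c: "\<And>n. c n \<ge> 0" and mass: "(\<Sum>n = 1..N. c n) = 1"
    and bad: "(\<Sum>n\<in>{n\<in>{1..N}. \<forall>j q m. \<not> splits_at J0 j q m n}. c n) \<le> 1 / 2"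
  shows "\<exists>c'. (\<forall>n. c' n \<ge> 0) \<and> (\<Sum>n = 1..N. c' n) = 1 \<and> (\<forall>h. c' h \<noteq> 0 \<longrightarrow> 1 \<le> h \<and> 512 * h \<le> N) \<and>
    conv_energy N c' c' \<le> 16 * (64 * (2 * 512 ^ 3)\<^sup>2) * conv_energy N c c"
proof -
  define J where "J = {J0..N}"
  define Bl where "Bl = (\<lambda>j. prime_block (512 ^ j) (512 ^ (j + 1)))"
  define K where "K = (\<lambda>j. prime_block (512 ^ (j - 2)) (512 ^ (j - 1)))"
  define U where "U = (\<lambda>j::nat. (512::nat) ^ (j - 2))"
  define A where "A = (\<lambda>q m. if q * m \<le> N \<and> (\<exists>j. splits_at J0 j q m (q * m)) then c (q * m) else 0)"
  define b where "b = (\<lambda>j m. \<Sum>q\<in>Bl j. A q m)"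
  define d where "d = (\<lambda>h. \<Sum>j\<in>J. dilate_average N (K j) (b j) h)"
  have j3: "j \<ge> 3" if "j \<in> J" for j using that J0 by (auto simp: J_def)
  have blocks: "i = j" if "q \<in> Bl i" "q \<in> Bl j" for q i j
  proof (rule ccontr)
    assume "i \<noteq> j"
    then have "(512::nat) ^ (i + 1) \<le> 512 ^ j \<or> (512::nat) ^ (j + 1) \<le> 512 ^ i"
    proof (cases "i < j")
      case True
      then have "(512::nat) ^ (i + 1) \<le> 512 ^ j" by (intro power_increasing) auto
      then show ?thesis by blast
    next
      case False
      then have "(512::nat) ^ (j + 1) \<le> 512 ^ i" using \<open>i \<noteq> j\<close> by (intro power_increasing) auto
      then show ?thesis by blast
    qed
    then show False using that by (auto simp: Bl_def prime_block_def)
  qed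
  have A0: "A q m \<ge> 0" for q m unfolding A_def using c by simp
  have AD: "q * m \<le> N \<and> splits_at J0 j q m (q * m) \<and> A q m = c (q * m)" if nz: "A q m \<noteq> 0" and q: "q \<in> Bl j" for q m j
  proof -
    have *: "q * m \<le> N \<and> (\<exists>j. splits_at J0 j q m (q * m))" using nz unfolding A_def by presburger
    then obtain i where i: "splits_at J0 i q m (q * m)" by blast
    then have "i = j" using blocks[of q i j] q by (auto simp: splits_at_def Bl_def)
    then show ?thesis using * i unfolding A_def by auto
  qed
  have b0: "b j m \<ge> 0" for j m unfolding b_def using A0 by (intro sum_nonneg) auto
  have fK: "finite (K j)" "K j \<noteq> {}" if "j \<in> J" for j
    using card_block_ratio(2)[OF j3[OF that]] by (auto simp: K_def)
  have kq: "512 * k \<le> q" if "q \<in> Bl j" "k \<in> K j" "j \<in> J" for q k j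
  proof -
    have "512 * k \<le> 512 * 512 ^ (j - 1)" using that by (simp add: K_def prime_block_def)
    also have "\<dots> = 512 ^ Suc (j - 1)" by simp
    also have "Suc (j - 1) = j" using j3[OF that(3)] by simp
    finally show ?thesis using that by (simp add: Bl_def prime_block_def)
  qed
  have energy: "conv_energy N d d \<le> 64 * (2 * 512 ^ 3)\<^sup>2 * conv_energy N c c"
    unfolding d_def b_def
  proof (rule prime_replacement_energy[where U = U])
    show "finite J" by (simp add: J_def)
    show "finite (Bl j)" for j by (simp add: Bl_def)
    show "finite (K j) \<and> K j \<noteq> {}" if "j \<in> J" for j using fK[OF that] by simp
    show "Bl i \<inter> Bl j = {}" if "i \<noteq> j" for i j using blocks that by blast
    show "1 \<le> m \<and> q * m \<le> N \<and> A q m \<le> c (q * m)" if "q \<in> Bl j" "A q m \<noteq> 0" for j q m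
      using AD[OF that(2,1)] by (auto simp: splits_at_def)
    show "r \<le> U j" if "q \<in> Bl j" "A q m \<noteq> 0" "prime r" "r dvd m" for j q m r
      using AD[OF that(2,1)] that by (auto simp: splits_at_def smooth_def U_def)
    show "q = q'" if "q \<in> Bl i" "q' \<in> Bl j" "A q m \<noteq> 0" "A q' m' \<noteq> 0" "q * m = q' * m'" for i j q q' m m'
      using splits_at_unique[of J0 i q m "q * m" j q' m'] AD[OF that(3,1)] AD[OF that(4,2)] that(5) by simp
    show "prime k \<and> U j < k" if "k \<in> K j" for j k using that by (simp add: K_def U_def prime_block_def)
    show "k \<le> U j" if "i < j" "k \<in> K i" for i j k
    proof -
      have "k \<le> 512 ^ (i - 1)" using that by (simp add: K_def prime_block_def)
      also have "\<dots> \<le> 512 ^ (j - 2)" using that by (intro power_increasing) auto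
      finally show ?thesis by (simp add: U_def)
    qed
    show "U i \<le> U j" if "i \<le> j" for i j using that by (simp add: U_def power_increasing)
    show "k \<le> q" if "j \<in> J" "q \<in> Bl j" "k \<in> K j" for j q k using kq[OF that(2,3,1)] by linarith
    show "real (card (Bl j)) \<le> 2 * 512 ^ 3 * real (card (K j))" if "j \<in> J" for j
      using card_block_ratio(1)[OF j3[OF that]] by (simp add: Bl_def K_def)
  qed (use c A0 in auto)
  have d0: "d h \<ge> 0" for h unfolding d_def by (intro sum_nonneg dilate_average_nonneg b0)
  have bD: "\<exists>q\<in>Bl j. A q m \<noteq> 0" if "b j m \<noteq> 0" for j m
    using that unfolding b_def by (meson sum.not_neutral_contains_not_neutral)
  have km: "1 \<le> k * m \<and> 512 * (k * m) \<le> N" if j: "j \<in> J" and k: "k \<in> K j" and bm: "b j m \<noteq> 0" for j k m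
  proof -
    obtain q where q: "q \<in> Bl j" "A q m \<noteq> 0" using bD[OF bm] by blast
    have "512 * k * m \<le> q * m" using kq[OF q(1) k j] by (rule mult_le_mono1)
    also have "\<dots> \<le> N" using AD[OF q(2,1)] by blast
    finally have "512 * (k * m) \<le> N" by (simp only: mult.assoc)
    moreover have "m \<ge> 1" using AD[OF q(2,1)] by (auto simp: splits_at_def)
    moreover have "k \<ge> 1" using k by (simp add: K_def prime_block_def Suc_le_eq prime_gt_0_nat)
    ultimately show ?thesis by (simp add: Suc_le_eq)
  qed
  have supp: "1 \<le> h \<and> 512 * h \<le> N" if dh: "d h \<noteq> 0" for h
  proof -
    obtain j where j: "j \<in> J" "dilate_average N (K j) (b j) h \<noteq> 0"
      using dh unfolding d_def by (rule sum.not_neutral_contains_not_neutral)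
    then obtain k m where "k \<in> K j" "h = k * m" "b j m \<noteq> 0"
      using dilate_average_nonzeroD by metis
    then show ?thesis using km[OF j(1)] by blast
  qed
  define \<mu> where "\<mu> = (\<Sum>h = 1..N. d h)"
  have \<mu>: "\<mu> = (\<Sum>j\<in>J. \<Sum>q\<in>Bl j. \<Sum>m = 1..N. A q m)"
  proof -
    have "\<mu> = (\<Sum>j\<in>J. \<Sum>h = 1..N. dilate_average N (K j) (b j) h)"
      unfolding \<mu>_def d_def by (rule sum.swap)
    also have "\<dots> = (\<Sum>j\<in>J. \<Sum>q\<in>Bl j. \<Sum>m = 1..N. A q m)"
    proof (rule sum.cong[OF refl])
      fix j assume j: "j \<in> J"
      have c0: "real (card (K j)) > 0" using fK[OF j] by (simp add: card_gt_0_iff)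
      have "(\<Sum>h = 1..N. dilate_average N (K j) (b j) h)
         = (\<Sum>k\<in>K j. \<Sum>m = 1..N. \<Sum>h = 1..N. if k * m = h then b j m / real (card (K j)) else 0)"
        unfolding dilate_average_def
        by (rule trans[OF sum.swap], rule sum.cong[OF refl], rule sum.swap)
      also have "\<dots> = (\<Sum>k\<in>K j. \<Sum>m = 1..N. b j m / real (card (K j)))"
      proof (intro sum.cong refl)
        fix k m assume k: "k \<in> K j"
        have "k * m \<in> {1..N} \<or> b j m = 0" using km[OF j k, of m] by auto
        then show "(\<Sum>h = 1..N. if k * m = h then b j m / real (card (K j)) else 0) = b j m / real (card (K j))"
          by (subst sum.delta') auto
      qed
      also have "\<dots> = (\<Sum>m = 1..N. b j m)" using c0 by (simp flip: sum_divide_distrib)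
      also have "\<dots> = (\<Sum>q\<in>Bl j. \<Sum>m = 1..N. A q m)" unfolding b_def by (rule sum.swap)
      finally show "(\<Sum>h = 1..N. dilate_average N (K j) (b j) h) = (\<Sum>q\<in>Bl j. \<Sum>m = 1..N. A q m)" .
    qed
    finally show ?thesis .
  qed
  have good: "(\<Sum>n\<in>{n\<in>{1..N}. \<exists>j q m. splits_at J0 j q m n}. c n) \<le> \<mu>"
  proof -
    let ?G = "{n\<in>{1..N}. \<exists>j q m. splits_at J0 j q m n}"
    let ?T = "Sigma J (\<lambda>j. Bl j \<times> {1..N})"
    let ?f = "\<lambda>t. fst (snd t) * snd (snd t)"
    have "\<exists>t. t \<in> ?T \<and> splits_at J0 (fst t) (fst (snd t)) (snd (snd t)) n" if n: "n \<in> ?G" for n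
    proof -
      obtain j q m where s: "splits_at J0 j q m n" using n by blast
      have sd: "J0 \<le> j" "n = q * m" "1 \<le> m" "q \<in> Bl j" using s by (auto simp: splits_at_def Bl_def)
      have jq: "512 ^ j < q" using sd(4) by (simp add: Bl_def prime_block_def)
      have jj: "j < 512 ^ j" by (rule power_gt_expt) simp
      have qn: "q \<le> n" unfolding sd(2) using sd(3) by (cases m) auto
      have mn: "m \<le> n" unfolding sd(2) using jq by (cases q) auto
      have "n \<le> N" using n by simp
      then have "j \<in> J" "m \<in> {1..N}" using jq jj qn mn sd(1,3) by (auto simp: J_def)
      then show ?thesis using s sd by (intro exI[of _ "(j, q, m)"]) simp
    qed
    then have "\<forall>n\<in>?G. \<exists>t. t \<in> ?T \<and> splits_at J0 (fst t) (fst (snd t)) (snd (snd t)) n" by blast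
    from bchoice[OF this] obtain g
      where g: "\<And>n. n \<in> ?G \<Longrightarrow> g n \<in> ?T \<and> splits_at J0 (fst (g n)) (fst (snd (g n))) (snd (snd (g n))) n"
      by blast
    have fg: "?f (g n) = n" if "n \<in> ?G" for n using g[OF that] by (auto simp: splits_at_def)
    have inj: "inj_on g ?G" by (rule inj_on_inverseI[of _ ?f]) (rule fg)
    have "(\<Sum>n\<in>?G. c n) = (\<Sum>n\<in>?G. A (fst (snd (g n))) (snd (snd (g n))))"
    proof (intro sum.cong refl)
      fix n assume n: "n \<in> ?G"
      then show "c n = A (fst (snd (g n))) (snd (snd (g n)))"
        using g[OF n] fg[OF n] unfolding A_def by auto
    qed
    also have "\<dots> = (\<Sum>t\<in>g ` ?G. A (fst (snd t)) (snd (snd t)))" by (rule sum.reindex[OF inj, unfolded o_def, symmetric])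
    also have "\<dots> \<le> (\<Sum>t\<in>?T. A (fst (snd t)) (snd (snd t)))"
    proof (rule sum_mono2)
      show "finite ?T" by (intro finite_SigmaI) (auto simp: J_def Bl_def)
      show "g ` ?G \<subseteq> ?T" using g by blast
    qed (rule A0)
    also have "\<dots> = (\<Sum>j\<in>J. \<Sum>w\<in>Bl j \<times> {1..N}. A (fst w) (snd w))"
      by (subst sum.Sigma) (auto simp: J_def Bl_def case_prod_beta)
    also have "\<dots> = \<mu>" unfolding \<mu> by (simp add: sum.cartesian_product case_prod_beta)
    finally show ?thesis .
  qed
  have "(\<Sum>n = 1..N. c n) = (\<Sum>n\<in>{n\<in>{1..N}. \<exists>j q m. splits_at J0 j q m n}. c n)
      + (\<Sum>n\<in>{n\<in>{1..N}. \<forall>j q m. \<not> splits_at J0 j q m n}. c n)"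
    by (subst sum.union_disjoint[symmetric]) (auto intro!: sum.cong)
  then have \<mu>2: "\<mu> \<ge> 1 / 2" using good bad mass by linarith
  define c' where "c' = (\<lambda>h. (1 / \<mu>) * d h)"
  have "conv_energy N c' c' = (1 / \<mu>) ^ 4 * conv_energy N d d" unfolding c'_def by (rule conv_energy_scale)
  also have "\<dots> \<le> 2 ^ 4 * (64 * (2 * 512 ^ 3)\<^sup>2 * conv_energy N c c)"
    using \<mu>2 energy by (intro mult_mono power_mono conv_energy_nonneg) (auto simp: field_simps)
  finally have "conv_energy N c' c' \<le> 16 * (64 * (2 * 512 ^ 3)\<^sup>2) * conv_energy N c c" by simp
  moreover have "(\<Sum>h = 1..N. c' h) = 1" unfolding c'_def using \<mu>2 by (simp add: \<mu>_def flip: sum_divide_distrib)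
  moreover have "c' h \<ge> 0" for h unfolding c'_def using d0 \<mu>2 by simp
  moreover have "1 \<le> h \<and> 512 * h \<le> N" if "c' h \<noteq> 0" for h using supp[of h] that by (simp add: c'_def)
  ultimately show ?thesis by blast
qed

text \<open>The threshold \<open>512^J0\<close> with \<open>J0\<close> about \<open>sqrt (ln N)\<close>
  balances two densities of exceptional products: smooth numbers contribute \<open>J0 / ln
  N\<close>, close prime factors contribute \<open>1 / J0\<close>. Products of exceptional
  integers lie in the union, so small energy leaves little mass on them.\<close>

lemma energy_shrink:
  "\<exists>C \<eta> N0. C \<ge> 1 \<and> \<eta> > 0 \<and> (\<forall>N\<ge>N0. \<forall>c. (\<forall>n. c n \<ge> 0) \<longrightarrow> (\<Sum>n = 1..N. c n) = 1 \<longrightarrow>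
     weighted_energy N c \<le> \<eta> * sqrt (ln (real N)) \<longrightarrow>
     (\<exists>c'. (\<forall>n. c' n \<ge> 0) \<and> (\<Sum>n = 1..N. c' n) = 1 \<and> (\<forall>h. c' h \<noteq> 0 \<longrightarrow> 1 \<le> h \<and> 512 * h \<le> N) \<and>
       conv_energy N c' c' \<le> C * conv_energy N c c))"
proof -
  define C :: real where "C = 16 * (64 * (2 * 512 ^ 3)\<^sup>2)"
  \<comment> \<open>density of the exceptional products times sqrt (ln N); the 21 stands for the integers up to N and the smooth ones\<close>
  define C' :: real where "C' = 21 + 6 * 512 ^ 4"
  define \<eta> where "\<eta> = 1 / (16 * C')"
  have C'0: "C' > 0" by (simp add: C'_def)
  have "\<exists>N0::nat. \<forall>N\<ge>N0. sqrt (ln (real N)) \<ge> 3 \<and> real N \<ge> sqrt (ln (real N)) \<and> N \<ge> 2"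
  proof -
    have "eventually (\<lambda>N::nat. sqrt (ln (real N)) \<ge> 3) at_top" by real_asymp
    moreover have "eventually (\<lambda>N::nat. real N \<ge> sqrt (ln (real N))) at_top" by real_asymp
    moreover have "eventually (\<lambda>N::nat. N \<ge> 2) at_top" by (rule eventually_ge_at_top)
    ultimately have "eventually (\<lambda>N::nat. sqrt (ln (real N)) \<ge> 3 \<and> real N \<ge> sqrt (ln (real N)) \<and> N \<ge> 2) at_top"
      by eventually_elim auto
    then show ?thesis by (simp add: eventually_at_top_linorder)
  qed
  then obtain N0 :: nat where N0: "\<And>N. N \<ge> N0 \<Longrightarrow> sqrt (ln (real N)) \<ge> 3 \<and> real N \<ge> sqrt (ln (real N)) \<and> N \<ge> 2" by blast
  have main: "\<exists>c'. (\<forall>n. c' n \<ge> 0) \<and> (\<Sum>n = 1..N. c' n) = 1 \<and> (\<forall>h. c' h \<noteq> 0 \<longrightarrow> 1 \<le> h \<and> 512 * h \<le> N) \<and>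
       conv_energy N c' c' \<le> C * conv_energy N c c"
    if N: "N \<ge> N0" and c: "\<forall>n. c n \<ge> 0" and mass: "(\<Sum>n = 1..N. c n) = 1"
      and E: "weighted_energy N c \<le> \<eta> * sqrt (ln (real N))" for N c
  proof -
    define s where "s = sqrt (ln (real N))"
    have s: "s \<ge> 3" "real N \<ge> s" "N \<ge> 2" using N0[OF N] by (auto simp: s_def)
    have s2: "ln (real N) = s * s" using s(3) by (simp add: s_def)
    define J0 where "J0 = nat \<lceil>s\<rceil>"
    have J0: "real J0 \<ge> s" "real J0 \<le> s + 1" "J0 \<ge> 3" using s(1) unfolding J0_def by linarith+
    let ?Bad = "{n\<in>{1..N}. \<forall>j q m. \<not> splits_at J0 j q m n}"
    let ?G1 = "{g\<in>{1..N\<^sup>2}. smooth (512 ^ J0) g}"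
    let ?G2 = "\<Union>j\<in>{J0..N}. \<Union>q\<in>prime_block (512 ^ j) (512 ^ (j + 1)). \<Union>r\<in>prime_block (512 ^ (j - 2)) (512 ^ (j + 1)). {g\<in>{1..N\<^sup>2}. q * r dvd g}"
    have "(\<Sum>n\<in>?Bad. c n) ^ 4 \<le> real (card (?G1 \<union> ?G2)) * conv_energy N c c"
    proof (rule sum_squared_le_conv_energy)
      fix x y assume x: "x \<in> ?Bad" and y: "y \<in> ?Bad"
      have xy: "x * y \<in> {1..N\<^sup>2}"
        using x y mult_le_mono[of x N y N] by (auto simp: power2_eq_square Suc_le_eq)
      have sx: "smooth (512 ^ J0) x \<or> (\<exists>j\<in>{J0..N}. \<exists>q\<in>prime_block (512 ^ j) (512 ^ (j + 1)). \<exists>r\<in>prime_block (512 ^ (j - 2)) (512 ^ (j + 1)). q * r dvd x)"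
        using x by (intro not_splits_at_imp J0) auto
      have sy: "smooth (512 ^ J0) y \<or> (\<exists>j\<in>{J0..N}. \<exists>q\<in>prime_block (512 ^ j) (512 ^ (j + 1)). \<exists>r\<in>prime_block (512 ^ (j - 2)) (512 ^ (j + 1)). q * r dvd y)"
        using y by (intro not_splits_at_imp J0) auto
      show "x * y \<in> ?G1 \<union> ?G2"
      proof (cases "smooth (512 ^ J0) x \<and> smooth (512 ^ J0) y")
        case True
        then have "smooth (512 ^ J0) (x * y)" by (auto simp: smooth_def prime_dvd_mult_iff)
        then show ?thesis using xy by blast
      next
        case False
        then obtain j q r where jqr: "j \<in> {J0..N}" "q \<in> prime_block (512 ^ j) (512 ^ (j + 1))"
          "r \<in> prime_block (512 ^ (j - 2)) (512 ^ (j + 1))" "q * r dvd x \<or> q * r dvd y" using sx sy by blast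
        then have "q * r dvd x * y" by (meson dvd_mult dvd_mult2)
        then show ?thesis using xy jqr(1-3) by blast
      qed
    qed (use c in \<open>auto simp: prime_block_def\<close>)
    also have "real (card (?G1 \<union> ?G2)) \<le> (real N)\<^sup>2 * (C' / s)"
    proof -
      have "real (card (?G1 \<union> ?G2)) \<le> real (card ?G1) + real (card ?G2)"
        using card_Un_le[of ?G1 ?G2] by (simp flip: of_nat_add)
      also have "\<dots> \<le> (real N + (real N)\<^sup>2 * (ln (real (512 ^ J0)) + 4) / ln (real N)) + real (N\<^sup>2) * (6 * 512 ^ 4 / real J0)"
        using s by (intro add_mono card_smooth_le card_primes_close_le J0) auto
      also have "\<dots> = (real N)\<^sup>2 * (1 / real N + (ln (real (512 ^ J0)) + 4) / ln (real N) + 6 * 512 ^ 4 / real J0)"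
        using s by (simp add: algebra_simps power2_eq_square)
      also have "\<dots> \<le> (real N)\<^sup>2 * (1 / s + 20 / s + 6 * 512 ^ 4 / s)"
      proof (intro mult_left_mono add_mono)
        show "1 / real N \<le> 1 / s" using s by (intro divide_left_mono) auto
        show "6 * 512 ^ 4 / real J0 \<le> 6 * 512 ^ 4 / s" using s J0 by (intro divide_left_mono) auto
        have "ln (512::real) = 9 * ln 2" using ln_realpow[of 2 9] by simp
        then have "ln (512::real) \<le> 9" using ln_2_less_1 by simp
        then have "ln (real (512 ^ J0)) \<le> (s + 1) * 9"
        proof -
          have "ln (real (512 ^ J0)) = real J0 * ln 512" by (simp add: ln_realpow)
          also have "\<dots> \<le> (s + 1) * 9" using J0 s \<open>ln (512::real) \<le> 9\<close> by (intro mult_mono) auto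
          finally show ?thesis .
        qed
        also have "(s + 1) * 9 + 4 \<le> 20 * s" using s by simp
        finally have "ln (real (512 ^ J0)) + 4 \<le> 20 * s" by simp
        then have "(ln (real (512 ^ J0)) + 4) / ln (real N) \<le> 20 * s / (s * s)"
          unfolding s2 using s by (intro divide_right_mono) auto
        then show "(ln (real (512 ^ J0)) + 4) / ln (real N) \<le> 20 / s" using s by simp
      qed auto
      also have "\<dots> = (real N)\<^sup>2 * (C' / s)" by (simp add: C'_def add_divide_distrib)
      finally show ?thesis .
    qed
    also have "(real N)\<^sup>2 * (C' / s) * conv_energy N c c = C' / s * weighted_energy N c"
      by (simp add: weighted_energy_eq)
    also have "\<dots> \<le> C' / s * (\<eta> * s)" using E C'0 s unfolding s_def[symmetric] by (intro mult_left_mono) auto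
    also have "\<dots> = (1 / 2) ^ 4" using C'0 s by (simp add: \<eta>_def power_one_over)
    finally have "(\<Sum>n\<in>?Bad. c n) ^ 4 \<le> (1 / 2) ^ 4"
      using conv_energy_nonneg by (simp add: mult_right_mono)
    then have "(\<Sum>n\<in>?Bad. c n) \<le> 1 / 2"
      using power_strict_mono[of "1 / 2" "\<Sum>n\<in>?Bad. c n" 4] by fastforce
    then show ?thesis unfolding C_def using c mass by (intro energy_shrink_core[OF J0(3)]) auto
  qed
  have "C \<ge> 1" "\<eta> > 0" using C'0 by (auto simp: C_def \<eta>_def)
  then show ?thesis using main by blast
qed

section \<open>Sparse sets of primes\<close>

text \<open>If consecutive elements of a set of primes have this distance on the \<open>log log\<close>
  scale, then \<open>4^j\<close> is about the logarithm of the \<open>j\<close>-th element.\<close>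

definition unit_gap :: real where "unit_gap = 2 * ln 2"

lemma unit_gap_bounds: "126 / 100 \<le> unit_gap" "unit_gap \<le> 152 / 100"
  using ln2_bounds by (simp_all add: unit_gap_def)

text \<open>A version of \<open>log log n\<close>. The shift by 2 makes the steps slightly smaller than
  \<open>1 / p\<close>, which absorbs the growth of the simplex volume within a step when volumes
  are compared with sums over primes.\<close>

definition prime_clock :: "nat \<Rightarrow> real" where
  "prime_clock n = (\<Sum>p\<in>primes_le n. 1 / (real p + 2))"

text \<open>The \<open>j\<close>-th smallest element \<open>p\<close> of the set satisfies \<open>log log p
  \<ge> 2 j ln 2\<close>, approximately.\<close>

definition sparse_primes :: "nat set \<Rightarrow> bool" where
  "sparse_primes A \<longleftrightarrow> (\<forall>p\<in>A. real (card {q\<in>A. q \<le> p}) * unit_gap \<le> prime_clock p)"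

definition sparse_family :: "nat \<Rightarrow> nat \<Rightarrow> nat set set" where
  "sparse_family k n = {A. A \<subseteq> primes_le n \<and> card A = k \<and> sparse_primes A}"

definition sparse_volume :: "nat \<Rightarrow> nat \<Rightarrow> real" where
  "sparse_volume k n = (\<Sum>A\<in>sparse_family k n. 1 / real (\<Prod>A))"

text \<open>The volume of \<open>0 \<le> t_1 \<le> ... \<le> t_k \<le> x\<close> with \<open>t_j \<ge> j
  u\<close>, where \<open>u\<close> is the gap (an Abel polynomial), provided \<open>x \<ge> k
  u\<close>.\<close>

fun simplex_volume :: "nat \<Rightarrow> real \<Rightarrow> real" where
  "simplex_volume 0 x = 1"
| "simplex_volume (Suc k) x = x ^ k * (x - real (Suc k) * unit_gap) / fact (Suc k)"

lemma prime_clock_nonneg: "prime_clock n \<ge> 0"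
  unfolding prime_clock_def by (intro sum_nonneg) auto

lemma prime_clock_mono: "m \<le> n \<Longrightarrow> prime_clock m \<le> prime_clock n"
  unfolding prime_clock_def by (intro sum_mono2 primes_le_mono) auto

lemma prime_clock_Suc:
  "prime_clock (Suc n) = prime_clock n + (if prime (Suc n) then 1 / (real (Suc n) + 2) else 0)"
  unfolding prime_clock_def primes_le_Suc by (auto simp: primes_le_def)

lemma prime_recip_Suc:
  "prime_recip (Suc n) = prime_recip n + (if prime (Suc n) then 1 / real (Suc n) else 0)"
  unfolding prime_recip_def primes_le_Suc by (auto simp: primes_le_def)

lemma prime_clock_le: "prime_clock n \<le> prime_recip n"
  unfolding prime_clock_def prime_recip_def
  by (intro sum_mono divide_left_mono) (auto dest!: primes_leD)

lemma prime_recip_le_clock: "prime_recip n \<le> prime_clock n + 2"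
proof -
  have "prime_recip n - prime_clock n = (\<Sum>p\<in>primes_le n. 1 / real p - 1 / (real p + 2))"
    unfolding prime_recip_def prime_clock_def by (simp add: sum_subtractf)
  also have "\<dots> \<le> (\<Sum>p\<in>primes_le n. 2 * (1 / (real p)\<^sup>2))"
  proof (rule sum_mono)
    fix p assume "p \<in> primes_le n"
    then have p: "real p \<ge> 2" using primes_leD by fastforce
    then have "1 / real p - 1 / (real p + 2) = 2 / (real p * (real p + 2))" by (simp add: field_simps)
    also have "\<dots> \<le> 2 / (real p * real p)" using p by (intro divide_left_mono mult_left_mono) auto
    finally show "1 / real p - 1 / (real p + 2) \<le> 2 * (1 / (real p)\<^sup>2)" by (simp add: power2_eq_square)
  qed
  also have "\<dots> = 2 * (\<Sum>p\<in>primes_le n. 1 / (real p)\<^sup>2)" by (simp add: sum_distrib_left)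
  also have "(\<Sum>p\<in>primes_le n. 1 / (real p)\<^sup>2) \<le> (\<Sum>d\<in>{2..n}. 1 / (real d)\<^sup>2)"
    by (rule sum_mono2) (auto dest!: primes_leD)
  also have "\<dots> \<le> 1" by (rule sum_inverse_squares_from2_le)
  finally show ?thesis by simp
qed

lemma finite_sparse_family [simp]: "finite (sparse_family k n)"
  by (rule finite_subset[of _ "Pow (primes_le n)"]) (auto simp: sparse_family_def)

lemma sparse_family_finite: "A \<in> sparse_family k n \<Longrightarrow> finite A"
  unfolding sparse_family_def by (auto intro: finite_subset[OF _ finite_primes_le])

lemma sparse_family_0: "sparse_family 0 n = {{}}"
proof -
  have "A = {}" if "A \<in> sparse_family 0 n" for A
    using sparse_family_finite[OF that] that by (simp add: sparse_family_def)
  moreover have "{} \<in> sparse_family 0 n" by (simp add: sparse_family_def sparse_primes_def)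
  ultimately show ?thesis by blast
qed

lemma sparse_volume_0 [simp]: "sparse_volume 0 n = 1"
  unfolding sparse_volume_def sparse_family_0 by simp

lemma sparse_volume_Suc_0 [simp]: "sparse_volume (Suc k) 0 = 0"
  unfolding sparse_volume_def sparse_family_def by (simp cong: conj_cong)

lemma sparse_volume_nonneg: "sparse_volume k n \<ge> 0"
  unfolding sparse_volume_def by (intro sum_nonneg divide_nonneg_nonneg) (auto intro: prod_nonneg)

lemma sparse_family_Suc:
  "sparse_family (Suc k) (Suc n) = sparse_family (Suc k) n \<union>
    (if prime (Suc n) \<and> real (Suc k) * unit_gap \<le> prime_clock (Suc n) then insert (Suc n) ` sparse_family k n else {})"
    (is "?L = ?R")
proof (rule Set.set_eqI)
  fix A
  have notin: "Suc n \<notin> primes_le n" by (simp add: primes_le_def)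
  have add: "insert (Suc n) B \<in> ?L \<longleftrightarrow> prime (Suc n) \<and> B \<in> sparse_family k n \<and> real (Suc k) * unit_gap \<le> prime_clock (Suc n)"
    if B: "B \<subseteq> primes_le n" for B
  proof -
    have fin: "finite B" using B finite_subset by blast
    have nB: "Suc n \<notin> B" using B notin by blast
    have le: "\<And>q. q \<in> B \<Longrightarrow> q \<le> n" using B by (auto simp: primes_le_def)
    have 1: "{q \<in> insert (Suc n) B. q \<le> Suc n} = insert (Suc n) B" using le by (auto intro: le_SucI)
    have 2: "{q \<in> insert (Suc n) B. q \<le> p} = {q \<in> B. q \<le> p}" if "p \<in> B" for p using le[OF that] by auto
    have "sparse_primes (insert (Suc n) B) \<longleftrightarrow> real (Suc (card B)) * unit_gap \<le> prime_clock (Suc n) \<and> sparse_primes B"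
      unfolding sparse_primes_def using 1 2 fin nB by auto
    moreover have "insert (Suc n) B \<subseteq> primes_le (Suc n) \<longleftrightarrow> prime (Suc n)"
      using B by (auto simp: primes_le_Suc primes_le_def)
    ultimately show ?thesis using B fin nB by (auto simp: sparse_family_def)
  qed
  show "A \<in> ?L \<longleftrightarrow> A \<in> ?R"
  proof (cases "Suc n \<in> A")
    case True
    then have A: "A = insert (Suc n) (A - {Suc n})" by blast
    have r: "A \<notin> sparse_family (Suc k) n" using True notin by (auto simp: sparse_family_def)
    show ?thesis
    proof (cases "A - {Suc n} \<subseteq> primes_le n")
      case sub: True
      have "A \<in> insert (Suc n) ` sparse_family k n \<longleftrightarrow> A - {Suc n} \<in> sparse_family k n"
      proof
        assume "A \<in> insert (Suc n) ` sparse_family k n"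
        then obtain B where B: "B \<in> sparse_family k n" "A = insert (Suc n) B" by blast
        then have "Suc n \<notin> B" using notin by (auto simp: sparse_family_def)
        then show "A - {Suc n} \<in> sparse_family k n" using B by simp
      qed (use A in blast)
      then show ?thesis using add[OF sub] A r by auto
    next
      case False
      then have "A \<notin> ?L" by (auto simp: sparse_family_def primes_le_Suc split: if_splits)
      moreover have "A \<notin> insert (Suc n) ` sparse_family k n" using False by (auto simp: sparse_family_def)
      ultimately show ?thesis using r by auto
    qed
  next
    case False
    then have "A \<subseteq> primes_le (Suc n) \<longleftrightarrow> A \<subseteq> primes_le n" by (auto simp: primes_le_Suc)
    then show ?thesis using False by (auto simp: sparse_family_def)
  qed
qed

text \<open>Sets that contain the new prime have it as largest element, so sparseness is one condition on
  it.\<close>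

lemma sparse_volume_Suc:
  "sparse_volume (Suc k) (Suc n) = sparse_volume (Suc k) n +
    (if prime (Suc n) \<and> real (Suc k) * unit_gap \<le> prime_clock (Suc n) then sparse_volume k n / real (Suc n) else 0)"
proof (cases "prime (Suc n) \<and> real (Suc k) * unit_gap \<le> prime_clock (Suc n)")
  case True
  have notin: "Suc n \<notin> B" if "B \<in> sparse_family j n" for B j using that by (auto simp: sparse_family_def primes_le_def)
  have inj: "inj_on (insert (Suc n)) (sparse_family k n)"
    using notin by (intro inj_onI) (metis insert_ident)
  have "sparse_volume (Suc k) (Suc n) = sparse_volume (Suc k) n + (\<Sum>A\<in>insert (Suc n) ` sparse_family k n. 1 / real (\<Prod>A))"
    unfolding sparse_volume_def sparse_family_Suc[of k n] using True notin
    by simp (rule sum.union_disjoint; auto)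
  also have "(\<Sum>A\<in>insert (Suc n) ` sparse_family k n. 1 / real (\<Prod>A)) = (\<Sum>B\<in>sparse_family k n. 1 / real (\<Prod>(insert (Suc n) B)))"
    by (rule sum.reindex[OF inj, unfolded o_def])
  also have "\<dots> = (\<Sum>B\<in>sparse_family k n. 1 / real (\<Prod>B) / real (Suc n))"
  proof (intro sum.cong refl)
    fix B assume B: "B \<in> sparse_family k n"
    have "\<Prod>(insert (Suc n) B) = Suc n * \<Prod>B"
      using notin[OF B] sparse_family_finite[OF B] by (subst prod.insert) auto
    then have "real (\<Prod>(insert (Suc n) B)) = real (Suc n) * real (\<Prod>B)" by (simp only: of_nat_mult)
    then show "1 / real (\<Prod>(insert (Suc n) B)) = 1 / real (\<Prod>B) / real (Suc n)"
      by (simp only: divide_divide_eq_left mult.commute)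
  qed
  finally show ?thesis using True by (simp add: sparse_volume_def sum_divide_distrib)
next
  case False
  show ?thesis unfolding sparse_volume_def sparse_family_Suc[of k n] if_not_P[OF False] by simp
qed

lemma simplex_volume_deriv: "(simplex_volume (Suc k) has_real_derivative simplex_volume k x) (at x)"
proof (cases k)
  case 0
  have "simplex_volume (Suc 0) = (\<lambda>x. x - unit_gap)" by (simp add: fun_eq_iff)
  then show ?thesis unfolding 0 by (auto intro!: derivative_eq_intros)
next
  case (Suc j)
  have "((\<lambda>x. x ^ Suc j * (x - c)) has_real_derivative (real (Suc j) * x ^ j * (x - c) + x ^ Suc j)) (at x)" for c :: real
  proof -
    have "((\<lambda>x. x ^ Suc j) has_real_derivative real (Suc j) * x ^ j) (at x)"
      using DERIV_pow[of "Suc j" x] by simp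
    moreover have "((\<lambda>x. x - c) has_real_derivative 1) (at x)"
      by (auto intro!: derivative_eq_intros)
    ultimately show ?thesis using DERIV_mult by fastforce
  qed
  from DERIV_cdivide[OF this, of "real (Suc (Suc j)) * unit_gap" "fact (Suc (Suc j))"]
  have "((\<lambda>x. x ^ Suc j * (x - real (Suc (Suc j)) * unit_gap) / fact (Suc (Suc j))) has_real_derivative
      (real (Suc j) * x ^ j * (x - real (Suc (Suc j)) * unit_gap) + x ^ Suc j) / fact (Suc (Suc j))) (at x)" .
  also have "(real (Suc j) * x ^ j * (x - real (Suc (Suc j)) * unit_gap) + x ^ Suc j)
      = real (Suc (Suc j)) * (x ^ j * (x - real (Suc j) * unit_gap))"
    by (simp add: algebra_simps)
  also have "\<dots> / fact (Suc (Suc j)) = simplex_volume k x"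
    unfolding Suc by (simp only: simplex_volume.simps fact_Suc[of "Suc j"] of_nat_mult) simp
  finally show ?thesis unfolding Suc by (simp only: simplex_volume.simps[abs_def])
qed

lemma simplex_volume_mono:
  assumes "real k * unit_gap \<le> x" "x \<le> y"
  shows "0 \<le> simplex_volume k x \<and> simplex_volume k x \<le> simplex_volume k y"
proof (cases k)
  case (Suc j)
  have x: "x \<ge> 0" using assms unit_gap_bounds(1) by (meson order_trans mult_nonneg_nonneg of_nat_0_le_iff divide_nonneg_nonneg zero_le_numeral)
  have "x ^ j * (x - real (Suc j) * unit_gap) \<le> y ^ j * (y - real (Suc j) * unit_gap)"
    using assms x unfolding Suc by (intro mult_mono power_mono) auto
  moreover have "0 \<le> x ^ j * (x - real (Suc j) * unit_gap)" using assms x unfolding Suc by simp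
  ultimately show ?thesis unfolding Suc by (simp add: divide_right_mono)
qed simp

lemma simplex_volume_step:
  assumes "x \<le> y"
  shows "\<exists>\<xi>. x \<le> \<xi> \<and> \<xi> \<le> y \<and> simplex_volume (Suc k) y - simplex_volume (Suc k) x = (y - x) * simplex_volume k \<xi>"
proof (cases "x = y")
  case False
  then have "x < y" using assms by simp
  from MVT2[OF this, of "simplex_volume (Suc k)" "simplex_volume k"]
  obtain z where "x < z" "z < y" "simplex_volume (Suc k) y - simplex_volume (Suc k) x = (y - x) * simplex_volume k z"
    using simplex_volume_deriv by blast
  then show ?thesis by (intro exI[of _ z]) auto
qed auto

text \<open>By the mean value theorem the increment is \<open>1 / (p + 2)\<close> times the volume at an
  intermediate point, and over such a short step the volume grows at most by the factor \<open>exp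
  (2 / (p + 2)) \<le> (p + 2) / p\<close>.\<close>

lemma simplex_volume_clock_step:
  assumes p: "p \<ge> 2" and x: "real (Suc k) * unit_gap \<le> x + 1 / (real p + 2)"
  shows "simplex_volume (Suc k) (x + 1 / (real p + 2)) \<le> simplex_volume (Suc k) x + simplex_volume k x / real p"
proof -
  define \<Delta> where "\<Delta> = 1 / (real p + 2)"
  have D: "0 < \<Delta>" "\<Delta> \<le> 1 / 4" unfolding \<Delta>_def using p by (auto simp: field_simps)
  have gap: "x - real k * unit_gap \<ge> 1" using x D unit_gap_bounds unfolding \<Delta>_def[symmetric] by (simp add: algebra_simps)
  then have xk: "real k * unit_gap \<le> x" by simp
  obtain \<xi> where xi: "x \<le> \<xi>" "\<xi> \<le> x + \<Delta>"
    "simplex_volume (Suc k) (x + \<Delta>) - simplex_volume (Suc k) x = \<Delta> * simplex_volume k \<xi>"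
    using simplex_volume_step[of x "x + \<Delta>" k] D by auto
  have "\<Delta> * simplex_volume k \<xi> \<le> \<Delta> * simplex_volume k (x + \<Delta>)"
    using simplex_volume_mono[of k \<xi> "x + \<Delta>"] xi xk D by (intro mult_left_mono) auto
  also have "\<dots> \<le> simplex_volume k x / real p"
  proof (cases k)
    case 0
    then show ?thesis unfolding \<Delta>_def using p by (simp add: field_simps)
  next
    case (Suc j)
    have xpos: "x \<ge> real j" "x > 0"
    proof -
      have "real k * 1 \<le> real k * unit_gap" using unit_gap_bounds by (intro mult_left_mono) auto
      moreover have "real k = real j + 1" using Suc by simp
      ultimately show "x \<ge> real j" "x > 0" using xk by linarith+
    qed
    have "x + \<Delta> = x * (1 + \<Delta> / x)" using xpos by (simp add: field_simps)
    also have "\<dots> \<le> x * exp (\<Delta> / x)" using xpos by (intro mult_left_mono exp_ge_add_one_self) auto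
    finally have "(x + \<Delta>) ^ j \<le> (x * exp (\<Delta> / x)) ^ j" using xpos D by (intro power_mono) auto
    also have "\<dots> = x ^ j * exp (real j * (\<Delta> / x))" by (simp only: power_mult_distrib exp_of_nat_mult)
    also have "\<dots> \<le> x ^ j * exp \<Delta>"
    proof -
      have "real j * (\<Delta> / x) \<le> \<Delta>" using xpos D by (simp add: field_simps)
      then show ?thesis using xpos by (intro mult_left_mono) auto
    qed
    finally have 1: "(x + \<Delta>) ^ j \<le> x ^ j * exp \<Delta>" .
    define g where "g = x - real k * unit_gap"
    have "g + \<Delta> \<le> g * (1 + \<Delta>)" using gap D unfolding g_def[symmetric] by (simp add: algebra_simps)
    also have "\<dots> \<le> g * exp \<Delta>" using gap unfolding g_def[symmetric] by (intro mult_left_mono exp_ge_add_one_self) auto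
    finally have 2: "g + \<Delta> \<le> g * exp \<Delta>" .
    have "(x + \<Delta>) ^ j * (g + \<Delta>) \<le> (x ^ j * exp \<Delta>) * (g * exp \<Delta>)"
      using 1 2 xpos D gap unfolding g_def[symmetric] by (intro mult_mono) auto
    also have "\<dots> = x ^ j * g * exp (2 * \<Delta>)" by (simp add: exp_add[symmetric] mult_ac)
    also have "\<dots> \<le> x ^ j * g * ((real p + 2) / real p)"
    proof (rule mult_left_mono)
      have "1 - 2 * \<Delta> = real p / (real p + 2)" unfolding \<Delta>_def by (simp add: field_simps)
      moreover have "1 - 2 * \<Delta> \<le> exp (- (2 * \<Delta>))" using exp_ge_add_one_self[of "- (2 * \<Delta>)"] by simp
      ultimately have "real p / (real p + 2) * exp (2 * \<Delta>) \<le> exp (- (2 * \<Delta>)) * exp (2 * \<Delta>)"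
        by (intro mult_right_mono) auto
      also have "\<dots> = 1" by (simp flip: exp_add)
      finally show "exp (2 * \<Delta>) \<le> (real p + 2) / real p" using p by (simp add: field_simps)
    qed (use xpos gap in \<open>auto simp: g_def\<close>)
    finally have "(x + \<Delta>) ^ j * (g + \<Delta>) \<le> x ^ j * g * ((real p + 2) / real p)" .
    then have "\<Delta> * ((x + \<Delta>) ^ j * (g + \<Delta>)) \<le> \<Delta> * (x ^ j * g * ((real p + 2) / real p))"
      using D by (intro mult_left_mono) auto
    also have "\<dots> = x ^ j * g / real p" unfolding \<Delta>_def by simp
    finally have "\<Delta> * ((x + \<Delta>) ^ j * (g + \<Delta>)) / fact k \<le> x ^ j * g / real p / fact k"
      by (intro divide_right_mono) auto
    moreover have "x + \<Delta> - real k * unit_gap = g + \<Delta>" by (simp add: g_def)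
    then have "simplex_volume k (x + \<Delta>) = (x + \<Delta>) ^ j * (g + \<Delta>) / fact k" unfolding Suc simplex_volume.simps by simp
    moreover have "simplex_volume k x = x ^ j * g / fact k" unfolding g_def Suc simplex_volume.simps by simp
    ultimately show ?thesis by (simp add: mult_ac)
  qed
  finally show ?thesis using xi(3) unfolding \<Delta>_def by linarith
qed

lemma simplex_volume_le_0:
  assumes "0 \<le> x" "x \<le> real (Suc k) * unit_gap" shows "simplex_volume (Suc k) x \<le> 0"
  using assms by (simp add: mult_nonneg_nonpos divide_nonpos_pos)

text \<open>Both sides satisfy the same recursion in \<open>n\<close>, up to the comparison of one step.\<close>

lemma sparse_volume_lower: "simplex_volume k (prime_clock n) \<le> sparse_volume k n"
proof (induction n arbitrary: k)
  case 0
  show ?case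
  proof (cases k)
    case (Suc j)
    have "simplex_volume (Suc j) (prime_clock 0) \<le> 0"
      using unit_gap_bounds by (intro simplex_volume_le_0) (auto simp: prime_clock_def)
    then show ?thesis using Suc sparse_volume_nonneg[of k 0] by simp
  qed simp
next
  case (Suc n)
  show ?case
  proof (cases k)
    case k: (Suc j)
    show ?thesis
    proof (cases "prime (Suc n)")
      case False
      then show ?thesis using Suc[of k] unfolding k by (simp only: prime_clock_Suc sparse_volume_Suc) simp
    next
      case True
      have p2: "Suc n \<ge> 2" using prime_ge_2_nat[OF True] .
      have clock: "prime_clock (Suc n) = prime_clock n + 1 / (real (Suc n) + 2)" using True by (simp only: prime_clock_Suc) simp
      show ?thesis
      proof (cases "real (Suc j) * unit_gap \<le> prime_clock (Suc n)")
        case le: True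
        have "simplex_volume (Suc j) (prime_clock (Suc n)) \<le> simplex_volume (Suc j) (prime_clock n) + simplex_volume j (prime_clock n) / real (Suc n)"
          unfolding clock using le unfolding clock by (rule simplex_volume_clock_step[OF p2])
        also have "\<dots> \<le> sparse_volume (Suc j) n + sparse_volume j n / real (Suc n)"
          by (intro add_mono divide_right_mono Suc) auto
        also have "\<dots> = sparse_volume (Suc j) (Suc n)" using True le by (simp only: sparse_volume_Suc) simp
        finally show ?thesis unfolding k .
      next
        case False
        then have "simplex_volume (Suc j) (prime_clock (Suc n)) \<le> 0"
          using prime_clock_nonneg[of "Suc n"] by (intro simplex_volume_le_0) auto
        then show ?thesis using sparse_volume_nonneg[of k "Suc n"] unfolding k by linarith
      qed
    qed
  qed simp
qed

text \<open>With steps \<open>1 / p\<close> the increment of the volume dominates because the volume is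
  increasing. The shift \<open>1/4\<close> is at least \<open>1 / (p + 2)\<close>, so a prime
  admitted by the clock is admitted by the simplex as well.\<close>

lemma sparse_volume_upper: "sparse_volume k n \<le> max 0 (simplex_volume k (prime_recip n + 1 / 4))"
proof (induction n arbitrary: k)
  case 0
  show ?case by (cases k) auto
next
  case (Suc n)
  show ?case
  proof (cases k)
    case k: (Suc j)
    let ?y = "prime_recip n + 1 / 4" and ?y' = "prime_recip (Suc n) + 1 / 4"
    have yy: "?y \<le> ?y'" using prime_recip_mono[of n "Suc n"] by simp
    have y0: "?y \<ge> 0" using prime_recip_nonneg[of n] by simp
    have mono: "max 0 (simplex_volume (Suc j) ?y) \<le> max 0 (simplex_volume (Suc j) ?y')"
    proof (cases "real (Suc j) * unit_gap \<le> ?y")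
      case True
      then show ?thesis using simplex_volume_mono[OF True yy] by linarith
    next
      case False
      then have "simplex_volume (Suc j) ?y \<le> 0" using y0 by (intro simplex_volume_le_0) auto
      then show ?thesis by linarith
    qed
    show ?thesis
    proof (cases "prime (Suc n) \<and> real (Suc j) * unit_gap \<le> prime_clock (Suc n)")
      case True
      have p2: "Suc n \<ge> 2" using True prime_ge_2_nat by blast
      have rec: "?y' = ?y + 1 / real (Suc n)" using True by (simp only: prime_recip_Suc) simp
      have "prime_clock (Suc n) = prime_clock n + 1 / (real (Suc n) + 2)" using True by (simp only: prime_clock_Suc) simp
      also have "\<dots> \<le> ?y"
      proof -
        have "1 / (real (Suc n) + 2) \<le> 1 / 4" using p2 by (simp add: field_simps)
        then show ?thesis using prime_clock_le[of n] by linarith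
      qed
      finally have y: "real (Suc j) * unit_gap \<le> ?y" using True by linarith
      have yj: "real j * unit_gap \<le> ?y" using y unit_gap_bounds by (simp add: algebra_simps)
      obtain \<xi> where xi: "?y \<le> \<xi>" "simplex_volume (Suc j) ?y' - simplex_volume (Suc j) ?y = (?y' - ?y) * simplex_volume j \<xi>"
        using simplex_volume_step[OF yy, of j] by blast
      have "simplex_volume j ?y / real (Suc n) \<le> simplex_volume j \<xi> / real (Suc n)"
        using simplex_volume_mono[OF yj xi(1)] by (intro divide_right_mono) auto
      also have "\<dots> = simplex_volume (Suc j) ?y' - simplex_volume (Suc j) ?y"
      proof -
        have "?y' - ?y = 1 / real (Suc n)" unfolding rec by simp
        then show ?thesis unfolding xi(2) by (simp only: times_divide_eq_left mult_1)
      qed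
      finally have step: "simplex_volume (Suc j) ?y + simplex_volume j ?y / real (Suc n) \<le> simplex_volume (Suc j) ?y'" by linarith
      have "sparse_volume (Suc j) (Suc n) = sparse_volume (Suc j) n + sparse_volume j n / real (Suc n)"
        using True by (simp only: sparse_volume_Suc) simp
      also have "\<dots> \<le> max 0 (simplex_volume (Suc j) ?y) + max 0 (simplex_volume j ?y) / real (Suc n)"
        by (intro add_mono divide_right_mono Suc) auto
      also have "\<dots> = simplex_volume (Suc j) ?y + simplex_volume j ?y / real (Suc n)"
        using simplex_volume_mono[OF y order_refl] simplex_volume_mono[OF yj order_refl] by (simp only: max_absorb2)
      also have "\<dots> \<le> simplex_volume (Suc j) ?y'" by (rule step)
      finally show ?thesis unfolding k by (rule order_trans) (rule max.cobounded2)
    next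
      case False
      then have "sparse_volume (Suc j) (Suc n) = sparse_volume (Suc j) n" by (simp only: sparse_volume_Suc) simp
      also have "\<dots> \<le> max 0 (simplex_volume (Suc j) ?y)" by (rule Suc)
      also have "\<dots> \<le> max 0 (simplex_volume (Suc j) ?y')" by (rule mono)
      finally show ?thesis unfolding k .
    qed
  qed simp
qed

section \<open>Sums over sets of primes\<close>

definition prime_sets :: "nat \<Rightarrow> nat \<Rightarrow> nat set set" where
  "prime_sets T b = {A. A \<subseteq> primes_le T \<and> card A = b}"

lemma finite_prime_sets [simp]: "finite (prime_sets T b)"
  unfolding prime_sets_def by (rule finite_subset[of _ "Pow (primes_le T)"]) auto

lemma prime_setsD:
  assumes "A \<in> prime_sets T b"
  shows "finite A" "A \<subseteq> primes_le T" "card A = b" "\<And>p. p \<in> A \<Longrightarrow> prime p" "\<Prod>A \<ge> 1" "\<And>p. p \<in> A \<Longrightarrow> p \<le> \<Prod>A"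
proof -
  show f: "finite A" and s: "A \<subseteq> primes_le T" and "card A = b"
    using assms by (auto simp: prime_sets_def intro: finite_subset[OF _ finite_primes_le])
  show pr: "\<And>p. p \<in> A \<Longrightarrow> prime p" using s primes_leD by blast
  have "\<Prod>A > 0" using pr by (intro prod_pos) (auto simp: prime_gt_0_nat)
  then show "\<Prod>A \<ge> 1" by simp
  show "p \<le> \<Prod>A" if "p \<in> A" for p
    using f that \<open>\<Prod>A > 0\<close> by (intro dvd_imp_le) (auto intro: dvd_prodI)
qed

text \<open>In the expansion of the power on the right, every subset of size \<open>b\<close> arises from
  \<open>b!\<close> orderings.\<close>

lemma sum_subsets_card_le:
  fixes f :: "'a \<Rightarrow> real"
  assumes "finite P" "\<And>p. p \<in> P \<Longrightarrow> f p \<ge> 0"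
  shows "(\<Sum>A\<in>{A. A \<subseteq> P \<and> card A = b}. \<Prod>p\<in>A. f p) \<le> (\<Sum>p\<in>P. f p) ^ b / fact b"
  using assms
proof (induction P arbitrary: b rule: finite_induct)
  case empty
  have "{A. A \<subseteq> {} \<and> card A = b} = (if b = 0 then {{}::'a set} else {})" by auto
  then show ?case by simp
next
  case (insert x P)
  let ?S = "sum f P"
  have S0: "?S \<ge> 0" and fx: "f x \<ge> 0" using insert by (auto intro: sum_nonneg)
  show ?case
  proof (cases b)
    case 0
    have "{A. A \<subseteq> insert x P \<and> card A = 0} = {{}}"
      using insert.hyps(1) by (auto dest: finite_subset)
    then show ?thesis using 0 by simp
  next
    case (Suc j)
    let ?F = "\<lambda>b. {A. A \<subseteq> P \<and> card A = b}"
    have fin: "finite (?F b)" for b using insert.hyps(1) by simp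
    have eq: "{A. A \<subseteq> insert x P \<and> card A = Suc j} = ?F (Suc j) \<union> insert x ` ?F j"
    proof (intro equalityI subsetI)
      fix A assume A: "A \<in> {A. A \<subseteq> insert x P \<and> card A = Suc j}"
      then have finA: "finite A" using insert.hyps(1) by (auto dest: finite_subset)
      show "A \<in> ?F (Suc j) \<union> insert x ` ?F j"
      proof (cases "x \<in> A")
        case True
        then have "A = insert x (A - {x})" "card (A - {x}) = j" using A finA by auto
        moreover have "A - {x} \<subseteq> P" using A by blast
        ultimately have "A \<in> insert x ` ?F j" by blast
        then show ?thesis by blast
      qed (use A in auto)
    next
      fix A assume "A \<in> ?F (Suc j) \<union> insert x ` ?F j"
      then consider "A \<in> ?F (Suc j)" | B where "B \<in> ?F j" "A = insert x B" by blast
      then show "A \<in> {A. A \<subseteq> insert x P \<and> card A = Suc j}"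
      proof cases
        case 2
        then have "finite B" "x \<notin> B" using insert.hyps by (auto dest: finite_subset)
        then show ?thesis using 2 by auto
      qed auto
    qed
    have inj: "inj_on (insert x) (?F j)" 
    proof (rule inj_onI)
      fix B B' assume "B \<in> ?F j" "B' \<in> ?F j" "insert x B = insert x B'"
      moreover from this have "x \<notin> B" "x \<notin> B'" using insert.hyps by auto
      ultimately show "B = B'" by (simp add: insert_ident)
    qed
    have "(\<Sum>A\<in>{A. A \<subseteq> insert x P \<and> card A = Suc j}. \<Prod>p\<in>A. f p)
       = (\<Sum>A\<in>?F (Suc j). \<Prod>p\<in>A. f p) + (\<Sum>A\<in>insert x ` ?F j. \<Prod>p\<in>A. f p)"
      unfolding eq using fin insert.hyps by (intro sum.union_disjoint) auto
    also have "(\<Sum>A\<in>insert x ` ?F j. \<Prod>p\<in>A. f p) = (\<Sum>A\<in>?F j. \<Prod>p\<in>insert x A. f p)"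
      by (rule sum.reindex[OF inj, unfolded o_def])
    also have "\<dots> = (\<Sum>A\<in>?F j. f x * (\<Prod>p\<in>A. f p))"
      using insert.hyps by (intro sum.cong refl prod.insert) (auto dest: finite_subset)
    also have "\<dots> = f x * (\<Sum>A\<in>?F j. \<Prod>p\<in>A. f p)" by (simp add: sum_distrib_left)
    also have "(\<Sum>A\<in>?F (Suc j). \<Prod>p\<in>A. f p) + f x * (\<Sum>A\<in>?F j. \<Prod>p\<in>A. f p)
       \<le> ?S ^ Suc j / fact (Suc j) + f x * (?S ^ j / fact j)"
      using insert.prems by (intro add_mono mult_left_mono fx insert.IH) auto
    also have "\<dots> = (?S ^ Suc j + real (Suc j) * f x * ?S ^ j) / fact (Suc j)"
      by (simp add: add_divide_distrib mult_ac)
    also have "\<dots> \<le> (f x + ?S) ^ Suc j / fact (Suc j)"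
    proof (rule divide_right_mono)
      have "?S ^ Suc j + real (Suc j) * f x * ?S ^ j \<le> (f x + ?S) ^ Suc j"
      proof (induction j)
        case (Suc j)
        have "?S ^ Suc (Suc j) + real (Suc (Suc j)) * f x * ?S ^ Suc j
           \<le> (f x + ?S) * (?S ^ Suc j + real (Suc j) * f x * ?S ^ j)"
        proof -
          have "0 \<le> real (Suc j) * f x * f x * ?S ^ j" using S0 fx by (intro mult_nonneg_nonneg) auto
          then show ?thesis by (simp add: algebra_simps)
        qed
        also have "\<dots> \<le> (f x + ?S) * (f x + ?S) ^ Suc j" using Suc S0 fx by (intro mult_left_mono) auto
        finally show ?case by simp
      qed simp
      then show "?S ^ Suc j + real (Suc j) * f x * ?S ^ j \<le> (f x + ?S) ^ Suc j" .
    qed simp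
    finally show ?thesis using insert.hyps Suc by simp
  qed
qed

lemma sum_inverse_prime_sets_le:
  "(\<Sum>A\<in>{A\<in>prime_sets T b. \<Prod>A \<le> y}. 1 / real (\<Prod>A)) \<le> prime_recip (min T y) ^ b / fact b"
proof -
  have "(\<Sum>A\<in>{A\<in>prime_sets T b. \<Prod>A \<le> y}. 1 / real (\<Prod>A))
     \<le> (\<Sum>A\<in>{A. A \<subseteq> primes_le (min T y) \<and> card A = b}. 1 / real (\<Prod>A))"
  proof (rule sum_mono2)
    show "{A\<in>prime_sets T b. \<Prod>A \<le> y} \<subseteq> {A. A \<subseteq> primes_le (min T y) \<and> card A = b}"
    proof
      fix A assume A: "A \<in> {A\<in>prime_sets T b. \<Prod>A \<le> y}"
      then have "p \<le> y" if "p \<in> A" for p using prime_setsD(6)[of A T b p] that by auto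
      then show "A \<in> {A. A \<subseteq> primes_le (min T y) \<and> card A = b}"
        using A by (auto simp: prime_sets_def primes_le_def)
    qed
    show "finite {A. A \<subseteq> primes_le (min T y) \<and> card A = b}"
      by (rule finite_subset[of _ "Pow (primes_le (min T y))"]) auto
  qed (auto intro: prod_nonneg)
  also have "\<dots> = (\<Sum>A\<in>{A. A \<subseteq> primes_le (min T y) \<and> card A = b}. \<Prod>p\<in>A. 1 / real p)"
    by (intro sum.cong refl) (simp add: prod_dividef)
  also have "\<dots> \<le> (\<Sum>p\<in>primes_le (min T y). 1 / real p) ^ b / fact b"
    by (rule sum_subsets_card_le) auto
  finally show ?thesis by (simp add: prime_recip_def)
qed

lemma sum_weighted_inverse_prime_sets_le:
  "(\<Sum>A\<in>prime_sets T b. (1 / 2) ^ card {p\<in>A. p \<le> y} / real (\<Prod>A))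
     \<le> (prime_recip T - prime_recip (min T y) / 2) ^ b / fact b"
proof -
  let ?f = "\<lambda>p. (if p \<le> y then 1 / 2 else 1) / real p"
  have eq: "(1 / 2) ^ card {p\<in>A. p \<le> y} / real (\<Prod>A) = (\<Prod>p\<in>A. ?f p)" if "A \<in> prime_sets T b" for A
  proof -
    have "(\<Prod>p\<in>A. if p \<le> y then 1 / 2 else (1::real)) = (1 / 2) ^ card {p\<in>A. p \<le> y}"
      using prime_setsD(1)[OF that] by (simp add: prod.If_cases Int_def)
    then show ?thesis by (simp add: prod_dividef)
  qed
  have "(\<Sum>A\<in>prime_sets T b. (1 / 2) ^ card {p\<in>A. p \<le> y} / real (\<Prod>A)) = (\<Sum>A\<in>prime_sets T b. \<Prod>p\<in>A. ?f p)"
    using eq by (intro sum.cong refl) auto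
  also have "\<dots> \<le> (\<Sum>p\<in>primes_le T. ?f p) ^ b / fact b"
    unfolding prime_sets_def by (rule sum_subsets_card_le) auto
  also have "(\<Sum>p\<in>primes_le T. ?f p) = prime_recip T - prime_recip (min T y) / 2"
  proof -
    have "prime_recip (min T y) = (\<Sum>p\<in>primes_le T. if p \<le> y then 1 / real p else 0)"
      unfolding prime_recip_def by (subst sum.inter_filter[symmetric]) (auto simp: primes_le_def intro!: sum.cong)
    then have "prime_recip T - prime_recip (min T y) / 2 = (\<Sum>p\<in>primes_le T. 1 / real p - (if p \<le> y then 1 / real p else 0) / 2)"
      unfolding prime_recip_def[of T] sum_subtractf by (simp add: sum_divide_distrib)
    also have "\<dots> = (\<Sum>p\<in>primes_le T. ?f p)" by (intro sum.cong refl) auto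
    finally show ?thesis by simp
  qed
  finally show ?thesis .
qed

text \<open>The term \<open>x^(b-1) / (b-1)!\<close> arises whenever one prime of a set of \<open>b\<close>
  primes is counted separately by Chebyshev's bound.\<close>

definition shifted_simplex :: "real \<Rightarrow> nat \<Rightarrow> real" where
  "shifted_simplex x b = (if b = 0 then 0 else x ^ (b - 1) / fact (b - 1))"

text \<open>Removing one element at a time: \<open>ln\<close> of the product is a sum over elements, and a
  set with a marked element is a smaller set together with a new prime.\<close>

lemma sum_ln_prime_sets_le:
  assumes g: "\<And>B p. p \<notin> B \<Longrightarrow> prime p \<Longrightarrow> insert p B \<in> F \<Longrightarrow> B \<in> G \<and> p \<le> lim_of B"
    and F: "F \<subseteq> prime_sets T b" "finite G"
  shows "(\<Sum>A\<in>F. w A * (\<Sum>p\<in>A. ln (real p)))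
     \<le> (\<Sum>B\<in>G. \<Sum>p\<in>primes_le (lim_of B) - B. \<bar>w (insert p B)\<bar> * ln (real p))"
proof -
  have finF: "finite F" using F(1) finite_prime_sets by (rule finite_subset)
  have D: "finite A" "\<And>p. p \<in> A \<Longrightarrow> prime p" if "A \<in> F" for A
    using F(1) prime_setsD(1,4)[of A T b] that by auto
  let ?S = "Sigma F (\<lambda>A. A)" and ?R = "Sigma G (\<lambda>B. primes_le (lim_of B) - B)"
  let ?h = "\<lambda>t. (fst t - {snd t}, snd t)"
  have "(\<Sum>A\<in>F. w A * (\<Sum>p\<in>A. ln (real p))) = (\<Sum>A\<in>F. \<Sum>p\<in>A. w A * ln (real p))" by (simp add: sum_distrib_left)
  also have "\<dots> = (\<Sum>t\<in>?S. w (fst t) * ln (real (snd t)))"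
    using finF D by (subst sum.Sigma) (auto simp: case_prod_beta)
  also have "\<dots> \<le> (\<Sum>t\<in>?S. \<bar>w (insert (snd (?h t)) (fst (?h t)))\<bar> * ln (real (snd (?h t))))"
  proof (rule sum_mono)
    fix t assume t: "t \<in> ?S"
    then have e: "insert (snd (?h t)) (fst (?h t)) = fst t" by auto
    have "prime (snd t)" using t D by auto
    then have "snd t \<ge> 1" by (rule prime_ge_1_nat)
    then show "w (fst t) * ln (real (snd t)) \<le> \<bar>w (insert (snd (?h t)) (fst (?h t)))\<bar> * ln (real (snd (?h t)))"
      unfolding e by (intro mult_mono) auto
  qed
  also have "\<dots> = (\<Sum>u\<in>?h ` ?S. \<bar>w (insert (snd u) (fst u))\<bar> * ln (real (snd u)))"
  proof -
    have "inj_on ?h ?S"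
    proof (rule inj_onI)
      fix s t assume st: "s \<in> ?S" "t \<in> ?S" "?h s = ?h t"
      have "fst s = insert (snd s) (fst s - {snd s})" "fst t = insert (snd t) (fst t - {snd t})" using st(1,2) by auto
      moreover have 1: "fst s - {snd s} = fst t - {snd t}" using st(3) by (rule Pair_inject)
      moreover have 2: "snd s = snd t" using st(3) by (rule Pair_inject)
      ultimately have "fst s = fst t" by (simp only:)
      then show "s = t" using 2 by (rule prod_eqI)
    qed
    from sum.reindex[OF this, of "\<lambda>u. \<bar>w (insert (snd u) (fst u))\<bar> * ln (real (snd u))", unfolded o_def]
    show ?thesis by (rule sym)
  qed
  also have "\<dots> \<le> (\<Sum>u\<in>?R. \<bar>w (insert (snd u) (fst u))\<bar> * ln (real (snd u)))"
  proof (rule sum_mono2)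
    show "finite ?R" using F by auto
    show "?h ` ?S \<subseteq> ?R"
    proof (rule image_subsetI)
      fix t assume t: "t \<in> ?S"
      then have pt: "prime (snd t)" and "insert (snd t) (fst t - {snd t}) = fst t" "fst t \<in> F" using D by auto
      then have "insert (snd t) (fst t - {snd t}) \<in> F" by simp
      from g[OF _ pt this] pt show "?h t \<in> ?R" by (auto simp: primes_le_def)
    qed
    show "0 \<le> \<bar>w (insert (snd u) (fst u))\<bar> * ln (real (snd u))" if "u \<in> ?R - ?h ` ?S" for u
    proof -
      have "snd u \<in> primes_le (lim_of (fst u))" using that by auto
      then have "2 \<le> snd u" using primes_leD by blast
      then show ?thesis by simp
    qed
  qed
  also have "\<dots> = (\<Sum>B\<in>G. \<Sum>p\<in>primes_le (lim_of B) - B. \<bar>w (insert p B)\<bar> * ln (real p))"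
    using F by (subst sum.Sigma) (auto simp: case_prod_beta)
  finally show ?thesis .
qed

lemma ln_prod_prime_set:
  assumes "A \<in> prime_sets T b" shows "ln (real (\<Prod>A)) = (\<Sum>p\<in>A. ln (real p))"
  unfolding of_nat_prod
proof (rule ln_prod)
  show "finite A" using assms by (rule prime_setsD)
  show "real p \<noteq> 0" if "p \<in> A" for p
    using prime_gt_0_nat[OF prime_setsD(4)[OF assms that]] by simp
qed

text \<open>A Chebyshev-type bound for integers with \<open>b\<close> prime factors: weighting by \<open>1 +
  ln t\<close> and splitting \<open>ln t = ln (t / \<Prod>A) + ln \<Prod>A\<close> saves a factor
  \<open>ln t\<close> over the trivial bound.\<close>

lemma card_prime_sets_le:
  assumes t: "t \<ge> 1"
  shows "(1 + ln (real t)) * real (card {A\<in>prime_sets T b. \<Prod>A \<le> t})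
    \<le> 2 * real t * (prime_recip (min T t) ^ b / fact b + shifted_simplex (prime_recip (min T t)) b)"
proof -
  let ?F = "{A\<in>prime_sets T b. \<Prod>A \<le> t}"
  let ?x = "prime_recip (min T t)"
  have x0: "?x \<ge> 0" by (rule prime_recip_nonneg)
  have pos: "real (\<Prod>A) \<ge> 1" if "A \<in> ?F" for A
    using prime_setsD(5)[of A T b] that by (metis (no_types, lifting) mem_Collect_eq of_nat_1 of_nat_le_iff)
  have "(1 + ln (real t)) * real (card ?F) = (\<Sum>A\<in>?F. 1 + ln (real t))" by simp
  also have "\<dots> \<le> (\<Sum>A\<in>?F. real t / real (\<Prod>A) + 1 * (\<Sum>p\<in>A. ln (real p)))"
  proof (rule sum_mono)
    fix A assume A: "A \<in> ?F"
    have "ln (real t / real (\<Prod>A)) \<le> real t / real (\<Prod>A) - 1"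
      using pos[OF A] t by (intro ln_le_minus_one) auto
    moreover have "ln (real t / real (\<Prod>A)) = ln (real t) - ln (real (\<Prod>A))"
      using pos[OF A] t by (intro ln_divide_pos) auto
    ultimately show "1 + ln (real t) \<le> real t / real (\<Prod>A) + 1 * (\<Sum>p\<in>A. ln (real p))"
      using ln_prod_prime_set[of A T b] A by simp
  qed
  also have "\<dots> = real t * (\<Sum>A\<in>?F. 1 / real (\<Prod>A)) + (\<Sum>A\<in>?F. 1 * (\<Sum>p\<in>A. ln (real p)))"
    by (simp add: sum.distrib sum_distrib_left)
  also have "\<dots> \<le> real t * (?x ^ b / fact b) + 2 * real t * shifted_simplex ?x b"
  proof (rule add_mono)
    show "real t * (\<Sum>A\<in>?F. 1 / real (\<Prod>A)) \<le> real t * (?x ^ b / fact b)"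
      by (intro mult_left_mono sum_inverse_prime_sets_le) auto
    show "(\<Sum>A\<in>?F. 1 * (\<Sum>p\<in>A. ln (real p))) \<le> 2 * real t * shifted_simplex ?x b"
    proof (cases b)
      case 0
      then have "A = {}" if "A \<in> ?F" for A using prime_setsD(1,3)[of A T b] that by auto
      then have "(\<Sum>p\<in>A. ln (real p)) = 0" if "A \<in> ?F" for A using that by (metis sum.empty)
      then have "(\<Sum>A\<in>?F. 1 * (\<Sum>p\<in>A. ln (real p))) = 0" by (intro sum.neutral) simp
      then show ?thesis using 0 by (simp add: shifted_simplex_def)
    next
      case (Suc j)
      let ?G = "{A\<in>prime_sets T j. \<Prod>A \<le> t}"
      have "(\<Sum>A\<in>?F. (\<lambda>_. 1) A * (\<Sum>p\<in>A. ln (real p)))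
          \<le> (\<Sum>B\<in>?G. \<Sum>p\<in>primes_le (t div \<Prod>B) - B. \<bar>(\<lambda>_. 1) (insert p B)\<bar> * ln (real p))"
      proof (rule sum_ln_prime_sets_le)
        fix B p assume p: "p \<notin> B" "prime (p::nat)" "insert p B \<in> ?F"
        have fin: "finite B" using p prime_setsD(1)[of "insert p B" T b] by auto
        have prod: "\<Prod>(insert p B) = p * \<Prod>B" using p fin by simp
        have B: "B \<in> prime_sets T j" using p fin Suc by (auto simp: prime_sets_def)
        have le: "p * \<Prod>B \<le> t" using p(3) prod by simp
        have "1 * \<Prod>B \<le> p * \<Prod>B" using prime_ge_1_nat[OF p(2)] by (rule mult_le_mono1)
        also note le
        finally have "\<Prod>B \<le> t" by simp
        have "p \<le> t div \<Prod>B"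
          using le prime_setsD(5)[OF B] by (simp add: less_eq_div_iff_mult_less_eq)
        with \<open>\<Prod>B \<le> t\<close> show "B \<in> ?G \<and> p \<le> t div \<Prod>B" using B by simp
      qed auto
      also have "\<dots> \<le> (\<Sum>B\<in>?G. \<Sum>p\<in>primes_le (t div \<Prod>B). ln (real p))"
        by (simp, intro sum_mono sum_mono2) (auto dest!: primes_leD)
      also have "\<dots> \<le> (\<Sum>B\<in>?G. 2 * real t * (1 / real (\<Prod>B)))"
      proof (rule sum_mono)
        fix B
        have l4: "ln (4::real) \<le> 2" using ln_realpow[of 2 2] ln_2_less_1 by simp
        have "(\<Sum>p\<in>primes_le (t div \<Prod>B). ln (real p)) \<le> real (t div \<Prod>B) * ln 4" by (rule sum_ln_primes_le)
        also have "\<dots> \<le> real t / real (\<Prod>B) * 2"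
          using l4 by (intro mult_mono of_nat_div_le_of_nat) (auto intro!: divide_nonneg_nonneg prod_nonneg)
        finally show "(\<Sum>p\<in>primes_le (t div \<Prod>B). ln (real p)) \<le> 2 * real t * (1 / real (\<Prod>B))"
          by (simp add: mult_ac)
      qed
      also have "\<dots> = 2 * real t * (\<Sum>B\<in>?G. 1 / real (\<Prod>B))" by (simp only: sum_distrib_left)
      also have "\<dots> \<le> 2 * real t * (?x ^ j / fact j)"
        by (intro mult_left_mono sum_inverse_prime_sets_le) auto
      finally show ?thesis using Suc by (simp add: shifted_simplex_def)
    qed
  qed
  also have "\<dots> \<le> 2 * real t * (?x ^ b / fact b + shifted_simplex ?x b)"
  proof -
    have gen: "y * a + 2 * y * s \<le> 2 * y * (a + s)" if "0 \<le> y * a" for y a s :: real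
      using that by (simp add: algebra_simps)
    show ?thesis by (rule gen) (use x0 in simp)
  qed
  finally show ?thesis .
qed

lemma sparse_family_prime_sets: "sparse_family k T \<subseteq> prime_sets T k"
  by (auto simp: sparse_family_def prime_sets_def)

lemma sparse_primes_subset:
  assumes A: "sparse_primes A" "finite A" and B: "B \<subseteq> A"
  shows "sparse_primes B"
  unfolding sparse_primes_def
proof
  fix p assume p: "p \<in> B"
  have "card {q\<in>B. q \<le> p} \<le> card {q\<in>A. q \<le> p}" using A B by (intro card_mono) auto
  then have "real (card {q\<in>B. q \<le> p}) * unit_gap \<le> real (card {q\<in>A. q \<le> p}) * unit_gap"
    using unit_gap_bounds by (intro mult_right_mono) auto
  also have "\<dots> \<le> prime_clock p" using A p B by (auto simp: sparse_primes_def)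
  finally show "real (card {q\<in>B. q \<le> p}) * unit_gap \<le> prime_clock p" .
qed

text \<open>Sparseness is stated at the elements of the set but holds at every \<open>y\<close>.\<close>

lemma sparse_primes_count:
  assumes A: "sparse_primes A" "finite A"
  shows "real (card {q\<in>A. q \<le> y}) * unit_gap \<le> prime_clock y"
proof (cases "{q\<in>A. q \<le> y} = {}")
  case True
  then show ?thesis using prime_clock_nonneg[of y] by (simp only: True card.empty)
next
  case False
  define p where "p = Max {q\<in>A. q \<le> y}"
  have p: "p \<in> {q\<in>A. q \<le> y}" unfolding p_def using False A by (intro Max_in) auto
  have "{q\<in>A. q \<le> y} = {q\<in>A. q \<le> p}"
    using A p by (auto simp: p_def)
  then have "real (card {q\<in>A. q \<le> y}) * unit_gap \<le> prime_clock p" using A p by (auto simp: sparse_primes_def)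
  also have "\<dots> \<le> prime_clock y" using p by (intro prime_clock_mono) auto
  finally show ?thesis .
qed

text \<open>Together with \<open>sparse_volume_ratio\<close>, this says that on average over the sparse
  family the product is at most a bounded power of \<open>T\<close>. Removing a prime keeps a set
  sparse, so Mertens' theorem applies to the removed prime.\<close>

lemma sum_ln_sparse_family_le:
  assumes T: "T \<ge> 1"
  shows "(\<Sum>A\<in>sparse_family (Suc k) T. ln (real (\<Prod>A)) / real (\<Prod>A)) \<le> (ln (real T) + 2) * sparse_volume k T"
proof -
  let ?w = "\<lambda>A::nat set. 1 / real (\<Prod>A)"
  have "(\<Sum>A\<in>sparse_family (Suc k) T. ln (real (\<Prod>A)) / real (\<Prod>A))
     = (\<Sum>A\<in>sparse_family (Suc k) T. ?w A * (\<Sum>p\<in>A. ln (real p)))"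
  proof (intro sum.cong refl)
    fix A assume "A \<in> sparse_family (Suc k) T"
    then have "A \<in> prime_sets T (Suc k)" using sparse_family_prime_sets by blast
    from ln_prod_prime_set[OF this] show "ln (real (\<Prod>A)) / real (\<Prod>A) = ?w A * (\<Sum>p\<in>A. ln (real p))" by simp
  qed
  also have "\<dots> \<le> (\<Sum>B\<in>sparse_family k T. \<Sum>p\<in>primes_le T - B. \<bar>?w (insert p B)\<bar> * ln (real p))"
  proof (rule sum_ln_prime_sets_le)
    fix B p assume p: "p \<notin> B" "prime (p::nat)" "insert p B \<in> sparse_family (Suc k) T"
    have fin: "finite (insert p B)" using p(3) by (rule sparse_family_finite)
    have i: "insert p B \<subseteq> primes_le T" "card (insert p B) = Suc k" "sparse_primes (insert p B)"
      using p(3) unfolding sparse_family_def by auto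
    have "sparse_primes B" using i(3) fin by (rule sparse_primes_subset) blast
    moreover have "card B = k" using i(2) p(1) fin by simp
    moreover have "p \<le> T" using i(1) by (simp add: primes_le_def)
    ultimately show "B \<in> sparse_family k T \<and> p \<le> T" using i(1) by (simp add: sparse_family_def)
  qed (auto intro: sparse_family_prime_sets[THEN subsetD])
  also have "\<dots> = (\<Sum>B\<in>sparse_family k T. \<Sum>p\<in>primes_le T - B. ?w B * (ln (real p) / real p))"
  proof (rule sum.cong[OF refl], rule sum.cong[OF refl])
    fix B p assume B: "B \<in> sparse_family k T" and p: "p \<in> primes_le T - B"
    have "B \<in> prime_sets T k" using B sparse_family_prime_sets by blast
    note Bd = prime_setsD[OF this]
    have "real (\<Prod>B) > 0" using Bd(5) by (metis of_nat_0_less_iff Suc_le_eq One_nat_def)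
    moreover have "real (\<Prod>(insert p B)) = real p * real (\<Prod>B)" using Bd(1) p by simp
    ultimately show "\<bar>?w (insert p B)\<bar> * ln (real p) = ?w B * (ln (real p) / real p)"
      by (simp only: abs_divide abs_mult abs_of_nat) (simp add: field_simps)
  qed
  also have "\<dots> \<le> (\<Sum>B\<in>sparse_family k T. \<Sum>p\<in>primes_le T. ?w B * (ln (real p) / real p))"
    by (intro sum_mono sum_mono2) (auto dest!: primes_leD intro!: mult_nonneg_nonneg divide_nonneg_nonneg prod_nonneg)
  also have "\<dots> = sparse_volume k T * (\<Sum>p\<in>primes_le T. ln (real p) / real p)"
    unfolding sparse_volume_def by (simp only: sum_product)
  also have "\<dots> \<le> sparse_volume k T * (ln (real T) + 2)"
  proof (rule mult_left_mono[OF _ sparse_volume_nonneg])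
    have "ln (4::real) \<le> 2" using ln_realpow[of 2 2] ln_2_less_1 by simp
    then show "(\<Sum>p\<in>primes_le T. ln (real p) / real p) \<le> ln (real T) + 2"
      using sum_ln_div_prime_upper[OF T] by linarith
  qed
  finally show ?thesis by (simp add: mult.commute)
qed

section \<open>Quadruples with equal products at one scale\<close>

lemma multiplicity_prod_primes:
  assumes A: "finite A" "\<And>q. q \<in> A \<Longrightarrow> prime (q::nat)" and p: "prime p"
  shows "multiplicity p (\<Prod>A) = (if p \<in> A then 1 else 0)"
  using A
proof (induction A rule: finite_induct)
  case (insert q A)
  have q: "prime q" using insert.prems by blast
  have "0 \<notin> A" using insert.prems[of 0] by auto
  then have nz: "\<Prod>A \<noteq> 0" using insert.hyps(1) by simp
  have "multiplicity p (\<Prod>(insert q A)) = multiplicity p q + multiplicity p (\<Prod>A)"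
    using insert.hyps q nz p by (simp add: prime_elem_multiplicity_mult_distrib prime_gt_0_nat)
  moreover have "multiplicity p q = (if p = q then 1 else 0)"
    using p q by (simp add: prime_multiplicity_other multiplicity_self prime_gt_1_nat)
  ultimately show ?case using insert by auto
qed simp

text \<open>The two factorisations \<open>A1 A2 = A3 A4\<close> share \<open>a = A1 \<inter> A3\<close> and
  \<open>d = A2 \<inter> A4\<close>; what moves is the exchange of \<open>b = A1 - A3\<close>
  against \<open>c = A3 - A1\<close>. So the four sets are described by four pieces.\<close>

lemma prime_set_product_eqD:
  assumes A: "A1 \<in> prime_sets T k" "A2 \<in> prime_sets T k" "A3 \<in> prime_sets T k" "A4 \<in> prime_sets T k"
    and eq: "\<Prod>A1 * \<Prod>A2 = \<Prod>A3 * \<Prod>A4"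
  shows "A1 = (A1 \<inter> A3) \<union> (A1 - A3)" "A3 = (A1 \<inter> A3) \<union> (A3 - A1)"
    "A2 = (A2 \<inter> A4) \<union> (A3 - A1)" "A4 = (A2 \<inter> A4) \<union> (A1 - A3)"
    "(A2 \<inter> A4) \<inter> (A3 - A1) = {}" "(A2 \<inter> A4) \<inter> (A1 - A3) = {}"
proof -
  have m: "(if p \<in> A1 then 1 else 0) + (if p \<in> A2 then 1 else 0) = ((if p \<in> A3 then 1 else 0) + (if p \<in> A4 then 1 else 0) :: nat)"
    if p: "prime p" for p
  proof -
    have mm: "multiplicity p (\<Prod>A * \<Prod>B) = (if p \<in> A then 1 else 0) + (if p \<in> B then 1 else 0)"
      if "A \<in> prime_sets T k" "B \<in> prime_sets T k" for A B
    proof -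
      have "\<Prod>A \<noteq> 0" "\<Prod>B \<noteq> 0" using prime_setsD(5)[OF that(1)] prime_setsD(5)[OF that(2)] by auto
      then have "multiplicity p (\<Prod>A * \<Prod>B) = multiplicity p (\<Prod>A) + multiplicity p (\<Prod>B)"
        using p by (intro prime_elem_multiplicity_mult_distrib) auto
      then show ?thesis
        using multiplicity_prod_primes[OF prime_setsD(1,4)[OF that(1)] p] multiplicity_prod_primes[OF prime_setsD(1,4)[OF that(2)] p] by simp
    qed
    show ?thesis using mm[OF A(1,2)] mm[OF A(3,4)] eq by simp
  qed
  have pr: "prime p" if "p \<in> A1 \<union> A2 \<union> A3 \<union> A4" for p
    using that prime_setsD(4)[OF A(1)] prime_setsD(4)[OF A(2)] prime_setsD(4)[OF A(3)] prime_setsD(4)[OF A(4)] by blast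
  have c: "p \<in> A1 - A3 \<Longrightarrow> p \<in> A4 \<and> p \<notin> A2" "p \<in> A3 - A1 \<Longrightarrow> p \<in> A2 \<and> p \<notin> A4"
    "(p \<in> A1 \<longleftrightarrow> p \<in> A3) \<Longrightarrow> (p \<in> A2 \<longleftrightarrow> p \<in> A4)" for p
    using m[of p] pr[of p] by (auto split: if_splits)
  show "A1 = (A1 \<inter> A3) \<union> (A1 - A3)" "A3 = (A1 \<inter> A3) \<union> (A3 - A1)" by blast+
  show "A2 = (A2 \<inter> A4) \<union> (A3 - A1)"
  proof (intro equalityI subsetI)
    fix p assume "p \<in> A2" then show "p \<in> (A2 \<inter> A4) \<union> (A3 - A1)" using c[of p] by auto
  next
    fix p assume "p \<in> (A2 \<inter> A4) \<union> (A3 - A1)" then show "p \<in> A2" using c[of p] by auto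
  qed
  show "A4 = (A2 \<inter> A4) \<union> (A1 - A3)"
  proof (intro equalityI subsetI)
    fix p assume "p \<in> A4" then show "p \<in> (A2 \<inter> A4) \<union> (A1 - A3)" using c[of p] by auto
  next
    fix p assume "p \<in> (A2 \<inter> A4) \<union> (A1 - A3)" then show "p \<in> A4" using c[of p] by auto
  qed
  show "(A2 \<inter> A4) \<inter> (A3 - A1) = {}"
  proof (intro equals0I)
    fix p assume "p \<in> (A2 \<inter> A4) \<inter> (A3 - A1)" then show False using c(2)[of p] by auto
  qed
  show "(A2 \<inter> A4) \<inter> (A1 - A3) = {}"
  proof (intro equals0I)
    fix p assume "p \<in> (A2 \<inter> A4) \<inter> (A1 - A3)" then show False using c(1)[of p] by auto
  qed
qed

text \<open>Doubly exponential scales: \<open>log log\<close> of the size of the exchanged part is resolved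
  up to a unit.\<close>

definition tower :: "nat \<Rightarrow> nat" where
  "tower i = nat \<lfloor>exp (exp (real i))\<rfloor>"

lemma tower_bounds: "real (tower i) \<le> exp (exp (real i))" "exp (exp (real i)) < real (tower i) + 1" "tower i \<ge> 2"
proof -
  have e: "exp (exp (real i)) \<ge> 2"
  proof -
    have "(1::real) \<le> exp (real i)" by simp
    then have "1 + 1 \<le> 1 + exp (real i)" by simp
    also have "\<dots> \<le> exp (exp (real i))" by (rule exp_ge_add_one_self)
    finally show ?thesis by simp
  qed
  show "real (tower i) \<le> exp (exp (real i))" "exp (exp (real i)) < real (tower i) + 1" "tower i \<ge> 2"
    unfolding tower_def using e by linarith+
qed

lemma prime_clock_tower: "prime_clock (tower i) \<le> real i + 5"
proof (cases "i = 0")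
  case True
  have "real (tower 0) \<le> exp 1" using tower_bounds(1)[of 0] by simp
  also have "exp 1 \<le> (3::real)" by (rule exp_le)
  finally have "tower 0 \<le> 3" by simp
  then have "prime_clock (tower 0) \<le> prime_clock 3" by (rule prime_clock_mono)
  also have "\<dots> \<le> (\<Sum>p\<in>{..3::nat}. 1)"
    unfolding prime_clock_def
  proof -
    have "(\<Sum>p\<in>primes_le 3. 1 / (real p + 2)) \<le> (\<Sum>p\<in>primes_le 3. 1)" by (intro sum_mono) (simp add: field_simps)
    also have "\<dots> \<le> (\<Sum>p\<in>{..3::nat}. 1)" by (rule sum_mono2) (auto simp: primes_le_def)
    finally show "(\<Sum>p\<in>primes_le 3. 1 / (real p + 2)) \<le> (\<Sum>p\<in>{..3::nat}. 1)" .
  qed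
  finally show ?thesis using True by simp
next
  case False
  have "(2::real) \<le> 1 + real i" using False by simp
  also have "\<dots> \<le> exp (real i)" by (rule exp_ge_add_one_self)
  finally have "(3::real) \<le> 1 + exp (real i)" by simp
  also have "\<dots> \<le> exp (exp (real i))" by (rule exp_ge_add_one_self)
  finally have t3: "tower i \<ge> 3" unfolding tower_def by linarith
  have "ln (real (tower i)) \<le> exp (real i)" using tower_bounds(1)[of i] t3
    by (metis ln_exp ln_le_cancel_iff exp_gt_zero of_nat_0_less_iff order_less_le_trans zero_less_numeral)
  moreover have "ln (real (tower i)) > 0" using t3 by simp
  ultimately have "ln (ln (real (tower i))) \<le> real i" by (metis ln_exp ln_le_cancel_iff exp_gt_zero)
  then show ?thesis using prime_recip_upper[OF t3] prime_clock_le[of "tower i"] by linarith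
qed

text \<open>A sparse set has at most \<open>(i + 5) / (2 ln 2)\<close> elements up to the
  \<open>i\<close>-th scale, so a weight \<open>1/2\<close> for each of them costs at most
  \<open>exp ((i + 5) / 2)\<close>. Here \<open>b\<close> lies entirely below the scale.\<close>

lemma sparse_weight_ge_1:
  assumes A: "sparse_primes (a \<union> b)" "finite a" "finite b" "a \<inter> b = {}" and b: "\<And>p. p \<in> b \<Longrightarrow> p \<le> tower i"
  shows "1 \<le> exp ((real i + 5) / 2) * ((1 / 2) ^ card b * (1 / 2) ^ card {p\<in>a. p \<le> tower i})"
proof -
  have e: "{q\<in>a \<union> b. q \<le> tower i} = b \<union> {p\<in>a. p \<le> tower i}" using b by auto
  have "card {q\<in>a \<union> b. q \<le> tower i} = card b + card {p\<in>a. p \<le> tower i}"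
    unfolding e using A by (intro card_Un_disjoint) auto
  then have "real (card b + card {p\<in>a. p \<le> tower i}) * unit_gap \<le> real i + 5"
    using sparse_primes_count[OF A(1), of "tower i"] prime_clock_tower[of i] A by simp
  then have "real (card b + card {p\<in>a. p \<le> tower i}) * ln 2 \<le> (real i + 5) / 2"
    by (simp add: unit_gap_def)
  then have "exp (real (card b + card {p\<in>a. p \<le> tower i}) * ln 2) \<le> exp ((real i + 5) / 2)" by simp
  also have "exp (real (card b + card {p\<in>a. p \<le> tower i}) * ln 2) = 2 ^ (card b + card {p\<in>a. p \<le> tower i})"
    by (subst exp_of_nat_mult) simp
  finally have le: "2 ^ (card b + card {p\<in>a. p \<le> tower i}) \<le> exp ((real i + 5) / 2)" .
  have "(1::real) = 2 ^ (card b + card {p\<in>a. p \<le> tower i}) * (1 / 2) ^ (card b + card {p\<in>a. p \<le> tower i})"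
    by (simp flip: power_mult_distrib)
  also have "\<dots> \<le> exp ((real i + 5) / 2) * (1 / 2) ^ (card b + card {p\<in>a. p \<le> tower i})"
    using le by (intro mult_right_mono) auto
  finally show ?thesis by (simp add: power_add)
qed

definition scale_sets :: "nat \<Rightarrow> nat \<Rightarrow> nat \<Rightarrow> nat set set" where
  "scale_sets T \<beta> i = {b\<in>prime_sets T \<beta>. \<Prod>b \<le> tower i \<and> (i = 0 \<or> tower (i - 1) < \<Prod>b)}"

lemma scale_sets_cover:
  assumes "b \<in> prime_sets T \<beta>" "\<Prod>b \<le> tower I"
  shows "\<exists>i\<le>I. b \<in> scale_sets T \<beta> i"
proof -
  define i where "i = (LEAST i. \<Prod>b \<le> tower i)"
  have 1: "\<Prod>b \<le> tower i" unfolding i_def by (rule LeastI[of "\<lambda>i. \<Prod>b \<le> tower i" I]) (rule assms)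
  have 2: "i \<le> I" unfolding i_def by (rule Least_le) (rule assms)
  have "i = 0 \<or> tower (i - 1) < \<Prod>b"
  proof (cases i)
    case (Suc j)
    then have "\<not> \<Prod>b \<le> tower j" using not_less_Least[of j "\<lambda>i. \<Prod>b \<le> tower i"] by (simp add: i_def)
    then show ?thesis using Suc by simp
  qed simp
  then show ?thesis using 1 2 assms by (auto simp: scale_sets_def)
qed

text \<open>The number of candidates \<open>c\<close> below \<open>\<Prod>b\<close> is smaller than
  \<open>\<Prod>b\<close> by the logarithm of \<open>\<Prod>b\<close>, that is, by about
  \<open>exp i\<close>. This cancels the factor \<open>exp (i + 5)\<close> that was paid for the
  weights.\<close>

lemma scale_sum_le:
  fixes F :: real and T i \<beta> :: nat
  assumes F: "F \<ge> 0"
  defines "x \<equiv> prime_recip (min T (tower i))"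
  shows "(\<Sum>b\<in>scale_sets T \<beta> i. \<Sum>c\<in>{c\<in>prime_sets T \<beta>. \<Prod>c \<le> \<Prod>b}.
      exp (real i + 5) * (1 / 4) ^ \<beta> * F\<^sup>2 / (real (\<Prod>b))\<^sup>2)
    \<le> 2 * exp 6 * F\<^sup>2 * (((x / 2) ^ \<beta> / fact \<beta>) * ((x / 2) ^ \<beta> / fact \<beta> + shifted_simplex (x / 2) \<beta>))"
proof -
  have x0: "x \<ge> 0" unfolding x_def by (rule prime_recip_nonneg)
  have s0: "shifted_simplex y \<beta> \<ge> 0" if "y \<ge> 0" for y using that by (simp add: shifted_simplex_def)
  let ?H = "x ^ \<beta> / fact \<beta> + shifted_simplex x \<beta>"
  have H0: "?H \<ge> 0" using x0 s0[OF x0] by simp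
  have one: "(\<Sum>c\<in>{c\<in>prime_sets T \<beta>. \<Prod>c \<le> \<Prod>b}. exp (real i + 5) * (1 / 4) ^ \<beta> * F\<^sup>2 / (real (\<Prod>b))\<^sup>2)
     \<le> 2 * exp 6 * (1 / 4) ^ \<beta> * F\<^sup>2 * ?H * (1 / real (\<Prod>b))" if b: "b \<in> scale_sets T \<beta> i" for b
  proof -
    have bp: "b \<in> prime_sets T \<beta>" "\<Prod>b \<le> tower i" "i = 0 \<or> tower (i - 1) < \<Prod>b" using b by (auto simp: scale_sets_def)
    have b1: "\<Prod>b \<ge> 1" using prime_setsD(5)[OF bp(1)] .
    then have r1: "real (\<Prod>b) \<ge> 1" by (metis of_nat_1 of_nat_le_iff)
    have lnb: "exp (real i - 1) \<le> 1 + ln (real (\<Prod>b))"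
    proof (cases i)
      case 0
      have "exp (- 1 :: real) \<le> 1" by simp
      then show ?thesis using 0 r1 by (simp add: add_increasing2)
    next
      case (Suc j)
      then have "tower j < \<Prod>b" using bp(3) by simp
      then have "Suc (tower j) \<le> \<Prod>b" by simp
      then have "real (Suc (tower j)) \<le> real (\<Prod>b)" by (simp only: of_nat_le_iff)
      then have "exp (exp (real j)) \<le> real (\<Prod>b)" using tower_bounds(2)[of j] unfolding of_nat_Suc by linarith
      then have "exp (real j) \<le> ln (real (\<Prod>b))" using r1 by (subst ln_ge_iff) auto
      then show ?thesis using Suc by simp
    qed
    have "exp (real i - 1) * real (card {c\<in>prime_sets T \<beta>. \<Prod>c \<le> \<Prod>b})
       \<le> (1 + ln (real (\<Prod>b))) * real (card {c\<in>prime_sets T \<beta>. \<Prod>c \<le> \<Prod>b})"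
      using lnb by (intro mult_right_mono) auto
    also have "\<dots> \<le> 2 * real (\<Prod>b) * (prime_recip (min T (\<Prod>b)) ^ \<beta> / fact \<beta> + shifted_simplex (prime_recip (min T (\<Prod>b))) \<beta>)"
      by (rule card_prime_sets_le[OF b1])
    also have "\<dots> \<le> 2 * real (\<Prod>b) * ?H"
    proof (rule mult_left_mono)
      have le: "prime_recip (min T (\<Prod>b)) \<le> x" unfolding x_def using bp(2) by (intro prime_recip_mono) auto
      have "prime_recip (min T (\<Prod>b)) ^ \<beta> / fact \<beta> \<le> x ^ \<beta> / fact \<beta>"
        using le prime_recip_nonneg by (intro divide_right_mono power_mono) auto
      moreover have "shifted_simplex (prime_recip (min T (\<Prod>b))) \<beta> \<le> shifted_simplex x \<beta>"
        unfolding shifted_simplex_def using le prime_recip_nonneg by (auto intro!: divide_right_mono power_mono)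
      ultimately show "prime_recip (min T (\<Prod>b)) ^ \<beta> / fact \<beta> + shifted_simplex (prime_recip (min T (\<Prod>b))) \<beta> \<le> ?H" by linarith
    qed (use r1 in linarith)
    finally have card: "exp (real i - 1) * real (card {c\<in>prime_sets T \<beta>. \<Prod>c \<le> \<Prod>b}) \<le> 2 * real (\<Prod>b) * ?H" .
    have "(\<Sum>c\<in>{c\<in>prime_sets T \<beta>. \<Prod>c \<le> \<Prod>b}. exp (real i + 5) * (1 / 4) ^ \<beta> * F\<^sup>2 / (real (\<Prod>b))\<^sup>2)
       = (exp (real i - 1) * real (card {c\<in>prime_sets T \<beta>. \<Prod>c \<le> \<Prod>b})) * (exp 6 * (1 / 4) ^ \<beta> * F\<^sup>2 / (real (\<Prod>b))\<^sup>2)"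
    proof -
      have "exp (real i + 5) = exp (real i - 1) * exp 6" by (simp flip: exp_add)
      then show ?thesis by (simp only: sum_constant) (simp add: mult_ac)
    qed
    also have "\<dots> \<le> (2 * real (\<Prod>b) * ?H) * (exp 6 * (1 / 4) ^ \<beta> * F\<^sup>2 / (real (\<Prod>b))\<^sup>2)"
      using card by (rule mult_right_mono) simp
    also have "\<dots> = 2 * exp 6 * (1 / 4) ^ \<beta> * F\<^sup>2 * ?H * (1 / real (\<Prod>b))"
    proof -
      have "(2 * y * h) * (e * F\<^sup>2 / y\<^sup>2) = 2 * e * F\<^sup>2 * h * (1 / y)" if "y \<ge> 1" for y h e :: real
        using that by (simp add: power2_eq_square field_simps)
      from this[OF r1, of ?H "exp 6 * (1 / 4) ^ \<beta>"] show ?thesis by (simp only: mult.assoc)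
    qed
    finally show ?thesis .
  qed
  have "(\<Sum>b\<in>scale_sets T \<beta> i. \<Sum>c\<in>{c\<in>prime_sets T \<beta>. \<Prod>c \<le> \<Prod>b}. exp (real i + 5) * (1 / 4) ^ \<beta> * F\<^sup>2 / (real (\<Prod>b))\<^sup>2)
     \<le> (\<Sum>b\<in>scale_sets T \<beta> i. 2 * exp 6 * (1 / 4) ^ \<beta> * F\<^sup>2 * ?H * (1 / real (\<Prod>b)))"
    using one by (rule sum_mono)
  also have "\<dots> = 2 * exp 6 * (1 / 4) ^ \<beta> * F\<^sup>2 * ?H * (\<Sum>b\<in>scale_sets T \<beta> i. 1 / real (\<Prod>b))"
    by (simp only: sum_distrib_left)
  also have "\<dots> \<le> 2 * exp 6 * (1 / 4) ^ \<beta> * F\<^sup>2 * ?H * (x ^ \<beta> / fact \<beta>)"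
  proof (rule mult_left_mono)
    have "(\<Sum>b\<in>scale_sets T \<beta> i. 1 / real (\<Prod>b)) \<le> (\<Sum>b\<in>{b\<in>prime_sets T \<beta>. \<Prod>b \<le> tower i}. 1 / real (\<Prod>b))"
      by (rule sum_mono2) (auto simp: scale_sets_def intro!: divide_nonneg_nonneg prod_nonneg)
    also have "\<dots> \<le> x ^ \<beta> / fact \<beta>" unfolding x_def by (rule sum_inverse_prime_sets_le)
    finally show "(\<Sum>b\<in>scale_sets T \<beta> i. 1 / real (\<Prod>b)) \<le> x ^ \<beta> / fact \<beta>" .
  qed (use H0 in simp)
  also have "\<dots> = 2 * exp 6 * F\<^sup>2 * (((1 / 2) ^ \<beta> * (x ^ \<beta> / fact \<beta>)) * ((1 / 2) ^ \<beta> * ?H))"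
  proof -
    have "(1 / 4 :: real) ^ \<beta> = (1 / 2) ^ \<beta> * (1 / 2) ^ \<beta>" by (simp flip: power_mult_distrib)
    then show ?thesis by (simp only: mult_ac)
  qed
  also have "\<dots> \<le> 2 * exp 6 * F\<^sup>2 * (((x / 2) ^ \<beta> / fact \<beta>) * ((x / 2) ^ \<beta> / fact \<beta> + shifted_simplex (x / 2) \<beta>))"
  proof (intro mult_left_mono mult_mono)
    have p: "(1 / 2) ^ \<beta> * (x ^ \<beta> / fact \<beta>) = (x / 2) ^ \<beta> / fact \<beta>" by (simp add: power_divide)
    then show "(1 / 2) ^ \<beta> * (x ^ \<beta> / fact \<beta>) \<le> (x / 2) ^ \<beta> / fact \<beta>" by simp
    have "(1 / 2) ^ \<beta> * shifted_simplex x \<beta> \<le> shifted_simplex (x / 2) \<beta>"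
    proof (cases \<beta>)
      case (Suc j)
      have "(1 / 2) ^ Suc j * (x ^ j / fact j) = (1 / 2) * ((x / 2) ^ j / fact j)" by (simp add: power_divide)
      also have "\<dots> \<le> (x / 2) ^ j / fact j" using x0 by (intro mult_left_le_one_le) auto
      finally show ?thesis using Suc by (simp add: shifted_simplex_def)
    qed (simp add: shifted_simplex_def)
    then show "(1 / 2) ^ \<beta> * ?H \<le> (x / 2) ^ \<beta> / fact \<beta> + shifted_simplex (x / 2) \<beta>"
      using p by (simp only: distrib_left)
    show "0 \<le> (1 / 2) ^ \<beta> * ?H" using H0 by simp
  qed (use x0 in auto)
  finally show ?thesis .
qed

section \<open>Summing over all scales\<close>

lemma sum_Sigma_iterate:
  assumes "finite A" "\<And>x. x \<in> A \<Longrightarrow> finite (B x)"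
  shows "sum f (Sigma A B) = (\<Sum>x\<in>A. \<Sum>y\<in>B x. f (x, y))"
  using sum.Sigma[of A B "\<lambda>x y. f (x, y)"] assms by simp

lemma sum_simplex_products:
  fixes y z :: real
  shows "(\<Sum>b\<le>k. (y ^ (k - b) / fact (k - b)) * (z ^ b / fact b)) = (y + z) ^ k / fact k"
proof -
  have "(y + z) ^ k / fact k = (\<Sum>b\<le>k. real (k choose b) * z ^ b * y ^ (k - b) / fact k)"
    unfolding add.commute[of y z] binomial_ring sum_divide_distrib ..
  also have "\<dots> = (\<Sum>b\<le>k. (y ^ (k - b) / fact (k - b)) * (z ^ b / fact b))"
    by (intro sum.cong refl) (simp add: binomial_fact mult.commute)
  finally show ?thesis ..
qed

lemma sum_shifted_simplex_products:
  fixes y z :: real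
  shows "(\<Sum>b\<le>k. (y ^ (k - b) / fact (k - b)) * shifted_simplex z b) = shifted_simplex (y + z) k"
proof (cases k)
  case (Suc j)
  have "(\<Sum>b\<le>Suc j. (y ^ (Suc j - b) / fact (Suc j - b)) * shifted_simplex z b)
     = (\<Sum>b\<le>j. (y ^ (j - b) / fact (j - b)) * (z ^ b / fact b))"
    by (subst sum.atMost_Suc_shift) (simp add: shifted_simplex_def)
  also have "\<dots> = (y + z) ^ j / fact j" by (rule sum_simplex_products)
  finally show ?thesis unfolding Suc by (simp add: shifted_simplex_def)
qed (simp add: shifted_simplex_def)

lemma sum_squares_le_square_sum:
  fixes f :: "'a \<Rightarrow> real"
  assumes "finite I" "\<And>i. i \<in> I \<Longrightarrow> f i \<ge> 0"
  shows "(\<Sum>i\<in>I. (f i)\<^sup>2) \<le> (\<Sum>i\<in>I. f i)\<^sup>2"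
proof -
  have "(\<Sum>i\<in>I. (f i)\<^sup>2) \<le> (\<Sum>i\<in>I. f i * (\<Sum>j\<in>I. f j))"
    unfolding power2_eq_square using assms by (intro sum_mono mult_left_mono member_le_sum) auto
  then show ?thesis by (simp add: power2_eq_square sum_distrib_right)
qed

text \<open>Sum over the number \<open>b\<close> of exchanged primes. Primes up to the scale weigh \<open>x
  / 2\<close> in the common part and \<open>x / 2\<close> in the exchanged part, and the binomial
  theorem restores \<open>X = (X - x/2) + x/2\<close>.\<close>

lemma scale_level_sum_le:
  fixes x X :: real and k :: nat
  assumes x: "0 \<le> x" "x \<le> X"
  defines "F \<equiv> \<lambda>b. (X - x / 2) ^ (k - b) / fact (k - b)" and "G \<equiv> \<lambda>b. (x / 2) ^ b / fact b"
  shows "(\<Sum>b\<le>k. (F b)\<^sup>2 * (G b * (G b + shifted_simplex (x / 2) b))) \<le> 2 * (X ^ k / fact k)\<^sup>2 + (shifted_simplex X k)\<^sup>2"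
proof -
  let ?S = "shifted_simplex (x / 2)"
  have F0: "F b \<ge> 0" and G0: "G b \<ge> 0" and S0: "?S b \<ge> 0" for b
    unfolding F_def G_def shifted_simplex_def using x by auto
  have "(\<Sum>b\<le>k. (F b)\<^sup>2 * (G b * (G b + ?S b))) \<le> (\<Sum>b\<le>k. 2 * (F b * G b)\<^sup>2 + (F b * ?S b)\<^sup>2)"
  proof (rule sum_mono)
    fix b
    have "g * (g + s) \<le> 2 * g\<^sup>2 + s\<^sup>2" for g s :: real
    proof -
      have "0 \<le> (g - s)\<^sup>2 + g\<^sup>2 + s\<^sup>2" by simp
      then show ?thesis by (simp add: power2_eq_square algebra_simps)
    qed
    then have "(F b)\<^sup>2 * (G b * (G b + ?S b)) \<le> (F b)\<^sup>2 * (2 * (G b)\<^sup>2 + (?S b)\<^sup>2)" by (intro mult_left_mono) auto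
    then show "(F b)\<^sup>2 * (G b * (G b + ?S b)) \<le> 2 * (F b * G b)\<^sup>2 + (F b * ?S b)\<^sup>2"
      by (simp add: power_mult_distrib algebra_simps)
  qed
  also have "\<dots> = 2 * (\<Sum>b\<le>k. (F b * G b)\<^sup>2) + (\<Sum>b\<le>k. (F b * ?S b)\<^sup>2)"
    by (simp add: sum.distrib sum_distrib_left)
  also have "\<dots> \<le> 2 * (\<Sum>b\<le>k. F b * G b)\<^sup>2 + (\<Sum>b\<le>k. F b * ?S b)\<^sup>2"
    using F0 G0 S0 by (intro add_mono mult_left_mono sum_squares_le_square_sum) auto
  also have "(\<Sum>b\<le>k. F b * G b) = X ^ k / fact k"
    unfolding F_def G_def sum_simplex_products by simp
  also have "(\<Sum>b\<le>k. F b * ?S b) = shifted_simplex X k"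
    unfolding F_def sum_shifted_simplex_products by simp
  finally show ?thesis .
qed

definition product_quads :: "nat \<Rightarrow> nat \<Rightarrow> (nat set \<times> nat set \<times> nat set \<times> nat set) set" where
  "product_quads k T = {(A1, A2, A3, A4). A1 \<in> sparse_family k T \<and> A2 \<in> sparse_family k T \<and>
     A3 \<in> sparse_family k T \<and> A4 \<in> sparse_family k T \<and> \<Prod>A1 * \<Prod>A2 = \<Prod>A3 * \<Prod>A4}"

lemma finite_product_quads [simp]: "finite (product_quads k T)"
  by (rule finite_subset[of _ "sparse_family k T \<times> sparse_family k T \<times> sparse_family k T \<times> sparse_family k T"])
     (auto simp: product_quads_def)

text \<open>Up to the factor \<open>(N / ln N)^2\<close>, a bound for the number of pairs of large primes
  that are compatible with the quadruple, see \<open>card_solution_quads_le\<close>.\<close>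

definition quad_weight :: "nat set \<times> nat set \<times> nat set \<times> nat set \<Rightarrow> real" where
  "quad_weight = (\<lambda>(A1, A2, A3, A4). 1 / (real (max (\<Prod>A1) (\<Prod>A3)) * real (max (\<Prod>A2) (\<Prod>A4))))"

text \<open>The weight of the pieces \<open>a\<close>, \<open>b\<close>, \<open>d\<close> of a quadruple,
  with \<open>\<beta>\<close> exchanged primes of product about \<open>tower i\<close>.\<close>

definition scale_term :: "nat \<Rightarrow> nat \<Rightarrow> nat set \<Rightarrow> nat set \<Rightarrow> nat set \<Rightarrow> real" where
  "scale_term i \<beta> b a d = exp (real i + 5) * (1 / 4) ^ \<beta> *
     (((1 / 2) ^ card {p\<in>a. p \<le> tower i} / real (\<Prod>a)) * ((1 / 2) ^ card {p\<in>d. p \<le> tower i} / real (\<Prod>d))) / (real (\<Prod>b))\<^sup>2"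

text \<open>The sparseness of \<open>A1 = a \<union> b\<close> and of \<open>A2 = d \<union> c\<close>
  inserts the weights \<open>1/2\<close>; the larger products are \<open>\<Prod>a \<Prod>b\<close>
  and \<open>\<Prod>d \<Prod>b\<close>.\<close>

lemma quad_weight_le_scale_term:
  assumes Q: "(A1, A2, A3, A4) \<in> product_quads k T" and le: "\<Prod>(A3 - A1) \<le> \<Prod>(A1 - A3)"
    and I: "\<Prod>(A1 - A3) \<le> tower I"
  defines "\<beta> \<equiv> card (A1 - A3)"
  shows "\<exists>i\<le>I. \<beta> \<le> k \<and> A1 - A3 \<in> scale_sets T \<beta> i \<and> A3 - A1 \<in> {c\<in>prime_sets T \<beta>. \<Prod>c \<le> \<Prod>(A1 - A3)} \<and>
    A1 \<inter> A3 \<in> prime_sets T (k - \<beta>) \<and> A2 \<inter> A4 \<in> prime_sets T (k - \<beta>) \<and>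
    quad_weight (A1, A2, A3, A4) \<le> scale_term i \<beta> (A1 - A3) (A1 \<inter> A3) (A2 \<inter> A4)"
proof -
  let ?a = "A1 \<inter> A3" and ?b = "A1 - A3" and ?c = "A3 - A1" and ?d = "A2 \<inter> A4"
  have fam: "A1 \<in> sparse_family k T" "A2 \<in> sparse_family k T" "A3 \<in> sparse_family k T" "A4 \<in> sparse_family k T"
    and eq: "\<Prod>A1 * \<Prod>A2 = \<Prod>A3 * \<Prod>A4" using Q by (auto simp: product_quads_def)
  have ps: "A1 \<in> prime_sets T k" "A2 \<in> prime_sets T k" "A3 \<in> prime_sets T k" "A4 \<in> prime_sets T k"
    using fam sparse_family_prime_sets by blast+
  note dec = prime_set_product_eqD[OF ps eq]
  have fin: "finite A1" "finite A2" "finite A3" "finite A4" using ps prime_setsD(1) by blast+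
  have subs: "A1 \<subseteq> primes_le T" "A2 \<subseteq> primes_le T" "A3 \<subseteq> primes_le T"
    using prime_setsD(2)[OF ps(1)] prime_setsD(2)[OF ps(2)] prime_setsD(2)[OF ps(3)] by auto
  have cards: "card A1 = k" "card A2 = k" "card A3 = k"
    using prime_setsD(3)[OF ps(1)] prime_setsD(3)[OF ps(2)] prime_setsD(3)[OF ps(3)] by auto
  have c1: "card A1 = card ?a + card ?b" using fin by (metis add.commute card_Diff_subset_Int card_mono Int_lower1 finite_Int le_add_diff_inverse)
  have c3: "card A3 = card ?a + card ?c" using fin by (metis Int_commute add.commute card_Diff_subset_Int card_mono Int_lower1 finite_Int le_add_diff_inverse)
  have c2: "card A2 = card ?d + card ?c"
    by (subst dec(3), rule card_Un_disjoint) (use fin dec(5) in auto)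
  have cc: "card ?c = \<beta>" "card ?a = k - \<beta>" "card ?d = k - \<beta>" "\<beta> \<le> k"
    using c1 c2 c3 cards unfolding \<beta>_def by linarith+
  have bP: "?b \<in> prime_sets T \<beta>" using subs unfolding prime_sets_def \<beta>_def by auto
  have cP: "?c \<in> prime_sets T \<beta>" using subs cc unfolding prime_sets_def by auto
  have aP: "?a \<in> prime_sets T (k - \<beta>)" using subs cc unfolding prime_sets_def by auto
  have dP: "?d \<in> prime_sets T (k - \<beta>)" using subs cc unfolding prime_sets_def by auto
  obtain i where i: "i \<le> I" "?b \<in> scale_sets T \<beta> i" using scale_sets_cover[OF bP I] by blast
  have bt: "\<Prod>?b \<le> tower i" using i(2) by (simp add: scale_sets_def)
  have b_le: "p \<le> tower i" if "p \<in> ?b" for p using prime_setsD(6)[OF bP that] bt by (rule le_trans)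
  have c_le: "p \<le> tower i" if "p \<in> ?c" for p using prime_setsD(6)[OF cP that] le bt by (meson le_trans)
  have sp: "sparse_primes A1" "sparse_primes A2" using fam by (auto simp: sparse_family_def)
  let ?wa = "(1 / 2 :: real) ^ card {p\<in>?a. p \<le> tower i}" and ?wd = "(1 / 2 :: real) ^ card {p\<in>?d. p \<le> tower i}"
  have w1: "1 \<le> exp ((real i + 5) / 2) * ((1 / 2) ^ \<beta> * ?wa)"
    unfolding \<beta>_def
  proof (rule sparse_weight_ge_1)
    show "sparse_primes (?a \<union> ?b)" using sp(1) dec(1) by metis
  qed (use fin b_le in auto)
  have w2: "1 \<le> exp ((real i + 5) / 2) * ((1 / 2) ^ \<beta> * ?wd)"
    unfolding cc(1)[symmetric]
  proof (rule sparse_weight_ge_1)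
    show "sparse_primes (?d \<union> ?c)" using sp(2) dec(3) by metis
  qed (use fin c_le dec(5) in auto)
  have "1 * 1 \<le> (exp ((real i + 5) / 2) * ((1 / 2) ^ \<beta> * ?wa)) * (exp ((real i + 5) / 2) * ((1 / 2) ^ \<beta> * ?wd))"
    using w1 w2 by (intro mult_mono) auto
  also have "\<dots> = exp (real i + 5) * (1 / 4) ^ \<beta> * (?wa * ?wd)"
  proof -
    have "exp (real i + 5) = exp ((real i + 5) / 2) * exp ((real i + 5) / 2)" by (simp flip: exp_add)
    moreover have "(1 / 4 :: real) ^ \<beta> = (1 / 2) ^ \<beta> * (1 / 2) ^ \<beta>" by (simp flip: power_mult_distrib)
    ultimately show ?thesis by (simp only: mult_ac)
  qed
  finally have w: "1 \<le> exp (real i + 5) * (1 / 4) ^ \<beta> * (?wa * ?wd)" by simp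
  have prod1: "\<Prod>A1 = \<Prod>?a * \<Prod>?b"
    by (subst dec(1), rule prod.union_disjoint) (use fin in auto)
  have prod3: "\<Prod>A3 = \<Prod>?a * \<Prod>?c"
    by (subst dec(2), rule prod.union_disjoint) (use fin in auto)
  have prod2: "\<Prod>A2 = \<Prod>?d * \<Prod>?c"
    by (subst dec(3), rule prod.union_disjoint) (use fin dec(5) in auto)
  have prod4: "\<Prod>A4 = \<Prod>?d * \<Prod>?b"
    by (subst dec(4), rule prod.union_disjoint) (use fin dec(6) in auto)
  have m13: "max (\<Prod>A1) (\<Prod>A3) = \<Prod>?a * \<Prod>?b" unfolding prod1 prod3 using le by (intro max_absorb1 mult_le_mono) auto
  have m24: "max (\<Prod>A2) (\<Prod>A4) = \<Prod>?d * \<Prod>?b" unfolding prod2 prod4 using le by (intro max_absorb2 mult_le_mono) auto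
  let ?y = "1 / (real (\<Prod>?a) * real (\<Prod>?d) * (real (\<Prod>?b))\<^sup>2)"
  have "quad_weight (A1, A2, A3, A4) = 1 * ?y"
    unfolding quad_weight_def case_prod_conv m13 m24 of_nat_mult power2_eq_square by (simp only: mult_ac mult_1)
  also have "\<dots> \<le> (exp (real i + 5) * (1 / 4) ^ \<beta> * (?wa * ?wd)) * ?y"
    by (rule mult_right_mono[OF w]) (simp del: of_nat_prod)
  also have "\<dots> = scale_term i \<beta> ?b ?a ?d"
    unfolding scale_term_def by (simp del: of_nat_prod)
  finally show ?thesis using i bP cP aP dP cc(4) le by blast
qed

text \<open>A quadruple is determined by its pieces \<open>a, b, c, d\<close>, so the sum over quadruples is
  at most the sum over all scales and all pieces without further constraints.\<close>

lemma half_quad_sum_le: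
  assumes I: "\<And>A. A \<in> sparse_family k T \<Longrightarrow> \<Prod>A \<le> tower I"
  defines "X \<equiv> prime_recip T"
  shows "(\<Sum>t\<in>{t\<in>product_quads k T. (\<lambda>(A1, A2, A3, A4). \<Prod>(A3 - A1) \<le> \<Prod>(A1 - A3)) t}. quad_weight t)
    \<le> real (I + 1) * (2 * exp 6 * (2 * (X ^ k / fact k)\<^sup>2 + (shifted_simplex X k)\<^sup>2))"
proof -
  let ?H = "{t\<in>product_quads k T. (\<lambda>(A1, A2, A3, A4). \<Prod>(A3 - A1) \<le> \<Prod>(A1 - A3)) t}"
  let ?C = "\<lambda>\<beta> b. {c\<in>prime_sets T \<beta>. \<Prod>c \<le> \<Prod>b}"
  define Dom where "Dom = (SIGMA i:{..I}. SIGMA \<beta>:{..k}. SIGMA b:scale_sets T \<beta> i. ?C \<beta> b \<times> prime_sets T (k - \<beta>) \<times> prime_sets T (k - \<beta>))"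
  define W where "W = (\<lambda>(i, \<beta>, b, c :: nat set, a, d). scale_term i \<beta> b a d)"
  define pieces where "pieces = (\<lambda>(A1, A2, A3, A4). (card (A1 - A3), A1 - A3, A3 - A1, (A1::nat set) \<inter> A3, A2 \<inter> (A4::nat set)))"
  have fin_scale: "finite (scale_sets T \<beta> i)" for \<beta> i unfolding scale_sets_def by simp
  have finD: "finite Dom" unfolding Dom_def by (intro finite_SigmaI fin_scale finite_cartesian_product) auto
  have "\<exists>i. (i, pieces t) \<in> Dom \<and> quad_weight t \<le> W (i, pieces t)" if t: "t \<in> ?H" for t
  proof -
    obtain A1 A2 A3 A4 where T: "t = (A1, A2, A3, A4)" by (cases t) auto
    have Q: "(A1, A2, A3, A4) \<in> product_quads k T" and le: "\<Prod>(A3 - A1) \<le> \<Prod>(A1 - A3)" using t T by auto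
    have A1: "A1 \<in> sparse_family k T" using Q by (simp add: product_quads_def)
    have "\<Prod>(A1 - A3) \<le> \<Prod>A1"
    proof (rule dvd_imp_le)
      show "\<Prod>(A1 - A3) dvd \<Prod>A1" using sparse_family_finite[OF A1] by (intro prod_dvd_prod_subset) auto
      show "0 < \<Prod>A1" using prime_setsD(5)[OF subsetD[OF sparse_family_prime_sets A1]] by simp
    qed
    then have "\<Prod>(A1 - A3) \<le> tower I" using I[OF A1] by (rule le_trans)
    from quad_weight_le_scale_term[OF Q le this] obtain i where i: "i \<le> I" "card (A1 - A3) \<le> k"
      "A1 - A3 \<in> scale_sets T (card (A1 - A3)) i" "A3 - A1 \<in> ?C (card (A1 - A3)) (A1 - A3)"
      "A1 \<inter> A3 \<in> prime_sets T (k - card (A1 - A3))" "A2 \<inter> A4 \<in> prime_sets T (k - card (A1 - A3))"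
      "quad_weight (A1, A2, A3, A4) \<le> scale_term i (card (A1 - A3)) (A1 - A3) (A1 \<inter> A3) (A2 \<inter> A4)"
      by blast
    have "(i, pieces t) \<in> Dom" unfolding Dom_def T pieces_def case_prod_conv
      using i(1-6) by (intro SigmaI atMost_iff[THEN iffD2])
    moreover have "quad_weight t \<le> W (i, pieces t)" unfolding T pieces_def W_def case_prod_conv using i(7) by simp
    ultimately show ?thesis by blast
  qed
  then have "\<forall>t\<in>?H. \<exists>i. (i, pieces t) \<in> Dom \<and> quad_weight t \<le> W (i, pieces t)" by blast
  from bchoice[OF this] obtain s where s: "\<And>t. t \<in> ?H \<Longrightarrow> (s t, pieces t) \<in> Dom \<and> quad_weight t \<le> W (s t, pieces t)" by blast
  have W0: "W u \<ge> 0" for u unfolding W_def scale_term_def by (auto simp: case_prod_beta intro!: divide_nonneg_nonneg mult_nonneg_nonneg prod_nonneg)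
  have inj: "inj_on (\<lambda>t. (s t, pieces t)) ?H"
  proof (rule inj_onI)
    fix t t' assume tt: "t \<in> ?H" "t' \<in> ?H" "(s t, pieces t) = (s t', pieces t')"
    obtain A1 A2 A3 A4 where T: "t = (A1, A2, A3, A4)" by (cases t) auto
    obtain B1 B2 B3 B4 where T': "t' = (B1, B2, B3, B4)" by (cases t') auto
    have e: "A1 - A3 = B1 - B3" "A3 - A1 = B3 - B1" "A1 \<inter> A3 = B1 \<inter> B3" "A2 \<inter> A4 = B2 \<inter> B4"
      using tt(3) unfolding T T' pieces_def by auto
    have rec: "C2 = (C2 \<inter> C4) \<union> (C3 - C1) \<and> C4 = (C2 \<inter> C4) \<union> (C1 - C3)"
      if "(C1, C2, C3, C4) \<in> product_quads k T" for C1 C2 C3 C4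
    proof -
      have ps: "C1 \<in> prime_sets T k" "C2 \<in> prime_sets T k" "C3 \<in> prime_sets T k" "C4 \<in> prime_sets T k"
        and eq: "\<Prod>C1 * \<Prod>C2 = \<Prod>C3 * \<Prod>C4"
        using that subsetD[OF sparse_family_prime_sets] unfolding product_quads_def by auto
      show ?thesis using prime_set_product_eqD(3,4)[OF ps eq] by (rule conjI)
    qed
    have qA: "(A1, A2, A3, A4) \<in> product_quads k T" and qB: "(B1, B2, B3, B4) \<in> product_quads k T"
      using tt(1,2) T T' by auto
    have "A1 = B1" "A3 = B3" using e by blast+
    moreover have "A2 = B2" "A4 = B4" using rec[OF qA] rec[OF qB] unfolding e by (metis, metis)
    ultimately show "t = t'" unfolding T T' by simp
  qed
  have "(\<Sum>t\<in>?H. quad_weight t) \<le> (\<Sum>t\<in>?H. W (s t, pieces t))" using s by (intro sum_mono) blast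
  also have "\<dots> = (\<Sum>u\<in>(\<lambda>t. (s t, pieces t)) ` ?H. W u)" by (rule sum.reindex[OF inj, unfolded o_def, symmetric])
  also have "\<dots> \<le> (\<Sum>u\<in>Dom. W u)"
  proof (rule sum_mono2[OF finD])
    show "(\<lambda>t. (s t, pieces t)) ` ?H \<subseteq> Dom" using s by blast
  qed (rule W0)
  also have "\<dots> = (\<Sum>i\<le>I. \<Sum>\<beta>\<le>k. \<Sum>b\<in>scale_sets T \<beta> i. \<Sum>c\<in>?C \<beta> b. \<Sum>a\<in>prime_sets T (k - \<beta>). \<Sum>d\<in>prime_sets T (k - \<beta>). scale_term i \<beta> b a d)"
    unfolding Dom_def W_def
    by (simp add: sum_Sigma_iterate finite_SigmaI fin_scale finite_cartesian_product)
  also have "\<dots> \<le> (\<Sum>i\<le>I. 2 * exp 6 * (2 * (X ^ k / fact k)\<^sup>2 + (shifted_simplex X k)\<^sup>2))"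
  proof (rule sum_mono)
    fix i
    define x where "x = prime_recip (min T (tower i))"
    have x: "0 \<le> x" "x \<le> X" unfolding x_def X_def by (auto intro: prime_recip_nonneg prime_recip_mono)
    let ?F = "\<lambda>\<beta>. (X - x / 2) ^ (k - \<beta>) / fact (k - \<beta>)" and ?G = "\<lambda>\<beta>. (x / 2) ^ \<beta> / fact \<beta>"
    define R where "R = (\<lambda>\<beta>. \<Sum>a\<in>prime_sets T (k - \<beta>). (1 / 2) ^ card {p\<in>a. p \<le> tower i} / real (\<Prod>a))"
    have R: "0 \<le> R \<beta>" "R \<beta> \<le> ?F \<beta>" for \<beta>
    proof -
      show "0 \<le> R \<beta>" unfolding R_def by (intro sum_nonneg divide_nonneg_nonneg) (auto intro: prod_nonneg)
      show "R \<beta> \<le> ?F \<beta>" unfolding R_def x_def X_def by (rule sum_weighted_inverse_prime_sets_le)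
    qed
    have fac: "(\<Sum>a\<in>P. \<Sum>d\<in>P. e * (f a * f d) / y) = e * (\<Sum>a\<in>P. f a)\<^sup>2 / y" for P and e y :: real and f :: "nat set \<Rightarrow> real"
      unfolding power2_eq_square sum_product by (simp only: sum_distrib_left sum_divide_distrib)
    have "(\<Sum>\<beta>\<le>k. \<Sum>b\<in>scale_sets T \<beta> i. \<Sum>c\<in>?C \<beta> b. \<Sum>a\<in>prime_sets T (k - \<beta>). \<Sum>d\<in>prime_sets T (k - \<beta>). scale_term i \<beta> b a d)
      = (\<Sum>\<beta>\<le>k. \<Sum>b\<in>scale_sets T \<beta> i. \<Sum>c\<in>?C \<beta> b. exp (real i + 5) * (1 / 4) ^ \<beta> * (R \<beta>)\<^sup>2 / (real (\<Prod>b))\<^sup>2)"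
      unfolding scale_term_def R_def
      by (rule sum.cong[OF refl], rule sum.cong[OF refl], rule sum.cong[OF refl], rule fac)
    also have "\<dots> \<le> (\<Sum>\<beta>\<le>k. 2 * exp 6 * (R \<beta>)\<^sup>2 * (?G \<beta> * (?G \<beta> + shifted_simplex (x / 2) \<beta>)))"
      unfolding x_def by (intro sum_mono scale_sum_le R)
    also have "\<dots> \<le> (\<Sum>\<beta>\<le>k. 2 * exp 6 * (?F \<beta>)\<^sup>2 * (?G \<beta> * (?G \<beta> + shifted_simplex (x / 2) \<beta>)))"
      using R x by (intro sum_mono mult_right_mono mult_left_mono power_mono) (auto simp: shifted_simplex_def)
    also have "\<dots> = 2 * exp 6 * (\<Sum>\<beta>\<le>k. (?F \<beta>)\<^sup>2 * (?G \<beta> * (?G \<beta> + shifted_simplex (x / 2) \<beta>)))"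
      by (simp only: sum_distrib_left mult.assoc)
    also have "\<dots> \<le> 2 * exp 6 * (2 * (X ^ k / fact k)\<^sup>2 + (shifted_simplex X k)\<^sup>2)"
      by (rule mult_left_mono[OF scale_level_sum_le[OF x]]) simp
    finally show "(\<Sum>\<beta>\<le>k. \<Sum>b\<in>scale_sets T \<beta> i. \<Sum>c\<in>?C \<beta> b. \<Sum>a\<in>prime_sets T (k - \<beta>). \<Sum>d\<in>prime_sets T (k - \<beta>). scale_term i \<beta> b a d)
       \<le> 2 * exp 6 * (2 * (X ^ k / fact k)\<^sup>2 + (shifted_simplex X k)\<^sup>2)" .
  qed
  also have "\<dots> = real (I + 1) * (2 * exp 6 * (2 * (X ^ k / fact k)\<^sup>2 + (shifted_simplex X k)\<^sup>2))" by simp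
  finally show ?thesis .
qed

text \<open>Exchanging the two pairs interchanges \<open>b\<close> and \<open>c\<close>, so one may assume
  that \<open>\<Prod>c \<le> \<Prod>b\<close>.\<close>

lemma quad_sum_le:
  assumes I: "\<And>A. A \<in> sparse_family k T \<Longrightarrow> \<Prod>A \<le> tower I"
  defines "X \<equiv> prime_recip T"
  shows "(\<Sum>t\<in>product_quads k T. quad_weight t)
    \<le> 2 * (real (I + 1) * (2 * exp 6 * (2 * (X ^ k / fact k)\<^sup>2 + (shifted_simplex X k)\<^sup>2)))"
proof -
  let ?P = "\<lambda>t. (\<lambda>(A1, A2, A3, A4). \<Prod>(A3 - A1) \<le> \<Prod>(A1 - A3)) t"
  let ?P' = "\<lambda>t. (\<lambda>(A1, A2, A3, A4). \<Prod>(A1 - A3) \<le> \<Prod>(A3 - A1)) t"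
  let ?sw = "\<lambda>(A1, A2, A3, A4). (A3, A4, A1, A2)"
  have q0: "quad_weight t \<ge> 0" for t unfolding quad_weight_def by (auto simp: case_prod_beta)
  have "(\<Sum>t\<in>product_quads k T. quad_weight t)
     \<le> (\<Sum>t\<in>{t\<in>product_quads k T. ?P t} \<union> {t\<in>product_quads k T. ?P' t}. quad_weight t)"
    by (rule sum_mono2) (auto simp: q0)
  also have "\<dots> \<le> (\<Sum>t\<in>{t\<in>product_quads k T. ?P t}. quad_weight t) + (\<Sum>t\<in>{t\<in>product_quads k T. ?P' t}. quad_weight t)"
    using q0 by (subst sum.union_inter[symmetric]) (auto intro!: sum_nonneg)
  also have "(\<Sum>t\<in>{t\<in>product_quads k T. ?P' t}. quad_weight t) = (\<Sum>t\<in>{t\<in>product_quads k T. ?P t}. quad_weight t)"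
    by (rule sum.reindex_bij_witness[where i = ?sw and j = ?sw])
       (auto simp: product_quads_def quad_weight_def max.commute)
  finally have le: "(\<Sum>t\<in>product_quads k T. quad_weight t) \<le> 2 * (\<Sum>t\<in>{t\<in>product_quads k T. ?P t}. quad_weight t)"
    by simp
  have "(\<Sum>t\<in>{t\<in>product_quads k T. ?P t}. quad_weight t)
     \<le> real (I + 1) * (2 * exp 6 * (2 * (X ^ k / fact k)\<^sup>2 + (shifted_simplex X k)\<^sup>2))"
    unfolding X_def by (rule half_quad_sum_le) (rule I)
  moreover have "s \<le> 2 * h \<Longrightarrow> h \<le> m \<Longrightarrow> s \<le> 2 * m" for s h m :: real by simp
  ultimately show ?thesis using le by blast
qed

section \<open>Integers with one large prime factor and sparse small factors\<close>

text \<open>The condition \<open>N < q^2\<close> ensures that \<open>q\<close> is the only prime factor of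
  its size.\<close>

definition large_cofactors :: "nat \<Rightarrow> nat \<Rightarrow> nat set" where
  "large_cofactors N m = {q. prime q \<and> N < q * q \<and> q * m \<le> N}"

lemma large_cofactors_subset:
  assumes "m \<ge> 1" shows "large_cofactors N m \<subseteq> primes_le (N div m)"
  using assms by (auto simp: large_cofactors_def primes_le_def less_eq_div_iff_mult_less_eq)

lemma finite_large_cofactors: "m \<ge> 1 \<Longrightarrow> finite (large_cofactors N m)"
  using large_cofactors_subset finite_primes_le by (rule finite_subset)

lemma card_large_cofactors_le:
  assumes m: "m \<ge> 1" and N: "N \<ge> 2"
  shows "real (card (large_cofactors N m)) \<le> 4 * real N / (real m * ln (real N))"
proof -
  have L: "ln (real N) > 0" using N by simp
  have "real (card (large_cofactors N m)) * (ln (real N) / 2) = (\<Sum>q\<in>large_cofactors N m. ln (real N) / 2)" by simp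
  also have "\<dots> \<le> (\<Sum>q\<in>large_cofactors N m. ln (real q))"
  proof (rule sum_mono)
    fix q assume "q \<in> large_cofactors N m"
    then have q: "N < q * q" "q > 0" by (auto simp: large_cofactors_def prime_gt_0_nat)
    then have "real N \<le> real q * real q" by (metis less_imp_le of_nat_le_iff of_nat_mult)
    then have "ln (real N) \<le> ln (real q * real q)" using N q by (subst ln_le_cancel_iff) auto
    also have "\<dots> = 2 * ln (real q)" using q by (simp add: ln_mult)
    finally show "ln (real N) / 2 \<le> ln (real q)" by simp
  qed
  also have "\<dots> \<le> (\<Sum>q\<in>primes_le (N div m). ln (real q))"
    using large_cofactors_subset[OF m] by (intro sum_mono2) (auto dest!: primes_leD)
  also have "\<dots> \<le> real (N div m) * ln 4" by (rule sum_ln_primes_le)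
  also have "\<dots> \<le> real N / real m * 2"
  proof (rule mult_mono[OF of_nat_div_le_of_nat])
    show "ln (4::real) \<le> 2" using ln_realpow[of 2 2] ln_2_less_1 by simp
  qed auto
  finally show ?thesis using L m by (simp add: field_simps)
qed

text \<open>The integers \<open>q \<Prod>A \<le> N\<close> that carry the weight of small energy, recorded
  by their factorisation.\<close>

definition witness_pairs :: "nat \<Rightarrow> nat \<Rightarrow> nat \<Rightarrow> (nat \<times> nat set) set" where
  "witness_pairs N T k = (SIGMA A:sparse_family k T. large_cofactors N (\<Prod>A))\<inverse>"

lemma witness_pairs_iff:
  "(q, A) \<in> witness_pairs N T k \<longleftrightarrow> A \<in> sparse_family k T \<and> prime q \<and> N < q * q \<and> q * \<Prod>A \<le> N"
  by (auto simp: witness_pairs_def large_cofactors_def)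

lemma sparse_prod_ge_1: "A \<in> sparse_family k T \<Longrightarrow> \<Prod>A \<ge> 1"
  using prime_setsD(5) sparse_family_prime_sets by blast

lemma card_witness_pairs:
  "finite (witness_pairs N T k)" "card (witness_pairs N T k) = (\<Sum>A\<in>sparse_family k T. card (large_cofactors N (\<Prod>A)))"
proof -
  have f: "finite (SIGMA A:sparse_family k T. large_cofactors N (\<Prod>A))"
    by (intro finite_SigmaI finite_large_cofactors sparse_prod_ge_1 finite_sparse_family)
  then show "finite (witness_pairs N T k)" by (simp add: witness_pairs_def)
  have "card (witness_pairs N T k) = card (SIGMA A:sparse_family k T. large_cofactors N (\<Prod>A))"
    unfolding witness_pairs_def by (rule card_inverse)
  also have "\<dots> = (\<Sum>A\<in>sparse_family k T. card (large_cofactors N (\<Prod>A)))"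
    by (rule card_SigmaI) (auto intro: finite_large_cofactors sparse_prod_ge_1)
  finally show "card (witness_pairs N T k) = (\<Sum>A\<in>sparse_family k T. card (large_cofactors N (\<Prod>A)))" .
qed

abbreviation pair_prod :: "nat \<times> nat set \<Rightarrow> nat" where
  "pair_prod s \<equiv> fst s * \<Prod>(snd s)"

lemma witness_pair_facts:
  assumes T: "T * T \<le> N" and s: "s \<in> witness_pairs N T k"
  shows "prime (fst s)" "\<And>A j. A \<in> sparse_family j T \<Longrightarrow> \<not> fst s dvd \<Prod>A" "pair_prod s \<in> {1..N}"
    "snd s \<in> sparse_family k T" "fst s \<in> large_cofactors N (\<Prod>(snd s))"
proof -
  obtain q A where qA: "s = (q, A)" by (cases s)
  have q: "A \<in> sparse_family k T" "prime q" "N < q * q" "q * \<Prod>A \<le> N"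
    using s unfolding qA witness_pairs_iff by auto
  show "prime (fst s)" "snd s \<in> sparse_family k T" "fst s \<in> large_cofactors N (\<Prod>(snd s))"
    using q qA by (auto simp: large_cofactors_def)
  have "T < q"
  proof (rule ccontr)
    assume "\<not> T < q"
    then have "q * q \<le> T * T" by (intro mult_le_mono) auto
    then show False using T q(3) by linarith
  qed
  show "\<not> fst s dvd \<Prod>B" if "B \<in> sparse_family j T" for B j
  proof
    assume d: "fst s dvd \<Prod>B"
    have B: "B \<in> prime_sets T j" using that sparse_family_prime_sets by blast
    then have "q \<in> B" using d qA q(2) prime_dvd_prod_primes_iff[OF prime_setsD(1,4)[OF B] q(2)] by simp
    then have "q \<le> T" using prime_setsD(2)[OF B] by (auto simp: primes_le_def)
    then show False using \<open>T < q\<close> by simp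
  qed
  have "q * \<Prod>A \<ge> 1" using sparse_prod_ge_1[OF q(1)] prime_gt_0_nat[OF q(2)] by (simp add: Suc_le_eq)
  then show "pair_prod s \<in> {1..N}" using q(4) qA by simp
qed

lemma prod_sparse_inject:
  assumes "A \<in> sparse_family k T" "B \<in> sparse_family k T" "\<Prod>A = \<Prod>B" shows "A = B"
proof -
  have "A \<subseteq> primes_le T" "B \<subseteq> primes_le T" using assms(1,2) by (auto simp: sparse_family_def)
  then show ?thesis using inj_onD[OF inj_on_prod_Pow_primes_le assms(3)] by simp
qed

lemma inj_on_pair_prod:
  assumes T: "T * T \<le> N" shows "inj_on pair_prod (witness_pairs N T k)"
proof (rule inj_onI)
  fix s t assume s: "s \<in> witness_pairs N T k" and t: "t \<in> witness_pairs N T k" and e: "pair_prod s = pair_prod t"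
  note fs = witness_pair_facts[OF T s] and ft = witness_pair_facts[OF T t]
  have "fst s dvd fst t * \<Prod>(snd t)" using e by (metis dvd_triv_left)
  then have "fst s dvd fst t" using fs(2)[OF ft(4)] fs(1) by (simp add: prime_dvd_mult_iff)
  then have eq: "fst s = fst t" using fs(1) ft(1) by (rule primes_dvd_imp_eq[rotated 2])
  then have "\<Prod>(snd s) = \<Prod>(snd t)" using e prime_gt_0_nat[OF fs(1)] by simp
  then have "snd s = snd t" using fs(4) ft(4) by (intro prod_sparse_inject)
  then show "s = t" using eq by (intro prod_eqI)
qed

text \<open>The large primes do not divide the products over the small primes, so they match up in one of
  the two orders and can be cancelled.\<close>

lemma pair_prod_eq_cases:
  assumes T: "T * T \<le> N"
    and s: "s1 \<in> witness_pairs N T k" "s2 \<in> witness_pairs N T k" "s3 \<in> witness_pairs N T k" "s4 \<in> witness_pairs N T k"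
    and eq: "pair_prod s1 * pair_prod s2 = pair_prod s3 * pair_prod s4"
  shows "(fst s1 = fst s3 \<and> fst s2 = fst s4 \<or> fst s1 = fst s4 \<and> fst s2 = fst s3) \<and>
    \<Prod>(snd s1) * \<Prod>(snd s2) = \<Prod>(snd s3) * \<Prod>(snd s4)"
proof -
  have aux: "fst t2 = fst t4 \<and> \<Prod>(snd t1) * \<Prod>(snd t2) = \<Prod>(snd t3) * \<Prod>(snd t4)"
    if t: "t1 \<in> witness_pairs N T k" "t2 \<in> witness_pairs N T k" "t3 \<in> witness_pairs N T k" "t4 \<in> witness_pairs N T k"
      and e: "pair_prod t1 * pair_prod t2 = pair_prod t3 * pair_prod t4" and f: "fst t1 = fst t3" for t1 t2 t3 t4
  proof -
    note f1 = witness_pair_facts[OF T t(1)] and f2 = witness_pair_facts[OF T t(2)]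
      and f3 = witness_pair_facts[OF T t(3)] and f4 = witness_pair_facts[OF T t(4)]
    have "fst t1 * (\<Prod>(snd t1) * pair_prod t2) = fst t1 * (\<Prod>(snd t3) * pair_prod t4)"
      using e f by (simp add: mult.assoc)
    then have e2: "\<Prod>(snd t1) * pair_prod t2 = \<Prod>(snd t3) * pair_prod t4" using prime_gt_0_nat[OF f1(1)] by simp
    have "fst t2 dvd \<Prod>(snd t1) * pair_prod t2" by simp
    then have "fst t2 dvd \<Prod>(snd t3) * (fst t4 * \<Prod>(snd t4))" by (simp only: e2)
    then have "fst t2 dvd fst t4" using f2(1) f2(2)[OF f3(4)] f2(2)[OF f4(4)] by (simp add: prime_dvd_mult_iff)
    then have q: "fst t2 = fst t4" using f2(1) f4(1) by (rule primes_dvd_imp_eq[rotated 2])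
    have "fst t2 * (\<Prod>(snd t1) * \<Prod>(snd t2)) = fst t2 * (\<Prod>(snd t3) * \<Prod>(snd t4))"
      using e2 q by (simp add: mult_ac)
    then show ?thesis using q prime_gt_0_nat[OF f2(1)] by simp
  qed
  note f1 = witness_pair_facts[OF T s(1)] and f3 = witness_pair_facts[OF T s(3)] and f4 = witness_pair_facts[OF T s(4)]
  have "fst s1 dvd pair_prod s1 * pair_prod s2" by simp
  then have "fst s1 dvd (fst s3 * \<Prod>(snd s3)) * (fst s4 * \<Prod>(snd s4))" by (simp only: eq)
  then have "fst s1 dvd fst s3 \<or> fst s1 dvd fst s4"
    using f1(1) f1(2)[OF f3(4)] f1(2)[OF f4(4)] by (simp add: prime_dvd_mult_iff)
  then have "fst s1 = fst s3 \<or> fst s1 = fst s4" using f1(1) f3(1) f4(1) by (metis primes_dvd_imp_eq)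
  then show ?thesis
  proof
    assume f: "fst s1 = fst s3"
    from aux[OF s eq f] f show ?thesis by simp
  next
    assume f: "fst s1 = fst s4"
    have "pair_prod s1 * pair_prod s2 = pair_prod s4 * pair_prod s3" using eq by (simp add: mult.commute)
    from aux[OF s(1,2,4,3) this f] f show ?thesis by (simp add: mult.commute)
  qed
qed

lemma quad_of_pairs:
  obtains s1 s2 s3 s4 where "z = ((s1, s2), (s3, s4))"
  by (metis surj_pair)

definition solution_quads :: "nat \<Rightarrow> nat \<Rightarrow> nat \<Rightarrow> (((nat \<times> nat set) \<times> (nat \<times> nat set)) \<times> ((nat \<times> nat set) \<times> (nat \<times> nat set))) set" where
  "solution_quads N T k = (SIGMA w:witness_pairs N T k \<times> witness_pairs N T k.
     {w' \<in> witness_pairs N T k \<times> witness_pairs N T k. pair_prod (fst w') * pair_prod (snd w') = pair_prod (fst w) * pair_prod (snd w)})"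

text \<open>The two ways to match the large primes are interchanged by swapping the second pair. If the
  first and the third large prime agree, that prime is at most \<open>N / max (\<Prod>A1)
  (\<Prod>A3)\<close>, and similarly for the other one, so Chebyshev's bound produces the weight
  of the quadruple.\<close>

lemma card_solution_quads_le:
  assumes T: "T * T \<le> N" and N: "N \<ge> 2"
  shows "real (card (solution_quads N T k)) \<le> 2 * (4 * real N / ln (real N))\<^sup>2 * (\<Sum>t\<in>product_quads k T. quad_weight t)"
proof -
  let ?W = "witness_pairs N T k"
  let ?Q1 = "{z \<in> (?W \<times> ?W) \<times> (?W \<times> ?W). fst (fst (fst z)) = fst (fst (snd z)) \<and> fst (snd (fst z)) = fst (snd (snd z)) \<and>
     \<Prod>(snd (fst (fst z))) * \<Prod>(snd (snd (fst z))) = \<Prod>(snd (fst (snd z))) * \<Prod>(snd (snd (snd z)))}"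
  let ?sw = "\<lambda>z :: ((nat \<times> nat set) \<times> (nat \<times> nat set)) \<times> ((nat \<times> nat set) \<times> (nat \<times> nat set)). (fst z, prod.swap (snd z))"
  have finW: "finite ?W" by (rule card_witness_pairs)
  then have fin1: "finite ?Q1" by simp
  have "solution_quads N T k \<subseteq> ?Q1 \<union> ?sw ` ?Q1"
  proof
    fix z assume z: "z \<in> solution_quads N T k"
    obtain s1 s2 s3 s4 where zz: "z = ((s1, s2), (s3, s4))" by (rule quad_of_pairs)
    have s: "s1 \<in> ?W" "s2 \<in> ?W" "s3 \<in> ?W" "s4 \<in> ?W" and eq: "pair_prod s1 * pair_prod s2 = pair_prod s3 * pair_prod s4"
      using z unfolding zz solution_quads_def by auto
    note cs = pair_prod_eq_cases[OF T s eq]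
    show "z \<in> ?Q1 \<union> ?sw ` ?Q1"
    proof (cases "fst s1 = fst s3 \<and> fst s2 = fst s4")
      case True
      then have "z \<in> ?Q1" using s cs unfolding zz by simp
      then show ?thesis by (rule UnI1)
    next
      case False
      then have f: "fst s1 = fst s4" "fst s2 = fst s3" using cs by blast+
      have "\<Prod>(snd s1) * \<Prod>(snd s2) = \<Prod>(snd s4) * \<Prod>(snd s3)"
        using cs by (simp only: mult.commute[of "\<Prod>(snd s4)"])
      then have "((s1, s2), (s4, s3)) \<in> ?Q1" using s f by simp
      then have "?sw ((s1, s2), (s4, s3)) \<in> ?sw ` ?Q1" by (rule imageI)
      then show ?thesis unfolding zz by simp
    qed
  qed
  then have "card (solution_quads N T k) \<le> card (?Q1 \<union> ?sw ` ?Q1)" using fin1 by (intro card_mono) auto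
  also have "\<dots> \<le> card ?Q1 + card (?sw ` ?Q1)" by (rule card_Un_le)
  also have "\<dots> \<le> 2 * card ?Q1" using card_image_le[OF fin1, of ?sw] by simp
  finally have 1: "real (card (solution_quads N T k)) \<le> 2 * real (card ?Q1)" by simp
  let ?R1 = "\<lambda>(A1, A2, A3, A4). large_cofactors N (max (\<Prod>A1) (\<Prod>A3))" and ?R2 = "\<lambda>(A1, A2, A3, A4). large_cofactors N (max (\<Prod>A2) (\<Prod>A4))"
  let ?S = "SIGMA t:product_quads k T. ?R1 t \<times> ?R2 t"
  let ?h = "\<lambda>z. ((snd (fst (fst z)), snd (snd (fst z)), snd (fst (snd z)), snd (snd (snd z))), (fst (fst (fst z)), fst (snd (fst z))))"
  have max1: "max (\<Prod>A) (\<Prod>B) \<ge> 1" if "A \<in> sparse_family k T" for A B :: "nat set"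
    using sparse_prod_ge_1[OF that] by (simp add: max.coboundedI1)
  have finR: "finite (?R1 t \<times> ?R2 t)" if t: "t \<in> product_quads k T" for t
  proof -
    obtain A1 A2 A3 A4 where tt: "t = (A1, A2, A3, A4)" by (cases t)
    have "A1 \<in> sparse_family k T" "A2 \<in> sparse_family k T" using t unfolding tt product_quads_def by auto
    then show ?thesis unfolding tt case_prod_conv by (intro finite_cartesian_product finite_large_cofactors max1)
  qed
  have finS: "finite ?S" using finite_product_quads finR by (rule finite_SigmaI)
  have "card ?Q1 \<le> card ?S"
  proof (rule card_inj_on_le[OF _ _ finS])
    show "inj_on ?h ?Q1"
    proof (rule inj_onI)
      fix x y assume x: "x \<in> ?Q1" and y: "y \<in> ?Q1" and e: "?h x = ?h y"
      have "fst (fst (fst x)) = fst (fst (snd x))" "fst (snd (fst x)) = fst (snd (snd x))"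
        "fst (fst (fst y)) = fst (fst (snd y))" "fst (snd (fst y)) = fst (snd (snd y))"
        using x y by simp_all
      then show "x = y" using e by (simp add: prod_eq_iff)
    qed
    show "?h ` ?Q1 \<subseteq> ?S"
    proof (rule image_subsetI)
      fix z assume z: "z \<in> ?Q1"
      obtain s1 s2 s3 s4 where zz: "z = ((s1, s2), (s3, s4))" by (rule quad_of_pairs)
      have s: "s1 \<in> ?W" "s2 \<in> ?W" "s3 \<in> ?W" "s4 \<in> ?W" and f: "fst s1 = fst s3" "fst s2 = fst s4"
        and eq: "\<Prod>(snd s1) * \<Prod>(snd s2) = \<Prod>(snd s3) * \<Prod>(snd s4)" using z unfolding zz by simp_all
      note f1 = witness_pair_facts[OF T s(1)] and f2 = witness_pair_facts[OF T s(2)]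
        and f3 = witness_pair_facts[OF T s(3)] and f4 = witness_pair_facts[OF T s(4)]
      have "(snd s1, snd s2, snd s3, snd s4) \<in> product_quads k T"
        using f1(4) f2(4) f3(4) f4(4) eq by (simp add: product_quads_def)
      moreover have "fst s1 \<in> large_cofactors N (max (\<Prod>(snd s1)) (\<Prod>(snd s3)))"
        using f1(5) f3(5) f unfolding large_cofactors_def by (simp add: max_def)
      moreover have "fst s2 \<in> large_cofactors N (max (\<Prod>(snd s2)) (\<Prod>(snd s4)))"
        using f2(5) f4(5) f unfolding large_cofactors_def by (simp add: max_def)
      ultimately show "?h z \<in> ?S" unfolding zz by simp
    qed
  qed
  also have "card ?S = (\<Sum>t\<in>product_quads k T. card (?R1 t \<times> ?R2 t))"
    using finR by (intro card_SigmaI) auto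
  finally have "real (card ?Q1) \<le> (\<Sum>t\<in>product_quads k T. real (card (?R1 t)) * real (card (?R2 t)))"
    by (simp only: card_cartesian_product of_nat_mult[symmetric] of_nat_sum[symmetric] of_nat_le_iff)
  also have "\<dots> \<le> (\<Sum>t\<in>product_quads k T. (4 * real N / ln (real N))\<^sup>2 * quad_weight t)"
  proof (rule sum_mono)
    fix t assume t: "t \<in> product_quads k T"
    obtain A1 A2 A3 A4 where tt: "t = (A1, A2, A3, A4)" by (cases t)
    have fam: "A1 \<in> sparse_family k T" "A2 \<in> sparse_family k T" using t unfolding tt product_quads_def by auto
    have "real (card (?R1 t)) * real (card (?R2 t))
       \<le> (4 * real N / (real (max (\<Prod>A1) (\<Prod>A3)) * ln (real N))) * (4 * real N / (real (max (\<Prod>A2) (\<Prod>A4)) * ln (real N)))"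
      unfolding tt case_prod_conv
      by (intro mult_mono card_large_cofactors_le max1 fam N) (use N in auto)
    also have "\<dots> = (4 * real N / ln (real N))\<^sup>2 * quad_weight t"
      unfolding tt quad_weight_def case_prod_conv by (simp add: power2_eq_square mult_ac del: of_nat_max)
    finally show "real (card (?R1 t)) * real (card (?R2 t)) \<le> (4 * real N / ln (real N))\<^sup>2 * quad_weight t" .
  qed
  also have "\<dots> = (4 * real N / ln (real N))\<^sup>2 * (\<Sum>t\<in>product_quads k T. quad_weight t)" by (rule sum_distrib_left[symmetric])
  finally show ?thesis using 1 by simp
qed

lemma dconv_indicator:
  assumes S: "S \<subseteq> {1..N}"
  shows "dconv N (\<lambda>n. if n \<in> S then 1 else 0) (\<lambda>n. if n \<in> S then 1 else 0) n = real (card {z \<in> S \<times> S. fst z * snd z = n})"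
proof -
  have "dconv N (\<lambda>n. if n \<in> S then 1 else 0) (\<lambda>n. if n \<in> S then 1 else 0) n
    = (\<Sum>z\<in>{(d, t). d \<in> {1..N} \<and> t \<in> {1..N} \<and> d * t = n}. if z \<in> S \<times> S then 1 else 0)"
    unfolding dconv_def case_prod_beta by (rule sum.cong[OF refl]) (simp add: mem_Times_iff)
  also have "\<dots> = real (card ({(d, t). d \<in> {1..N} \<and> t \<in> {1..N} \<and> d * t = n} \<inter> (S \<times> S)))"
    using finite_factor_pairs by (subst sum.If_cases) simp_all
  also have "{(d, t). d \<in> {1..N} \<and> t \<in> {1..N} \<and> d * t = n} \<inter> (S \<times> S) = {z \<in> S \<times> S. fst z * snd z = n}"
    using S by auto
  finally show ?thesis .
qed

text \<open>For the uniform weight the energy counts quadruples with equal products.\<close>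

lemma conv_energy_indicator_image:
  assumes fin: "finite W" and inj: "inj_on f W" and SN: "f ` W \<subseteq> {1..N}"
  shows "conv_energy N (\<lambda>n. if n \<in> f ` W then 1 else 0) (\<lambda>n. if n \<in> f ` W then 1 else 0)
    = real (card (SIGMA w:W \<times> W. {w' \<in> W \<times> W. f (fst w') * f (snd w') = f (fst w) * f (snd w)}))"
proof -
  let ?P = "\<lambda>w. f (fst w) * f (snd w)"
  let ?Fib = "\<lambda>n. {w \<in> W \<times> W. ?P w = n}"
  let ?ind = "\<lambda>n. if n \<in> f ` W then 1 else 0 :: real"
  have inj2: "inj_on (map_prod f f) (W \<times> W)" by (rule map_prod_inj_on[OF inj inj])
  have im: "{z \<in> f ` W \<times> f ` W. fst z * snd z = n} = map_prod f f ` ?Fib n" for n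
    by (force simp: image_iff)
  have dc: "dconv N ?ind ?ind n = real (card (?Fib n))" for n
    unfolding dconv_indicator[OF SN] im
    by (rule arg_cong[of _ _ real], rule card_image, rule inj_on_subset[OF inj2]) simp
  have "conv_energy N ?ind ?ind = (\<Sum>n = 1..N\<^sup>2. \<Sum>w\<in>?Fib n. real (card (?Fib (?P w))))"
    unfolding conv_energy_def dc by (rule sum.cong[OF refl]) (simp add: power2_eq_square)
  also have "\<dots> = (\<Sum>w\<in>W \<times> W. real (card (?Fib (?P w))))"
  proof (rule sum.group)
    show "?P ` (W \<times> W) \<subseteq> {1..N\<^sup>2}"
    proof (rule image_subsetI)
      fix w assume "w \<in> W \<times> W"
      then have "f (fst w) \<in> {1..N}" "f (snd w) \<in> {1..N}"
        using SN by (simp_all add: image_subset_iff mem_Times_iff)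
      then show "?P w \<in> {1..N\<^sup>2}"
        using mult_le_mono[of "f (fst w)" N "f (snd w)" N] by (simp add: power2_eq_square Suc_le_eq)
    qed
  qed (use fin in simp_all)
  also have "\<dots> = real (card (SIGMA w:W \<times> W. ?Fib (?P w)))"
    using fin by (subst card_SigmaI) simp_all
  finally show ?thesis .
qed

lemma witness_energy:
  assumes T: "T * T \<le> N" and N: "N \<ge> 2" and ne: "witness_pairs N T k \<noteq> {}"
  defines "M \<equiv> real (card (witness_pairs N T k))"
  shows "\<exists>c. (\<forall>n. c n \<ge> 0) \<and> (\<Sum>n = 1..N. c n) = 1 \<and>
    conv_energy N c c \<le> (1 / M) ^ 4 * (2 * (4 * real N / ln (real N))\<^sup>2 * (\<Sum>t\<in>product_quads k T. quad_weight t))"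
proof -
  let ?W = "witness_pairs N T k"
  let ?S = "pair_prod ` ?W"
  define ind where "ind = (\<lambda>n. if n \<in> ?S then 1 else 0 :: real)"
  have finW: "finite ?W" by (rule card_witness_pairs)
  have M: "M > 0" unfolding M_def using finW ne by (simp add: card_gt_0_iff)
  have inj: "inj_on pair_prod ?W" by (rule inj_on_pair_prod[OF T])
  have SN: "?S \<subseteq> {1..N}" by (rule image_subsetI) (rule witness_pair_facts(3)[OF T])
  have ce: "conv_energy N ind ind = real (card (solution_quads N T k))"
    unfolding ind_def solution_quads_def by (rule conv_energy_indicator_image[OF finW inj SN])
  define c where "c = (\<lambda>n. (1 / M) * ind n)"
  have "conv_energy N c c = (1 / M) ^ 4 * conv_energy N ind ind"
  proof -
    have "dconv N c c n = (1 / M)\<^sup>2 * dconv N ind ind n" for n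
      unfolding dconv_def c_def sum_distrib_left by (rule sum.cong[OF refl]) (simp add: power2_eq_square case_prod_beta)
    then show ?thesis
      unfolding conv_energy_def sum_distrib_left by (simp add: power_mult_distrib flip: power_mult)
  qed
  also have "\<dots> \<le> (1 / M) ^ 4 * (2 * (4 * real N / ln (real N))\<^sup>2 * (\<Sum>t\<in>product_quads k T. quad_weight t))"
    unfolding ce by (intro mult_left_mono card_solution_quads_le[OF T N]) (use M in auto)
  finally have 1: "conv_energy N c c \<le> (1 / M) ^ 4 * (2 * (4 * real N / ln (real N))\<^sup>2 * (\<Sum>t\<in>product_quads k T. quad_weight t))" .
  have "(\<Sum>n = 1..N. ind n) = real (card ({1..N} \<inter> ?S))" unfolding ind_def by (subst sum.If_cases) auto
  also have "{1..N} \<inter> ?S = ?S" using SN by blast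
  also have "real (card ?S) = M" unfolding M_def using card_image[OF inj] by simp
  finally have "(\<Sum>n = 1..N. c n) = 1" unfolding c_def using M by (simp flip: sum_divide_distrib)
  moreover have "c n \<ge> 0" for n unfolding c_def ind_def using M by simp
  ultimately show ?thesis using 1 by blast
qed

section \<open>Choice of the number of small prime factors\<close>

text \<open>Stirling's upper bound with the correct power of \<open>k\<close>: the sequence \<open>k! e^k /
  k^(k + 1/2)\<close> decreases since \<open>(k + 1/2) ln (1 + 1/k) \<ge> 1\<close>.\<close>

lemma ln_fact_le:
  assumes "k \<ge> 1"
  shows "ln (fact k :: real) \<le> 1 + (real k + 1 / 2) * ln (real k) - real k"
  using assms
proof (induction k rule: nat_induct_at_least)
  case base
  then show ?case by simp
next
  case (Suc k)
  define x where "x = real k"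
  have x: "x \<ge> 1" using Suc.hyps by (simp add: x_def)
  define g where "g = (\<lambda>y::real. ln (1 + y) - 2 * y / (2 + y))"
  have "g 0 \<le> g (1 / x)"
  proof (rule DERIV_nonneg_imp_nondecreasing[of 0 "1 / x" g])
    show "0 \<le> 1 / x" using x by simp
    fix y :: real assume "0 \<le> y" "y \<le> 1 / x"
    have "(g has_real_derivative (1 / (1 + y) - (2 * (2 + y) - 2 * y) / (2 + y)\<^sup>2)) (at y)"
      unfolding g_def using \<open>0 \<le> y\<close> by (auto intro!: derivative_eq_intros simp: power2_eq_square)
    moreover have "0 \<le> 1 / (1 + y) - (2 * (2 + y) - 2 * y) / (2 + y)\<^sup>2"
      using \<open>0 \<le> y\<close> by (simp add: divide_simps power2_eq_square) (simp add: algebra_simps)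
    ultimately show "\<exists>d. (g has_real_derivative d) (at y) \<and> 0 \<le> d" by blast
  qed
  then have 1: "2 * (1 / x) / (2 + 1 / x) \<le> ln (1 + 1 / x)" by (simp add: g_def)
  have "1 + 1 / x = (x + 1) / x" using x by (simp add: field_simps)
  then have 2: "ln (1 + 1 / x) = ln (x + 1) - ln x" using x by (simp add: ln_divide_pos)
  have "2 * (1 / x) / (2 + 1 / x) * (x + 1 / 2) = 1"
    using x by (simp add: divide_simps)
  then have 3: "1 \<le> (ln (x + 1) - ln x) * (x + 1 / 2)"
    using mult_right_mono[OF 1, of "x + 1 / 2"] x 2 by simp
  have "ln (fact (Suc k) :: real) = ln (x + 1) + ln (fact k :: real)"
    by (simp add: ln_mult x_def add.commute)
  also have "\<dots> \<le> ln (x + 1) + (1 + (x + 1 / 2) * ln x - x)" using Suc.IH by (simp add: x_def)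
  also have "\<dots> \<le> 1 + (x + 1 + 1 / 2) * ln (x + 1) - (x + 1)" using 3 by (simp add: algebra_simps)
  finally show ?case by (simp add: x_def add_ac)
qed

text \<open>This is where the exponent comes from: with \<open>k\<close> about \<open>X / u\<close>,
  Stirling's formula turns \<open>k! / X^k\<close> into \<open>(1 / (e u))^k\<close>, up to
  \<open>sqrt k\<close>.\<close>

lemma fact_over_power_le:
  assumes k: "k \<ge> 1" and X: "real k * unit_gap \<le> X" "X \<le> real k * unit_gap + 1 + unit_gap"
  shows "(fact k / X ^ k)\<^sup>2 \<le> exp 20 * X * exp (- (2 * (1 + ln unit_gap) / unit_gap) * X)"
proof -
  define u where "u = unit_gap"
  define x where "x = real k"
  have u: "126 / 100 \<le> u" "u \<le> 152 / 100" using unit_gap_bounds by (simp_all add: u_def)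
  have x: "x \<ge> 1" using k by (simp add: x_def)
  have ux: "u * x \<le> X" "X \<le> u * x + 1 + u" using X by (simp_all add: u_def x_def mult.commute)
  have "1 * x \<le> u * x" using u x by (intro mult_right_mono) auto
  then have X0: "X \<ge> x" "X > 0" using ux x by linarith+
  have lu: "0 \<le> ln u" "ln u \<le> 1" using u ln_le_minus_one[of u] by auto
  have lX: "ln X \<ge> ln u + ln x"
  proof -
    have "ln (u * x) \<le> ln X" using ux X0 u x by (subst ln_le_cancel_iff) auto
    then show ?thesis using u x by (simp add: ln_mult)
  qed
  have "ln ((fact k / X ^ k)\<^sup>2) = 2 * (ln (fact k) - x * ln X)"
    using X0 by (simp add: ln_realpow ln_divide_pos x_def)
  also have "\<dots> \<le> 2 * (1 + (x + 1 / 2) * ln x - x - x * (ln u + ln x))"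
  proof -
    have "x * (ln u + ln x) \<le> x * ln X" using lX x by (intro mult_left_mono) auto
    then show ?thesis using ln_fact_le[OF k] unfolding x_def[symmetric] by (simp add: algebra_simps)
  qed
  also have "\<dots> = 2 + ln x - 2 * x * (1 + ln u)" by (simp add: algebra_simps)
  also have "\<dots> \<le> 20 + ln X - 2 * (1 + ln u) / u * X"
  proof -
    have "X / u \<le> x + 3" using ux u by (simp add: field_simps)
    then have "2 * (1 + ln u) * (X / u) \<le> 2 * (1 + ln u) * (x + 3)" using lu by (intro mult_left_mono) auto
    also have "\<dots> = 2 * x * (1 + ln u) + 6 * (1 + ln u)" by (simp add: algebra_simps)
    also have "\<dots> \<le> 2 * x * (1 + ln u) + 12" using lu by simp
    finally have "2 * (1 + ln u) / u * X \<le> 2 * x * (1 + ln u) + 12" by simp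
    moreover have "ln x \<le> ln X" using X0 x by simp
    ultimately show ?thesis by linarith
  qed
  finally have "ln ((fact k / X ^ k)\<^sup>2) \<le> 20 + ln X - 2 * (1 + ln u) / u * X" .
  then have "exp (ln ((fact k / X ^ k)\<^sup>2)) \<le> exp (20 + ln X - 2 * (1 + ln u) / u * X)" by (simp only: exp_le_cancel_iff)
  moreover have "exp (ln ((fact k / X ^ k)\<^sup>2)) = (fact k / X ^ k)\<^sup>2" using X0 by (intro exp_ln) simp
  moreover have "exp (20 + ln X - 2 * (1 + ln u) / u * X) = exp 20 * X * exp (- (2 * (1 + ln u) / u) * X)"
    using X0 by (simp add: exp_add exp_diff exp_minus divide_inverse)
  ultimately show ?thesis by (simp add: u_def)
qed

lemma unit_gap_exponent: "2 - 2 * (1 + ln unit_gap) / unit_gap = delta_exp"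
proof -
  have l: "ln (2::real) > 0" by simp
  have "ln unit_gap = ln 2 + ln (ln 2)" unfolding unit_gap_def using l by (subst ln_mult) auto
  then show ?thesis unfolding delta_exp_def unit_gap_def using l by (simp add: field_simps)
qed

text \<open>Positivity is \<open>ln y < y - 1\<close> at \<open>y = ln 2\<close>. The upper bound
  \<open>1/2\<close> is what makes the energy bound strong enough for shrinking supports.\<close>

lemma delta_exp_bounds: "0 < delta_exp" "delta_exp < 1 / 2"
proof -
  define y where "y = ln (2::real)"
  have y: "63 / 100 \<le> y" "y \<le> 76 / 100" using ln2_bounds by (simp_all add: y_def)
  have d: "delta_exp = (y - 1 - ln y) / y" unfolding delta_exp_def y_def by (simp add: field_simps)
  have "ln y < y - 1" using ln_le_minus_one[of y] ln_eq_minus_one[of y] y by fastforce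
  then show "0 < delta_exp" unfolding d using y by simp
  have "ln y \<ge> 1 - 1 / y" using ln_le_minus_one[of "1 / y"] y by (simp add: ln_divide_pos)
  then have "y - 1 - ln y \<le> y + 1 / y - 2" by simp
  also have "\<dots> < y / 2"
  proof -
    have "y * y / 2 + 1 < 2 * y"
    proof -
      have "(y - 63 / 100) * (y - 76 / 100) \<le> 0" using y by (intro mult_nonneg_nonpos) auto
      moreover have "(y - 63 / 100) * (y - 76 / 100) = y * y - 139 / 100 * y + 4788 / 10000" by (simp add: field_simps)
      ultimately show ?thesis using y by linarith
    qed
    then show ?thesis using y by (simp add: field_simps)
  qed
  finally show "delta_exp < 1 / 2" unfolding d using y by (simp add: field_simps)
qed

text \<open>\<open>k\<close> is as large as possible such that the simplex still has a gap of at least 1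
  left.\<close>

lemma gap_index:
  assumes "X \<ge> 6"
  obtains k where "k \<ge> 2" "real k * unit_gap + 1 \<le> X" "X \<le> real k * unit_gap + 1 + unit_gap" "real k \<le> X"
proof
  let ?k = "nat \<lfloor>(X - 1) / unit_gap\<rfloor>"
  have u: "unit_gap > 0" "1 \<le> unit_gap" "unit_gap \<le> 152 / 100" using unit_gap_bounds by auto
  have k: "real ?k = of_int \<lfloor>(X - 1) / unit_gap\<rfloor>" using assms u by simp
  have k2: "real ?k \<le> (X - 1) / unit_gap" "(X - 1) / unit_gap < real ?k + 1" unfolding k by linarith+
  show a: "real ?k * unit_gap + 1 \<le> X" using k2(1) u by (simp add: field_simps)
  show b: "X \<le> real ?k * unit_gap + 1 + unit_gap" using k2(2) u by (simp add: field_simps)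
  have "real ?k * 1 \<le> real ?k * unit_gap" using u by (intro mult_left_mono) auto
  then show "real ?k \<le> X" using a by linarith
  show "?k \<ge> 2"
  proof (rule ccontr)
    assume "\<not> 2 \<le> ?k"
    then have "real ?k * unit_gap \<le> 1 * unit_gap" using u by (intro mult_right_mono) auto
    then show False using b u assms by linarith
  qed
qed

lemma sparse_volume_ge:
  assumes k: "k \<ge> 1" and X: "real k * unit_gap + 1 \<le> prime_clock T"
  shows "prime_clock T ^ (k - 1) / fact k \<le> sparse_volume k T"
proof -
  obtain j where j: "k = Suc j" using k by (cases k) auto
  have "prime_clock T ^ j * 1 \<le> prime_clock T ^ j * (prime_clock T - real (Suc j) * unit_gap)"
    using X unfolding j by (intro mult_left_mono) (auto simp: prime_clock_nonneg)
  then have "prime_clock T ^ (k - 1) / fact k \<le> simplex_volume k (prime_clock T)"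
    unfolding j simplex_volume.simps by (intro divide_right_mono) auto
  then show ?thesis using sparse_volume_lower[of k T] by linarith
qed

lemma power_shift_le:
  fixes X a :: real
  assumes "X > 0" "a \<ge> 0" "real n \<le> X"
  shows "(X + a) ^ n \<le> exp a * X ^ n"
proof -
  have "X + a = X * (1 + a / X)" using assms by (simp add: field_simps)
  also have "\<dots> \<le> X * exp (a / X)" using assms by (intro mult_left_mono exp_ge_add_one_self) auto
  finally have "(X + a) ^ n \<le> (X * exp (a / X)) ^ n" using assms by (intro power_mono) auto
  also have "\<dots> = X ^ n * exp (real n * (a / X))" by (simp only: power_mult_distrib exp_of_nat_mult)
  also have "real n * (a / X) \<le> a" using assms by (simp add: divide_simps) (metis mult.commute mult_left_mono)
  then have "X ^ n * exp (real n * (a / X)) \<le> X ^ n * exp a" using assms by (intro mult_left_mono) auto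
  finally show ?thesis by (simp add: mult.commute)
qed

text \<open>Passing from \<open>k\<close> to \<open>k + 1\<close> elements loses at most a constant factor,
  because \<open>X\<close> exceeds \<open>k u\<close> by a bounded amount and \<open>k\<close>
  does not exceed \<open>X\<close>.\<close>

lemma sparse_volume_ratio:
  assumes k: "real (Suc k) * unit_gap + 1 \<le> prime_clock T" "prime_clock T \<le> real (Suc k) * unit_gap + 1 + unit_gap"
    and k1: "k \<ge> 1" and kX: "real (Suc k) \<le> prime_clock T"
  shows "sparse_volume k T \<le> 7 * exp 3 * sparse_volume (Suc k) T"
proof -
  obtain j where j: "k = Suc j" using k1 by (cases k) auto
  define X where "X = prime_clock T"
  define Z where "Z = prime_recip T + 1 / 4"
  have u: "126 / 100 \<le> unit_gap" "unit_gap \<le> 152 / 100" by (rule unit_gap_bounds)+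
  have X: "X > 0" using kX by (simp add: X_def)
  have Z: "0 \<le> Z" "Z \<le> X + 3" using prime_recip_le_clock[of T] prime_recip_nonneg[of T] by (auto simp: Z_def X_def)
  have kk: "real (Suc k) = real k + 1" by simp
  have "Z - real k * unit_gap \<le> 7"
    using k(2) Z(2) u prime_recip_le_clock[of T] unfolding kk X_def Z_def by (simp add: algebra_simps)
  then have "simplex_volume k Z \<le> Z ^ j * 7 / fact k"
    unfolding j simplex_volume.simps using Z(1) by (intro divide_right_mono mult_left_mono) auto
  also have "\<dots> \<le> (exp 3 * X ^ j) * 7 / fact k"
  proof (intro divide_right_mono mult_right_mono)
    have "Z ^ j \<le> (X + 3) ^ j" using Z by (intro power_mono) auto
    also have "\<dots> \<le> exp 3 * X ^ j" using kX X unfolding j X_def[symmetric] by (intro power_shift_le) auto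
    finally show "Z ^ j \<le> exp 3 * X ^ j" .
  qed auto
  also have "\<dots> \<le> 7 * exp 3 * (X ^ k / fact (Suc k))"
  proof -
    have "X ^ j * real (Suc k) \<le> X ^ j * X" using kX X unfolding X_def[symmetric] by (intro mult_left_mono) auto
    then have "X ^ j * real (Suc k) / (real (Suc k) * fact k) \<le> X ^ j * X / (real (Suc k) * fact k)"
      by (intro divide_right_mono) auto
    then have "X ^ j / fact k \<le> X ^ k / fact (Suc k)"
      unfolding fact_Suc j by (simp add: mult.commute)
    then have "7 * exp 3 * (X ^ j / fact k) \<le> 7 * exp 3 * (X ^ k / fact (Suc k))" by (intro mult_left_mono) auto
    then show ?thesis by (simp add: mult_ac)
  qed
  also have "\<dots> \<le> 7 * exp 3 * sparse_volume (Suc k) T"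
    using sparse_volume_ge[of "Suc k" T] k(1) by (intro mult_left_mono) (auto simp: X_def)
  finally show ?thesis
    using sparse_volume_upper[of k T] sparse_volume_nonneg[of "Suc k" T] unfolding Z_def[symmetric] by (smt (verit) exp_gt_zero mult_nonneg_nonneg)
qed

section \<open>Lower bound for the number of witnesses\<close>

text \<open>If \<open>m^4 \<le> N\<close>, the primes in the top block below \<open>N / m\<close> are still
  larger than \<open>sqrt N\<close>.\<close>

lemma card_large_cofactors_ge:
  assumes m: "m \<ge> 1" "m ^ 4 \<le> N" and N: "N > 512 ^ 4"
  shows "real N / (1024 * real m * ln (real N)) \<le> real (card (large_cofactors N m))"
proof -
  define z where "z = N div m"
  have key: "N < (z + 1) * m"
    unfolding z_def using dividend_less_div_times[of m N] m by (simp add: algebra_simps)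
  have small: False if q: "N < 512 * q * m" "q * q \<le> N" for q
  proof -
    have "N ^ 4 < (512 * q * m) ^ 4" using q by (intro power_strict_mono) auto
    also have "\<dots> = 512 ^ 4 * ((q * q) ^ 2 * m ^ 4)" by (simp add: power_mult_distrib power2_eq_square power4_eq_xxxx)
    also have "\<dots> \<le> 512 ^ 4 * (N ^ 2 * N)" using q m by (intro mult_le_mono power_mono) auto
    also have "\<dots> \<le> N * (N ^ 2 * N)" using N by (intro mult_le_mono1) auto
    also have "\<dots> = N ^ 4" by (simp add: power2_eq_square power4_eq_xxxx)
    finally show False by simp
  qed
  have z: "z \<ge> 512"
  proof (rule ccontr)
    assume "\<not> z \<ge> 512"
    then have "(z + 1) * m \<le> 512 * 1 * m" by (intro mult_le_mono1) auto
    then have "N < 512 * 1 * m" using key by linarith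
    then show False using small[of 1] N by simp
  qed
  have zm: "z * m \<le> N" unfolding z_def by simp
  have "{q. prime q \<and> z div 512 < q \<and> q \<le> z} \<subseteq> large_cofactors N m"
  proof
    fix q assume "q \<in> {q. prime q \<and> z div 512 < q \<and> q \<le> z}"
    then have q: "prime q" "z div 512 < q" "q \<le> z" by auto
    have "z + 1 \<le> 512 * q" using q(2) by linarith
    then have "(z + 1) * m \<le> 512 * q * m" by (rule mult_le_mono1)
    then have "N < 512 * q * m" using key by (rule less_le_trans[rotated])
    then have "N < q * q" using small[of q] by (meson not_le)
    moreover have "q * m \<le> N" using mult_le_mono1[OF q(3), of m] zm by linarith
    ultimately show "q \<in> large_cofactors N m" using q by (simp add: large_cofactors_def)
  qed
  then have "card {q. prime q \<and> z div 512 < q \<and> q \<le> z} \<le> card (large_cofactors N m)"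
    by (rule card_mono[OF finite_large_cofactors[OF m(1)]])
  then have 1: "real z / (512 * ln (real z)) \<le> real (card (large_cofactors N m))"
    using card_primes_between_ge[OF z] by linarith
  have "z * 1 \<le> z * m" using m by (intro mult_le_mono2) auto
  then have zN: "z \<le> N" using zm by linarith
  have L: "ln (real z) > 0" "ln (real z) \<le> ln (real N)" using z zN by auto
  have "(z + 1) * m \<le> 2 * z * m" using z by (intro mult_le_mono1) auto
  then have "real N \<le> real (2 * z * m)" using key by (subst of_nat_le_iff) linarith
  then have "real N / (2 * real m) \<le> real z" using m by (simp add: field_simps)
  then have "real N / (2 * real m) / (512 * ln (real N)) \<le> real z / (512 * ln (real z))"
    using L z by (intro frac_le) auto
  then show ?thesis using 1 by (simp add: mult_ac)
qed

text \<open>Markov's inequality: at most half of the volume of the sparse family is carried by sets with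
  product above \<open>N^(1/4)\<close>. Each of the other sets has many cofactors.\<close>

lemma card_witness_pairs_ge:
  assumes T: "T \<ge> 1" and N: "N > 512 ^ 4"
    and ratio: "sparse_volume k T \<le> R * sparse_volume (Suc k) T" and R: "(ln (real T) + 2) * R \<le> ln (real N) / 8"
  shows "real N * sparse_volume (Suc k) T / (2048 * ln (real N)) \<le> real (card (witness_pairs N T (Suc k)))"
proof -
  define L where "L = ln (real N)"
  let ?F = "sparse_family (Suc k) T"
  let ?G = "{A \<in> ?F. (\<Prod>A) ^ 4 \<le> N}"
  let ?w = "\<lambda>A::nat set. 1 / real (\<Prod>A)"
  let ?W = "sparse_volume (Suc k) T"
  have L: "L > 0" unfolding L_def using N by simp
  have p1: "\<Prod>A \<ge> 1" if "A \<in> ?F" for A using that by (rule sparse_prod_ge_1)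
  have r1: "real (\<Prod>A) \<ge> 1" if "A \<in> ?F" for A using p1[OF that] by (subst of_nat_1[symmetric]) (simp only: of_nat_le_iff)
  have lnT: "ln (real T) + 2 \<ge> 0" using T by (auto simp: add_nonneg_nonneg)
  have "(\<Sum>A\<in>?F - ?G. ?w A) * (L / 4) = (\<Sum>A\<in>?F - ?G. L / 4 * ?w A)"
    unfolding sum_distrib_right by (simp add: mult.commute)
  also have "\<dots> \<le> (\<Sum>A\<in>?F - ?G. ln (real (\<Prod>A)) / real (\<Prod>A))"
  proof (rule sum_mono)
    fix A assume A: "A \<in> ?F - ?G"
    then have "N \<le> (\<Prod>A) ^ 4" by auto
    then have "real N \<le> real (\<Prod>A) ^ 4" by (metis of_nat_le_iff of_nat_power)
    moreover have "real (\<Prod>A) \<ge> 1" using r1 A by (simp only: Diff_iff)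
    ultimately have "L \<le> ln (real (\<Prod>A) ^ 4)" unfolding L_def using N by (subst ln_le_cancel_iff) auto
    also have "\<dots> = 4 * ln (real (\<Prod>A))" using \<open>real (\<Prod>A) \<ge> 1\<close> by (simp add: ln_realpow)
    finally have "L / 4 \<le> ln (real (\<Prod>A))" by simp
    then have "L / 4 * ?w A \<le> ln (real (\<Prod>A)) * ?w A" using \<open>real (\<Prod>A) \<ge> 1\<close> by (intro mult_right_mono divide_nonneg_nonneg) linarith+
    then show "L / 4 * ?w A \<le> ln (real (\<Prod>A)) / real (\<Prod>A)" by simp
  qed
  also have "\<dots> \<le> (\<Sum>A\<in>?F. ln (real (\<Prod>A)) / real (\<Prod>A))"
  proof (rule sum_mono2)
    fix A assume "A \<in> ?F - (?F - ?G)"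
    then have "real (\<Prod>A) \<ge> 1" using r1 by (simp only: Diff_iff)
    then show "0 \<le> ln (real (\<Prod>A)) / real (\<Prod>A)" by (intro divide_nonneg_nonneg ln_ge_zero of_nat_0_le_iff)
  qed simp_all
  also have "\<dots> \<le> (ln (real T) + 2) * sparse_volume k T" by (rule sum_ln_sparse_family_le[OF T])
  also have "\<dots> \<le> (ln (real T) + 2) * (R * ?W)" using ratio lnT by (rule mult_left_mono)
  also have "\<dots> = ((ln (real T) + 2) * R) * ?W" by simp
  also have "\<dots> \<le> (L / 8) * ?W" unfolding L_def using R sparse_volume_nonneg by (rule mult_right_mono)
  finally have "(\<Sum>A\<in>?F - ?G. ?w A) * (L / 4) \<le> (L / 8) * ?W" .
  then have half: "(\<Sum>A\<in>?F - ?G. ?w A) \<le> ?W / 2" using L by (simp add: field_simps)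
  have "?W = (\<Sum>A\<in>?F - ?G. ?w A) + (\<Sum>A\<in>?G. ?w A)"
    unfolding sparse_volume_def by (rule sum.subset_diff) simp_all
  then have good: "(\<Sum>A\<in>?G. ?w A) \<ge> ?W / 2" using half by linarith
  have "real N * ?W / (2048 * L) = (real N / (1024 * L)) * (?W / 2)" by simp
  also have "\<dots> \<le> (real N / (1024 * L)) * (\<Sum>A\<in>?G. ?w A)" using good L by (intro mult_left_mono) auto
  also have "\<dots> = (\<Sum>A\<in>?G. real N / (1024 * real (\<Prod>A) * L))" unfolding sum_distrib_left by (simp add: mult_ac)
  also have "\<dots> \<le> (\<Sum>A\<in>?G. real (card (large_cofactors N (\<Prod>A))))"
    unfolding L_def
  proof (rule sum_mono)
    fix A assume "A \<in> ?G"
    then have "A \<in> ?F" "(\<Prod>A) ^ 4 \<le> N" by simp_all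
    then show "real N / (1024 * real (\<Prod>A) * ln (real N)) \<le> real (card (large_cofactors N (\<Prod>A)))"
      using card_large_cofactors_ge[OF p1 _ N] by blast
  qed
  also have "\<dots> \<le> (\<Sum>A\<in>?F. real (card (large_cofactors N (\<Prod>A))))" by (rule sum_mono2) simp_all
  also have "\<dots> = real (card (witness_pairs N T (Suc k)))" unfolding card_witness_pairs by simp
  finally show ?thesis unfolding L_def .
qed

text \<open>The powers of all parameters are collected here once, with \<open>F = X^k / k!\<close> and
  \<open>J\<close> the number of scales.\<close>

lemma witness_energy_algebra:
  fixes Nr L X F M Q J :: real
  assumes pos: "Nr > 0" "L > 0" "X > 0" "F > 0" "J \<ge> 0" "M \<ge> Nr * (F / X) / (2048 * L)" and Q: "Q \<le> 2 * (J * (2 * exp 6 * (3 * (exp 4 * F\<^sup>2))))"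
  shows "Nr\<^sup>2 * ((1 / M) ^ 4 * (2 * (4 * Nr / L)\<^sup>2 * Q)) \<le> (2048 ^ 4 * 384 * exp 10) * (J * L\<^sup>2 * X ^ 4 * (1 / F)\<^sup>2)"
proof -
  define M0 where "M0 = Nr * (F / X) / (2048 * L)"
  have M0: "M0 > 0" "M \<ge> M0" using pos by (auto simp: M0_def)
  have "1 / M \<le> 1 / M0" using M0 by (intro divide_left_mono) auto
  then have "(1 / M) ^ 4 \<le> (1 / M0) ^ 4" using M0 by (intro power_mono) auto
  then have "Nr\<^sup>2 * ((1 / M) ^ 4 * (2 * (4 * Nr / L)\<^sup>2 * Q)) \<le> Nr\<^sup>2 * ((1 / M0) ^ 4 * (2 * (4 * Nr / L)\<^sup>2 * (2 * (J * (2 * exp 6 * (3 * (exp 4 * F\<^sup>2)))))))"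
  proof -
    have a: "2 * (4 * Nr / L)\<^sup>2 * Q \<le> 2 * (4 * Nr / L)\<^sup>2 * (2 * (J * (2 * exp 6 * (3 * (exp 4 * F\<^sup>2)))))"
      using Q by (intro mult_left_mono) auto
    have b: "0 \<le> 2 * (4 * Nr / L)\<^sup>2 * (2 * (J * (2 * exp 6 * (3 * (exp 4 * F\<^sup>2)))))" using pos by auto
    have "(1 / M) ^ 4 * (2 * (4 * Nr / L)\<^sup>2 * Q) \<le> (1 / M) ^ 4 * (2 * (4 * Nr / L)\<^sup>2 * (2 * (J * (2 * exp 6 * (3 * (exp 4 * F\<^sup>2))))))"
      using a by (rule mult_left_mono) (use M0 in simp)
    also have "\<dots> \<le> (1 / M0) ^ 4 * (2 * (4 * Nr / L)\<^sup>2 * (2 * (J * (2 * exp 6 * (3 * (exp 4 * F\<^sup>2))))))"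
      using \<open>(1 / M) ^ 4 \<le> (1 / M0) ^ 4\<close> b by (rule mult_right_mono)
    finally show ?thesis by (intro mult_left_mono) auto
  qed
  also have "\<dots> = 2048 ^ 4 * 384 * (exp 6 * exp 4) * (J * L\<^sup>2 * X ^ 4 * (1 / F)\<^sup>2)"
    unfolding M0_def using pos by (simp add: field_simps power2_eq_square power4_eq_xxxx)
  also have "exp 6 * exp 4 = (exp 10 :: real)" by (simp flip: exp_add)
  finally show ?thesis .
qed

text \<open>The number of witnesses is at least \<open>N F / (X log N)\<close> and the weighted number of
  quadruples is at most \<open>J F^2\<close>, up to constants; the four factors \<open>X\<close>
  are lost from the number of witnesses.\<close>

lemma energy_le_of_clock:
  assumes k1: "k \<ge> 1" and X: "real (Suc k) * unit_gap + 1 \<le> prime_clock T" "prime_clock T \<le> real (Suc k) * unit_gap + 1 + unit_gap"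
    and kX: "real (Suc k) \<le> prime_clock T"
    and T: "T \<ge> 1" "T * T \<le> N" and N: "N > 512 ^ 4" and R: "(ln (real T) + 2) * (7 * exp 3) \<le> ln (real N) / 8"
    and I: "\<And>A. A \<in> sparse_family (Suc k) T \<Longrightarrow> \<Prod>A \<le> tower I"
  shows "\<exists>c. (\<forall>n. c n \<ge> 0) \<and> (\<Sum>n = 1..N. c n) = 1 \<and> weighted_energy N c
    \<le> (2048 ^ 4 * 384 * exp 10) * (real (I + 1) * (ln (real N))\<^sup>2 * prime_clock T ^ 4 * (fact (Suc k) / prime_clock T ^ Suc k)\<^sup>2)"
proof -
  define L where "L = ln (real N)"
  define Xc where "Xc = prime_clock T"
  define F where "F = Xc ^ Suc k / fact (Suc k)"
  define Y where "Y = prime_recip T"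
  have Xc: "Xc > 0" "real (Suc k) \<le> Xc" using kX by (simp_all add: Xc_def)
  have L: "L > 0" unfolding L_def using N by simp
  have F: "F > 0" unfolding F_def using Xc by simp
  have Y: "0 \<le> Y" "Y \<le> Xc + 2" unfolding Y_def Xc_def by (rule prime_recip_nonneg prime_recip_le_clock)+
  have vol: "F / Xc \<le> sparse_volume (Suc k) T"
    using sparse_volume_ge[OF _ X(1)] Xc unfolding F_def Xc_def[symmetric] by simp
  have M: "real N * (F / Xc) / (2048 * L) \<le> real (card (witness_pairs N T (Suc k)))"
  proof -
    have "real N * (F / Xc) / (2048 * L) \<le> real N * sparse_volume (Suc k) T / (2048 * L)"
      using vol L by (intro divide_right_mono mult_left_mono) auto
    also have "\<dots> \<le> real (card (witness_pairs N T (Suc k)))"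
      unfolding L_def by (rule card_witness_pairs_ge[OF T(1) N sparse_volume_ratio[OF X k1 kX] R])
    finally show ?thesis .
  qed
  moreover have "real N * (F / Xc) / (2048 * L) > 0" using N F Xc L by simp
  ultimately have ne: "witness_pairs N T (Suc k) \<noteq> {}" by (intro notI) simp
  have "Y ^ Suc k \<le> (Xc + 2) ^ Suc k" using Y by (intro power_mono) auto
  also have "\<dots> \<le> exp 2 * Xc ^ Suc k" using Xc by (intro power_shift_le) auto
  finally have a: "Y ^ Suc k / fact (Suc k) \<le> exp 2 * F" unfolding F_def using divide_right_mono[of _ _ "fact (Suc k)"] by fastforce
  have "Y ^ k \<le> (Xc + 2) ^ k" using Y by (intro power_mono) auto
  also have "\<dots> \<le> exp 2 * Xc ^ k" using Xc by (intro power_shift_le) auto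
  finally have "Y ^ k / fact k \<le> exp 2 * Xc ^ k / fact k" by (rule divide_right_mono) simp
  also have "\<dots> = exp 2 * (Xc ^ k * real (Suc k) / fact (Suc k))" by (simp add: fact_Suc del: of_nat_Suc)
  also have "\<dots> \<le> exp 2 * (Xc ^ k * Xc / fact (Suc k))" using Xc by (intro mult_left_mono divide_right_mono) auto
  also have "\<dots> = exp 2 * F" by (simp add: F_def mult.commute)
  finally have b: "shifted_simplex Y (Suc k) \<le> exp 2 * F" by (simp add: shifted_simplex_def)
  have e4: "(exp 2 * F)\<^sup>2 = exp 4 * F\<^sup>2" by (simp add: power_mult_distrib flip: exp_double)
  have "(Y ^ Suc k / fact (Suc k))\<^sup>2 \<le> (exp 2 * F)\<^sup>2" using a Y by (intro power_mono) auto
  moreover have "(shifted_simplex Y (Suc k))\<^sup>2 \<le> (exp 2 * F)\<^sup>2" using b Y by (intro power_mono) (auto simp: shifted_simplex_def)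
  ultimately have ab: "2 * (Y ^ Suc k / fact (Suc k))\<^sup>2 + (shifted_simplex Y (Suc k))\<^sup>2 \<le> 3 * (exp 4 * F\<^sup>2)" unfolding e4 by linarith
  have Q: "(\<Sum>t\<in>product_quads (Suc k) T. quad_weight t) \<le> 2 * (real (I + 1) * (2 * exp 6 * (3 * (exp 4 * F\<^sup>2))))"
    by (rule order_trans[OF quad_sum_le[OF I]]) (use ab in \<open>auto simp: Y_def intro!: mult_left_mono\<close>)
  obtain c where c: "\<forall>n. c n \<ge> 0" "(\<Sum>n = 1..N. c n) = 1" and ce:
    "conv_energy N c c \<le> (1 / real (card (witness_pairs N T (Suc k)))) ^ 4 * (2 * (4 * real N / L)\<^sup>2 * (\<Sum>t\<in>product_quads (Suc k) T. quad_weight t))"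
    using witness_energy[OF T(2) _ ne] N unfolding L_def by auto
  have "weighted_energy N c \<le> (real N)\<^sup>2 * ((1 / real (card (witness_pairs N T (Suc k)))) ^ 4 * (2 * (4 * real N / L)\<^sup>2 * (\<Sum>t\<in>product_quads (Suc k) T. quad_weight t)))"
    unfolding weighted_energy_eq using ce by (intro mult_left_mono) auto
  also have "\<dots> \<le> (2048 ^ 4 * 384 * exp 10) * (real (I + 1) * L\<^sup>2 * Xc ^ 4 * (1 / F)\<^sup>2)"
    by (rule witness_energy_algebra[OF _ L Xc(1) F _ M Q]) (use N in auto)
  finally show ?thesis using c unfolding F_def L_def Xc_def by (intro exI[of _ c]) simp
qed

section \<open>Upper bound for the minimal energy\<close>

lemma clock_bounds:
  assumes C: "C \<ge> 1" and L: "exp (L / C) \<ge> 3" "exp (L / C) - 1 \<ge> exp (L / (2 * C))" "L > 0"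
  defines "T \<equiv> nat \<lfloor>exp (L / C)\<rfloor>"
  shows "T \<ge> 3" "real T \<le> exp (L / C)" "ln L - (ln (2 * C) + 3) \<le> prime_clock T" "prime_clock T \<le> ln L + 5"
proof -
  have fl: "real T = of_int \<lfloor>exp (L / C)\<rfloor>" unfolding T_def by simp
  show T: "T \<ge> 3" unfolding T_def using L(1) by linarith
  show T2: "real T \<le> exp (L / C)" unfolding fl by linarith
  have "exp (L / C) - 1 \<le> real T" unfolding fl by linarith
  then have "exp (L / (2 * C)) \<le> real T" using L(2) by linarith
  then have l1: "L / (2 * C) \<le> ln (real T)" using T by (subst ln_ge_iff) auto
  have l2: "ln (real T) \<le> L / C" using T2 T ln_le_cancel_iff[of "real T" "exp (L / C)"] by simp
  have "L / C \<le> L" using C L(3) by (simp add: field_simps)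
  then have l3: "ln (real T) \<le> L" using l2 by linarith
  have lT: "ln (real T) > 0" using T by simp
  have "ln (L / (2 * C)) \<le> ln (ln (real T))" using l1 L(3) C lT by (subst ln_le_cancel_iff) auto
  then have "ln L - ln (2 * C) \<le> ln (ln (real T))" using L(3) C by (simp add: ln_divide_pos)
  moreover have "ln (ln (real T)) - 1 \<le> prime_recip T" using T by (intro prime_recip_lower) auto
  ultimately show "ln L - (ln (2 * C) + 3) \<le> prime_clock T" using prime_recip_le_clock[of T] by linarith
  have "ln (ln (real T)) \<le> ln L" using l3 lT L(3) by (subst ln_le_cancel_iff) auto
  then show "prime_clock T \<le> ln L + 5" using prime_recip_upper[OF T] prime_clock_le[of T] by linarith
qed

lemma sparse_prod_le_tower:
  assumes A: "A \<in> sparse_family k T" and T: "T \<ge> 1" "ln (real T) \<le> L" and L: "L \<ge> 1" and k: "k \<ge> 1"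
  shows "\<Prod>A \<le> tower (nat \<lceil>ln (real k * L)\<rceil>)"
proof -
  let ?I = "nat \<lceil>ln (real k * L)\<rceil>"
  have A': "A \<subseteq> primes_le T" "card A = k" using A by (auto simp: sparse_family_def)
  have "1 * 1 \<le> real k * L" using k L by (intro mult_mono) auto
  then have kL: "real k * L \<ge> 1" by simp
  have "\<Prod>A \<le> (\<Prod>p\<in>A. T)"
    using A'(1) by (intro prod_mono) (auto simp: primes_le_def)
  then have "\<Prod>A \<le> T ^ k" using A'(2) by simp
  then have "real (\<Prod>A) \<le> real T ^ k" by (metis of_nat_le_iff of_nat_power)
  also have "\<dots> = exp (real k * ln (real T))" using T by (simp add: exp_of_nat_mult)
  also have "\<dots> \<le> exp (real k * L)" using T by (simp add: mult_left_mono)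
  also have "\<dots> = exp (exp (ln (real k * L)))" using kL by (subst exp_ln) auto
  also have "\<dots> \<le> exp (exp (real ?I))" unfolding exp_le_cancel_iff by linarith
  also have "\<dots> < real (tower ?I) + 1" by (rule tower_bounds)
  finally have "real (\<Prod>A) < real (tower ?I + 1)" by simp
  then have "\<Prod>A < tower ?I + 1" unfolding of_nat_less_iff .
  then show ?thesis by simp
qed

text \<open>Take small primes up to \<open>T = N^(1/C1)\<close>. The power \<open>(log log N)^6\<close>
  consists of the fourth power of the clock, one factor for the number of scales, and one from the
  square of \<open>sqrt k\<close> in Stirling's formula.\<close>

lemma energy_upper_bound:
  "\<exists>C N0. C > 0 \<and> (\<forall>N\<ge>N0. \<exists>c. (\<forall>n. c n \<ge> 0) \<and> (\<Sum>n = 1..N. c n) = 1 \<and>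
     weighted_energy N c \<le> C * (ln (real N) powr delta_exp * ln (ln (real N)) ^ 6))"
proof -
  \<comment> \<open>this makes ln T times the constant 7 exp 3 of the volume ratio at most (ln N) / 16\<close>
  define C1 :: real where "C1 = 112 * exp 3"
  \<comment> \<open>loss of the clock of T against log log N\<close>
  define C3 where "C3 = ln (2 * C1) + 3"
  define \<theta> where "\<theta> = 2 * (1 + ln unit_gap) / unit_gap"
  define K :: real where "K = 2048 ^ 4 * 384 * exp 10"
  define C where "C = K * (96 * exp 20 * exp (\<theta> * C3))"
  have C1: "C1 \<ge> 2" unfolding C1_def using exp_ge_add_one_self[of "3::real"] by simp
  have C1pos: "C1 > 0" using C1 by simp
  have \<theta>: "\<theta> > 0" unfolding \<theta>_def using unit_gap_bounds by (intro divide_pos_pos mult_pos_pos add_pos_nonneg) auto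
  have K: "K > 0" unfolding K_def by simp
  have C: "C > 0" unfolding C_def using K by simp
  have "eventually (\<lambda>N::nat. exp (ln (real N) / C1) \<ge> 3 \<and> exp (ln (real N) / C1) - 1 \<ge> exp (ln (real N) / (2 * C1))
      \<and> ln (ln (real N)) - C3 \<ge> 6 \<and> ln (ln (real N)) \<ge> 7 \<and> ln (real N) \<ge> 2 * C1 \<and> N > 512 ^ 4) at_top"
  proof (intro eventually_conj)
    show "eventually (\<lambda>N::nat. exp (ln (real N) / C1) \<ge> 3) at_top" using C1pos by real_asymp
    show "eventually (\<lambda>N::nat. exp (ln (real N) / C1) - 1 \<ge> exp (ln (real N) / (2 * C1))) at_top"
    proof -
      have "eventually (\<lambda>N::nat. exp (ln (real N) / (2 * C1)) \<ge> 2) at_top" using C1pos by real_asymp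
      then show ?thesis
      proof eventually_elim
        case (elim N)
        define y where "y = exp (ln (real N) / (2 * C1))"
        have "exp (ln (real N) / C1) = y * y" unfolding y_def using C1pos by (simp flip: exp_add add: field_simps)
        moreover have "2 * y \<le> y * y" using elim unfolding y_def by (intro mult_right_mono) auto
        ultimately show ?case using elim unfolding y_def by linarith
      qed
    qed
    show "eventually (\<lambda>N::nat. ln (ln (real N)) - C3 \<ge> 6) at_top" by real_asymp
    show "eventually (\<lambda>N::nat. ln (ln (real N)) \<ge> 7) at_top" by real_asymp
    show "eventually (\<lambda>N::nat. ln (real N) \<ge> 2 * C1) at_top" by real_asymp
    show "eventually (\<lambda>N::nat. N > 512 ^ 4) at_top" by (rule eventually_gt_at_top)
  qed
  then obtain N0 where N0: "\<And>N. N \<ge> N0 \<Longrightarrow> exp (ln (real N) / C1) \<ge> 3 \<and> exp (ln (real N) / C1) - 1 \<ge> exp (ln (real N) / (2 * C1))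
      \<and> ln (ln (real N)) - C3 \<ge> 6 \<and> ln (ln (real N)) \<ge> 7 \<and> ln (real N) \<ge> 2 * C1 \<and> N > 512 ^ 4"
    unfolding eventually_at_top_linorder by blast
  have "\<exists>c. (\<forall>n. c n \<ge> 0) \<and> (\<Sum>n = 1..N. c n) = 1 \<and>
     weighted_energy N c \<le> C * (ln (real N) powr delta_exp * ln (ln (real N)) ^ 6)" if NN: "N \<ge> N0" for N
  proof -
    define L where "L = ln (real N)"
    define ll where "ll = ln L"
    have big: "exp (L / C1) \<ge> 3" "exp (L / C1) - 1 \<ge> exp (L / (2 * C1))" "ll - C3 \<ge> 6" "ll \<ge> 7" "L \<ge> 2 * C1" "N > 512 ^ 4"
      using N0[OF NN] unfolding L_def ll_def by blast+
    have L: "L > 0" "L \<ge> 1" using big(5) C1 by linarith+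
    define T where "T = nat \<lfloor>exp (L / C1)\<rfloor>"
    define X where "X = prime_clock T"
    have T: "T \<ge> 3" "real T \<le> exp (L / C1)" "ll - C3 \<le> X" "X \<le> ll + 5"
      using clock_bounds[OF _ big(1,2) L(1)] C1 unfolding T_def X_def ll_def C3_def by auto
    have X6: "X \<ge> 6" using T(3) big(3) by linarith
    obtain k' where k': "k' \<ge> 2" "real k' * unit_gap + 1 \<le> X" "X \<le> real k' * unit_gap + 1 + unit_gap" "real k' \<le> X"
      using gap_index[OF X6] .
    obtain k where k: "k' = Suc k" "k \<ge> 1" using k'(1) by (cases k') auto
    have lnT: "ln (real T) \<le> L / C1" using T(1,2) ln_le_cancel_iff[of "real T" "exp (L / C1)"] by simp
    have LC: "L / C1 \<le> L / 2" using C1 L by (intro divide_left_mono) auto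
    have TT: "T * T \<le> N"
    proof -
      have "real T * real T \<le> exp (L / C1) * exp (L / C1)" using T(2) by (intro mult_mono) auto
      also have "\<dots> = exp (L / C1 + L / C1)" by (rule exp_add[symmetric])
      also have "L / C1 + L / C1 \<le> L" using LC by linarith
      then have "exp (L / C1 + L / C1) \<le> exp L" by (simp only: exp_le_cancel_iff)
      also have "\<dots> = real N" unfolding L_def using big(6) by simp
      finally have "real (T * T) \<le> real N" by simp
      then show ?thesis by (simp only: of_nat_le_iff)
    qed
    have R: "(ln (real T) + 2) * (7 * exp 3) \<le> L / 8"
    proof -
      have "(ln (real T) + 2) * C1 \<le> (L / C1 + 2) * C1" using lnT C1pos by (intro mult_right_mono) auto
      also have "\<dots> = L + 2 * C1" using C1pos by (simp add: field_simps)
      also have "\<dots> \<le> 2 * L" using big(5) by simp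
      finally have "(ln (real T) + 2) * C1 \<le> 2 * L" .
      then show ?thesis unfolding C1_def by (simp add: algebra_simps)
    qed
    define I where "I = nat \<lceil>ln (real k' * L)\<rceil>"
    have I: "\<Prod>A \<le> tower I" if "A \<in> sparse_family k' T" for A
    proof -
      have "ln (real T) \<le> L" using lnT LC L by linarith
      then show ?thesis unfolding I_def using T(1) L k'(1) by (intro sparse_prod_le_tower[OF that]) auto
    qed
    have I3: "real (I + 1) \<le> 3 * ll"
    proof -
      have kp: "real k' > 0" using k'(1) by simp
      have "1 * 1 \<le> real k' * L" using k'(1) L by (intro mult_mono) auto
      then have "ln (real k' * L) \<ge> 0" by simp
      then have "real (I + 1) \<le> ln (real k' * L) + 2" unfolding I_def by linarith
      also have "ln (real k' * L) = ln (real k') + ll" using kp L by (simp add: ln_mult ll_def)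
      also have "ln (real k') \<le> X - 1" using ln_le_minus_one[OF kp] k'(4) by linarith
      finally show ?thesis using T(4) big(4) by linarith
    qed
    have X2: "X \<le> 2 * ll" using T(4) big(4) by linarith
    obtain c where c: "\<forall>n. c n \<ge> 0" "(\<Sum>n = 1..N. c n) = 1"
      "weighted_energy N c \<le> K * (real (I + 1) * L\<^sup>2 * X ^ 4 * (fact k' / X ^ k')\<^sup>2)"
      using energy_le_of_clock[OF k(2) _ _ _ _ TT big(6), of I] k' T(1) R I
      unfolding k(1) K_def L_def[symmetric] X_def[symmetric] by auto
    have fp: "(fact k' / X ^ k')\<^sup>2 \<le> exp 20 * X * exp (- \<theta> * X)"
      unfolding \<theta>_def using k' by (intro fact_over_power_le) auto
    have "exp (- \<theta> * X) \<le> exp (- \<theta> * (ll - C3))" using T(3) \<theta> by (simp add: mult_left_mono)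
    also have "\<dots> = exp (\<theta> * C3) * L powr (- \<theta>)" using L by (simp add: powr_def ll_def algebra_simps flip: exp_add)
    finally have e: "exp (- \<theta> * X) \<le> exp (\<theta> * C3) * L powr (- \<theta>)" .
    have "real (I + 1) * L\<^sup>2 * X ^ 4 * (fact k' / X ^ k')\<^sup>2 \<le> 3 * ll * L\<^sup>2 * X ^ 4 * (exp 20 * X * (exp (\<theta> * C3) * L powr (- \<theta>)))"
    proof (intro mult_mono mult_nonneg_nonneg)
      have "exp 20 * X * exp (- \<theta> * X) \<le> exp 20 * X * (exp (\<theta> * C3) * L powr (- \<theta>))"
        using e X6 by (intro mult_left_mono) auto
      then show "(fact k' / X ^ k')\<^sup>2 \<le> exp 20 * X * (exp (\<theta> * C3) * L powr (- \<theta>))" using fp by linarith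
    qed (use I3 big(4) X6 in auto)
    also have "\<dots> = 3 * exp 20 * exp (\<theta> * C3) * (ll * X ^ 5) * (L\<^sup>2 * L powr (- \<theta>))"
      by (simp add: mult_ac power_numeral_reduce)
    also have "\<dots> \<le> 3 * exp 20 * exp (\<theta> * C3) * (ll * (2 * ll) ^ 5) * (L\<^sup>2 * L powr (- \<theta>))"
      using X2 X6 big(4) by (intro mult_right_mono mult_left_mono power_mono) auto
    also have "L\<^sup>2 * L powr (- \<theta>) = L powr delta_exp"
    proof -
      have "L\<^sup>2 = L powr 2" using L by simp
      then have "L\<^sup>2 * L powr (- \<theta>) = L powr (2 + - \<theta>)" by (simp only: powr_add)
      also have "2 + - \<theta> = delta_exp" using unit_gap_exponent by (simp add: \<theta>_def)
      finally show ?thesis .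
    qed
    also have "ll * (2 * ll) ^ 5 = 32 * ll ^ 6" by (simp add: power_numeral_reduce)
    also have "3 * exp 20 * exp (\<theta> * C3) * (32 * ll ^ 6) * L powr delta_exp = (96 * exp 20 * exp (\<theta> * C3)) * (L powr delta_exp * ll ^ 6)"
      by simp
    finally have "K * (real (I + 1) * L\<^sup>2 * X ^ 4 * (fact k' / X ^ k')\<^sup>2) \<le> K * ((96 * exp 20 * exp (\<theta> * C3)) * (L powr delta_exp * ll ^ 6))"
      using K by (intro mult_left_mono) auto
    then have "weighted_energy N c \<le> C * (L powr delta_exp * ll ^ 6)" using c(3) unfolding C_def by simp
    then show ?thesis using c(1,2) unfolding L_def ll_def by blast
  qed
  then show ?thesis using C by blast
qed

section \<open>Near minimizers of the energy\<close>

lemma ln_3_gt_1: "ln (3::real) > 1"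
proof -
  have "1 / 9 \<le> ln (9 / 8 :: real)" using ln_le_minus_one[of "8 / 9 :: real"] by (simp add: ln_divide_pos)
  moreover have "ln (9 / 8 :: real) = 2 * ln 3 - 3 * ln 2"
    using ln_realpow[of 3 2] ln_realpow[of 2 3] by (simp add: ln_divide_pos)
  ultimately show ?thesis using ln2_bounds(1) by linarith
qed

text \<open>Values outside \<open>{1..N}\<close> do not enter the energy, and setting them to zero makes the
  weight nonnegative everywhere.\<close>

lemma normalized_weights_truncate:
  assumes "c \<in> normalized_weights N"
  obtains c' where "\<And>n. c' n \<ge> 0" "(\<Sum>n = 1..N. c' n) = 1" "weighted_energy N c' = weighted_energy N c"
proof
  let ?c = "\<lambda>n. if n \<in> {1..N} then c n else 0"
  have c: "\<forall>n\<in>{1..N}. c n \<ge> 0" "(\<Sum>n = 1..N. \<bar>c n\<bar>) = 1" using assms unfolding normalized_weights_def mem_Collect_eq by blast+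
  show "?c n \<ge> 0" for n using c(1) by simp
  have "(\<Sum>n = 1..N. ?c n) = (\<Sum>n = 1..N. \<bar>c n\<bar>)" using c(1) by (intro sum.cong[OF refl]) simp
  then show "(\<Sum>n = 1..N. ?c n) = 1" using c(2) by simp
  have "dconv N ?c ?c n = dconv N c c n" for n
    unfolding dconv_def by (rule sum.cong[OF refl]) (simp add: case_prod_beta split_beta)
  then show "weighted_energy N ?c = weighted_energy N c" unfolding weighted_energy_eq conv_energy_def by simp
qed

lemma min_energy_ge_1:
  assumes "nat \<lfloor>\<nu>\<rfloor> \<ge> 1" shows "1 \<le> min_energy \<nu>"
  unfolding min_energy_def
proof (rule cINF_greatest[OF normalized_weights_nonempty[OF assms]])
  fix c assume "c \<in> normalized_weights (nat \<lfloor>\<nu>\<rfloor>)"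
  then obtain c' where c': "\<And>n. c' n \<ge> 0" "(\<Sum>n = 1..nat \<lfloor>\<nu>\<rfloor>. c' n) = 1"
    "weighted_energy (nat \<lfloor>\<nu>\<rfloor>) c' = weighted_energy (nat \<lfloor>\<nu>\<rfloor>) c" using normalized_weights_truncate by blast
  then show "1 \<le> weighted_energy (nat \<lfloor>\<nu>\<rfloor>) c" using conv_energy_ge[OF c'(1,2)] by (simp only: c'(3)[symmetric] weighted_energy_eq)
qed

lemma min_energy_le:
  assumes "\<And>n. c n \<ge> 0" "(\<Sum>n = 1..nat \<lfloor>\<nu>\<rfloor>. c n) = 1"
  shows "min_energy \<nu> \<le> weighted_energy (nat \<lfloor>\<nu>\<rfloor>) c"
  unfolding min_energy_def
  by (rule cINF_lower[OF bdd_below_weighted_energy]) (use assms in \<open>simp add: normalized_weights_def\<close>)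

lemma near_minimizer:
  assumes "nat \<lfloor>\<nu>\<rfloor> \<ge> 1"
  obtains c where "\<And>n. c n \<ge> 0" "(\<Sum>n = 1..nat \<lfloor>\<nu>\<rfloor>. c n) = 1" "weighted_energy (nat \<lfloor>\<nu>\<rfloor>) c \<le> 2 * min_energy \<nu>"
proof -
  have "min_energy \<nu> < 2 * min_energy \<nu>" using min_energy_ge_1[OF assms] by linarith
  then obtain c where c: "c \<in> normalized_weights (nat \<lfloor>\<nu>\<rfloor>)" "weighted_energy (nat \<lfloor>\<nu>\<rfloor>) c < 2 * min_energy \<nu>"
    unfolding min_energy_def
    by (subst (asm) cINF_less_iff[OF normalized_weights_nonempty[OF assms] bdd_below_weighted_energy]) blast
  obtain c' where "\<And>n. c' n \<ge> 0" "(\<Sum>n = 1..nat \<lfloor>\<nu>\<rfloor>. c' n) = 1"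
    "weighted_energy (nat \<lfloor>\<nu>\<rfloor>) c' = weighted_energy (nat \<lfloor>\<nu>\<rfloor>) c" using normalized_weights_truncate[OF c(1)] by blast
  then show ?thesis using c(2) by (intro that[of c']) auto
qed

lemma conv_energy_unit:
  assumes "n \<ge> 1" shows "conv_energy n (\<lambda>k. if k = 1 then 1 else 0) (\<lambda>k. if k = 1 then 1 else 0) = 1"
proof -
  have "conv_energy n (\<lambda>k. if k \<in> id ` {1} then 1 else 0) (\<lambda>k. if k \<in> id ` {1} then 1 else 0)
    = real (card (SIGMA w:{1::nat} \<times> {1::nat}. {w' \<in> {1} \<times> {1}. id (fst w') * id (snd w') = id (fst w) * id (snd w)}))"
    using assms by (intro conv_energy_indicator_image) auto
  also have "(SIGMA w:{1::nat} \<times> {1::nat}. {w' \<in> {1} \<times> {1}. id (fst w') * id (snd w') = id (fst w) * id (snd w)}) = {((1, 1), (1, 1))}" by auto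
  finally show ?thesis by simp
qed

lemma min_energy_le_square:
  assumes n: "nat \<lfloor>\<nu>\<rfloor> \<ge> 1" shows "min_energy \<nu> \<le> (real (nat \<lfloor>\<nu>\<rfloor>))\<^sup>2"
proof -
  have "(\<Sum>k = 1..nat \<lfloor>\<nu>\<rfloor>. if k = 1 then 1 else 0 :: real) = 1" using n by (subst sum.delta) auto
  then have "min_energy \<nu> \<le> weighted_energy (nat \<lfloor>\<nu>\<rfloor>) (\<lambda>k. if k = 1 then 1 else 0)" by (intro min_energy_le) auto
  then show ?thesis unfolding weighted_energy_eq conv_energy_unit[OF n] by simp
qed

lemma min_energy_log_bound:
  "\<exists>K>0. \<forall>\<nu>\<ge>3. min_energy \<nu> \<le> K * (ln \<nu> powr delta_exp * ln (ln \<nu>) ^ 6)"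
proof -
  obtain C N0 where C: "C > 0" and N0: "\<And>N. N \<ge> N0 \<Longrightarrow> \<exists>c. (\<forall>n. c n \<ge> 0) \<and> (\<Sum>n = 1..N. c n) = 1 \<and>
     weighted_energy N c \<le> C * (ln (real N) powr delta_exp * ln (ln (real N)) ^ 6)" using energy_upper_bound by blast
  define b where "b = ln (ln (3::real)) ^ 6"
  have l3: "ln (ln (3::real)) > 0" using ln_3_gt_1 by simp
  then have b: "b > 0" by (simp add: b_def)
  define K where "K = C + (real N0)\<^sup>2 / b"
  have K: "K > 0" unfolding K_def using C b by (intro add_pos_nonneg) auto
  have "min_energy \<nu> \<le> K * (ln \<nu> powr delta_exp * ln (ln \<nu>) ^ 6)" if \<nu>: "\<nu> \<ge> 3" for \<nu>
  proof -
    define n where "n = nat \<lfloor>\<nu>\<rfloor>"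
    have n: "n \<ge> 3" "real n \<le> \<nu>" unfolding n_def using \<nu> by linarith+
    have ln1: "ln (real n) \<ge> ln 3" "ln \<nu> \<ge> ln (real n)" using n \<nu> by auto
    have ln2: "ln (ln (real n)) \<ge> ln (ln 3)" "ln (ln \<nu>) \<ge> ln (ln (real n))" using ln1 ln_3_gt_1 by auto
    have g1: "ln \<nu> powr delta_exp \<ge> 1" using ln1 ln_3_gt_1 delta_exp_bounds by (intro ge_one_powr_ge_zero) auto
    have b1: "b \<le> ln (ln \<nu>) ^ 6" unfolding b_def using ln2 l3 by (intro power_mono) auto
    let ?G = "ln \<nu> powr delta_exp * ln (ln \<nu>) ^ 6"
    have "1 * b \<le> ?G" using g1 b1 b by (intro mult_mono) auto
    then have Gb: "b \<le> ?G" by simp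
    show ?thesis
    proof (cases "n \<ge> N0")
      case True
      then obtain c where c: "\<forall>k. c k \<ge> 0" "(\<Sum>k = 1..n. c k) = 1"
        "weighted_energy n c \<le> C * (ln (real n) powr delta_exp * ln (ln (real n)) ^ 6)" using N0 by blast
      have "min_energy \<nu> \<le> weighted_energy n c" unfolding n_def using c(1,2) by (intro min_energy_le) (auto simp: n_def)
      also have "\<dots> \<le> C * (ln (real n) powr delta_exp * ln (ln (real n)) ^ 6)" by (rule c(3))
      also have "\<dots> \<le> C * ?G"
        using C ln1 ln2 l3 ln_3_gt_1 delta_exp_bounds
        by (intro mult_left_mono mult_mono powr_mono2 power_mono) auto
      also have "\<dots> \<le> K * ?G" unfolding K_def using Gb b by (intro mult_right_mono) auto
      finally show ?thesis .
    next
      case False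
      have "min_energy \<nu> \<le> (real n)\<^sup>2" unfolding n_def using n by (intro min_energy_le_square) (simp add: n_def)
      also have "\<dots> \<le> (real N0)\<^sup>2" using False by (intro power_mono) auto
      also have "\<dots> = (real N0)\<^sup>2 / b * b" using b by simp
      also have "\<dots> \<le> (real N0)\<^sup>2 / b * ?G" using Gb b by (intro mult_left_mono) auto
      also have "\<dots> \<le> K * ?G" unfolding K_def using Gb b C by (intro mult_right_mono) auto
      finally show ?thesis .
    qed
  qed
  then show ?thesis using K by blast
qed

text \<open>The hypothesis of \<open>energy_shrink\<close> holds for a near minimizer since \<open>\<delta>
  < 1/2\<close>.\<close>

lemma regular_near_minimizer:
  "\<exists>C N0. C \<ge> 1 \<and> N0 \<ge> 1 \<and> (\<forall>\<nu>. nat \<lfloor>\<nu>\<rfloor> \<ge> N0 \<longrightarrow> (\<exists>c. (\<forall>h. c h \<ge> 0) \<and> (\<Sum>h = 1..nat \<lfloor>\<nu>\<rfloor>. c h) = 1 \<and>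
     (\<forall>h. c h \<noteq> 0 \<longrightarrow> 1 \<le> h \<and> 512 * h \<le> nat \<lfloor>\<nu>\<rfloor>) \<and>
     (real (nat \<lfloor>\<nu>\<rfloor>))\<^sup>2 * conv_energy (nat \<lfloor>\<nu>\<rfloor>) c c \<le> C * min_energy \<nu>))"
proof -
  obtain C1 \<eta> N1 where C1: "C1 \<ge> 1" "\<eta> > 0" and shrink: "\<And>N c. N \<ge> N1 \<Longrightarrow> (\<forall>n. c n \<ge> 0) \<Longrightarrow> (\<Sum>n = 1..N. c n) = 1 \<Longrightarrow>
     weighted_energy N c \<le> \<eta> * sqrt (ln (real N)) \<Longrightarrow>
     \<exists>c'. (\<forall>n. c' n \<ge> 0) \<and> (\<Sum>n = 1..N. c' n) = 1 \<and> (\<forall>h. c' h \<noteq> 0 \<longrightarrow> 1 \<le> h \<and> 512 * h \<le> N) \<and>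
       conv_energy N c' c' \<le> C1 * conv_energy N c c" using energy_shrink by blast
  obtain C2 N2 where C2: "C2 > 0" and up: "\<And>N. N \<ge> N2 \<Longrightarrow> \<exists>c. (\<forall>n. c n \<ge> 0) \<and> (\<Sum>n = 1..N. c n) = 1 \<and>
     weighted_energy N c \<le> C2 * (ln (real N) powr delta_exp * ln (ln (real N)) ^ 6)" using energy_upper_bound by blast
  have "eventually (\<lambda>N::nat. 2 * C2 * (ln (real N) powr delta_exp * ln (ln (real N)) ^ 6) \<le> \<eta> * sqrt (ln (real N))) at_top"
    using C1(2) C2 delta_exp_bounds by real_asymp
  then obtain N3 where N3: "\<And>N. N \<ge> N3 \<Longrightarrow> 2 * C2 * (ln (real N) powr delta_exp * ln (ln (real N)) ^ 6) \<le> \<eta> * sqrt (ln (real N))"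
    unfolding eventually_at_top_linorder by blast
  define N0 where "N0 = N1 + N2 + N3 + 1"
  have "\<exists>c. (\<forall>h. c h \<ge> 0) \<and> (\<Sum>h = 1..nat \<lfloor>\<nu>\<rfloor>. c h) = 1 \<and>
     (\<forall>h. c h \<noteq> 0 \<longrightarrow> 1 \<le> h \<and> 512 * h \<le> nat \<lfloor>\<nu>\<rfloor>) \<and>
     (real (nat \<lfloor>\<nu>\<rfloor>))\<^sup>2 * conv_energy (nat \<lfloor>\<nu>\<rfloor>) c c \<le> 2 * C1 * min_energy \<nu>" if \<nu>: "nat \<lfloor>\<nu>\<rfloor> \<ge> N0" for \<nu>
  proof -
    define n where "n = nat \<lfloor>\<nu>\<rfloor>"
    have n: "n \<ge> N1" "n \<ge> N2" "n \<ge> N3" "n \<ge> 1" using \<nu> unfolding n_def N0_def by linarith+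
    obtain c where c: "\<And>k. c k \<ge> 0" "(\<Sum>k = 1..n. c k) = 1" "weighted_energy n c \<le> 2 * min_energy \<nu>"
      using near_minimizer[of \<nu>] n(4) unfolding n_def by blast
    obtain b where bb: "\<forall>k. b k \<ge> 0" "(\<Sum>k = 1..n. b k) = 1"
      "weighted_energy n b \<le> C2 * (ln (real n) powr delta_exp * ln (ln (real n)) ^ 6)" using up[OF n(2)] by blast
    have "min_energy \<nu> \<le> weighted_energy n b" unfolding n_def using bb(1,2) by (intro min_energy_le) (auto simp: n_def)
    then have "weighted_energy n c \<le> \<eta> * sqrt (ln (real n))" using c(3) bb(3) N3[OF n(3)] by linarith
    then obtain c' where c': "\<forall>k. c' k \<ge> 0" "(\<Sum>k = 1..n. c' k) = 1" "\<forall>h. c' h \<noteq> 0 \<longrightarrow> 1 \<le> h \<and> 512 * h \<le> n"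
      "conv_energy n c' c' \<le> C1 * conv_energy n c c" using shrink[OF n(1) _ c(2)] c(1) by blast
    have "(real n)\<^sup>2 * conv_energy n c' c' \<le> (real n)\<^sup>2 * (C1 * conv_energy n c c)" using c'(4) by (intro mult_left_mono) auto
    also have "\<dots> = C1 * weighted_energy n c" by (simp add: weighted_energy_eq)
    also have "\<dots> \<le> C1 * (2 * min_energy \<nu>)" using c(3) C1(1) by (intro mult_left_mono) auto
    finally have "(real n)\<^sup>2 * conv_energy n c' c' \<le> 2 * C1 * min_energy \<nu>" by simp
    then show ?thesis using c'(1-3) unfolding n_def by blast
  qed
  moreover have "N0 \<ge> 1" "2 * C1 \<ge> 1" using C1 by (auto simp: N0_def)
  ultimately show ?thesis by blast
qed

section \<open>Resonators\<close>

definition weight_poly :: "nat \<Rightarrow> (nat \<Rightarrow> real) \<Rightarrow> (int \<Rightarrow> complex) \<Rightarrow> complex" where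
  "weight_poly q c \<chi> = (\<Sum>h\<in>{1..q}. complex_of_real (c h) * \<chi> (int h))"

lemma weight_poly_square:
  assumes \<chi>: "dirichlet_character p \<chi>"
  shows "(weight_poly q c \<chi>)\<^sup>2 = (\<Sum>g\<in>{1..q\<^sup>2}. complex_of_real (dconv q c c g) * \<chi> (int g))"
proof -
  let ?f = "\<lambda>z. complex_of_real (c (fst z) * c (snd z)) * \<chi> (int (fst z * snd z))"
  have "(weight_poly q c \<chi>)\<^sup>2 = (\<Sum>z\<in>{1..q} \<times> {1..q}. ?f z)"
    unfolding weight_poly_def power2_eq_square sum_product sum.cartesian_product
    by (rule sum.cong[OF refl]) (simp add: case_prod_beta dirichlet_character_mult[OF \<chi>] mult_ac)
  also have "\<dots> = (\<Sum>g\<in>{1..q\<^sup>2}. \<Sum>z\<in>{z \<in> {1..q} \<times> {1..q}. fst z * snd z = g}. ?f z)"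
  proof (rule sum.group[symmetric])
    show "(\<lambda>z. fst z * snd z) ` ({1..q} \<times> {1..q}) \<subseteq> {1..q\<^sup>2}"
    proof (rule image_subsetI)
      fix z :: "nat \<times> nat" assume "z \<in> {1..q} \<times> {1..q}"
      then have "fst z \<le> q" "snd z \<le> q" "1 \<le> fst z" "1 \<le> snd z" by (simp_all add: mem_Times_iff)
      then show "fst z * snd z \<in> {1..q\<^sup>2}"
        using mult_le_mono[of "fst z" q "snd z" q] mult_le_mono[of 1 "fst z" 1 "snd z"] by (simp add: power2_eq_square)
    qed
  qed simp_all
  also have "\<dots> = (\<Sum>g\<in>{1..q\<^sup>2}. complex_of_real (dconv q c c g) * \<chi> (int g))"
  proof (rule sum.cong[OF refl])
    fix g
    have "complex_of_real (dconv q c c g) = (\<Sum>z\<in>{z \<in> {1..q} \<times> {1..q}. fst z * snd z = g}. complex_of_real (c (fst z) * c (snd z)))"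
      unfolding dconv_def factor_pairs_eq of_real_sum by (rule sum.cong[OF refl]) (simp add: case_prod_beta)
    moreover have "(\<Sum>z\<in>{z \<in> {1..q} \<times> {1..q}. fst z * snd z = g}. ?f z)
      = (\<Sum>z\<in>{z \<in> {1..q} \<times> {1..q}. fst z * snd z = g}. complex_of_real (c (fst z) * c (snd z)) * \<chi> (int g))"
      by (rule sum.cong[OF refl]) simp
    ultimately show "(\<Sum>z\<in>{z \<in> {1..q} \<times> {1..q}. fst z * snd z = g}. ?f z) = complex_of_real (dconv q c c g) * \<chi> (int g)"
      by (simp only: sum_distrib_right)
  qed
  finally show ?thesis .
qed

text \<open>The square of the polynomial has the convolution as coefficients, at indices below
  \<open>p\<close>.\<close>

lemma weight_poly_fourth_moment:
  assumes p: "prime p" and q: "q\<^sup>2 < p"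
  shows "(\<Sum>\<chi>\<in>dchars p. cmod (weight_poly q c \<chi>) ^ 4) = real (p - 1) * conv_energy q c c"
proof -
  have A: "{1..q\<^sup>2} \<subseteq> {1..<p}" using q by auto
  have "(\<Sum>\<chi>\<in>dchars p. cmod (weight_poly q c \<chi>) ^ 4)
    = (\<Sum>\<chi>\<in>dchars p. (cmod (\<Sum>g\<in>{1..q\<^sup>2}. complex_of_real (dconv q c c g) * \<chi> (int g)))\<^sup>2)"
  proof (rule sum.cong[OF refl])
    fix \<chi> assume "\<chi> \<in> dchars p"
    then have "(cmod (\<Sum>g\<in>{1..q\<^sup>2}. complex_of_real (dconv q c c g) * \<chi> (int g)))\<^sup>2 = (cmod ((weight_poly q c \<chi>)\<^sup>2))\<^sup>2"
      using weight_poly_square[of p \<chi> q c] by simp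
    also have "\<dots> = cmod (weight_poly q c \<chi>) ^ 4" by (simp add: norm_power flip: power_mult)
    finally show "cmod (weight_poly q c \<chi>) ^ 4 = (cmod (\<Sum>g\<in>{1..q\<^sup>2}. complex_of_real (dconv q c c g) * \<chi> (int g)))\<^sup>2" ..
  qed
  also have "\<dots> = real (p - 1) * (\<Sum>g\<in>{1..q\<^sup>2}. (cmod (complex_of_real (dconv q c c g)))\<^sup>2)"
    by (rule character_mean_square[OF p A])
  also have "\<dots> = real (p - 1) * conv_energy q c c" unfolding conv_energy_def by simp
  finally show ?thesis .
qed

lemma dchars_split:
  assumes "p > 0"
  shows "(\<Sum>\<chi>\<in>dchars p. F \<chi>) = F (principal_character p) + (\<Sum>\<chi>\<in>nonprincipal_characters p. F \<chi>)"
proof -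
  have "dchars p = insert (principal_character p) (nonprincipal_characters p)"
    using dirichlet_character_principal by (auto simp: nonprincipal_characters_def)
  moreover have "principal_character p \<notin> nonprincipal_characters p" by (simp add: nonprincipal_characters_def)
  ultimately show ?thesis using finite_nonprincipal_characters[OF assms] by simp
qed

lemma sum_nonprincipal_le:
  fixes F :: "_ \<Rightarrow> real"
  assumes "p > 0" "\<And>\<chi>. F \<chi> \<ge> 0"
  shows "(\<Sum>\<chi>\<in>nonprincipal_characters p. F \<chi>) \<le> (\<Sum>\<chi>\<in>dchars p. F \<chi>)"
  using dchars_split[OF assms(1), of F] assms(2)[of "principal_character p"] by linarith

lemma character_sum_mean_square_le:
  assumes p: "prime p" and n: "n < p"
  shows "(\<Sum>\<chi>\<in>nonprincipal_characters p. (cmod (\<Sum>k = 1..n. \<chi> (int k)))\<^sup>2) \<le> real p * real n"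
proof -
  have p0: "p > 0" using p prime_gt_0_nat by blast
  have "(\<Sum>\<chi>\<in>nonprincipal_characters p. (cmod (\<Sum>k = 1..n. \<chi> (int k)))\<^sup>2) \<le> (\<Sum>\<chi>\<in>dchars p. (cmod (\<Sum>k\<in>{1..n}. 1 * \<chi> (int k)))\<^sup>2)"
    using sum_nonprincipal_le[OF p0, of "\<lambda>\<chi>. (cmod (\<Sum>k = 1..n. \<chi> (int k)))\<^sup>2"] by simp
  also have "\<dots> = real (p - 1) * (\<Sum>k\<in>{1..n}. (cmod 1)\<^sup>2)"
    by (rule character_mean_square[OF p]) (use n in auto)
  also have "\<dots> \<le> real p * real n" by (simp add: mult_right_mono)
  finally show ?thesis .
qed

text \<open>The correlation is bounded below by \<open>a\<close>, the fourth moment above by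
  \<open>B\<close>; the comparison of both is scaled such that \<open>low_moment_ge\<close> gives
  the main inequality with the constant \<open>\<kappa>\<close>.\<close>

lemma moment_of_resonator:
  fixes T :: "(int \<Rightarrow> complex) \<Rightarrow> complex"
  assumes p: "prime p" and n: "n < p" "real n \<le> N" "N > 0" and r: "0 < r" "r < 4 / 3"
    and pos: "\<kappa> > 0" "E > 0" "a > 0"
    and a: "a \<le> cmod (\<Sum>\<chi>\<in>nonprincipal_characters p. (\<Sum>k = 1..n. \<chi> (int k)) * T \<chi>)"
    and B: "(\<Sum>\<chi>\<in>nonprincipal_characters p. cmod (T \<chi>) ^ 4) \<le> B"
    and aB: "\<kappa> * (real p ^ 3 * N\<^sup>2 / E) * B \<le> a ^ 4"
  shows "(\<Sum>\<chi>\<in>nonprincipal_characters p. cmod (\<Sum>k = 1..n. \<chi> (int k)) powr r)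
    \<ge> \<kappa> powr (1 - r / 2) * real p * (N powr (r / 2) / E powr (1 - r / 2))"
proof -
  let ?D = "nonprincipal_characters p" and ?S = "\<lambda>\<chi>. \<Sum>k = 1..n. \<chi> (int k)"
  have p0: "p > 0" using p prime_gt_0_nat by blast
  have fin: "finite ?D" by (rule finite_nonprincipal_characters[OF p0])
  have a2: "a \<le> (\<Sum>\<chi>\<in>?D. cmod (?S \<chi>) * cmod (T \<chi>))"
    by (rule order_trans[OF a]) (rule order_trans[OF norm_sum], simp add: norm_mult)
  have "(\<Sum>\<chi>\<in>?D. cmod (T \<chi>) ^ 4) \<noteq> 0"
  proof
    assume "(\<Sum>\<chi>\<in>?D. cmod (T \<chi>) ^ 4) = 0"
    then have "\<forall>\<chi>\<in>?D. cmod (T \<chi>) ^ 4 = 0" using fin by (subst (asm) sum_nonneg_eq_0_iff) auto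
    then have "(\<Sum>\<chi>\<in>?D. cmod (?S \<chi>) * cmod (T \<chi>)) = (\<Sum>\<chi>\<in>?D. 0)" by (intro sum.cong) auto
    then show False using a2 pos(3) by simp
  qed
  moreover have "(\<Sum>\<chi>\<in>?D. cmod (T \<chi>) ^ 4) \<ge> 0" by (intro sum_nonneg) simp
  ultimately have Q: "(\<Sum>\<chi>\<in>?D. cmod (T \<chi>) ^ 4) > 0" by linarith
  have "\<kappa> * (real p ^ 3 * N\<^sup>2 / E) * (\<Sum>\<chi>\<in>?D. cmod (T \<chi>) ^ 4) \<le> \<kappa> * (real p ^ 3 * N\<^sup>2 / E) * B"
    using B pos by (intro mult_left_mono) auto
  also have "\<dots> \<le> a ^ 4" by (rule aB)
  also have "\<dots> \<le> (\<Sum>\<chi>\<in>?D. cmod (?S \<chi>) * cmod (T \<chi>)) ^ 4" using a2 pos by (intro power_mono) auto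
  finally have lower: "\<kappa> * (real p ^ 3 * N\<^sup>2 / E) * (\<Sum>\<chi>\<in>?D. cmod (T \<chi>) ^ 4) \<le> (\<Sum>\<chi>\<in>?D. cmod (?S \<chi>) * cmod (T \<chi>)) ^ 4" .
  have "real p * real n \<le> real p * N" using n by (intro mult_left_mono) auto
  then have sq: "(\<Sum>\<chi>\<in>?D. (cmod (?S \<chi>))\<^sup>2) \<le> real p * N" using character_sum_mean_square_le[OF p n(1)] by linarith
  show ?thesis
    by (rule low_moment_ge[OF r fin pos(1) _ n(3) pos(2) sq Q lower]) (use p0 in simp)
qed

text \<open>Over all characters the correlation is exactly \<open>p - 1\<close>, and the principal character
  accounts for only \<open>q\<close> of it.\<close>

lemma short_resonator:
  assumes p: "prime p" and q: "q\<^sup>2 < p" and n: "q < p" and s: "(\<Sum>h = 1..q. c h) = 1" and c: "\<And>h. c h \<ge> 0"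
  defines "T \<equiv> \<lambda>\<chi>. cnj (weight_poly q c \<chi>)"
  shows "real p - 1 - real q \<le> cmod (\<Sum>\<chi>\<in>nonprincipal_characters p. (\<Sum>k = 1..q. \<chi> (int k)) * T \<chi>)"
    "(\<Sum>\<chi>\<in>nonprincipal_characters p. cmod (T \<chi>) ^ 4) \<le> real p * conv_energy q c c"
proof -
  have p0: "p > 0" using p prime_gt_0_nat by blast
  let ?F = "\<lambda>\<chi>. (\<Sum>k = 1..q. \<chi> (int k)) * T \<chi>"
  have sub: "{1..q} \<subseteq> {1..<p}" using n by auto
  have "(\<Sum>\<chi>\<in>dchars p. ?F \<chi>) = (\<Sum>\<chi>\<in>dchars p. (\<Sum>k\<in>{1..q}. 1 * \<chi> (int k)) * cnj (\<Sum>h\<in>{1..q}. complex_of_real (c h) * \<chi> (int h)))"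
    unfolding T_def weight_poly_def by simp
  also have "\<dots> = of_nat (p - 1) * (\<Sum>h\<in>{1..q} \<inter> {1..q}. 1 * cnj (complex_of_real (c h)))"
    by (rule character_parseval[OF p sub sub])
  also have "(\<Sum>h\<in>{1..q} \<inter> {1..q}. 1 * cnj (complex_of_real (c h))) = complex_of_real (\<Sum>h = 1..q. c h)" by simp
  also have "of_nat (p - 1) * complex_of_real (\<Sum>h = 1..q. c h) = of_nat (p - 1)" by (simp only: s of_real_1 mult_1_right)
  finally have tot: "(\<Sum>\<chi>\<in>dchars p. ?F \<chi>) = of_nat (p - 1)" .
  have pr1: "principal_character p (int k) = 1" if "k \<in> {1..q}" for k
    using prime_units[OF p, of k] that n by (simp add: principal_character_def)
  have "(\<Sum>k = 1..q. principal_character p (int k)) = (\<Sum>k = 1..q. 1)" by (rule sum.cong[OF refl pr1])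
  moreover have "weight_poly q c (principal_character p) = (\<Sum>h = 1..q. complex_of_real (c h))"
    unfolding weight_poly_def by (rule sum.cong[OF refl]) (simp only: pr1 mult_1_right)
  then have "weight_poly q c (principal_character p) = 1" by (simp only: of_real_sum[symmetric] s of_real_1)
  ultimately have prin: "?F (principal_character p) = of_nat q" unfolding T_def by simp
  have "(\<Sum>\<chi>\<in>nonprincipal_characters p. ?F \<chi>) = complex_of_real (real (p - 1) - real q)"
    using dchars_split[OF p0, of ?F] tot prin by (simp add: algebra_simps)
  then show "real p - 1 - real q \<le> cmod (\<Sum>\<chi>\<in>nonprincipal_characters p. ?F \<chi>)" 
    by (rule ssubst) (simp add: norm_of_real del: of_real_diff)
  have "(\<Sum>\<chi>\<in>nonprincipal_characters p. cmod (T \<chi>) ^ 4) \<le> (\<Sum>\<chi>\<in>dchars p. cmod (weight_poly q c \<chi>) ^ 4)"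
    unfolding T_def complex_mod_cnj by (rule sum_nonprincipal_le[OF p0]) simp
  also have "\<dots> = real (p - 1) * conv_energy q c c" by (rule weight_poly_fourth_moment[OF p q])
  also have "\<dots> \<le> real p * conv_energy q c c" by (intro mult_right_mono conv_energy_nonneg) simp
  finally show "(\<Sum>\<chi>\<in>nonprincipal_characters p. cmod (T \<chi>) ^ 4) \<le> real p * conv_energy q c c" .
qed

text \<open>Over all characters the correlation is an average of exponential sums. The principal character
  contributes at most \<open>n sqrt p\<close>, of smaller order. In the fourth moment the Gauss
  sums cost \<open>p^2\<close>.\<close>

lemma dual_resonator:
  assumes p: "prime p" and q: "q\<^sup>2 < p" and n: "n < p" "q < p" and s: "(\<Sum>h = 1..q. c h) = 1" and c: "\<And>h. c h \<ge> 0"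
  defines "T \<equiv> \<lambda>\<chi>. weight_poly q c \<chi> * cnj (gauss_sum p \<chi>)"
  shows "real (p - 1) * cmod (\<Sum>h = 1..q. complex_of_real (c h) * (\<Sum>k = 1..n. cnj (cis (2 * pi * real (k * h) / real p)))) - real n * sqrt (real p)
      \<le> cmod (\<Sum>\<chi>\<in>nonprincipal_characters p. (\<Sum>k = 1..n. \<chi> (int k)) * T \<chi>)"
    "(\<Sum>\<chi>\<in>nonprincipal_characters p. cmod (T \<chi>) ^ 4) \<le> real p ^ 3 * conv_energy q c c"
proof -
  have p0: "p > 0" using p prime_gt_0_nat by blast
  let ?F = "\<lambda>\<chi>. (\<Sum>k = 1..n. \<chi> (int k)) * T \<chi>"
  let ?G = "\<lambda>h. \<Sum>k = 1..n. cnj (cis (2 * pi * real (k * h) / real p))"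
  have "(\<Sum>\<chi>\<in>dchars p. ?F \<chi>) = (\<Sum>\<chi>\<in>dchars p. \<Sum>h = 1..q. complex_of_real (c h) * ((\<Sum>k\<in>{1..n}. \<chi> (int k)) * (\<chi> (int h) * cnj (gauss_sum p \<chi>))))"
    unfolding T_def weight_poly_def by (rule sum.cong[OF refl]) (simp add: sum_distrib_left sum_distrib_right mult_ac)
  also have "\<dots> = (\<Sum>h = 1..q. complex_of_real (c h) * (\<Sum>\<chi>\<in>dchars p. (\<Sum>k\<in>{1..n}. \<chi> (int k)) * (\<chi> (int h) * cnj (gauss_sum p \<chi>))))"
    by (subst sum.swap) (simp only: sum_distrib_left)
  also have "\<dots> = (\<Sum>h = 1..q. complex_of_real (c h) * (of_nat (p - 1) * ?G h))"
  proof (rule sum.cong[OF refl])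
    fix h assume "h \<in> {1..q}"
    then have h: "h \<in> {1..<p}" using n(2) by auto
    show "complex_of_real (c h) * (\<Sum>\<chi>\<in>dchars p. (\<Sum>k\<in>{1..n}. \<chi> (int k)) * (\<chi> (int h) * cnj (gauss_sum p \<chi>))) = complex_of_real (c h) * (of_nat (p - 1) * ?G h)"
      by (simp only: sum_character_gauss_twist[OF p h n(1)])
  qed
  also have "\<dots> = of_nat (p - 1) * (\<Sum>h = 1..q. complex_of_real (c h) * ?G h)"
    unfolding sum_distrib_left by (rule sum.cong[OF refl]) (simp only: mult.left_commute)
  finally have tot: "(\<Sum>\<chi>\<in>dchars p. ?F \<chi>) = of_nat (p - 1) * (\<Sum>h = 1..q. complex_of_real (c h) * ?G h)" .
  have nc: "cmod (\<chi> (int k)) \<le> 1" if "dirichlet_character p \<chi>" for \<chi> k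
  proof (cases "coprime (int k) (int p)")
    case True
    then show ?thesis using norm_dirichlet_character[OF that p0] by (simp only:)
  next
    case False
    then have "\<chi> (int k) = 0" using dirichlet_character_eq_0_iff[OF that] by blast
    then show ?thesis by simp
  qed
  have nM: "cmod (weight_poly q c \<chi>) \<le> 1" if "dirichlet_character p \<chi>" for \<chi>
  proof -
    have "cmod (weight_poly q c \<chi>) \<le> (\<Sum>h\<in>{1..q}. c h * 1)"
      unfolding weight_poly_def
      by (rule sum_norm_le) (simp only: norm_mult norm_of_real abs_of_nonneg[OF c] mult_left_mono[OF nc[OF that] c])
    then show ?thesis using s by simp
  qed
  have ng: "cmod (gauss_sum p \<chi>) \<le> sqrt (real p)" if "dirichlet_character p \<chi>" for \<chi>
    using norm_gauss_sum_le[OF p that] by (simp add: real_le_rsqrt)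
  have prin: "cmod (?F (principal_character p)) \<le> real n * sqrt (real p)"
  proof -
    let ?c = "principal_character p"
    have d: "dirichlet_character p ?c" by (rule dirichlet_character_principal)
    have "cmod (\<Sum>k = 1..n. ?c (int k)) \<le> (\<Sum>k = 1..n. 1)" by (rule sum_norm_le) (rule nc[OF d])
    then have s1: "cmod (\<Sum>k = 1..n. ?c (int k)) \<le> real n" by simp
    have "cmod (T ?c) \<le> 1 * sqrt (real p)" unfolding T_def norm_mult complex_mod_cnj
      by (rule mult_mono[OF nM[OF d] ng[OF d]]) simp_all
    then have "cmod (\<Sum>k = 1..n. ?c (int k)) * cmod (T ?c) \<le> real n * sqrt (real p)" using s1 by (intro mult_mono) auto
    then show ?thesis by (simp only: norm_mult)
  qed
  have "cmod (\<Sum>\<chi>\<in>dchars p. ?F \<chi>) \<le> cmod (?F (principal_character p)) + cmod (\<Sum>\<chi>\<in>nonprincipal_characters p. ?F \<chi>)"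
    unfolding dchars_split[OF p0, of ?F] by (rule norm_triangle_ineq)
  moreover have "cmod (\<Sum>\<chi>\<in>dchars p. ?F \<chi>) = real (p - 1) * cmod (\<Sum>h = 1..q. complex_of_real (c h) * ?G h)"
    unfolding tot norm_mult norm_of_nat ..
  ultimately show "real (p - 1) * cmod (\<Sum>h = 1..q. complex_of_real (c h) * ?G h) - real n * sqrt (real p)
      \<le> cmod (\<Sum>\<chi>\<in>nonprincipal_characters p. ?F \<chi>)" using prin by linarith
  have "(\<Sum>\<chi>\<in>nonprincipal_characters p. cmod (T \<chi>) ^ 4) \<le> (\<Sum>\<chi>\<in>dchars p. cmod (T \<chi>) ^ 4)"
    by (rule sum_nonprincipal_le[OF p0]) simp
  also have "\<dots> \<le> (\<Sum>\<chi>\<in>dchars p. (real p)\<^sup>2 * cmod (weight_poly q c \<chi>) ^ 4)"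
  proof (rule sum_mono)
    fix \<chi> assume "\<chi> \<in> dchars p"
    then have "((cmod (gauss_sum p \<chi>))\<^sup>2)\<^sup>2 \<le> (real p)\<^sup>2" using norm_gauss_sum_le[OF p] by (intro power_mono) auto
    then have "cmod (gauss_sum p \<chi>) ^ 4 \<le> (real p)\<^sup>2" by (simp flip: power_mult)
    then have "cmod (gauss_sum p \<chi>) ^ 4 * cmod (weight_poly q c \<chi>) ^ 4 \<le> (real p)\<^sup>2 * cmod (weight_poly q c \<chi>) ^ 4" by (rule mult_right_mono) simp
    then show "cmod (T \<chi>) ^ 4 \<le> (real p)\<^sup>2 * cmod (weight_poly q c \<chi>) ^ 4"
      unfolding T_def norm_mult complex_mod_cnj power_mult_distrib by (simp add: mult.commute)
  qed
  also have "\<dots> = (real p)\<^sup>2 * (real (p - 1) * conv_energy q c c)"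
    unfolding sum_distrib_left[symmetric] weight_poly_fourth_moment[OF p q] ..
  also have "\<dots> \<le> (real p)\<^sup>2 * (real p * conv_energy q c c)" by (intro mult_left_mono mult_right_mono conv_energy_nonneg) auto
  finally show "(\<Sum>\<chi>\<in>nonprincipal_characters p. cmod (T \<chi>) ^ 4) \<le> real p ^ 3 * conv_energy q c c" by (simp add: power_numeral_reduce)
qed

section \<open>Resonance in the three ranges\<close>

text \<open>The existence of \<open>T\<close> that satisfies the hypotheses of
  \<open>moment_of_resonator\<close> with \<open>B\<close> its actual fourth moment.\<close>

definition resonates :: "real \<Rightarrow> nat \<Rightarrow> real \<Rightarrow> real \<Rightarrow> bool" where
  "resonates \<kappa> p N E \<longleftrightarrow> (\<exists>T a. a > 0 \<and>
     a \<le> cmod (\<Sum>\<chi>\<in>nonprincipal_characters p. (\<Sum>k = 1..nat \<lfloor>N\<rfloor>. \<chi> (int k)) * T \<chi>) \<and>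
     \<kappa> * (real p ^ 3 * N\<^sup>2 / E) * (\<Sum>\<chi>\<in>nonprincipal_characters p. cmod (T \<chi>) ^ 4) \<le> a ^ 4)"

lemma resonatesI:
  assumes "\<kappa> \<ge> 0" "E > 0" "a > 0" "a \<le> cmod (\<Sum>\<chi>\<in>nonprincipal_characters p. (\<Sum>k = 1..nat \<lfloor>N\<rfloor>. \<chi> (int k)) * T \<chi>)"
    "(\<Sum>\<chi>\<in>nonprincipal_characters p. cmod (T \<chi>) ^ 4) \<le> B" "\<kappa> * (real p ^ 3 * N\<^sup>2 / E) * B \<le> a ^ 4"
  shows "resonates \<kappa> p N E"
proof -
  have "\<kappa> * (real p ^ 3 * N\<^sup>2 / E) * (\<Sum>\<chi>\<in>nonprincipal_characters p. cmod (T \<chi>) ^ 4) \<le> \<kappa> * (real p ^ 3 * N\<^sup>2 / E) * B"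
    using assms(1,2,5) by (intro mult_left_mono) auto
  then have "\<kappa> * (real p ^ 3 * N\<^sup>2 / E) * (\<Sum>\<chi>\<in>nonprincipal_characters p. cmod (T \<chi>) ^ 4) \<le> a ^ 4" using assms(6) by linarith
  then show ?thesis unfolding resonates_def using assms(3,4) by blast
qed

lemma resonates_mono:
  assumes "resonates \<kappa> p N E" "\<kappa>' \<le> \<kappa>" "E > 0" shows "resonates \<kappa>' p N E"
proof -
  obtain T a where T: "a > 0" "a \<le> cmod (\<Sum>\<chi>\<in>nonprincipal_characters p. (\<Sum>k = 1..nat \<lfloor>N\<rfloor>. \<chi> (int k)) * T \<chi>)"
     "\<kappa> * (real p ^ 3 * N\<^sup>2 / E) * (\<Sum>\<chi>\<in>nonprincipal_characters p. cmod (T \<chi>) ^ 4) \<le> a ^ 4"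
    using assms(1) unfolding resonates_def by blast
  have "\<kappa>' * (real p ^ 3 * N\<^sup>2 / E) * (\<Sum>\<chi>\<in>nonprincipal_characters p. cmod (T \<chi>) ^ 4)
    \<le> \<kappa> * (real p ^ 3 * N\<^sup>2 / E) * (\<Sum>\<chi>\<in>nonprincipal_characters p. cmod (T \<chi>) ^ 4)"
    using assms(2,3) by (intro mult_right_mono sum_nonneg) auto
  then have "\<kappa>' * (real p ^ 3 * N\<^sup>2 / E) * (\<Sum>\<chi>\<in>nonprincipal_characters p. cmod (T \<chi>) ^ 4) \<le> a ^ 4" using T(3) by linarith
  then show ?thesis unfolding resonates_def using T(1,2) by blast
qed

lemma moment_of_resonates:
  assumes p: "prime p" and N: "1 \<le> N" "N < real p" and r: "0 < r" "r < 4 / 3" and pos: "\<kappa> > 0" "E > 0" and R: "resonates \<kappa> p N E"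
  shows "(\<Sum>\<chi>\<in>nonprincipal_characters p. cmod (character_sum \<chi> N) powr r)
    \<ge> \<kappa> powr (1 - r / 2) * real p * (N powr (r / 2) / E powr (1 - r / 2))"
proof -
  obtain T a where T: "a > 0" "a \<le> cmod (\<Sum>\<chi>\<in>nonprincipal_characters p. (\<Sum>k = 1..nat \<lfloor>N\<rfloor>. \<chi> (int k)) * T \<chi>)"
     "\<kappa> * (real p ^ 3 * N\<^sup>2 / E) * (\<Sum>\<chi>\<in>nonprincipal_characters p. cmod (T \<chi>) ^ 4) \<le> a ^ 4"
    using R unfolding resonates_def by blast
  have n: "nat \<lfloor>N\<rfloor> < p" "real (nat \<lfloor>N\<rfloor>) \<le> N" using N by linarith+
  show ?thesis unfolding character_sum_def
    by (rule moment_of_resonator[OF p n _ r pos T(1,2) order_refl T(3)]) (use N in simp)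
qed

lemma floor_ge_half:
  assumes "x \<ge> (1::real)" shows "real (nat \<lfloor>x\<rfloor>) \<ge> x / 2" "real (nat \<lfloor>x\<rfloor>) \<le> x" "nat \<lfloor>x\<rfloor> \<ge> 1"
proof -
  have f: "\<lfloor>x\<rfloor> \<ge> 1" using assms by simp
  then have r: "real (nat \<lfloor>x\<rfloor>) = of_int \<lfloor>x\<rfloor>" "of_int \<lfloor>x\<rfloor> \<ge> (1::real)" by simp_all
  show "real (nat \<lfloor>x\<rfloor>) \<ge> x / 2" using r floor_correct[of x] by linarith
  show "real (nat \<lfloor>x\<rfloor>) \<le> x" using r by simp
  show "nat \<lfloor>x\<rfloor> \<ge> 1" using f by linarith
qed

text \<open>The square of the length is at most \<open>p\<close>, and not equal to \<open>p\<close> as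
  \<open>p\<close> is prime.\<close>

lemma resonates_short:
  assumes p: "prime p" "p \<ge> 4" and N: "1 \<le> N" "N < real p / 2" "N * N \<le> real p"
  shows "resonates (1 / 2048) p N (min_energy N)"
proof -
  define n where "n = nat \<lfloor>N\<rfloor>"
  define E where "E = min_energy N"
  have n: "real n \<ge> N / 2" "real n \<le> N" "n \<ge> 1" unfolding n_def by (rule floor_ge_half[OF N(1)])+
  have E: "E \<ge> 1" unfolding E_def using min_energy_ge_1 n(3) by (simp add: n_def)
  obtain c where c: "\<And>k. c k \<ge> 0" "(\<Sum>k = 1..n. c k) = 1" "weighted_energy n c \<le> 2 * E"
    using near_minimizer[of N] n(3) unfolding n_def E_def by blast
  have "real n * real n \<le> N * N" using n N by (intro mult_mono) auto
  then have "real (n * n) \<le> real p" using N(3) by simp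
  then have "n * n \<le> p" by (simp only: of_nat_le_iff)
  moreover have "n * n \<noteq> p"
  proof
    assume "n * n = p"
    then have "n dvd p" by auto
    then have "n = 1 \<or> n = p" using p(1) by (metis prime_nat_iff)
    then show False using \<open>n * n = p\<close> p(2) by auto
  qed
  ultimately have q: "n\<^sup>2 < p" by (simp add: power2_eq_square)
  have np: "n < p" using n(2) N(2) by linarith
  note SR = short_resonator[OF p(1) q np c(2,1)]
  have "(real n)\<^sup>2 * conv_energy n c c \<le> 2 * E" using c(3) by (simp add: weighted_energy_eq)
  moreover have "(N / 2)\<^sup>2 * conv_energy n c c \<le> (real n)\<^sup>2 * conv_energy n c c"
    using n N by (intro mult_right_mono power_mono conv_energy_nonneg) auto
  ultimately have "(N / 2)\<^sup>2 * conv_energy n c c \<le> 2 * E" by linarith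
  then have ce: "N\<^sup>2 / E * conv_energy n c c \<le> 8" using E by (simp add: field_simps)
  show ?thesis unfolding E_def[symmetric]
  proof (rule resonatesI[OF _ _ _ _ SR(2)])
    show "real p / 4 \<le> cmod (\<Sum>\<chi>\<in>nonprincipal_characters p. (\<Sum>k = 1..nat \<lfloor>N\<rfloor>. \<chi> (int k)) * cnj (weight_poly n c \<chi>))"
      unfolding n_def[symmetric] by (rule order_trans[OF _ SR(1)]) (use p(2) n(2) N(2) in linarith)
    have "1 / 2048 * (real p ^ 3 * N\<^sup>2 / E) * (real p * conv_energy n c c) = 1 / 2048 * real p ^ 4 * (N\<^sup>2 / E * conv_energy n c c)"
      by (simp add: power_numeral_reduce)
    also have "\<dots> \<le> 1 / 2048 * real p ^ 4 * 8" using ce by (intro mult_left_mono) auto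
    also have "\<dots> = (real p / 4) ^ 4" by (simp add: power_divide)
    finally show "1 / 2048 * (real p ^ 3 * N\<^sup>2 / E) * (real p * conv_energy n c c) \<le> (real p / 4) ^ 4" .
  qed (use E p(2) in auto)
qed

text \<open>For \<open>h \<le> \<nu> / 512\<close> and \<open>n \<le> N\<close> the phase \<open>2 \<pi> n h
  / p\<close> is at most \<open>\<pi> / 3\<close>, so all terms of the exponential sum have real
  part at least \<open>1/2\<close>.\<close>

lemma resonates_long:
  assumes p: "prime p" "p \<ge> 100" and N: "1 \<le> N" "N < real p / 2" "real p < N * N" and C: "C > 0"
    and c: "\<And>h. c h \<ge> 0" "(\<Sum>h = 1..nat \<lfloor>real p / N\<rfloor>. c h) = 1" "\<And>h. c h \<noteq> 0 \<Longrightarrow> 1 \<le> h \<and> 512 * h \<le> nat \<lfloor>real p / N\<rfloor>"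
      "(real (nat \<lfloor>real p / N\<rfloor>))\<^sup>2 * conv_energy (nat \<lfloor>real p / N\<rfloor>) c c \<le> C * min_energy (real p / N)"
  shows "resonates (1 / (16384 * C)) p N (min_energy (real p / N))"
proof -
  define n where "n = nat \<lfloor>N\<rfloor>"
  \<comment> \<open>the dual length\<close>
  define q where "q = nat \<lfloor>real p / N\<rfloor>"
  define E where "E = min_energy (real p / N)"
  have nu: "real p / N \<ge> 1" using N by (simp add: field_simps)
  have n: "real n \<ge> N / 2" "real n \<le> N" "n \<ge> 1" unfolding n_def by (rule floor_ge_half[OF N(1)])+
  have qq: "real q \<ge> real p / N / 2" "real q \<le> real p / N" "q \<ge> 1" unfolding q_def by (rule floor_ge_half[OF nu])+
  have E: "E \<ge> 1" unfolding E_def using min_energy_ge_1 qq(3) by (simp add: q_def)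
  note c = c[folded q_def E_def]
  have "real p / N < N" using N by (simp add: field_simps)
  then have "real p / N * (real p / N) < N * (real p / N)" using nu by (intro mult_strict_right_mono) auto
  moreover have "N * (real p / N) = real p" using N by simp
  moreover have "real q * real q \<le> real p / N * (real p / N)" using qq nu by (intro mult_mono) auto
  ultimately have "real (q * q) < real p" by simp
  then have q2: "q\<^sup>2 < p" by (simp only: of_nat_less_iff power2_eq_square)
  have np: "n < p" using n(2) N(2) by linarith
  have "q * 1 \<le> q * q" using qq(3) by (intro mult_le_mono2) auto
  then have qp: "q < p" using q2 by (simp only: power2_eq_square)
  note DR = dual_resonator[OF p(1) q2 np qp c(2,1)]
  let ?Z = "\<Sum>h = 1..q. complex_of_real (c h) * (\<Sum>k = 1..n. cnj (cis (2 * pi * real (k * h) / real p)))"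
  have p0: "real p > 0" using p by simp
  have cosb: "cos (2 * pi * real (k * h) / real p) \<ge> 1 / 2" if "512 * h \<le> q" "k \<le> n" for k h
  proof -
    have "real k * (512 * real h) \<le> N * (real p / N)"
    proof (rule mult_mono)
      show "real k \<le> N" using that(2) n(2) by linarith
      show "512 * real h \<le> real p / N" using that(1) qq(2) by linarith
    qed (use N in auto)
    then have "real (k * h) \<le> real p / 512" using N by simp
    then have "real (k * h) \<le> real p / 6" using p0 by simp
    then have "2 * pi * real (k * h) / real p \<le> 2 * pi * (real p / 6) / real p"
      using p0 by (intro divide_right_mono mult_left_mono) auto
    also have "\<dots> = pi / 3" using p0 by simp
    finally have "cos (pi / 3) \<le> cos (2 * pi * real (k * h) / real p)"
      by (intro cos_monotone_0_pi_le) auto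
    then show ?thesis by (simp add: cos_60)
  qed
  have "Re ?Z = (\<Sum>h = 1..q. c h * (\<Sum>k = 1..n. cos (2 * pi * real (k * h) / real p)))"
    by simp
  also have "\<dots> \<ge> (\<Sum>h = 1..q. c h * (real n / 2))"
  proof (rule sum_mono)
    fix h
    show "c h * (real n / 2) \<le> c h * (\<Sum>k = 1..n. cos (2 * pi * real (k * h) / real p))"
    proof (cases "c h = 0")
      case False
      then have "512 * h \<le> q" using c(3) by blast
      then have "(\<Sum>k = 1..n. 1 / 2) \<le> (\<Sum>k = 1..n. cos (2 * pi * real (k * h) / real p))"
        by (intro sum_mono cosb) auto
      then show ?thesis using c(1) by (intro mult_left_mono) auto
    qed simp
  qed
  also have "(\<Sum>h = 1..q. c h * (real n / 2)) = real n / 2" by (simp only: sum_distrib_right[symmetric] c(2) mult_1_left)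
  finally have Z: "real n / 2 \<le> cmod ?Z" using complex_Re_le_cmod[of ?Z] by linarith
  have sq: "sqrt (real p) \<le> real p / 10"
  proof -
    have "10 * sqrt (real p) \<le> sqrt (real p) * sqrt (real p)" using p(2) by (intro mult_right_mono) (auto intro: real_le_rsqrt)
    then show ?thesis by simp
  qed
  have "real p * N / 8 \<le> real n * (real p / 4)" using mult_right_mono[OF n(1), of "real p / 4"] by simp
  also have "\<dots> \<le> real n * (real p / 2 - 1 / 2 - sqrt (real p))"
  proof (rule mult_left_mono)
    have aux: "x / 4 \<le> x / 2 - 1 / 2 - s" if "x \<ge> 100" "s \<le> x / 10" for x s :: real using that by linarith
    show "real p / 4 \<le> real p / 2 - 1 / 2 - sqrt (real p)" by (rule aux[OF _ sq]) (use p(2) in simp)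
  qed simp
  also have "\<dots> = real (p - 1) * (real n / 2) - real n * sqrt (real p)" using p(2) by (simp add: algebra_simps of_nat_diff)
  also have "\<dots> \<le> real (p - 1) * cmod ?Z - real n * sqrt (real p)" using Z by (intro diff_right_mono mult_left_mono) auto
  finally have a: "real p * N / 8 \<le> real (p - 1) * cmod ?Z - real n * sqrt (real p)" .
  have "(real p / N / 2)\<^sup>2 * conv_energy q c c \<le> (real q)\<^sup>2 * conv_energy q c c"
    using qq nu by (intro mult_right_mono power_mono conv_energy_nonneg) auto
  then have "(real p / N / 2)\<^sup>2 * conv_energy q c c \<le> C * E" using c(4) by linarith
  then have ce: "real p ^ 2 * conv_energy q c c / E \<le> 4 * C * N\<^sup>2" using E N by (simp add: field_simps)
  show ?thesis unfolding E_def[symmetric]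
  proof (rule resonatesI[OF _ _ _ _ DR(2)])
    show "real p * N / 8 \<le> cmod (\<Sum>\<chi>\<in>nonprincipal_characters p. (\<Sum>k = 1..nat \<lfloor>N\<rfloor>. \<chi> (int k)) * (weight_poly q c \<chi> * cnj (gauss_sum p \<chi>)))"
      unfolding n_def[symmetric] by (rule order_trans[OF a DR(1)])
    have "1 / (16384 * C) * (real p ^ 3 * N\<^sup>2 / E) * (real p ^ 3 * conv_energy q c c)
      = 1 / (16384 * C) * (real p ^ 4 * N\<^sup>2) * (real p ^ 2 * conv_energy q c c / E)"
      by (simp add: power_numeral_reduce)
    also have "\<dots> \<le> 1 / (16384 * C) * (real p ^ 4 * N\<^sup>2) * (4 * C * N\<^sup>2)" using ce C by (intro mult_left_mono) auto
    also have "\<dots> = (real p * N / 8) ^ 4" using C by (simp add: power_divide power_mult_distrib power_numeral_reduce)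
    finally show "1 / (16384 * C) * (real p ^ 3 * N\<^sup>2 / E) * (real p ^ 3 * conv_energy q c c) \<le> (real p * N / 8) ^ 4" .
  qed (use E p0 N C in auto)
qed

lemma sin_ge_half:
  assumes "0 \<le> x" "x \<le> pi / 3" shows "x / 2 \<le> sin x"
proof -
  have "sin 0 - 0 / 2 \<le> sin x - x / 2"
  proof (rule DERIV_nonneg_imp_nondecreasing[of 0 x "\<lambda>x. sin x - x / 2"])
    fix y assume y: "0 \<le> y" "y \<le> x"
    then have "cos (pi / 3) \<le> cos y" using assms by (intro cos_monotone_0_pi_le) auto
    then have "0 \<le> cos y - 1 / 2" by (simp add: cos_60)
    moreover have "((\<lambda>x. sin x - x / 2) has_real_derivative (cos y - 1 / 2)) (at y)" by (auto intro!: derivative_eq_intros)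
    ultimately show "\<exists>d. ((\<lambda>x. sin x - x / 2) has_real_derivative d) (at y) \<and> 0 \<le> d" by blast
  qed (rule assms)
  then show ?thesis by simp
qed

text \<open>If \<open>N \<ge> p / m\<close>, the phases \<open>2 \<pi> k / p\<close> for \<open>k \<le>
  N\<close> cover a positive proportion of the half circle, but possibly all of it, so cosines may
  cancel. Since \<open>N < p / 2\<close>, the sines are nonnegative and do not cancel.\<close>

lemma resonates_very_long:
  fixes m :: nat
  assumes p: "prime p" "p \<ge> 1024 ^ 2 * m ^ 4" and m: "m \<ge> 1" and N: "1 \<le> N" "N < real p / 2" "real p \<le> N * real m" and E: "E \<ge> 1"
  shows "resonates ((1 / (2048 * (real m)\<^sup>2)) ^ 4) p N E"
proof -
  define n where "n = nat \<lfloor>N\<rfloor>"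
  \<comment> \<open>only these terms are used; up to p / 8 the sine is at least half its argument\<close>
  define l where "l = nat \<lfloor>real p / (8 * real m)\<rfloor>"
  define c :: "nat \<Rightarrow> real" where "c = (\<lambda>k. if k = 1 then 1 else 0)"
  \<comment> \<open>the sum of the sines is at least 4 b p, of which the principal character takes away half\<close>
  define b where "b = 1 / (2048 * (real m)\<^sup>2)"
  have n: "real n \<ge> N / 2" "real n \<le> N" "n \<ge> 1" unfolding n_def by (rule floor_ge_half[OF N(1)])+
  have m4: "m ^ 1 \<le> m ^ 4" using m by (intro power_increasing) auto
  have "8 * m \<le> 1024 ^ 2 * m ^ 4" using m4 by simp
  then have pm: "8 * m \<le> p" "1 < p" using p(2) m by linarith+
  have p0: "real p > 0" using pm by simp
  have "real p / (8 * real m) \<ge> 1" using pm(1) m by (simp add: field_simps)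
  note l = floor_ge_half[OF this, folded l_def]
  have ln: "l \<le> n"
  proof -
    have "real p / (8 * real m) \<le> N / 8" using N(3) m by (simp add: field_simps)
    then have "real l \<le> real n" using l(2) n(1) N(1) by linarith
    then show ?thesis by (simp only: of_nat_le_iff)
  qed
  have lp: "8 * real l \<le> real p"
  proof -
    have "real p / (8 * real m) \<le> real p / 8" using m p0 by (intro divide_left_mono) auto
    then show ?thesis using l(2) by linarith
  qed
  have np: "n < p" using n(2) N(2) by linarith
  have q2: "1\<^sup>2 < p" using pm(2) by simp
  have c1: "(\<Sum>h = 1..1. c h) = 1" "\<And>h. c h \<ge> 0" by (simp_all add: c_def)
  note DR = dual_resonator[OF p(1) q2 np pm(2) c1]
  let ?Z = "\<Sum>h = 1..1. complex_of_real (c h) * (\<Sum>k = 1..n. cnj (cis (2 * pi * real (k * h) / real p)))"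
  have "Im ?Z = - (\<Sum>k = 1..n. sin (2 * pi * real k / real p))" by (simp add: c_def sum_negf)
  then have Z: "(\<Sum>k = 1..n. sin (2 * pi * real k / real p)) \<le> cmod ?Z" using abs_Im_le_cmod[of ?Z] by linarith
  have "(real l)\<^sup>2 / (2 * real p) \<le> (\<Sum>k = 1..l. real k / real p)"
  proof -
    have "2 * (\<Sum>k = 1..l. real k) = real l * (real l + 1)" by (induction l) (auto simp: algebra_simps)
    then have "(real l)\<^sup>2 / 2 \<le> (\<Sum>k = 1..l. real k)" by (simp add: power2_eq_square algebra_simps)
    then have "(real l)\<^sup>2 / 2 / real p \<le> (\<Sum>k = 1..l. real k) / real p" using p0 by (intro divide_right_mono) auto
    then show ?thesis by (simp add: sum_divide_distrib)
  qed
  also have "\<dots> \<le> (\<Sum>k = 1..l. sin (2 * pi * real k / real p))"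
  proof (rule sum_mono)
    fix k assume "k \<in> {1..l}"
    then have k: "real k \<le> real p / 8" using lp by simp
    have "2 * pi * real k / real p \<le> 2 * pi * (real p / 8) / real p" using k p0 by (intro divide_right_mono mult_left_mono) auto
    also have "\<dots> \<le> pi / 3" using p0 by simp
    finally have "2 * pi * real k / real p / 2 \<le> sin (2 * pi * real k / real p)" by (intro sin_ge_half) auto
    moreover have "1 * (real k / real p) \<le> pi * (real k / real p)" using pi_ge_two by (intro mult_right_mono) auto
    ultimately show "real k / real p \<le> sin (2 * pi * real k / real p)" by simp
  qed
  also have "\<dots> \<le> (\<Sum>k = 1..n. sin (2 * pi * real k / real p))"
  proof (rule sum_mono2)
    fix k assume "k \<in> {1..n} - {1..l}"
    then have "real k \<le> real p / 2" using n(2) N(2) by auto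
    then have "2 * pi * real k / real p \<le> 2 * pi * (real p / 2) / real p" using p0 by (intro divide_right_mono mult_left_mono) auto
    then show "0 \<le> sin (2 * pi * real k / real p)" using p0 by (intro sin_ge_zero) auto
  qed (use ln in auto)
  finally have Z2: "(real l)\<^sup>2 / (2 * real p) \<le> cmod ?Z" using Z by linarith
  have "4 * b * real p = (real p / (8 * real m) / 2)\<^sup>2 / (2 * real p)"
    using p0 m by (simp add: b_def field_simps power2_eq_square)
  also have "\<dots> \<le> (real l)\<^sup>2 / (2 * real p)" using l p0 m by (intro divide_right_mono power_mono) auto
  finally have Z3: "4 * b * real p \<le> cmod ?Z" using Z2 by linarith
  have b0: "b > 0" using m by (simp add: b_def)
  have sq: "sqrt (real p) \<le> 2 * b * real p"
  proof -
    have "(1024 * (real m)\<^sup>2)\<^sup>2 = real (1024 ^ 2 * m ^ 4)" by (simp add: power_mult_distrib flip: power_mult)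
    also have "\<dots> \<le> real p" using p(2) by (subst of_nat_le_iff)
    finally have "1024 * (real m)\<^sup>2 \<le> sqrt (real p)" by (rule real_le_rsqrt)
    then have "1024 * (real m)\<^sup>2 * sqrt (real p) \<le> sqrt (real p) * sqrt (real p)" by (intro mult_right_mono) auto
    then show ?thesis using m by (simp add: b_def field_simps)
  qed
  have "b * (real p)\<^sup>2 \<le> real (p - 1) * (4 * b * real p) - real n * sqrt (real p)"
  proof -
    define Y where "Y = real (p - 1) * (4 * b * real p)"
    have "real n * sqrt (real p) \<le> real p / 2 * (2 * b * real p)" using sq n(2) N(2) by (intro mult_mono) auto
    also have "\<dots> = b * (real p)\<^sup>2" by (simp add: power2_eq_square)
    finally have 1: "real n * sqrt (real p) \<le> b * (real p)\<^sup>2" .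
    have "2 * (b * (real p)\<^sup>2) = real p / 2 * (4 * b * real p)" by (simp add: power2_eq_square)
    also have "\<dots> \<le> Y" unfolding Y_def
      using pm b0 by (intro mult_right_mono) (auto simp: of_nat_diff)
    finally show ?thesis using 1 unfolding Y_def[symmetric] by linarith
  qed
  also have "\<dots> \<le> real (p - 1) * cmod ?Z - real n * sqrt (real p)" using Z3 by (intro diff_right_mono mult_left_mono) auto
  finally have a: "b * (real p)\<^sup>2 \<le> real (p - 1) * cmod ?Z - real n * sqrt (real p)" .
  have ce: "conv_energy 1 c c = 1" unfolding c_def by (rule conv_energy_unit) simp
  show ?thesis unfolding b_def[symmetric]
  proof (rule resonatesI[OF _ _ _ _ DR(2)])
    show "b * (real p)\<^sup>2 \<le> cmod (\<Sum>\<chi>\<in>nonprincipal_characters p. (\<Sum>k = 1..nat \<lfloor>N\<rfloor>. \<chi> (int k)) * (weight_poly 1 c \<chi> * cnj (gauss_sum p \<chi>)))"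
      unfolding n_def[symmetric] by (rule order_trans[OF a DR(1)])
    have NE: "N\<^sup>2 / E \<le> (real p)\<^sup>2 / 1" using N E by (intro frac_le power_mono) auto
    have "b ^ 4 * (real p ^ 3 * N\<^sup>2 / E) * (real p ^ 3 * conv_energy 1 c c) = b ^ 4 * real p ^ 6 * (N\<^sup>2 / E)"
      unfolding ce by (simp add: power_numeral_reduce)
    also have "\<dots> \<le> b ^ 4 * real p ^ 6 * ((real p)\<^sup>2 / 1)" using NE by (intro mult_left_mono) auto
    also have "\<dots> = (b * (real p)\<^sup>2) ^ 4" by (simp add: power_mult_distrib power_numeral_reduce)
    finally show "b ^ 4 * (real p ^ 3 * N\<^sup>2 / E) * (real p ^ 3 * conv_energy 1 c c) \<le> (b * (real p)\<^sup>2) ^ 4" .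
  qed (use E p0 b0 in auto)
qed

lemma resonance:
  "\<exists>\<kappa>>0. \<exists>p0. \<forall>p N. prime p \<and> p \<ge> p0 \<and> 1 \<le> N \<and> N < real p / 2 \<longrightarrow>
     min_energy (min N (real p / N)) \<ge> 1 \<and> resonates \<kappa> p N (min_energy (min N (real p / N)))"
proof -
  obtain C N0 where C: "C \<ge> 1" "N0 \<ge> 1" and reg: "\<And>\<nu>. nat \<lfloor>\<nu>\<rfloor> \<ge> N0 \<Longrightarrow> \<exists>c. (\<forall>h. c h \<ge> 0) \<and> (\<Sum>h = 1..nat \<lfloor>\<nu>\<rfloor>. c h) = 1 \<and>
     (\<forall>h. c h \<noteq> 0 \<longrightarrow> 1 \<le> h \<and> 512 * h \<le> nat \<lfloor>\<nu>\<rfloor>) \<and>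
     (real (nat \<lfloor>\<nu>\<rfloor>))\<^sup>2 * conv_energy (nat \<lfloor>\<nu>\<rfloor>) c c \<le> C * min_energy \<nu>" using regular_near_minimizer by blast
  define \<kappa> where "\<kappa> = min (1 / 2048) (min (1 / (16384 * C)) ((1 / (2048 * (real N0)\<^sup>2)) ^ 4))"
  have k0: "\<kappa> > 0" unfolding \<kappa>_def using C by simp
  have kk: "\<kappa> \<le> 1 / 2048" "\<kappa> \<le> 1 / (16384 * C)" "\<kappa> \<le> (1 / (2048 * (real N0)\<^sup>2)) ^ 4" unfolding \<kappa>_def by linarith+
  have "min_energy (min N (real p / N)) \<ge> 1 \<and> resonates \<kappa> p N (min_energy (min N (real p / N)))"
    if p: "prime p" "p \<ge> 100 + 1024 ^ 2 * N0 ^ 4" and N: "1 \<le> N" "N < real p / 2" for p N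
  proof -
    have nu1: "real p / N \<ge> 1" using N by (simp add: field_simps)
    then have E1: "min_energy (min N (real p / N)) \<ge> 1"
      using floor_ge_half(3)[of "min N (real p / N)"] N(1) by (intro min_energy_ge_1) simp
    show ?thesis
    proof (cases "N * N \<le> real p")
      case True
      then have eq: "min N (real p / N) = N" using N by (simp add: field_simps min_def)
      have "resonates (1 / 2048) p N (min_energy N)" using p N True by (intro resonates_short) auto
      then show ?thesis using E1 unfolding eq by (auto intro: resonates_mono[OF _ kk(1)])
    next
      case False
      then have eq: "min N (real p / N) = real p / N" using N by (simp add: field_simps min_def)
      note E = E1[unfolded eq]
      show ?thesis
      proof (cases "nat \<lfloor>real p / N\<rfloor> \<ge> N0")
        case True
        obtain c where c: "\<forall>h. c h \<ge> 0" "(\<Sum>h = 1..nat \<lfloor>real p / N\<rfloor>. c h) = 1"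
          "\<forall>h. c h \<noteq> 0 \<longrightarrow> 1 \<le> h \<and> 512 * h \<le> nat \<lfloor>real p / N\<rfloor>"
          "(real (nat \<lfloor>real p / N\<rfloor>))\<^sup>2 * conv_energy (nat \<lfloor>real p / N\<rfloor>) c c \<le> C * min_energy (real p / N)" using reg[OF True] by blast
        have "resonates (1 / (16384 * C)) p N (min_energy (real p / N))"
        proof (rule resonates_long[OF p(1) _ N _ _ _ c(2) _ c(4)])
          show "0 \<le> c h" for h using c(1) by blast
          show "c h \<noteq> 0 \<Longrightarrow> 1 \<le> h \<and> 512 * h \<le> nat \<lfloor>real p / N\<rfloor>" for h using c(3) by blast
        qed (use p(2) False C in auto)
        then show ?thesis using E unfolding eq by (auto intro: resonates_mono[OF _ kk(2)])
      next
        case False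
        then have "real p / N \<le> real N0" by linarith
        then have "real p \<le> N * real N0" using N by (simp add: field_simps)
        then have "resonates ((1 / (2048 * (real N0)\<^sup>2)) ^ 4) p N (min_energy (real p / N))"
          using p(2) C(2) E by (intro resonates_very_long[OF p(1) _ _ N]) auto
        then show ?thesis using E unfolding eq by (auto intro: resonates_mono[OF _ kk(3)])
      qed
    qed
  qed
  then show ?thesis using k0 by blast
qed

section \<open>Moments of character sums\<close>

text \<open>Dividing by \<open>p - 2\<close> instead of \<open>p\<close> only helps.\<close>

lemma mean_of_moment:
  assumes "p > 2" "M \<ge> c * real p * Q" "c \<ge> 0" "Q \<ge> 0"
  shows "1 / (real p - 2) * M \<ge> c * Q"
proof -
  have "c * Q * (real p - 2) \<le> c * Q * real p" using assms by (intro mult_left_mono) auto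
  also have "\<dots> \<le> M" using assms(2) by (simp add: mult_ac)
  finally show ?thesis using assms(1) by (simp add: field_simps)
qed

theorem theorem1p5:
  "(\<forall>r::real. 0 < r \<and> r < 4 / 3 \<longrightarrow>
      (\<exists>K>0. \<exists>p0::nat. \<forall>(p::nat) (N::real) (\<nu>::real).
         prime p \<and> p \<ge> p0 \<and> 1 \<le> N \<and> N < real p / 2 \<and> \<nu> = min N (real p / N) \<longrightarrow>
           1 / (real p - 2) * (\<Sum>\<chi>\<in>nonprincipal_characters p. cmod (character_sum \<chi> N) powr r)
             \<ge> K * (N powr (r / 2) / min_energy \<nu> powr (1 - r / 2))))
   \<and>
   (\<exists>K>0. \<exists>p0::nat. \<forall>(p::nat) (N::real) (\<nu>::real).
      prime p \<and> p \<ge> p0 \<and> 1 \<le> N \<and> N < real p / 2 \<and> \<nu> = min N (real p / N) \<longrightarrow>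
        1 / (real p - 2) * (\<Sum>\<chi>\<in>nonprincipal_characters p. cmod (character_sum \<chi> N))
          \<ge> K * sqrt (N / min_energy \<nu>)
        \<and> (\<nu> \<ge> 3 \<longrightarrow>
             sqrt (N / min_energy \<nu>)
               \<ge> K * (sqrt N / (ln \<nu> powr (delta_exp / 2) * ln (ln \<nu>) ^ 3))))"
proof -
  obtain \<kappa> p0 where k: "\<kappa> > 0" and res: "\<And>p N. prime p \<Longrightarrow> p \<ge> p0 \<Longrightarrow> 1 \<le> N \<Longrightarrow> N < real p / 2 \<Longrightarrow>
     min_energy (min N (real p / N)) \<ge> 1 \<and> resonates \<kappa> p N (min_energy (min N (real p / N)))"
    using resonance by blast
  obtain C where C: "C > 0" and log_le: "\<And>\<nu>. \<nu> \<ge> 3 \<Longrightarrow> min_energy \<nu> \<le> C * (ln \<nu> powr delta_exp * ln (ln \<nu>) ^ 6)"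
    using min_energy_log_bound by blast
  have E1: "min_energy \<nu> \<ge> 1" if "prime p" "p \<ge> p0 + 3" "1 \<le> N" "N < real p / 2" "\<nu> = min N (real p / N)" for p N \<nu>
    using res[of p N] that by simp
  have moment: "1 / (real p - 2) * (\<Sum>\<chi>\<in>nonprincipal_characters p. cmod (character_sum \<chi> N) powr r)
             \<ge> \<kappa> powr (1 - r / 2) * (N powr (r / 2) / min_energy \<nu> powr (1 - r / 2))"
    if r: "0 < r" "r < 4 / 3" and p: "prime p" "p \<ge> p0 + 3" and N: "1 \<le> N" "N < real p / 2" and \<nu>: "\<nu> = min N (real p / N)" for r p N \<nu>
  proof (rule mean_of_moment)
    show "\<kappa> powr (1 - r / 2) * real p * (N powr (r / 2) / min_energy \<nu> powr (1 - r / 2))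
      \<le> (\<Sum>\<chi>\<in>nonprincipal_characters p. cmod (character_sum \<chi> N) powr r)"
      using res[of p N] p N \<nu> by (intro moment_of_resonates[OF p(1) N(1) _ r k]) auto
  qed (use p in auto)
  have first: "\<exists>K>0. \<exists>p0::nat. \<forall>(p::nat) (N::real) (\<nu>::real).
         prime p \<and> p \<ge> p0 \<and> 1 \<le> N \<and> N < real p / 2 \<and> \<nu> = min N (real p / N) \<longrightarrow>
           1 / (real p - 2) * (\<Sum>\<chi>\<in>nonprincipal_characters p. cmod (character_sum \<chi> N) powr r)
             \<ge> K * (N powr (r / 2) / min_energy \<nu> powr (1 - r / 2))" if r: "0 < r" "r < 4 / 3" for r :: real
  proof (intro exI[of _ "\<kappa> powr (1 - r / 2)"] exI[of _ "p0 + 3"] conjI allI impI)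
    show "\<kappa> powr (1 - r / 2) > 0" using k by simp
  qed (elim conjE, rule moment[OF r])
  define K where "K = min (\<kappa> powr (1 / 2)) (1 / sqrt C)"
  have K: "K > 0" "K \<le> \<kappa> powr (1 / 2)" "K \<le> 1 / sqrt C" using k C unfolding K_def by auto
  have mean: "1 / (real p - 2) * (\<Sum>\<chi>\<in>nonprincipal_characters p. cmod (character_sum \<chi> N)) \<ge> K * sqrt (N / min_energy \<nu>)"
    if p: "prime p" "p \<ge> p0 + 3" and N: "1 \<le> N" "N < real p / 2" and \<nu>: "\<nu> = min N (real p / N)" for p N \<nu>
  proof -
    have "K * sqrt (N / min_energy \<nu>) \<le> \<kappa> powr (1 / 2) * sqrt (N / min_energy \<nu>)"
      using K(2) N(1) E1[OF p N \<nu>] by (intro mult_right_mono) auto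
    also have "\<dots> = \<kappa> powr (1 - 1 / 2) * (N powr (1 / 2) / min_energy \<nu> powr (1 - 1 / 2))"
      using N(1) E1[OF p N \<nu>] by (simp add: powr_half_sqrt real_sqrt_divide)
    also have "\<dots> \<le> 1 / (real p - 2) * (\<Sum>\<chi>\<in>nonprincipal_characters p. cmod (character_sum \<chi> N) powr 1)"
      by (rule moment[OF _ _ p N \<nu>]) auto
    finally show ?thesis by simp
  qed
  have log_form: "K * (sqrt N / (ln \<nu> powr (delta_exp / 2) * ln (ln \<nu>) ^ 3)) \<le> sqrt (N / min_energy \<nu>)"
    if p: "prime p" "p \<ge> p0 + 3" and N: "1 \<le> N" "N < real p / 2" and \<nu>: "\<nu> = min N (real p / N)" and \<nu>3: "\<nu> \<ge> 3" for p N \<nu>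
  proof -
    define G where "G = ln \<nu> powr (delta_exp / 2) * ln (ln \<nu>) ^ 3"
    have l: "ln \<nu> > 1" using ln_3_gt_1 \<nu>3 ln_le_cancel_iff[of 3 \<nu>] by linarith
    then have G: "G > 0" by (simp add: G_def)
    have "ln \<nu> powr delta_exp = (ln \<nu> powr (delta_exp / 2))\<^sup>2"
      using l by (simp add: power2_eq_square flip: powr_add)
    then have "ln \<nu> powr delta_exp * ln (ln \<nu>) ^ 6 = G\<^sup>2" by (simp add: G_def power_mult_distrib flip: power_mult)
    then have "min_energy \<nu> \<le> C * G\<^sup>2" using log_le[OF \<nu>3] by simp
    then have "sqrt (min_energy \<nu>) \<le> sqrt C * G" using G C by (intro real_le_lsqrt) (auto simp: power_mult_distrib)
    then have "sqrt N / (sqrt C * G) \<le> sqrt N / sqrt (min_energy \<nu>)"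
      using E1[OF p N \<nu>] N(1) C G by (intro divide_left_mono mult_pos_pos) auto
    moreover have "K * (sqrt N / G) \<le> 1 / sqrt C * (sqrt N / G)" using K(3) N(1) G by (intro mult_right_mono) auto
    ultimately show ?thesis unfolding G_def[symmetric] by (simp add: real_sqrt_divide)
  qed
  show ?thesis
  proof (intro conjI allI impI)
    fix r :: real assume "0 < r \<and> r < 4 / 3"
    then show "\<exists>K>0. \<exists>p0::nat. \<forall>(p::nat) (N::real) (\<nu>::real).
         prime p \<and> p \<ge> p0 \<and> 1 \<le> N \<and> N < real p / 2 \<and> \<nu> = min N (real p / N) \<longrightarrow>
           1 / (real p - 2) * (\<Sum>\<chi>\<in>nonprincipal_characters p. cmod (character_sum \<chi> N) powr r)
             \<ge> K * (N powr (r / 2) / min_energy \<nu> powr (1 - r / 2))" by (intro first) auto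
  next
    show "\<exists>K>0. \<exists>p0::nat. \<forall>(p::nat) (N::real) (\<nu>::real).
      prime p \<and> p \<ge> p0 \<and> 1 \<le> N \<and> N < real p / 2 \<and> \<nu> = min N (real p / N) \<longrightarrow>
        1 / (real p - 2) * (\<Sum>\<chi>\<in>nonprincipal_characters p. cmod (character_sum \<chi> N))
          \<ge> K * sqrt (N / min_energy \<nu>)
        \<and> (\<nu> \<ge> 3 \<longrightarrow>
             sqrt (N / min_energy \<nu>)
               \<ge> K * (sqrt N / (ln \<nu> powr (delta_exp / 2) * ln (ln \<nu>) ^ 3)))"
      using K(1) mean log_form by (intro exI[of _ K] exI[of _ "p0 + 3"]) blast
  qed
qed

end
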